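(* Let $\Omega$, $\alpha$, $\alpha_M$, $V$, $L$, $a$ and $l$ be as in the context; in particular $\alpha\in L^\infty(\partial\Omega)$ takes values a.e. in $[-\alpha_M,\alpha_M]$ with $\alpha_M\in[0,1)$, $L=L^2(\Omega)^{d+1}\times L^2(\partial\Omega)$, and the data satisfy $\mathbf f\in L^2(\Omega)^{d+1}$, $g\in L^2(\partial\Omega)$. Then the variational problem to find $\boldsymbol\xi\in V$ such that $$a(\hat{\boldsymbol\eta},\boldsymbol\xi)=l(\hat{\boldsymbol\eta})\qquad\forall\,\hat{\boldsymbol\eta}\in L$$ has a unique solution, and it satisfies $$\|\boldsymbol\xi\|_V\le\frac{3}{1-\alpha_M}\|l\|,$$ where $\|l\|$ is the norm of $l$ as a bounded linear functional on $L$.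
   Context: $\Omega\subset\mathbb R^d$ ($d=2$ or $3$) is open, bounded, connected and Lipschitz, with outward unit normal $\boldsymbol n$. $\alpha\in L^\infty(\partial\Omega)$ satisfies $\operatorname{ess.\,im}\alpha\subset[-\alpha_M,\alpha_M]$ for some $\alpha_M\in[0,1)$. Elements of $L^2(\Omega)^{d+1}$ are blocked as $\boldsymbol\xi=[\boldsymbol\xi_1,\xi_2]^T$ with $\boldsymbol\xi_1$ a $d$-vector field and $\xi_2$ a scalar field. The operator $\mathbf T$ is (weak derivatives) $\mathbf T\boldsymbol\xi=[\boldsymbol\xi_1+\nabla\xi_2,\ \xi_2+\nabla\cdot\boldsymbol\xi_1]^T$. Its graph space is $W=\{\boldsymbol\xi\in L^2(\Omega)^{d+1}\mid\mathbf T\boldsymbol\xi\in L^2(\Omega)^{d+1}\}$ with graph norm $\|\boldsymbol\xi\|_W=(\|\boldsymbol\xi\|^2_{L^2(\Omega)^{d+1}}+\|\mathbf T\boldsymbol\xi\|^2_{L^2(\Omega)^{d+1}})^{1/2}$; it equals the set of $[\boldsymbol\xi_1,\xi_2]^T$ with $\boldsymbol\xi_1\in H(\mathrm{div};\Omega)$ and $\xi_2\in H^1(\Omega)$. $\gamma_{\boldsymbol n}:H(\mathrm{div};\Omega)\to H^{-1/2}(\partial\Omega)$ is the continuous normal trace, with $\gamma_{\boldsymbol n}\boldsymbol u=\boldsymbol n\cdot\boldsymbol u|_{\partial\Omega}$ for $\boldsymbol u\in C^1(\overline\Omega)^d$. Set $U=\{\boldsymbol u\in H(\mathrm{div};\Omega)\mid\gamma_{\boldsymbol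 n}\boldsymbol u\in L^2(\partial\Omega)\}$. The solution space is $V=\{\boldsymbol\xi=[\boldsymbol\xi_1,\xi_2]^T\in W\mid\boldsymbol\xi_1\in U\}$ with norm $\|\boldsymbol\xi\|_V=(\|\boldsymbol\xi\|_W^2+\|\gamma_{\boldsymbol n}\boldsymbol\xi_1\|^2_{L^2(\partial\Omega)})^{1/2}$. For $\boldsymbol\xi\in V$, $\operatorname{tr}_\alpha\boldsymbol\xi=\frac1{\sqrt2}\bigl[(1-\alpha)\xi_2|_{\partial\Omega}-(1+\alpha)\gamma_{\boldsymbol n}\boldsymbol\xi_1\bigr]\in L^2(\partial\Omega)$. $L=L^2(\Omega)^{d+1}\times L^2(\partial\Omega)$ has elements $\hat{\boldsymbol\eta}=(\boldsymbol\eta,\eta_R)$ and norm $\bigl(\int_\Omega|\boldsymbol\eta|^2+\int_{\partial\Omega}|\eta_R|^2\bigr)^{1/2}$. For $\hat{\boldsymbol\eta}\in L$, $\boldsymbol\xi\in V$, $$a(\hat{\boldsymbol\eta},\boldsymbol\xi)=\int_\Omega\boldsymbol\eta^T\mathbf T\boldsymbol\xi+\int_{\partial\Omega}\eta_R\operatorname{tr}_\alpha\boldsymbol\xi,\qquad l(\hat{\boldsymbol\eta})=\int_\Omega\boldsymbol\eta^T\mathbf f+\sqrt2\int_{\partial\Omega}\eta_R\,g.$$ *)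

theory Defs
  imports "HOL-Analysis.Analysis"
begin

text \<open>Functions that are equal almost everywhere are not identified: elements of L^2, H^1, H(div)
  etc. are represented by functions, and operators that are determined only up to null sets
  (weak derivatives, traces) pick one representative by Hilbert choice.\<close>

section \<open>Lipschitz domains, surface measure, outward unit normal\<close>

text \<open>Inside the ball around \<open>x0\<close>, \<open>\<Omega>\<close> is the strict subgraph, in the direction of the unit vector
  \<open>e\<close>, of a Lipschitz function on the hyperplane orthogonal to \<open>e\<close>. That function is represented by
  its extension \<open>\<phi>\<close> to the whole space that is constant along \<open>e\<close>.\<close>

definition lipschitz_chart ::
    "(real^'d) set \<Rightarrow> real^'d \<Rightarrow> real \<Rightarrow> real^'d \<Rightarrow> (real^'d \<Rightarrow> real) \<Rightarrow> bool" where
  "lipschitz_chart \<Omega> x0 r e \<phi> \<longleftrightarrow>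
     r > 0 \<and> norm e = 1 \<and> (\<exists>C. C-lipschitz_on UNIV \<phi>) \<and> (\<forall>x t. \<phi> (x + t *\<^sub>R e) = \<phi> x) \<and>
     \<Omega> \<inter> ball x0 r = {y \<in> ball x0 r. y \<bullet> e < \<phi> y}"

definition lipschitz_domain :: "(real^'d) set \<Rightarrow> bool" where
  "lipschitz_domain \<Omega> \<longleftrightarrow>
     open \<Omega> \<and> bounded \<Omega> \<and> connected \<Omega> \<and>
     (\<forall>x0 \<in> frontier \<Omega>. \<exists>r e \<phi>. lipschitz_chart \<Omega> x0 r e \<phi>)"

definition graph_point :: "real^'d \<Rightarrow> (real^'d \<Rightarrow> real) \<Rightarrow> real^'d \<Rightarrow> real^'d" where
  "graph_point e \<phi> x = x + (\<phi> x - x \<bullet> e) *\<^sub>R e"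

definition grad :: "(real^'d \<Rightarrow> real) \<Rightarrow> real^'d \<Rightarrow> real^'d" where
  "grad f x = (\<chi> i. frechet_derivative f (at x) (axis i 1))"

text \<open>In each chart the area element is \<open>sqrt (1 + |grad \<phi>|^2)\<close> times the (d-1)-dimensional
  Lebesgue measure of the hyperplane orthogonal to \<open>e\<close>. The latter is expressed as the
  d-dimensional Lebesgue measure of the cylinder of height 1 over a subset of the hyperplane; all
  functions integrated are constant along \<open>e\<close>. As the charts cover \<open>frontier \<Omega>\<close>, the measure is
  uniquely determined.\<close>

definition is_surface_measure :: "(real^'d) set \<Rightarrow> (real^'d) measure \<Rightarrow> bool" where
  "is_surface_measure \<Omega> \<sigma> \<longleftrightarrow>
     sets \<sigma> = sets borel \<and> emeasure \<sigma> (- frontier \<Omega>) = 0 \<and>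
     (\<forall>x0 r e \<phi>. lipschitz_chart \<Omega> x0 r e \<phi> \<longrightarrow>
        (\<forall>A \<in> sets borel. A \<subseteq> frontier \<Omega> \<inter> ball x0 r \<longrightarrow>
           emeasure \<sigma> A =
             (\<integral>\<^sup>+ x. indicator {x. 0 \<le> x \<bullet> e \<and> x \<bullet> e \<le> 1 \<and> graph_point e \<phi> x \<in> A} x
                    * ennreal (sqrt (1 + (norm (grad \<phi> x))\<^sup>2)) \<partial>lebesgue)))"

text \<open>\<open>\<Omega>\<close> lies below the graph, so the outward normal is the upward normal of the graph; it exists at
  almost every boundary point (Rademacher).\<close>

definition is_outward_unit_normal :: "(real^'d) set \<Rightarrow> (real^'d \<Rightarrow> real^'d) \<Rightarrow> bool" where
  "is_outward_unit_normal \<Omega> n \<longleftrightarrow>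
     n \<in> borel_measurable borel \<and>
     (\<forall>x0 r e \<phi>. lipschitz_chart \<Omega> x0 r e \<phi> \<longrightarrow>
        (AE x in lebesgue. graph_point e \<phi> x \<in> ball x0 r \<longrightarrow>
           (\<exists>D. GDERIV \<phi> x :> D \<and>
                n (graph_point e \<phi> x) = (1 / sqrt (1 + (norm D)\<^sup>2)) *\<^sub>R (e - D))))"

section \<open>Function spaces on the domain\<close>

definition L2 :: "'x measure \<Rightarrow> ('x \<Rightarrow> 'b::euclidean_space) set" where
  "L2 M = {f \<in> borel_measurable M. integrable M (\<lambda>x. (norm (f x))\<^sup>2)}"

definition L2_norm :: "'x measure \<Rightarrow> ('x \<Rightarrow> 'b::euclidean_space) \<Rightarrow> real" where
  "L2_norm M f = sqrt (\<integral>x. (norm (f x))\<^sup>2 \<partial>M)"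

primrec Ck :: "nat \<Rightarrow> ('a::euclidean_space \<Rightarrow> 'b::real_normed_vector) \<Rightarrow> bool" where
  "Ck 0 f \<longleftrightarrow> continuous_on UNIV f"
| "Ck (Suc k) f \<longleftrightarrow>
     (\<exists>f'. (\<forall>x. (f has_derivative f' x) (at x)) \<and> (\<forall>v. Ck k (\<lambda>x. f' x v)))"

definition test_functions :: "(real^'d) set \<Rightarrow> (real^'d \<Rightarrow> real) set" where
  "test_functions \<Omega> =
     {\<psi>. (\<forall>k. Ck k \<psi>) \<and> compact (closure {x. \<psi> x \<noteq> 0}) \<and> closure {x. \<psi> x \<noteq> 0} \<subseteq> \<Omega>}"

definition locally_integrable :: "(real^'d) set \<Rightarrow> (real^'d \<Rightarrow> 'b::euclidean_space) \<Rightarrow> bool" where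
  "locally_integrable \<Omega> f \<longleftrightarrow> (\<forall>K. compact K \<longrightarrow> K \<subseteq> \<Omega> \<longrightarrow> integrable (lebesgue_on K) f)"

definition has_weak_gradient ::
    "(real^'d) set \<Rightarrow> (real^'d \<Rightarrow> real) \<Rightarrow> (real^'d \<Rightarrow> real^'d) \<Rightarrow> bool" where
  "has_weak_gradient \<Omega> p G \<longleftrightarrow>
     locally_integrable \<Omega> p \<and> locally_integrable \<Omega> G \<and>
     (\<forall>\<psi> \<in> test_functions \<Omega>. \<forall>i.
        (\<integral>x. p x * (grad \<psi> x $ i) \<partial>lebesgue_on \<Omega>) = - (\<integral>x. (G x $ i) * \<psi> x \<partial>lebesgue_on \<Omega>))"

definition has_weak_divergence ::
    "(real^'d) set \<Rightarrow> (real^'d \<Rightarrow> real^'d) \<Rightarrow> (real^'d \<Rightarrow> real) \<Rightarrow> bool" where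
  "has_weak_divergence \<Omega> u D \<longleftrightarrow>
     locally_integrable \<Omega> u \<and> locally_integrable \<Omega> D \<and>
     (\<forall>\<psi> \<in> test_functions \<Omega>.
        (\<integral>x. u x \<bullet> grad \<psi> x \<partial>lebesgue_on \<Omega>) = - (\<integral>x. D x * \<psi> x \<partial>lebesgue_on \<Omega>))"

definition weak_grad :: "(real^'d) set \<Rightarrow> (real^'d \<Rightarrow> real) \<Rightarrow> real^'d \<Rightarrow> real^'d" where
  "weak_grad \<Omega> p = (SOME G. has_weak_gradient \<Omega> p G)"

definition weak_div :: "(real^'d) set \<Rightarrow> (real^'d \<Rightarrow> real^'d) \<Rightarrow> real^'d \<Rightarrow> real" where
  "weak_div \<Omega> u = (SOME D. has_weak_divergence \<Omega> u D)"

definition H1 :: "(real^'d) set \<Rightarrow> (real^'d \<Rightarrow> real) set" where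
  "H1 \<Omega> = {p \<in> L2 (lebesgue_on \<Omega>).
             (\<exists>G. has_weak_gradient \<Omega> p G) \<and> weak_grad \<Omega> p \<in> L2 (lebesgue_on \<Omega>)}"

definition H1_norm :: "(real^'d) set \<Rightarrow> (real^'d \<Rightarrow> real) \<Rightarrow> real" where
  "H1_norm \<Omega> p =
     sqrt ((L2_norm (lebesgue_on \<Omega>) p)\<^sup>2 + (L2_norm (lebesgue_on \<Omega>) (weak_grad \<Omega> p))\<^sup>2)"

definition Hdiv :: "(real^'d) set \<Rightarrow> (real^'d \<Rightarrow> real^'d) set" where
  "Hdiv \<Omega> = {u \<in> L2 (lebesgue_on \<Omega>).
               (\<exists>D. has_weak_divergence \<Omega> u D) \<and> weak_div \<Omega> u \<in> L2 (lebesgue_on \<Omega>)}"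

definition Hdiv_norm :: "(real^'d) set \<Rightarrow> (real^'d \<Rightarrow> real^'d) \<Rightarrow> real" where
  "Hdiv_norm \<Omega> u =
     sqrt ((L2_norm (lebesgue_on \<Omega>) u)\<^sup>2 + (L2_norm (lebesgue_on \<Omega>) (weak_div \<Omega> u))\<^sup>2)"

section \<open>Traces\<close>

text \<open>The trace of \<open>H1 \<Omega>\<close> is the extension by continuity, from \<open>H1 \<Omega>\<close> to \<open>L2 \<sigma>\<close>, of the restriction
  to the boundary. Here and below, \<open>C^1\<close> functions on the closure of \<open>\<Omega>\<close> are understood as
  restrictions of \<open>C^1\<close> functions on the whole space.\<close>

definition has_trace ::
    "(real^'d) set \<Rightarrow> (real^'d) measure \<Rightarrow> (real^'d \<Rightarrow> real) \<Rightarrow> (real^'d \<Rightarrow> real) \<Rightarrow> bool" where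
  "has_trace \<Omega> \<sigma> p t \<longleftrightarrow>
     p \<in> H1 \<Omega> \<and> t \<in> L2 \<sigma> \<and>
     (\<exists>q :: nat \<Rightarrow> real^'d \<Rightarrow> real. (\<forall>k. Ck 1 (q k)) \<and>
        (\<lambda>k. H1_norm \<Omega> (\<lambda>x. q k x - p x)) \<longlonglongrightarrow> 0 \<and>
        (\<lambda>k. L2_norm \<sigma> (\<lambda>x. q k x - t x)) \<longlonglongrightarrow> 0)"

definition bdry_trace ::
    "(real^'d) set \<Rightarrow> (real^'d) measure \<Rightarrow> (real^'d \<Rightarrow> real) \<Rightarrow> real^'d \<Rightarrow> real" where
  "bdry_trace \<Omega> \<sigma> p = (SOME t. has_trace \<Omega> \<sigma> p t)"

text \<open>\<open>H^{1/2}\<close> of the boundary is the range of the trace with the quotient norm.\<close>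

definition Hhalf :: "(real^'d) set \<Rightarrow> (real^'d) measure \<Rightarrow> (real^'d \<Rightarrow> real) set" where
  "Hhalf \<Omega> \<sigma> = {\<mu>. \<exists>p \<in> H1 \<Omega>. has_trace \<Omega> \<sigma> p \<mu>}"

definition Hhalf_norm ::
    "(real^'d) set \<Rightarrow> (real^'d) measure \<Rightarrow> (real^'d \<Rightarrow> real) \<Rightarrow> real" where
  "Hhalf_norm \<Omega> \<sigma> \<mu> = Inf {H1_norm \<Omega> p |p. p \<in> H1 \<Omega> \<and> has_trace \<Omega> \<sigma> p \<mu>}"

text \<open>Elements of the dual \<open>H^{-1/2}\<close> are functionals on \<open>Hhalf \<Omega> \<sigma>\<close> (their values elsewhere are
  irrelevant). The normal trace is the extension by continuity, from \<open>H(div)\<close> to \<open>H^{-1/2}\<close>, of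
  \<open>u \<mapsto> n \<bullet> u\<close> on \<open>C^1\<close> fields, where a boundary function acts on \<open>H^{1/2}\<close> by the \<open>L^2\<close> pairing.
  The last conjunct is convergence in the dual norm.\<close>

definition has_normal_trace ::
    "(real^'d) set \<Rightarrow> (real^'d) measure \<Rightarrow> (real^'d \<Rightarrow> real^'d) \<Rightarrow> (real^'d \<Rightarrow> real^'d)
       \<Rightarrow> ((real^'d \<Rightarrow> real) \<Rightarrow> real) \<Rightarrow> bool" where
  "has_normal_trace \<Omega> \<sigma> n u h \<longleftrightarrow>
     u \<in> Hdiv \<Omega> \<and>
     (\<exists>w :: nat \<Rightarrow> real^'d \<Rightarrow> real^'d. (\<forall>k. Ck 1 (w k)) \<and>
        (\<lambda>k. Hdiv_norm \<Omega> (\<lambda>x. w k x - u x)) \<longlonglongrightarrow> 0 \<and>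
        (\<forall>\<epsilon>>0. \<forall>\<^sub>F k in sequentially. \<forall>\<mu> \<in> Hhalf \<Omega> \<sigma>.
           \<bar>(\<integral>x. (n x \<bullet> w k x) * \<mu> x \<partial>\<sigma>) - h \<mu>\<bar> \<le> \<epsilon> * Hhalf_norm \<Omega> \<sigma> \<mu>))"

definition normal_trace ::
    "(real^'d) set \<Rightarrow> (real^'d) measure \<Rightarrow> (real^'d \<Rightarrow> real^'d) \<Rightarrow> (real^'d \<Rightarrow> real^'d)
       \<Rightarrow> ((real^'d \<Rightarrow> real) \<Rightarrow> real)" where
  "normal_trace \<Omega> \<sigma> n u = (SOME h. has_normal_trace \<Omega> \<sigma> n u h)"

definition represents_normal_trace ::
    "(real^'d) set \<Rightarrow> (real^'d) measure \<Rightarrow> (real^'d \<Rightarrow> real^'d) \<Rightarrow> (real^'d \<Rightarrow> real^'d)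
       \<Rightarrow> (real^'d \<Rightarrow> real) \<Rightarrow> bool" where
  "represents_normal_trace \<Omega> \<sigma> n u g \<longleftrightarrow>
     g \<in> L2 \<sigma> \<and> (\<forall>\<mu> \<in> Hhalf \<Omega> \<sigma>. normal_trace \<Omega> \<sigma> n u \<mu> = (\<integral>x. g x * \<mu> x \<partial>\<sigma>))"

definition U_space ::
    "(real^'d) set \<Rightarrow> (real^'d) measure \<Rightarrow> (real^'d \<Rightarrow> real^'d) \<Rightarrow> (real^'d \<Rightarrow> real^'d) set" where
  "U_space \<Omega> \<sigma> n = {u \<in> Hdiv \<Omega>. \<exists>g. represents_normal_trace \<Omega> \<sigma> n u g}"

definition normal_trace_fun ::
    "(real^'d) set \<Rightarrow> (real^'d) measure \<Rightarrow> (real^'d \<Rightarrow> real^'d) \<Rightarrow> (real^'d \<Rightarrow> real^'d)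
       \<Rightarrow> real^'d \<Rightarrow> real" where
  "normal_trace_fun \<Omega> \<sigma> n u = (SOME g. represents_normal_trace \<Omega> \<sigma> n u g)"

section \<open>The operator T, the spaces W, V and L, and the variational problem\<close>

definition T_op ::
    "(real^'d) set \<Rightarrow> (real^'d \<Rightarrow> (real^'d) \<times> real) \<Rightarrow> real^'d \<Rightarrow> (real^'d) \<times> real" where
  "T_op \<Omega> \<xi> = (\<lambda>x. (fst (\<xi> x) + weak_grad \<Omega> (\<lambda>y. snd (\<xi> y)) x,
                    snd (\<xi> x) + weak_div \<Omega> (\<lambda>y. fst (\<xi> y)) x))"

definition W_space :: "(real^'d) set \<Rightarrow> (real^'d \<Rightarrow> (real^'d) \<times> real) set" where
  "W_space \<Omega> =
     {\<xi> \<in> L2 (lebesgue_on \<Omega>).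
        (\<exists>G. has_weak_gradient \<Omega> (\<lambda>y. snd (\<xi> y)) G) \<and>
        (\<exists>D. has_weak_divergence \<Omega> (\<lambda>y. fst (\<xi> y)) D) \<and>
        T_op \<Omega> \<xi> \<in> L2 (lebesgue_on \<Omega>)}"

definition W_norm :: "(real^'d) set \<Rightarrow> (real^'d \<Rightarrow> (real^'d) \<times> real) \<Rightarrow> real" where
  "W_norm \<Omega> \<xi> =
     sqrt ((L2_norm (lebesgue_on \<Omega>) \<xi>)\<^sup>2 + (L2_norm (lebesgue_on \<Omega>) (T_op \<Omega> \<xi>))\<^sup>2)"

definition V_space ::
    "(real^'d) set \<Rightarrow> (real^'d) measure \<Rightarrow> (real^'d \<Rightarrow> real^'d)
       \<Rightarrow> (real^'d \<Rightarrow> (real^'d) \<times> real) set" where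
  "V_space \<Omega> \<sigma> n = {\<xi> \<in> W_space \<Omega>. (\<lambda>x. fst (\<xi> x)) \<in> U_space \<Omega> \<sigma> n}"

definition V_norm ::
    "(real^'d) set \<Rightarrow> (real^'d) measure \<Rightarrow> (real^'d \<Rightarrow> real^'d)
       \<Rightarrow> (real^'d \<Rightarrow> (real^'d) \<times> real) \<Rightarrow> real" where
  "V_norm \<Omega> \<sigma> n \<xi> =
     sqrt ((W_norm \<Omega> \<xi>)\<^sup>2 + (L2_norm \<sigma> (normal_trace_fun \<Omega> \<sigma> n (\<lambda>x. fst (\<xi> x))))\<^sup>2)"

definition tr_alpha ::
    "(real^'d) set \<Rightarrow> (real^'d) measure \<Rightarrow> (real^'d \<Rightarrow> real^'d) \<Rightarrow> (real^'d \<Rightarrow> real)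
       \<Rightarrow> (real^'d \<Rightarrow> (real^'d) \<times> real) \<Rightarrow> real^'d \<Rightarrow> real" where
  "tr_alpha \<Omega> \<sigma> n \<alpha> \<xi> = (\<lambda>x. 1 / sqrt 2 *
     ((1 - \<alpha> x) * bdry_trace \<Omega> \<sigma> (\<lambda>y. snd (\<xi> y)) x
      - (1 + \<alpha> x) * normal_trace_fun \<Omega> \<sigma> n (\<lambda>y. fst (\<xi> y)) x))"

definition L_space ::
    "(real^'d) set \<Rightarrow> (real^'d) measure
       \<Rightarrow> ((real^'d \<Rightarrow> (real^'d) \<times> real) \<times> (real^'d \<Rightarrow> real)) set" where
  "L_space \<Omega> \<sigma> = L2 (lebesgue_on \<Omega>) \<times> L2 \<sigma>"

definition L_norm ::
    "(real^'d) set \<Rightarrow> (real^'d) measure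
       \<Rightarrow> (real^'d \<Rightarrow> (real^'d) \<times> real) \<times> (real^'d \<Rightarrow> real) \<Rightarrow> real" where
  "L_norm \<Omega> \<sigma> \<eta> =
     sqrt ((\<integral>x. (norm (fst \<eta> x))\<^sup>2 \<partial>lebesgue_on \<Omega>) + (\<integral>x. \<bar>snd \<eta> x\<bar>\<^sup>2 \<partial>\<sigma>))"

definition form_a ::
    "(real^'d) set \<Rightarrow> (real^'d) measure \<Rightarrow> (real^'d \<Rightarrow> real^'d) \<Rightarrow> (real^'d \<Rightarrow> real)
       \<Rightarrow> (real^'d \<Rightarrow> (real^'d) \<times> real) \<times> (real^'d \<Rightarrow> real)
       \<Rightarrow> (real^'d \<Rightarrow> (real^'d) \<times> real) \<Rightarrow> real" where
  "form_a \<Omega> \<sigma> n \<alpha> \<eta> \<xi> =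
     (\<integral>x. fst \<eta> x \<bullet> T_op \<Omega> \<xi> x \<partial>lebesgue_on \<Omega>) + (\<integral>x. snd \<eta> x * tr_alpha \<Omega> \<sigma> n \<alpha> \<xi> x \<partial>\<sigma>)"

definition form_l ::
    "(real^'d) set \<Rightarrow> (real^'d) measure \<Rightarrow> (real^'d \<Rightarrow> (real^'d) \<times> real) \<Rightarrow> (real^'d \<Rightarrow> real)
       \<Rightarrow> (real^'d \<Rightarrow> (real^'d) \<times> real) \<times> (real^'d \<Rightarrow> real) \<Rightarrow> real" where
  "form_l \<Omega> \<sigma> f g \<eta> =
     (\<integral>x. fst \<eta> x \<bullet> f x \<partial>lebesgue_on \<Omega>) + sqrt 2 * (\<integral>x. snd \<eta> x * g x \<partial>\<sigma>)"

definition L_dual_norm ::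
    "(real^'d) set \<Rightarrow> (real^'d) measure
       \<Rightarrow> ((real^'d \<Rightarrow> (real^'d) \<times> real) \<times> (real^'d \<Rightarrow> real) \<Rightarrow> real) \<Rightarrow> real" where
  "L_dual_norm \<Omega> \<sigma> l = Sup {\<bar>l \<eta>\<bar> |\<eta>. \<eta> \<in> L_space \<Omega> \<sigma> \<and> L_norm \<Omega> \<sigma> \<eta> \<le> 1}"

definition solves_problem ::
    "(real^'d) set \<Rightarrow> (real^'d) measure \<Rightarrow> (real^'d \<Rightarrow> real^'d) \<Rightarrow> (real^'d \<Rightarrow> real)
       \<Rightarrow> (real^'d \<Rightarrow> (real^'d) \<times> real) \<Rightarrow> (real^'d \<Rightarrow> real)
       \<Rightarrow> (real^'d \<Rightarrow> (real^'d) \<times> real) \<Rightarrow> bool" where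
  "solves_problem \<Omega> \<sigma> n \<alpha> f g \<xi> \<longleftrightarrow>
     \<xi> \<in> V_space \<Omega> \<sigma> n \<and>
     (\<forall>\<eta> \<in> L_space \<Omega> \<sigma>. form_a \<Omega> \<sigma> n \<alpha> \<eta> \<xi> = form_l \<Omega> \<sigma> f g \<eta>)"

end

theory Submission imports Defs begin

text \<open>Tested against \<open>L^2\<close>, the problem says \<open>T \<xi> = f\<close> almost everywhere and \<open>tr \<xi> = sqrt 2 g\<close> on the
  boundary. Eliminating \<open>\<xi>\<^sub>1 = f\<^sub>1 - \<nabla>\<xi>\<^sub>2\<close> leaves the weak Robin problem for \<open>- \<Delta>\<xi>\<^sub>2 + \<xi>\<^sub>2\<close> with coefficient
  \<open>(1 - \<alpha>) / (1 + \<alpha>) \<ge> 0\<close>, which is solved by minimising its energy over \<open>C^1\<close> functions; a minimising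
  sequence is Cauchy in \<open>H^1\<close> and, by the trace inequality, in \<open>L^2\<close> of the boundary. Conversely, Green's
  formula gives \<open>\<integral>|\<xi>|\<^sup>2 + \<integral>h t = \<integral>\<xi> \<bullet> f\<close> for the traces \<open>t\<close> of \<open>\<xi>\<^sub>2\<close> and \<open>h\<close> of \<open>\<xi>\<^sub>1\<close>. The boundary condition
  reads \<open>t - h = 2 g + \<alpha> (t + h)\<close>, so \<open>4 h t = (t + h)\<^sup>2 - (t - h)\<^sup>2\<close> is bounded below by
  \<open>(1 - \<alpha>\<^sub>M) (t + h)\<^sup>2 - 4 g\<^sup>2 / (1 - \<alpha>\<^sub>M)\<close>; this yields uniqueness and the estimate.

  Traces and Green's formula rest on Gauss's theorem for Lipschitz subgraphs, obtained from difference
  quotients and slicing in the vertical direction, and on the density of \<open>C^1\<close> functions in \<open>H^1\<close> and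
  \<open>H(div)\<close>, obtained by mollifying into interior cones.\<close>


section \<open>Square integrable functions\<close>

text \<open>Elements of the spaces are plain functions, and \<open>weak_grad\<close>,
  \<open>bdry_trace\<close>, \<open>normal_trace\<close> and \<open>normal_trace_fun\<close> are
  arbitrary choices. Nothing can be computed with them before existence and the appropriate
  uniqueness are known. Being choices, they are not linear either; differences go through the
  relations \<open>has_trace\<close> and \<open>has_weak_gradient\<close>. Eliminating the vector
  unknown makes the reduced form symmetric and coercive on H^1, with a bounded nonnegative weight on
  the boundary, so that the L^2 trace controls its boundary term. The flux condition then becomes a
  natural boundary condition and delivers a normal trace in L^2. The surface measure is known only
  through charts, so boundary statements are localised by a partition of unity. The almost
  everywhere derivative of the graph is supplied by the formula for the normal. In the estimate one
  division by 1 - \<open>\<alpha>M\<close> comes from the bound on 4 h t and a second from solving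
  for (t + h)^2; after the square root a single one remains. The data enter as sqrt (|f|^2 + 2
  |g|^2), which the norm of l dominates.\<close>

lemma L2_measurable: "f \<in> L2 M \<Longrightarrow> f \<in> borel_measurable M"
  by (simp add: L2_def)

lemma L2_integrable_sq: "f \<in> L2 M \<Longrightarrow> integrable M (\<lambda>x. (norm (f x))\<^sup>2)"
  by (simp add: L2_def)

lemma L2_I: "f \<in> borel_measurable M \<Longrightarrow> integrable M (\<lambda>x. (norm (f x))\<^sup>2) \<Longrightarrow> f \<in> L2 M"
  by (simp add: L2_def)

lemma L2_dominated:
  fixes f :: "'x \<Rightarrow> 'b::euclidean_space"
  assumes "f \<in> borel_measurable M" "h \<in> L2 M" "AE x in M. norm (f x) \<le> norm (h x)"
  shows "f \<in> L2 M"
proof (rule L2_I[OF assms(1)])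
  show "integrable M (\<lambda>x. (norm (f x))\<^sup>2)"
    by (rule Bochner_Integration.integrable_bound[OF L2_integrable_sq[OF assms(2)]])
      (use assms in \<open>auto intro!: power_mono elim!: eventually_mono\<close>)
qed

lemma L2_cong_AE:
  assumes "f \<in> L2 M" "g \<in> borel_measurable M" "AE x in M. f x = g x"
  shows "g \<in> L2 M"
  by (rule L2_dominated[OF assms(2,1)]) (use assms(3) in \<open>auto elim!: eventually_mono\<close>)

lemma L2_norm_cong_AE:
  assumes "f \<in> borel_measurable M" "g \<in> borel_measurable M" "AE x in M. f x = g x"
  shows "L2_norm M f = L2_norm M g"
  unfolding L2_norm_def
  by (intro arg_cong[where f=sqrt] integral_cong_AE) (use assms in \<open>auto elim!: eventually_mono\<close>)

lemma L2_zero [simp]: "(\<lambda>x. 0) \<in> L2 M"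
  by (simp add: L2_def)

lemma L2_add:
  assumes f: "f \<in> L2 M" and g: "g \<in> L2 M"
  shows "(\<lambda>x. f x + g x) \<in> L2 M"
proof (rule L2_I)
  note [measurable] = L2_measurable[OF f] L2_measurable[OF g]
  show "(\<lambda>x. f x + g x) \<in> borel_measurable M" by measurable
  show "integrable M (\<lambda>x. (norm (f x + g x))\<^sup>2)"
  proof (rule Bochner_Integration.integrable_bound)
    show "integrable M (\<lambda>x. 2 * (norm (f x))\<^sup>2 + 2 * (norm (g x))\<^sup>2)"
      using f g by (auto simp: L2_def)
    have "(norm (f x + g x))\<^sup>2 \<le> 2 * (norm (f x))\<^sup>2 + 2 * (norm (g x))\<^sup>2" for x
    proof -
      have "(norm (f x + g x))\<^sup>2 \<le> (norm (f x) + norm (g x))\<^sup>2"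
        by (intro power_mono norm_triangle_ineq) auto
      also have "\<dots> \<le> 2 * (norm (f x))\<^sup>2 + 2 * (norm (g x))\<^sup>2"
        using sum_squares_bound[of "norm (f x)" "norm (g x)"] by (simp add: power2_sum)
      finally show ?thesis .
    qed
    then show "AE x in M. norm ((norm (f x + g x))\<^sup>2) \<le> norm (2 * (norm (f x))\<^sup>2 + 2 * (norm (g x))\<^sup>2)"
      by simp
  qed measurable
qed

lemma L2_scaleR: "f \<in> L2 M \<Longrightarrow> (\<lambda>x. c *\<^sub>R f x) \<in> L2 M"
  by (auto simp: L2_def power_mult_distrib)

lemma L2_cmult: "f \<in> L2 M \<Longrightarrow> (\<lambda>x. c * f x :: real) \<in> L2 M"
  using L2_scaleR[of f M c] by simp

lemma L2_uminus: "f \<in> L2 M \<Longrightarrow> (\<lambda>x. - f x) \<in> L2 M"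
  by (auto simp: L2_def)

lemma L2_diff: "f \<in> L2 M \<Longrightarrow> g \<in> L2 M \<Longrightarrow> (\<lambda>x. f x - g x) \<in> L2 M"
  using L2_add[of f M "\<lambda>x. - g x"] L2_uminus by fastforce

lemma L2_sum: "(\<And>i. i \<in> I \<Longrightarrow> f i \<in> L2 M) \<Longrightarrow> (\<lambda>x. \<Sum>i\<in>I. f i x) \<in> L2 M"
  by (induction I rule: infinite_finite_induct) (auto intro: L2_add)

lemma L2_bounded_scaleR:
  fixes f :: "'x \<Rightarrow> 'b::euclidean_space"
  assumes "f \<in> L2 M" "a \<in> borel_measurable M" "AE x in M. \<bar>a x\<bar> \<le> B"
  shows "(\<lambda>x. a x *\<^sub>R f x) \<in> L2 M"
proof (rule L2_dominated[OF _ L2_scaleR[OF assms(1), of B]])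
  show "(\<lambda>x. a x *\<^sub>R f x) \<in> borel_measurable M"
    using assms L2_measurable by measurable
  show "AE x in M. norm (a x *\<^sub>R f x) \<le> norm (B *\<^sub>R f x)"
    using assms(3) by eventually_elim (auto intro!: mult_right_mono)
qed

lemma L2_bounded_mult:
  fixes f :: "'x \<Rightarrow> real"
  assumes "f \<in> L2 M" "a \<in> borel_measurable M" "AE x in M. \<bar>a x\<bar> \<le> B"
  shows "(\<lambda>x. a x * f x) \<in> L2 M"
  using L2_bounded_scaleR[OF assms] by simp

lemma L2_norm_nonneg [simp]: "0 \<le> L2_norm M f"
  by (simp add: L2_norm_def)

lemma L2_norm_power2: "(L2_norm M f)\<^sup>2 = (\<integral>x. (norm (f x))\<^sup>2 \<partial>M)"
  by (simp add: L2_norm_def)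

lemma L2_norm_uminus: "L2_norm M (\<lambda>x. - f x) = L2_norm M f"
  by (simp add: L2_norm_def)

lemma L2_norm_minus_commute: "L2_norm M (\<lambda>x. f x - g x) = L2_norm M (\<lambda>x. g x - f x)"
  by (simp add: L2_norm_def norm_minus_commute)

lemma L2_norm_scaleR: "L2_norm M (\<lambda>x. c *\<^sub>R f x) = \<bar>c\<bar> * L2_norm M f"
  by (simp add: L2_norm_def power_mult_distrib real_sqrt_mult)

lemma L2_norm_cmult: "L2_norm M (\<lambda>x. c * f x :: real) = \<bar>c\<bar> * L2_norm M f"
  using L2_norm_scaleR[of M c f] by simp

lemma L2_norm_zero [simp]: "L2_norm M (\<lambda>x. 0) = 0"
  by (simp add: L2_norm_def)

lemma L2_norm_mono:
  assumes "f \<in> borel_measurable M" "h \<in> L2 M" "AE x in M. norm (f x) \<le> norm (h x)"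
  shows "L2_norm M f \<le> L2_norm M h"
  unfolding L2_norm_def
  by (intro real_sqrt_le_mono integral_mono_AE L2_integrable_sq assms L2_dominated[OF assms])
    (use assms in \<open>auto elim!: eventually_mono intro!: power_mono\<close>)

lemma nn_integral_L2:
  assumes "f \<in> L2 M"
  shows "(\<integral>\<^sup>+x. ennreal ((norm (f x))\<^sup>2) \<partial>M) = ennreal ((L2_norm M f)\<^sup>2)"
  unfolding L2_norm_power2
  by (rule nn_integral_eq_integral[OF L2_integrable_sq[OF assms]]) simp

text \<open>Membership is read off from a bound on the nonnegative integral, the form in which
  Fatou's lemma and Tonelli's theorem deliver their estimates.\<close>

lemma L2_I_nn:
  assumes "f \<in> borel_measurable M" "(\<integral>\<^sup>+x. ennreal ((norm (f x))\<^sup>2) \<partial>M) \<le> ennreal c"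
  shows "f \<in> L2 M"
proof (rule L2_I[OF assms(1)], rule integrableI_bounded)
  show "(\<lambda>x. (norm (f x))\<^sup>2) \<in> borel_measurable M" using assms(1) by measurable
  show "(\<integral>\<^sup>+x. ennreal (norm ((norm (f x))\<^sup>2)) \<partial>M) < \<infinity>"
    using assms(2) by (simp add: order_le_less_trans[OF _ ennreal_less_top])
qed

lemma L2_norm_le_nn:
  assumes "f \<in> borel_measurable M" "(\<integral>\<^sup>+x. ennreal ((norm (f x))\<^sup>2) \<partial>M) \<le> ennreal (c\<^sup>2)" "0 \<le> c"
  shows "L2_norm M f \<le> c"
proof -
  have "ennreal ((L2_norm M f)\<^sup>2) \<le> ennreal (c\<^sup>2)"
    using nn_integral_L2[OF L2_I_nn[OF assms(1,2)]] assms(2) by simp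
  then show ?thesis using assms(3) by (simp add: power2_le_iff_abs_le)
qed

lemma L2_norm_eq_0:
  assumes "f \<in> L2 M" "L2_norm M f = 0"
  shows "AE x in M. f x = 0"
proof -
  have "(\<integral>x. (norm (f x))\<^sup>2 \<partial>M) = 0" using L2_norm_power2[of M f] assms(2) by simp
  then have "AE x in M. (norm (f x))\<^sup>2 = 0"
    by (subst (asm) integral_nonneg_eq_0_iff_AE) (use assms in \<open>auto simp: L2_def\<close>)
  then show ?thesis by simp
qed

lemma L2_inner_integrable:
  assumes f: "f \<in> L2 M" and g: "g \<in> L2 M"
  shows "integrable M (\<lambda>x. f x \<bullet> g x)"
proof (rule Bochner_Integration.integrable_bound)
  note [measurable] = L2_measurable[OF f] L2_measurable[OF g]
  show "integrable M (\<lambda>x. (norm (f x))\<^sup>2 + (norm (g x))\<^sup>2)"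
    using f g by (auto simp: L2_def)
  show "(\<lambda>x. f x \<bullet> g x) \<in> borel_measurable M" by measurable
  have "\<bar>f x \<bullet> g x\<bar> \<le> (norm (f x))\<^sup>2 + (norm (g x))\<^sup>2" for x
  proof -
    have "\<bar>f x \<bullet> g x\<bar> \<le> norm (f x) * norm (g x)" by (rule Cauchy_Schwarz_ineq2)
    moreover have "2 * norm (f x) * norm (g x) \<le> (norm (f x))\<^sup>2 + (norm (g x))\<^sup>2"
      by (rule sum_squares_bound)
    ultimately show ?thesis using mult_nonneg_nonneg[OF norm_ge_zero[of "f x"] norm_ge_zero[of "g x"]] by linarith
  qed
  then show "AE x in M. norm (f x \<bullet> g x) \<le> norm ((norm (f x))\<^sup>2 + (norm (g x))\<^sup>2)" by simp
qed

lemma L2_mult_integrable: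
  fixes f g :: "'x \<Rightarrow> real"
  shows "f \<in> L2 M \<Longrightarrow> g \<in> L2 M \<Longrightarrow> integrable M (\<lambda>x. f x * g x)"
  using L2_inner_integrable[of f M g] by simp

text \<open>The squared norm of f + t g is a quadratic in t that is never negative. It is evaluated
  at its minimiser if g has positive norm; otherwise it is affine in t, and a nonzero slope would
  make it equal to -1 for the t used below.\<close>

lemma L2_Cauchy_Schwarz:
  assumes f: "f \<in> L2 M" and g: "g \<in> L2 M"
  shows "\<bar>\<integral>x. f x \<bullet> g x \<partial>M\<bar> \<le> L2_norm M f * L2_norm M g"
proof -
  let ?I = "\<integral>x. f x \<bullet> g x \<partial>M" and ?F = "L2_norm M f" and ?G = "L2_norm M g"
  have q: "0 \<le> ?F\<^sup>2 + 2 * t * ?I + t\<^sup>2 * ?G\<^sup>2" for t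
  proof -
    have "0 \<le> (\<integral>x. (norm (f x + t *\<^sub>R g x))\<^sup>2 \<partial>M)" by simp
    also have "\<dots> = (\<integral>x. (norm (f x))\<^sup>2 + 2 * t * (f x \<bullet> g x) + t\<^sup>2 * (norm (g x))\<^sup>2 \<partial>M)"
      unfolding power2_norm_eq_inner
      by (intro Bochner_Integration.integral_cong)
        (auto simp: inner_simps inner_commute algebra_simps power2_eq_square)
    also have "\<dots> = ?F\<^sup>2 + 2 * t * ?I + t\<^sup>2 * ?G\<^sup>2"
      using f g L2_inner_integrable[OF f g] by (simp add: L2_integrable_sq L2_norm_power2)
    finally show ?thesis .
  qed
  show ?thesis
  proof (cases "?G = 0")
    case True
    have "?I = 0"
    proof (rule ccontr)
      assume "?I \<noteq> 0"
      with q[of "- (?F\<^sup>2 + 1) / (2 * ?I)"] True show False by (simp add: field_simps)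
    qed
    then show ?thesis using True by simp
  next
    case False
    have "0 \<le> (?F\<^sup>2 + 2 * (- ?I / ?G\<^sup>2) * ?I + (- ?I / ?G\<^sup>2)\<^sup>2 * ?G\<^sup>2) * ?G\<^sup>2"
      by (intro mult_nonneg_nonneg q) auto
    also have "\<dots> = ?F\<^sup>2 * ?G\<^sup>2 - ?I\<^sup>2"
      using False by (simp add: field_simps power2_eq_square)
    finally have "?I\<^sup>2 \<le> (?F * ?G)\<^sup>2" by (simp add: power_mult_distrib)
    then show ?thesis by (simp add: abs_le_square_iff[symmetric] abs_mult)
  qed
qed

lemma L2_norm_triangle:
  assumes f: "f \<in> L2 M" and g: "g \<in> L2 M"
  shows "L2_norm M (\<lambda>x. f x + g x) \<le> L2_norm M f + L2_norm M g"
proof (rule power2_le_imp_le)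
  have "(L2_norm M (\<lambda>x. f x + g x))\<^sup>2 = (\<integral>x. (norm (f x))\<^sup>2 + 2 * (f x \<bullet> g x) + (norm (g x))\<^sup>2 \<partial>M)"
    unfolding L2_norm_power2
    by (intro Bochner_Integration.integral_cong)
      (auto simp: power2_norm_eq_inner inner_simps inner_commute algebra_simps)
  also have "\<dots> = (L2_norm M f)\<^sup>2 + 2 * (\<integral>x. f x \<bullet> g x \<partial>M) + (L2_norm M g)\<^sup>2"
    using f g L2_inner_integrable[OF f g] by (simp add: L2_integrable_sq L2_norm_power2)
  also have "\<dots> \<le> (L2_norm M f + L2_norm M g)\<^sup>2"
    using L2_Cauchy_Schwarz[OF f g] by (simp add: power2_sum)
  finally show "(L2_norm M (\<lambda>x. f x + g x))\<^sup>2 \<le> (L2_norm M f + L2_norm M g)\<^sup>2" .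
qed simp

lemma L2_norm_triangle_diff:
  assumes "f \<in> L2 M" "g \<in> L2 M" "h \<in> L2 M"
  shows "L2_norm M (\<lambda>x. f x - h x) \<le> L2_norm M (\<lambda>x. f x - g x) + L2_norm M (\<lambda>x. g x - h x)"
  using L2_norm_triangle[of "\<lambda>x. f x - g x" M "\<lambda>x. g x - h x"] assms by (simp add: L2_diff)

lemma L2_norm_sum:
  assumes "finite I" "\<And>i. i \<in> I \<Longrightarrow> f i \<in> L2 M"
  shows "L2_norm M (\<lambda>x. \<Sum>i\<in>I. f i x) \<le> (\<Sum>i\<in>I. L2_norm M (f i))"
  using assms
proof (induction I rule: finite_induct)
  case (insert i I)
  have "L2_norm M (\<lambda>x. f i x + (\<Sum>i\<in>I. f i x)) \<le> L2_norm M (f i) + L2_norm M (\<lambda>x. \<Sum>i\<in>I. f i x)"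
    by (rule L2_norm_triangle) (use insert in \<open>auto intro: L2_sum\<close>)
  with insert show ?case by simp
qed simp

text \<open>The difference of the products is expanded around the limits, so that only the
  convergent differences and the fixed norms of f' and g' have to be estimated.\<close>

lemma L2_tendsto_inner:
  assumes f: "\<And>k. f k \<in> L2 M" "f' \<in> L2 M" "(\<lambda>k. L2_norm M (\<lambda>x. f k x - f' x)) \<longlonglongrightarrow> 0"
    and g: "\<And>k. g k \<in> L2 M" "g' \<in> L2 M" "(\<lambda>k. L2_norm M (\<lambda>x. g k x - g' x)) \<longlonglongrightarrow> 0"
  shows "(\<lambda>k. \<integral>x. f k x \<bullet> g k x \<partial>M) \<longlonglongrightarrow> (\<integral>x. f' x \<bullet> g' x \<partial>M)"
proof (rule LIM_zero_cancel, rule Lim_null_comparison)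
  let ?df = "\<lambda>k. L2_norm M (\<lambda>x. f k x - f' x)" and ?dg = "\<lambda>k. L2_norm M (\<lambda>x. g k x - g' x)"
  let ?b = "\<lambda>k. ?df k * ?dg k + ?df k * L2_norm M g' + L2_norm M f' * ?dg k"
  have "?b \<longlonglongrightarrow> 0 * 0 + 0 * L2_norm M g' + L2_norm M f' * 0"
    by (intro tendsto_intros f g)
  then show "?b \<longlonglongrightarrow> 0" by simp
  have "norm ((\<integral>x. f k x \<bullet> g k x \<partial>M) - (\<integral>x. f' x \<bullet> g' x \<partial>M)) \<le> ?b k" for k
  proof -
    note i = L2_inner_integrable[OF L2_diff[OF f(1) f(2)] L2_diff[OF g(1) g(2)], of k k]
      L2_inner_integrable[OF L2_diff[OF f(1) f(2)] g(2), of k]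
      L2_inner_integrable[OF f(2) L2_diff[OF g(1) g(2)], of k]
    have "(\<integral>x. f k x \<bullet> g k x \<partial>M) - (\<integral>x. f' x \<bullet> g' x \<partial>M) = (\<integral>x. f k x \<bullet> g k x - f' x \<bullet> g' x \<partial>M)"
      by (simp add: L2_inner_integrable f g)
    also have "\<dots> = (\<integral>x. (f k x - f' x) \<bullet> (g k x - g' x) + (f k x - f' x) \<bullet> g' x + f' x \<bullet> (g k x - g' x) \<partial>M)"
      by (simp add: inner_simps algebra_simps)
    also have "\<dots> = (\<integral>x. (f k x - f' x) \<bullet> (g k x - g' x) \<partial>M) + (\<integral>x. (f k x - f' x) \<bullet> g' x \<partial>M)
        + (\<integral>x. f' x \<bullet> (g k x - g' x) \<partial>M)"
      using i by simp
    finally show ?thesis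
      using L2_Cauchy_Schwarz[OF L2_diff[OF f(1) f(2)] L2_diff[OF g(1) g(2)], of k k]
        L2_Cauchy_Schwarz[OF L2_diff[OF f(1) f(2)] g(2), of k]
        L2_Cauchy_Schwarz[OF f(2) L2_diff[OF g(1) g(2)], of k] by simp
  qed
  then show "\<forall>\<^sub>F k in sequentially. norm ((\<integral>x. f k x \<bullet> g k x \<partial>M) - (\<integral>x. f' x \<bullet> g' x \<partial>M)) \<le> ?b k"
    by simp
qed

lemma L2_tendsto_inner_const:
  assumes f: "\<And>k. f k \<in> L2 M" "f' \<in> L2 M" "(\<lambda>k. L2_norm M (\<lambda>x. f k x - f' x)) \<longlonglongrightarrow> 0"
    and g: "g \<in> L2 M"
  shows "(\<lambda>k. \<integral>x. f k x \<bullet> g x \<partial>M) \<longlonglongrightarrow> (\<integral>x. f' x \<bullet> g x \<partial>M)"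
  by (rule L2_tendsto_inner[OF f, of "\<lambda>_. g"]) (use g in auto)

lemma L2_tendsto_imp_Cauchy:
  assumes f: "\<And>k. f k \<in> L2 M" "f' \<in> L2 M" "(\<lambda>k. L2_norm M (\<lambda>x. f k x - f' x)) \<longlonglongrightarrow> 0" and e: "e > 0"
  shows "\<exists>N. \<forall>m\<ge>N. \<forall>n\<ge>N. L2_norm M (\<lambda>x. f m x - f n x) < e"
proof -
  obtain N where N: "\<And>n. n \<ge> N \<Longrightarrow> L2_norm M (\<lambda>x. f n x - f' x) < e / 2"
    using order_tendstoD(2)[OF f(3), of "e/2"] e by (auto simp: eventually_sequentially)
  show ?thesis
  proof (intro exI[of _ N] allI impI)
    fix m n assume "m \<ge> N" "n \<ge> N"
    then have "L2_norm M (\<lambda>x. f m x - f' x) < e / 2" "L2_norm M (\<lambda>x. f' x - f n x) < e / 2"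
      using N[of m] N[of n] by (auto simp: L2_norm_minus_commute[of M f'])
    then show "L2_norm M (\<lambda>x. f m x - f n x) < e"
      using L2_norm_triangle_diff[OF f(1) f(2) f(1), of m n] by linarith
  qed
qed

text \<open>Summing the weighted squares of the increments of a fast subsequence gives
  pointwise convergence almost everywhere without using Minkowski's inequality for series.\<close>

lemma L2_complete:
  fixes f :: "nat \<Rightarrow> 'x \<Rightarrow> 'b::euclidean_space"
  assumes f: "\<And>k. f k \<in> L2 M"
    and cauchy: "\<And>e. e > 0 \<Longrightarrow> \<exists>N. \<forall>m\<ge>N. \<forall>n\<ge>N. L2_norm M (\<lambda>x. f m x - f n x) < e"
  shows "\<exists>g\<in>L2 M. (\<lambda>k. L2_norm M (\<lambda>x. f k x - g x)) \<longlonglongrightarrow> 0"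
proof -
  note [measurable] = L2_measurable[OF f]
  have "\<exists>N. \<forall>k. \<forall>m\<ge>N k. \<forall>n\<ge>N k. L2_norm M (\<lambda>x. f m x - f n x) < (1/2)^k"
    using cauchy[of "(1/2)^k" for k] by (intro choice) auto
  then obtain N where N: "\<And>k m n. m \<ge> N k \<Longrightarrow> n \<ge> N k \<Longrightarrow> L2_norm M (\<lambda>x. f m x - f n x) < (1/2)^k"
    by blast
  \<comment> \<open>Summing the thresholds puts both \<open>r k\<close> and \<open>r (Suc k)\<close>
    beyond \<open>N k\<close>, so the k-th increment has norm below (1/2)^k.\<close>
  define r where "r k = (\<Sum>i\<le>k. N i)" for k
  have rN: "N k \<le> r k" for k unfolding r_def by (rule member_le_sum) auto
  have rN': "N k \<le> r (Suc k)" for k using rN[of k] by (simp add: r_def)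
  define d where "d k x = f (r (Suc k)) x - f (r k) x" for k x
  have [measurable]: "d k \<in> borel_measurable M" for k unfolding d_def by measurable
  have dL2: "d k \<in> L2 M" for k unfolding d_def by (intro L2_diff f)
  have dn: "(L2_norm M (d k))\<^sup>2 \<le> (1/4)^k" for k
  proof -
    have "L2_norm M (d k) \<le> (1/2)^k" using N[OF rN' rN] unfolding d_def by (simp add: less_imp_le)
    then have "(L2_norm M (d k))\<^sup>2 \<le> ((1/2)^k)\<^sup>2" by (intro power_mono) auto
    also have "((1/2)^k)\<^sup>2 = ((1/4)^k::real)" by (simp add: power2_eq_square power_mult_distrib[symmetric])
    finally show ?thesis .
  qed
  have "(\<integral>\<^sup>+x. (\<Sum>k. ennreal (2^k * (norm (d k x))\<^sup>2)) \<partial>M) = (\<Sum>k. \<integral>\<^sup>+x. ennreal (2^k * (norm (d k x))\<^sup>2) \<partial>M)"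
    by (rule nn_integral_suminf) measurable
  also have "\<dots> \<le> (\<Sum>k. ennreal ((1/2)^k))"
  proof (intro suminf_le summableI)
    fix k
    have "(\<integral>\<^sup>+x. ennreal (2^k * (norm (d k x))\<^sup>2) \<partial>M) = ennreal (2^k) * (\<integral>\<^sup>+x. ennreal ((norm (d k x))\<^sup>2) \<partial>M)"
      by (subst nn_integral_cmult[symmetric]) (auto simp: ennreal_mult)
    also have "\<dots> = ennreal (2^k * (L2_norm M (d k))\<^sup>2)"
      by (simp add: nn_integral_L2[OF dL2] ennreal_mult)
    also have "\<dots> \<le> ennreal (2^k * (1/4)^k)"
      by (intro ennreal_leI mult_left_mono dn) auto
    also have "(2^k * (1/4)^k) = ((1/2)^k::real)" by (simp add: power_mult_distrib[symmetric])
    finally show "(\<integral>\<^sup>+x. ennreal (2^k * (norm (d k x))\<^sup>2) \<partial>M) \<le> ennreal ((1/2)^k)" .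
  qed
  also have "\<dots> < \<infinity>"
    by (subst suminf_ennreal2) (auto intro: summable_geometric)
  finally have fin: "(\<integral>\<^sup>+x. (\<Sum>k. ennreal (2^k * (norm (d k x))\<^sup>2)) \<partial>M) \<noteq> \<infinity>" by simp
  have ae: "AE x in M. (\<Sum>k. ennreal (2^k * (norm (d k x))\<^sup>2)) \<noteq> \<infinity>"
    by (rule nn_integral_noteq_infinite[OF _ fin]) measurable
  have conv: "convergent (\<lambda>k. f (r k) x)" if fin: "(\<Sum>k. ennreal (2^k * (norm (d k x))\<^sup>2)) \<noteq> \<infinity>" for x
  proof -
    have "summable (\<lambda>k. 2^k * (norm (d k x))\<^sup>2)"
      by (rule summable_suminf_not_top) (use fin in auto)
    then have s2: "summable (\<lambda>k. (1/2)^k + 2^k * (norm (d k x))\<^sup>2)"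
      by (intro summable_add summable_geometric) auto
    have "summable (\<lambda>k. d k x)"
    proof (rule summable_comparison_test'[OF s2])
      fix k :: nat
      have pos: "(0::real) < 2^k" by simp
      \<comment> \<open>Young's inequality with weight 2^k gives |d| <= (1/2)^k + 2^k |d|^2:
        summability of the weighted squares passes to the increments themselves.\<close>
      have "2 * 1 * (2^k * norm (d k x)) \<le> 1\<^sup>2 + (2^k * norm (d k x))\<^sup>2" by (rule sum_squares_bound)
      then have "2^k * norm (d k x) \<le> 1 + (2^k * norm (d k x))\<^sup>2"
        using mult_nonneg_nonneg[OF less_imp_le[OF pos] norm_ge_zero[of "d k x"]]
        by (simp only: power_one mult_1_right)
      also have "\<dots> = 2^k * ((1/2)^k + 2^k * (norm (d k x))\<^sup>2)"
        by (simp add: field_simps power2_eq_square)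
      finally show "norm (d k x) \<le> (1/2)^k + 2^k * (norm (d k x))\<^sup>2"
        using pos by (simp only: mult_le_cancel_left_pos)
    qed
    then have "convergent (\<lambda>n. \<Sum>k<n. d k x)" by (simp add: summable_iff_convergent)
    moreover have "(\<Sum>k<n. d k x) = f (r n) x - f (r 0) x" for n
      unfolding d_def by (rule sum_lessThan_telescope)
    ultimately have "convergent (\<lambda>n. (f (r n) x - f (r 0) x) + f (r 0) x)"
      by (intro convergent_add convergent_const) simp
    then show ?thesis by simp
  qed
  define g where "g x = lim (\<lambda>k. f (r k) x)" for x
  have gm[measurable]: "g \<in> borel_measurable M"
    unfolding g_def by (rule borel_measurable_lim_metric) measurable
  have lim: "AE x in M. (\<lambda>k. f (r k) x) \<longlonglongrightarrow> g x"
    using ae by eventually_elim (use conv in \<open>auto simp: g_def convergent_LIMSEQ_iff\<close>)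
  \<comment> \<open>Fatou's lemma along the subsequence turns the Cauchy estimate for
    \<open>f n - f (r k)\<close> into the same bound for \<open>f n - g\<close>.\<close>
  have bound: "(\<integral>\<^sup>+x. ennreal ((norm (f n x - g x))\<^sup>2) \<partial>M) \<le> ennreal (((1/2)^j)\<^sup>2)" if n: "n \<ge> N j" for n j
  proof -
    have "(\<integral>\<^sup>+x. ennreal ((norm (f n x - g x))\<^sup>2) \<partial>M)
        = (\<integral>\<^sup>+x. liminf (\<lambda>k. ennreal ((norm (f n x - f (r k) x))\<^sup>2)) \<partial>M)"
    proof (rule nn_integral_cong_AE)
      show "AE x in M. ennreal ((norm (f n x - g x))\<^sup>2) = liminf (\<lambda>k. ennreal ((norm (f n x - f (r k) x))\<^sup>2))"
        using lim
      proof eventually_elim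
        case (elim x)
        have "(\<lambda>k. ennreal ((norm (f n x - f (r k) x))\<^sup>2)) \<longlonglongrightarrow> ennreal ((norm (f n x - g x))\<^sup>2)"
          by (intro tendsto_intros elim)
        from lim_imp_Liminf[OF sequentially_bot this] show ?case by (rule sym)
      qed
    qed
    also have "\<dots> \<le> liminf (\<lambda>k. \<integral>\<^sup>+x. ennreal ((norm (f n x - f (r k) x))\<^sup>2) \<partial>M)"
      by (rule nn_integral_liminf) measurable
    also have "\<dots> \<le> ennreal (((1/2)^j)\<^sup>2)"
    proof (rule Liminf_le)
      show "\<forall>\<^sub>F k in sequentially. (\<integral>\<^sup>+x. ennreal ((norm (f n x - f (r k) x))\<^sup>2) \<partial>M) \<le> ennreal (((1/2)^j)\<^sup>2)"
      proof (rule eventually_sequentiallyI[of j])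
        fix k assume "j \<le> k"
        have "N j \<le> r k" using \<open>j \<le> k\<close> unfolding r_def by (intro member_le_sum) auto
        from N[OF n this] have "(L2_norm M (\<lambda>x. f n x - f (r k) x))\<^sup>2 \<le> ((1/2)^j)\<^sup>2"
          by (intro power_mono) auto
        then show "(\<integral>\<^sup>+x. ennreal ((norm (f n x - f (r k) x))\<^sup>2) \<partial>M) \<le> ennreal (((1/2)^j)\<^sup>2)"
          by (subst nn_integral_L2[OF L2_diff[OF f f]]) (rule ennreal_leI)
      qed
    qed simp
    finally show ?thesis .
  qed
  have "(\<lambda>x. f (N 0) x - g x) \<in> L2 M"
    by (rule L2_I_nn[OF _ bound[of 0 "N 0"]]) auto
  then have "(\<lambda>x. f (N 0) x - (f (N 0) x - g x)) \<in> L2 M" by (rule L2_diff[OF f])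
  then have gL2: "g \<in> L2 M" by simp
  have "(\<lambda>k. L2_norm M (\<lambda>x. f k x - g x)) \<longlonglongrightarrow> 0"
  proof (rule LIMSEQ_I)
    fix e :: real assume "e > 0"
    then obtain j where j: "(1/2)^j < e" using real_arch_pow_inv[of e "1/2"] by auto
    have "L2_norm M (\<lambda>x. f n x - g x) < e" if "n \<ge> N j" for n
      using L2_norm_le_nn[OF _ bound[OF that]] j by simp
    then show "\<exists>no. \<forall>n\<ge>no. norm (L2_norm M (\<lambda>x. f n x - g x) - 0) < e" by (intro exI[of _ "N j"]) simp
  qed
  with gL2 show ?thesis by blast
qed

section \<open>Functions of class C^k\<close>

lemma Ck_SucI:
  assumes "\<And>x. (f has_derivative f' x) (at x)" "\<And>v. Ck k (\<lambda>x. f' x v)"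
  shows "Ck (Suc k) f"
  using assms by auto

lemma Ck_Suc_imp_Ck: "Ck (Suc k) f \<Longrightarrow> Ck k f"
proof (induction k arbitrary: f)
  case 0
  then show ?case
    using has_derivative_continuous by (fastforce intro: continuous_at_imp_continuous_on)
next
  case (Suc k)
  from Suc.prems obtain f' where f': "\<And>x. (f has_derivative f' x) (at x)" "\<And>v. Ck (Suc k) (\<lambda>x. f' x v)"
    by auto
  show ?case by (rule Ck_SucI[OF f'(1)]) (rule Suc.IH[OF f'(2)])
qed

lemma Ck_imp_continuous: "Ck k f \<Longrightarrow> continuous_on UNIV f"
  by (induction k) (use Ck_Suc_imp_Ck in \<open>auto simp del: Ck.simps(2)\<close>)

lemma Ck_const [simp, intro]: "Ck k (\<lambda>x. c)"
proof (induction k arbitrary: c)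
  case (Suc k)
  show ?case by (rule Ck_SucI[where f'="\<lambda>x v. 0"]) (auto simp: Suc)
qed simp

lemma Ck_bounded_linear:
  assumes "bounded_linear L"
  shows "Ck k L"
proof (cases k)
  case 0
  then show ?thesis using assms by (simp add: linear_continuous_on)
next
  case (Suc j)
  show ?thesis unfolding Suc
    by (rule Ck_SucI[where f'="\<lambda>x. L"]) (use assms in \<open>auto intro: bounded_linear_imp_has_derivative\<close>)
qed

lemma Ck_add: "Ck k f \<Longrightarrow> Ck k g \<Longrightarrow> Ck k (\<lambda>x. f x + g x)"
proof (induction k arbitrary: f g)
  case 0
  then show ?case by (auto intro: continuous_on_add)
next
  case (Suc k)
  from Suc.prems obtain f' g' where f': "\<And>x. (f has_derivative f' x) (at x)" "\<And>v. Ck k (\<lambda>x. f' x v)"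
    and g': "\<And>x. (g has_derivative g' x) (at x)" "\<And>v. Ck k (\<lambda>x. g' x v)"
    by auto
  show ?case
    by (rule Ck_SucI[OF has_derivative_add[OF f'(1) g'(1)]]) (rule Suc.IH[OF f'(2) g'(2)])
qed

lemma Ck_compose_linear:
  assumes "bounded_linear L"
  shows "Ck k f \<Longrightarrow> Ck k (\<lambda>x. f (c + L x))"
proof (induction k arbitrary: f)
  case 0
  then show ?case
    by (auto intro!: continuous_on_compose2[of UNIV f] continuous_intros linear_continuous_on[OF assms])
next
  case (Suc k)
  from Suc.prems obtain f' where f': "\<And>x. (f has_derivative f' x) (at x)" "\<And>v. Ck k (\<lambda>x. f' x v)"
    by auto
  show ?case
  proof (rule Ck_SucI)
    show "((\<lambda>x. f (c + L x)) has_derivative (\<lambda>v. f' (c + L x) (L v))) (at x)" for x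
    proof -
      have "((\<lambda>x. c + L x) has_derivative L) (at x)"
        using has_derivative_add[OF has_derivative_const bounded_linear_imp_has_derivative[OF assms], of c] by simp
      from has_derivative_compose[OF this f'(1)] show ?thesis .
    qed
    show "Ck k (\<lambda>x. f' (c + L x) (L v))" for v
      by (rule Suc.IH[OF f'(2)])
  qed
qed

lemma Ck_linear_compose:
  assumes "bounded_linear L"
  shows "Ck k f \<Longrightarrow> Ck k (\<lambda>x. L (f x))"
proof (induction k arbitrary: f)
  case 0
  then show ?case
    by (auto intro!: continuous_on_compose2[of UNIV L] linear_continuous_on[OF assms])
next
  case (Suc k)
  from Suc.prems obtain f' where f': "\<And>x. (f has_derivative f' x) (at x)" "\<And>v. Ck k (\<lambda>x. f' x v)"
    by auto
  show ?case
    by (rule Ck_SucI[OF bounded_linear.has_derivative[OF assms f'(1)]]) (rule Suc.IH[OF f'(2)])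
qed

lemma Ck_uminus: "Ck k f \<Longrightarrow> Ck k (\<lambda>x. - f x)"
  by (rule Ck_linear_compose) (auto intro: bounded_linear_minus bounded_linear_ident)

lemma Ck_diff: "Ck k f \<Longrightarrow> Ck k g \<Longrightarrow> Ck k (\<lambda>x. f x - g x)"
  using Ck_add[of k f "\<lambda>x. - g x"] Ck_uminus[of k g] by simp

lemma Ck_scaleR:
  fixes f :: "'a::euclidean_space \<Rightarrow> real" and g :: "'a \<Rightarrow> 'b::real_normed_vector"
  shows "Ck k f \<Longrightarrow> Ck k g \<Longrightarrow> Ck k (\<lambda>x. f x *\<^sub>R g x)"
proof (induction k arbitrary: f g)
  case 0
  then show ?case by (auto intro: continuous_on_scaleR)
next
  case (Suc k)
  from Suc.prems obtain f' g' where f': "\<And>x. (f has_derivative f' x) (at x)" "\<And>v. Ck k (\<lambda>x. f' x v)"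
    and g': "\<And>x. (g has_derivative g' x) (at x)" "\<And>v. Ck k (\<lambda>x. g' x v)"
    by auto
  show ?case
    by (rule Ck_SucI[OF has_derivative_scaleR[OF f'(1) g'(1)]])
      (intro Ck_add Suc.IH f' g' Ck_Suc_imp_Ck[OF Suc.prems(1)] Ck_Suc_imp_Ck[OF Suc.prems(2)])
qed

lemma Ck_mult:
  fixes f g :: "'a::euclidean_space \<Rightarrow> real"
  shows "Ck k f \<Longrightarrow> Ck k g \<Longrightarrow> Ck k (\<lambda>x. f x * g x)"
  using Ck_scaleR[of k f g] by simp

lemma Ck_sum: "(\<And>i. i \<in> I \<Longrightarrow> Ck k (f i)) \<Longrightarrow> Ck k (\<lambda>x. \<Sum>i\<in>I. f i x)"
  by (induction I rule: infinite_finite_induct) (auto intro: Ck_add)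

lemma Ck_prod:
  fixes f :: "'i \<Rightarrow> 'a::euclidean_space \<Rightarrow> real"
  shows "(\<And>i. i \<in> I \<Longrightarrow> Ck k (f i)) \<Longrightarrow> Ck k (\<lambda>x. \<Prod>i\<in>I. f i x)"
  by (induction I rule: infinite_finite_induct) (auto intro: Ck_mult)

lemma Ck_power:
  fixes f :: "'a::euclidean_space \<Rightarrow> real"
  shows "Ck k f \<Longrightarrow> Ck k (\<lambda>x. f x ^ n)"
  by (induction n) (auto intro: Ck_mult)

lemma Ck_inner_const: "Ck k f \<Longrightarrow> Ck k (\<lambda>x. f x \<bullet> v)"
  by (rule Ck_linear_compose) (auto intro: bounded_linear_inner_left)

lemma Ck_inner:
  fixes f g :: "'a::euclidean_space \<Rightarrow> 'b::euclidean_space"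
  assumes "Ck k f" "Ck k g"
  shows "Ck k (\<lambda>x. f x \<bullet> g x)"
  by (subst euclidean_inner) (intro Ck_sum Ck_mult Ck_inner_const assms)

lemma Ck_component: "Ck k f \<Longrightarrow> Ck k (\<lambda>x. f x $ i)"
  by (rule Ck_linear_compose) (auto intro: bounded_linear_vec_nth)

lemma Ck_ident: "Ck k (\<lambda>x. x)"
  by (rule Ck_bounded_linear) (rule bounded_linear_ident)

lemma Ck_vec:
  fixes f :: "'a::euclidean_space \<Rightarrow> real^'n"
  assumes "\<And>i. Ck k (\<lambda>x. f x $ i)"
  shows "Ck k f"
proof -
  have "Ck k (\<lambda>x. \<Sum>i\<in>UNIV. (f x $ i) *\<^sub>R axis i (1::real))"
    by (intro Ck_sum Ck_scaleR assms Ck_const)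
  moreover have "(\<lambda>x. \<Sum>i\<in>UNIV. (f x $ i) *\<^sub>R axis i (1::real)) = f"
    using basis_expansion[of "f _"] by (simp add: scalar_mult_eq_scaleR)
  ultimately show ?thesis by (simp only:)
qed

text \<open>On the reals the derivative of h is multiplication by \<open>h' x 1\<close>, so the
  chain rule yields a product of a derivative of g with a function of g. The induction hypothesis
  covers the latter; in several variables h' would be applied to a varying direction.\<close>

lemma Ck_compose_real:
  fixes g :: "'a::euclidean_space \<Rightarrow> real"
  shows "Ck k h \<Longrightarrow> Ck k g \<Longrightarrow> Ck k (\<lambda>x. h (g x) :: real)"
proof (induction k arbitrary: h)
  case 0
  then show ?case by (auto intro: continuous_on_compose2[of UNIV h])
next
  case (Suc k)
  from Suc.prems obtain h' g' where h': "\<And>x. (h has_derivative h' x) (at x)" "\<And>v. Ck k (\<lambda>x. h' x v)"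
    and g': "\<And>x. (g has_derivative g' x) (at x)" "\<And>v. Ck k (\<lambda>x. g' x v)"
    by auto
  have lin: "h' x v = v * h' x 1" for x v
    using linear_scale[OF has_derivative_linear[OF h'(1)], of x v 1] by simp
  show ?case
  proof (rule Ck_SucI)
    show "((\<lambda>x. h (g x)) has_derivative (\<lambda>v. g' x v * h' (g x) 1)) (at x)" for x
      by (rule has_derivative_eq_rhs[OF has_derivative_compose[OF g'(1) h'(1)] ext]) (rule lin)
    show "Ck k (\<lambda>x. g' x v * h' (g x) 1)" for v
      by (intro Ck_mult g' Suc.IH[OF h'(2)] Ck_Suc_imp_Ck[OF Suc.prems(2)])
  qed
qed

text \<open>The powers of \<open>1 / t\<close> are needed for the derivatives: \<open>flat n' = flat (n + 2) - n * flat (n + 1)\<close>.\<close>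

definition flat :: "nat \<Rightarrow> real \<Rightarrow> real" where
  "flat n t = (if t > 0 then (1 / t) ^ n * exp (- (1 / t)) else 0)"

lemma flat_tendsto_0: "(flat n \<longlongrightarrow> 0) (at_right 0)"
proof -
  have "((\<lambda>t::real. inverse t ^ n / exp (inverse t)) \<longlongrightarrow> 0) (at_right 0)"
    by (rule filterlim_compose[OF tendsto_power_div_exp_0 filterlim_inverse_at_top_right])
  moreover have "\<forall>\<^sub>F t in at_right 0. inverse t ^ n / exp (inverse t) = flat n t"
    by (auto simp: eventually_at_right_field flat_def exp_minus field_simps intro!: exI[of _ 1])
  ultimately show ?thesis by (rule Lim_transform_eventually)
qed

lemma flat_deriv:
  "(flat n has_real_derivative (flat (n + 2) t - real n * flat (n + 1) t)) (at t)"
proof -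
  consider "t < 0" | "t = 0" | "t > 0" by linarith
  then show ?thesis
  proof cases
    case 1
    have "((\<lambda>_. 0) has_real_derivative 0) (at t)" by simp
    then have "(flat n has_real_derivative 0) (at t)"
      by (rule has_field_derivative_transform_within_open[where S="{..<0}"]) (use 1 in \<open>auto simp: flat_def\<close>)
    then show ?thesis using 1 by (simp add: flat_def)
  next
    case 2
    have "((\<lambda>h. flat n h / h) \<longlongrightarrow> 0) (at_left 0)"
      by (rule tendsto_eventually) (auto simp: eventually_at_left_field flat_def intro!: exI[of _ "-1"])
    \<comment> \<open>For positive h the quotient \<open>flat n h / h\<close> is
      \<open>flat (Suc n) h\<close>, whose limit at 0 is already known.\<close>
    moreover have "((\<lambda>h. flat n h / h) \<longlongrightarrow> 0) (at_right 0)"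
      by (rule Lim_transform_eventually[OF flat_tendsto_0[of "Suc n"]])
        (auto simp: eventually_at_right_field flat_def intro!: exI[of _ 1])
    ultimately have "((\<lambda>h. flat n h / h) \<longlongrightarrow> 0) (at 0)"
      by (simp add: filterlim_split_at_real)
    then show ?thesis unfolding 2 DERIV_def by (simp add: flat_def)
  next
    case 3
    have "((\<lambda>t. (1 / t) ^ n * exp (- (1 / t))) has_real_derivative
        (real n * (1 / t) ^ (n - 1) * (- (1 / t\<^sup>2)) * exp (- (1 / t)) + (1 / t) ^ n * (exp (- (1 / t)) * (1 / t\<^sup>2)))) (at t)"
      using 3 by (auto intro!: derivative_eq_intros simp: power2_eq_square)
    also have "real n * (1 / t) ^ (n - 1) * (- (1 / t\<^sup>2)) * exp (- (1 / t)) + (1 / t) ^ n * (exp (- (1 / t)) * (1 / t\<^sup>2))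
        = flat (n + 2) t - real n * flat (n + 1) t"
      using 3 by (cases n) (auto simp: flat_def field_simps power2_eq_square)
    finally show ?thesis
      by (rule has_field_derivative_transform_within_open[where S="{0<..}"]) (use 3 in \<open>auto simp: flat_def\<close>)
  qed
qed

lemma Ck_flat: "Ck k (flat n)"
proof (induction k arbitrary: n)
  case 0
  show ?case
    using flat_deriv[of n] by (auto intro!: continuous_at_imp_continuous_on DERIV_isCont)
next
  case (Suc k)
  show ?case
  proof (rule Ck_SucI)
    show "(flat n has_derivative (\<lambda>v. v * (flat (n + 2) t - real n * flat (n + 1) t))) (at t)" for t
      using flat_deriv[of n t] unfolding has_field_derivative_def
      by (rule has_derivative_eq_rhs) (simp add: fun_eq_iff)
    show "Ck k (\<lambda>t. v * (flat (n + 2) t - real n * flat (n + 1) t))" for v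
      by (intro Ck_mult Ck_diff Ck_const Suc)
  qed
qed

lemma flat_pos: "0 < t \<Longrightarrow> 0 < flat 0 t" and flat_zero: "t \<le> 0 \<Longrightarrow> flat 0 t = 0"
  and flat_nonneg: "0 \<le> flat 0 t" and flat_le_1: "flat 0 t \<le> 1"
  by (auto simp: flat_def)

text \<open>A product of one-dimensional bumps, positive exactly on the open box. Boxes are
  preferred to balls because they form an intersection-stable generator of the Borel sets; the
  functions \<open>1 - (1 - box_bump a b x) ^ k\<close> converge to the indicator of the
  box.\<close>

definition box_bump :: "'a::euclidean_space \<Rightarrow> 'a \<Rightarrow> 'a \<Rightarrow> real" where
  "box_bump a b x = (\<Prod>i\<in>Basis. flat 0 (x \<bullet> i - a \<bullet> i) * flat 0 (b \<bullet> i - x \<bullet> i))"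

lemma Ck_box_bump: "Ck k (box_bump a b)"
proof -
  have "Ck k (\<lambda>x. \<Prod>i\<in>Basis. flat 0 (x \<bullet> i - a \<bullet> i) * flat 0 (b \<bullet> i - x \<bullet> i))"
    by (intro Ck_prod Ck_mult Ck_compose_real[OF Ck_flat] Ck_diff Ck_inner_const Ck_ident Ck_const)
  then show ?thesis by (simp add: box_bump_def[abs_def])
qed

lemma box_bump_nonneg: "0 \<le> box_bump a b x"
  unfolding box_bump_def by (intro prod_nonneg mult_nonneg_nonneg flat_nonneg) 

lemma box_bump_le_1: "box_bump a b x \<le> 1"
  unfolding box_bump_def
  by (intro prod_le_1 conjI mult_nonneg_nonneg flat_nonneg mult_le_one flat_le_1)

lemma box_bump_pos: "x \<in> box a b \<Longrightarrow> 0 < box_bump a b x"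
  unfolding box_bump_def by (intro prod_pos mult_pos_pos flat_pos) (auto simp: mem_box)

lemma box_bump_zero: 
  assumes "x \<notin> box a b" shows "box_bump a b x = 0"
proof -
  from assms obtain i where i: "i \<in> Basis" "x \<bullet> i \<le> a \<bullet> i \<or> b \<bullet> i \<le> x \<bullet> i"
    by (auto simp: mem_box not_less)
  then have "flat 0 (x \<bullet> i - a \<bullet> i) * flat 0 (b \<bullet> i - x \<bullet> i) = 0"
    by (auto simp: flat_zero)
  then show ?thesis unfolding box_bump_def using i(1) by auto
qed

lemma test_functionsI:
  assumes "\<And>k. Ck k \<psi>" "compact K" "K \<subseteq> \<Omega>" "\<And>x. x \<notin> K \<Longrightarrow> \<psi> x = 0"
  shows "\<psi> \<in> test_functions \<Omega>"
proof -
  have "closure {x. \<psi> x \<noteq> 0} \<subseteq> K"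
    by (rule closure_minimal) (use assms in \<open>auto intro: compact_imp_closed\<close>)
  then show ?thesis using assms
    by (auto simp: test_functions_def compact_closure intro: bounded_subset[OF compact_imp_bounded] closure_subset[THEN subsetD])
qed

text \<open>A \<open>C^1\<close> substitute for \<open>max 0\<close>.\<close>

definition sqpos :: "real \<Rightarrow> real" where
  "sqpos t = (max 0 t)\<^sup>2"

lemma sqpos_deriv: "(sqpos has_real_derivative 2 * max 0 t) (at t)"
proof -
  consider "t < 0" | "t = 0" | "t > 0" by linarith
  then show ?thesis
  proof cases
    case 1
    have "((\<lambda>_. 0) has_real_derivative 0) (at t)" by simp
    then have "(sqpos has_real_derivative 0) (at t)"
      by (rule has_field_derivative_transform_within_open[where S="{..<0}"]) (use 1 in \<open>auto simp: sqpos_def\<close>)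
    then show ?thesis using 1 by simp
  next
    case 2
    have "((\<lambda>h. sqpos h / h) \<longlongrightarrow> 0) (at 0)"
    proof (rule Lim_null_comparison)
      show "\<forall>\<^sub>F h in at 0. norm (sqpos h / h) \<le> \<bar>h\<bar>"
        by (rule always_eventually) (auto simp: sqpos_def max_def power2_eq_square)
      show "((\<lambda>h::real. \<bar>h\<bar>) \<longlongrightarrow> 0) (at 0)" by (rule tendsto_rabs_zero) simp
    qed
    then show ?thesis unfolding 2 DERIV_def by (simp add: sqpos_def)
  next
    case 3
    have "((\<lambda>t. t\<^sup>2) has_real_derivative 2 * t) (at t)" by (auto intro!: derivative_eq_intros)
    then have "(sqpos has_real_derivative 2 * t) (at t)"
      by (rule has_field_derivative_transform_within_open[where S="{0<..}"]) (use 3 in \<open>auto simp: sqpos_def\<close>)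
    then show ?thesis using 3 by simp
  qed
qed

lemma Ck_sqpos: "Ck 1 sqpos"
proof -
  have "Ck (Suc 0) sqpos"
  proof (rule Ck_SucI)
    show "(sqpos has_derivative (\<lambda>v. v * (2 * max 0 t))) (at t)" for t
      using sqpos_deriv[of t] unfolding has_field_derivative_def
      by (rule has_derivative_eq_rhs) (simp add: fun_eq_iff)
    show "Ck 0 (\<lambda>t::real. v * (2 * max 0 t))" for v
      by (auto intro!: continuous_intros)
  qed
  then show ?thesis by simp
qed

section \<open>Cutoff functions and partitions of unity\<close>

lemma C1_cutoff:
  fixes x0 :: "'a::euclidean_space"
  assumes "r > 0"
  obtains \<theta> where "Ck 1 \<theta>" "\<And>x. 0 \<le> \<theta> x" "\<And>x. \<theta> x \<le> 1" "\<And>x. x \<in> ball x0 (r/2) \<Longrightarrow> \<theta> x = (1::real)"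
    "\<And>x. x \<notin> cball x0 (3/4 * r) \<Longrightarrow> \<theta> x = 0"
proof
  \<comment> \<open>For |x - x0| < r/2 the inner argument is negative and the outer one equals 1.
    Beyond 3r/4 the inner argument is at least 9/4 - 1 > 1, so the outer one is at most 0. The
    squared distance keeps the function C^1 at x0.\<close>
  let ?\<theta> = "\<lambda>x. sqpos (1 - sqpos (4 / r\<^sup>2 * ((x - x0) \<bullet> (x - x0)) - 1))"
  show "Ck 1 ?\<theta>"
    by (intro Ck_compose_real[OF Ck_sqpos] Ck_diff Ck_const Ck_mult Ck_inner Ck_ident)
  show "0 \<le> ?\<theta> x" for x by (simp add: sqpos_def)
  show "?\<theta> x \<le> 1" for x by (simp add: sqpos_def power_le_one)
  show "?\<theta> x = 1" if "x \<in> ball x0 (r/2)" for x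
  proof -
    have "norm (x - x0) < r / 2" using that by (simp add: dist_norm norm_minus_commute)
    then have "(norm (x - x0))\<^sup>2 \<le> (r/2)\<^sup>2" by (intro power_mono) auto
    then have "4 / r\<^sup>2 * ((x - x0) \<bullet> (x - x0)) - 1 \<le> 0"
      using assms by (simp add: power2_norm_eq_inner field_simps)
    then show ?thesis by (simp add: sqpos_def)
  qed
  show "?\<theta> x = 0" if "x \<notin> cball x0 (3/4 * r)" for x
  proof -
    have "3/4 * r < norm (x - x0)" using that by (simp add: dist_norm norm_minus_commute)
    then have "(3/4 * r)\<^sup>2 \<le> (norm (x - x0))\<^sup>2" using assms by (intro power_mono) auto
    then have "9/4 \<le> 4 / r\<^sup>2 * ((x - x0) \<bullet> (x - x0))"
      using assms by (simp add: power2_norm_eq_inner field_simps)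
    then have "1 \<le> 4 / r\<^sup>2 * ((x - x0) \<bullet> (x - x0)) - 1" by simp
    then have "1\<^sup>2 \<le> sqpos (4 / r\<^sup>2 * ((x - x0) \<bullet> (x - x0)) - 1)"
      unfolding sqpos_def by (intro power_mono) auto
    then show ?thesis by (simp add: sqpos_def)
  qed
qed

text \<open>The sum of the \<open>\<psi> i\<close> below telescopes.\<close>

lemma partition_of_unity_telescope:
  fixes \<theta> :: "'i \<Rightarrow> 'a::euclidean_space \<Rightarrow> real"
  assumes "finite I" "\<And>i. i \<in> I \<Longrightarrow> Ck k (\<theta> i)"
    "\<And>i x. i \<in> I \<Longrightarrow> 0 \<le> \<theta> i x" "\<And>i x. i \<in> I \<Longrightarrow> \<theta> i x \<le> 1"
  shows "\<exists>\<psi>. (\<forall>i\<in>I. Ck k (\<psi> i) \<and> (\<forall>x. 0 \<le> \<psi> i x) \<and> (\<forall>x. \<theta> i x = 0 \<longrightarrow> \<psi> i x = 0)) \<and>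
     (\<forall>x. (\<Sum>i\<in>I. \<psi> i x) = 1 - (\<Prod>i\<in>I. 1 - \<theta> i x))"
  using assms
proof (induction I rule: finite_induct)
  case (insert j I)
  have "\<exists>\<psi>. (\<forall>i\<in>I. Ck k (\<psi> i) \<and> (\<forall>x. 0 \<le> \<psi> i x) \<and> (\<forall>x. \<theta> i x = 0 \<longrightarrow> \<psi> i x = 0)) \<and>
     (\<forall>x. (\<Sum>i\<in>I. \<psi> i x) = 1 - (\<Prod>i\<in>I. 1 - \<theta> i x))"
    by (rule insert.IH) (use insert.prems in auto)
  then obtain \<psi> where \<psi>: "\<And>i. i \<in> I \<Longrightarrow> Ck k (\<psi> i)" "\<And>i x. i \<in> I \<Longrightarrow> 0 \<le> \<psi> i x"
    "\<And>i x. i \<in> I \<Longrightarrow> \<theta> i x = 0 \<Longrightarrow> \<psi> i x = 0" "\<And>x. (\<Sum>i\<in>I. \<psi> i x) = 1 - (\<Prod>i\<in>I. 1 - \<theta> i x)"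
    by blast
  \<comment> \<open>The new function takes the share \<open>\<theta> j\<close> of the part of 1 that
    the earlier ones have left over.\<close>
  define \<psi>' where "\<psi>' = \<psi>(j := (\<lambda>x. \<theta> j x * (\<Prod>i\<in>I. 1 - \<theta> i x)))"
  have j: "\<psi>' j = (\<lambda>x. \<theta> j x * (\<Prod>i\<in>I. 1 - \<theta> i x))" by (simp add: \<psi>'_def)
  have i: "\<psi>' i = \<psi> i" if "i \<in> I" for i using that insert by (auto simp: \<psi>'_def)
  have "Ck k (\<psi>' j)" unfolding j
    by (intro Ck_mult Ck_prod Ck_diff Ck_const insert) auto
  moreover have "0 \<le> \<psi>' j x" for x
    unfolding j by (intro mult_nonneg_nonneg prod_nonneg) (auto simp: insert)
  moreover have "\<theta> j x = 0 \<Longrightarrow> \<psi>' j x = 0" for x by (simp add: j)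
  moreover have "(\<Sum>i\<in>insert j I. \<psi>' i x) = 1 - (\<Prod>i\<in>insert j I. 1 - \<theta> i x)" for x
    using insert(1,2) \<psi>(4)[of x] by (simp add: j i algebra_simps)
  ultimately show ?case using \<psi>(1-3) i by (intro exI[of _ \<psi>']) auto
qed simp

section \<open>Gradient and divergence\<close>

lemma grad_unique:
  fixes f :: "real^'d \<Rightarrow> real"
  assumes "(f has_derivative f') (at x)"
  shows "f' v = grad f x \<bullet> v"
proof -
  have f': "f' = frechet_derivative f (at x)" by (rule frechet_derivative_at[OF assms])
  have lin: "linear f'" by (rule has_derivative_linear[OF assms])
  have "f' v = f' (\<Sum>i\<in>UNIV. (v $ i) *\<^sub>R axis i 1)"
    using basis_expansion[of v] by (simp add: scalar_mult_eq_scaleR)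
  also have "\<dots> = (\<Sum>i\<in>UNIV. (v $ i) * f' (axis i 1))"
    by (simp add: linear_sum[OF lin] linear_scale[OF lin])
  also have "\<dots> = grad f x \<bullet> v"
    by (simp add: grad_def f'[symmetric] inner_vec_def mult.commute)
  finally show ?thesis .
qed

lemma has_derivative_grad:
  fixes f :: "real^'d \<Rightarrow> real"
  assumes "(f has_derivative f') (at x)"
  shows "(f has_derivative (\<lambda>v. grad f x \<bullet> v)) (at x)"
  using assms grad_unique[OF assms] by (simp add: has_derivative_eq_rhs fun_eq_iff)

lemma grad_eqI:
  fixes f :: "real^'d \<Rightarrow> real"
  assumes "(f has_derivative (\<lambda>v. D \<bullet> v)) (at x)"
  shows "grad f x = D"
  using grad_unique[OF assms] by (metis vector_eq_rdot)

lemma C1_grad: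
  fixes f :: "real^'d \<Rightarrow> real"
  assumes "Ck 1 f"
  shows "(f has_derivative (\<lambda>v. grad f x \<bullet> v)) (at x)" "continuous_on UNIV (grad f)"
proof -
  from assms obtain f' where f': "\<And>x. (f has_derivative f' x) (at x)" "\<And>v. continuous_on UNIV (\<lambda>x. f' x v)"
    by auto
  show "(f has_derivative (\<lambda>v. grad f x \<bullet> v)) (at x)" using has_derivative_grad[OF f'(1)] .
  have "continuous_on UNIV (\<lambda>x. grad f x \<bullet> i)" for i
    using f'(2)[of i] grad_unique[OF f'(1)] by simp
  then show "continuous_on UNIV (grad f)"
    by (subst continuous_on_componentwise) auto
qed

lemma Ck_grad:
  fixes f :: "real^'d \<Rightarrow> real"
  assumes "Ck (Suc k) f"
  shows "Ck k (\<lambda>x. grad f x \<bullet> v)"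
proof -
  from assms obtain f' where f': "\<And>x. (f has_derivative f' x) (at x)" "\<And>v. Ck k (\<lambda>x. f' x v)"
    by auto
  show ?thesis using f'(2)[of v] grad_unique[OF f'(1)] by simp
qed

lemma C1_continuous: "Ck 1 f \<Longrightarrow> continuous_on UNIV f"
  by (rule Ck_imp_continuous)

lemma C1_borel: "Ck 1 f \<Longrightarrow> f \<in> borel_measurable borel"
  by (rule borel_measurable_continuous_onI) (rule C1_continuous)

lemma C1_grad_borel: "Ck 1 f \<Longrightarrow> grad f \<in> borel_measurable borel"
  by (rule borel_measurable_continuous_onI) (rule C1_grad)

lemma grad_mult:
  fixes f g :: "real^'d \<Rightarrow> real"
  assumes "Ck 1 f" "Ck 1 g"
  shows "grad (\<lambda>x. f x * g x) x = f x *\<^sub>R grad g x + g x *\<^sub>R grad f x"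
  by (rule grad_eqI, rule has_derivative_eq_rhs[OF has_derivative_mult[OF C1_grad(1)[OF assms(1)] C1_grad(1)[OF assms(2)]]])
    (simp add: fun_eq_iff inner_simps)

lemma grad_diff:
  fixes f g :: "real^'d \<Rightarrow> real"
  assumes "Ck 1 f" "Ck 1 g"
  shows "grad (\<lambda>x. f x - g x) x = grad f x - grad g x"
  by (rule grad_eqI, rule has_derivative_eq_rhs[OF has_derivative_diff[OF C1_grad(1)[OF assms(1)] C1_grad(1)[OF assms(2)]]])
    (simp add: fun_eq_iff inner_simps)

lemma grad_add:
  fixes f g :: "real^'d \<Rightarrow> real"
  assumes "Ck 1 f" "Ck 1 g"
  shows "grad (\<lambda>x. f x + g x) x = grad f x + grad g x"
  by (rule grad_eqI, rule has_derivative_eq_rhs[OF has_derivative_add[OF C1_grad(1)[OF assms(1)] C1_grad(1)[OF assms(2)]]])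
    (simp add: fun_eq_iff inner_simps)

lemma grad_const [simp]: "grad (\<lambda>x. c) x = 0"
  by (rule grad_eqI) simp

lemma grad_sum:
  fixes f :: "'i \<Rightarrow> real^'d \<Rightarrow> real"
  assumes "finite I" "\<And>i. i \<in> I \<Longrightarrow> Ck 1 (f i)"
  shows "grad (\<lambda>x. \<Sum>i\<in>I. f i x) x = (\<Sum>i\<in>I. grad (f i) x)"
  using assms by (induction I rule: finite_induct) (auto simp: grad_add Ck_sum simp del: One_nat_def)

lemma grad_cmult:
  fixes f :: "real^'d \<Rightarrow> real"
  assumes "Ck 1 f"
  shows "grad (\<lambda>x. c * f x) x = c *\<^sub>R grad f x"
  using grad_mult[OF Ck_const assms, of c] by simp

lemma grad_cong_open:
  fixes f g :: "real^'d \<Rightarrow> real"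
  assumes "Ck 1 f" "open S" "x \<in> S" "\<And>y. y \<in> S \<Longrightarrow> f y = g y"
  shows "grad g x = grad f x"
  by (rule grad_eqI)
    (rule has_derivative_transform_within_open[OF C1_grad(1)[OF assms(1)] assms(2,3,4)])

definition divg :: "(real^'d \<Rightarrow> real^'d) \<Rightarrow> real^'d \<Rightarrow> real" where
  "divg w x = (\<Sum>i\<in>UNIV. grad (\<lambda>y. w y $ i) x $ i)"

lemma C1_divg_continuous: "Ck 1 w \<Longrightarrow> continuous_on UNIV (divg w)"
  unfolding divg_def
  by (intro continuous_on_sum continuous_on_component C1_grad Ck_component)

section \<open>Lebesgue measure\<close>

lemma lborel_integral_translation:
  fixes f :: "'a::euclidean_space \<Rightarrow> 'b::{banach, second_countable_topology}"
  assumes [measurable]: "f \<in> borel_measurable borel"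
  shows "(\<integral>x. f (c + x) \<partial>lborel) = (\<integral>x. f x \<partial>lborel)"
proof -
  have "(\<integral>x. f x \<partial>lborel) = (\<integral>x. f x \<partial>distr lborel borel ((+) c))" by (simp add: lborel_distr_plus)
  also have "\<dots> = (\<integral>x. f (c + x) \<partial>lborel)" by (subst integral_distr) auto
  finally show ?thesis by simp
qed

lemma lborel_nn_integral_translation:
  fixes f :: "'a::euclidean_space \<Rightarrow> ennreal"
  assumes [measurable]: "f \<in> borel_measurable borel"
  shows "(\<integral>\<^sup>+x. f (c + x) \<partial>lborel) = (\<integral>\<^sup>+x. f x \<partial>lborel)"
proof -
  have "(\<integral>\<^sup>+x. f x \<partial>lborel) = (\<integral>\<^sup>+x. f x \<partial>distr lborel borel ((+) c))" by (simp add: lborel_distr_plus)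
  also have "\<dots> = (\<integral>\<^sup>+x. f (c + x) \<partial>lborel)" by (subst nn_integral_distr) auto
  finally show ?thesis by simp
qed

lemma lborel_integrable_translation:
  fixes f :: "'a::euclidean_space \<Rightarrow> 'b::{banach, second_countable_topology}"
  assumes "integrable lborel f"
  shows "integrable lborel (\<lambda>x. f (c + x))"
proof -
  have "integrable (distr lborel borel ((+) c)) f" using assms by (simp add: lborel_distr_plus)
  then show ?thesis by (subst (asm) integrable_distr_eq) (use assms in auto)
qed

text \<open>The bridge from \<open>lebesgue_on\<close>, in which the spaces are defined, to
  \<open>lborel\<close>, where translations and Fubini's theorem are at hand.\<close>

lemma lebesgue_on_integral:
  fixes h :: "'a::euclidean_space \<Rightarrow> 'b::euclidean_space"
  assumes [measurable]: "\<Omega> \<in> sets borel" "h \<in> borel_measurable borel"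
  shows "(\<integral>x. h x \<partial>lebesgue_on \<Omega>) = (\<integral>x. indicator \<Omega> x *\<^sub>R h x \<partial>lborel)"
  by (subst integral_restrict_space) (auto intro!: integral_completion)

lemma lebesgue_on_integrable:
  fixes h :: "'a::euclidean_space \<Rightarrow> 'b::euclidean_space"
  assumes [measurable]: "\<Omega> \<in> sets borel" "h \<in> borel_measurable borel"
  shows "integrable (lebesgue_on \<Omega>) h \<longleftrightarrow> integrable lborel (\<lambda>x. indicator \<Omega> x *\<^sub>R h x)"
  by (subst integrable_restrict_space) (auto intro!: integrable_completion)

lemma borel_lebesgue_on:
  "h \<in> borel_measurable borel \<Longrightarrow> h \<in> borel_measurable (lebesgue_on S)"
  by (intro measurable_restrict_space1 measurable_completion) simp

lemma bounded_lborel_integrable: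
  fixes f :: "'a::euclidean_space \<Rightarrow> 'b::{banach, second_countable_topology}"
  assumes [measurable]: "f \<in> borel_measurable borel" and B: "\<And>x. norm (f x) \<le> B"
    and R: "\<And>x. x \<notin> cball 0 R \<Longrightarrow> f x = 0"
  shows "integrable lborel f"
proof (rule Bochner_Integration.integrable_bound)
  show "integrable lborel (\<lambda>x. indicator (cball 0 R) x *\<^sub>R B)"
    by (rule integrable_indicator) (use emeasure_bounded_finite[OF bounded_cball] in auto)
  have "norm (f x) \<le> norm (indicator (cball 0 R) x *\<^sub>R B)" for x
    using B[of x] R[of x] by (cases "x \<in> cball 0 R") auto
  then show "AE x in lborel. norm (f x) \<le> norm (indicator (cball 0 R) x *\<^sub>R B)" by simp
qed simp

lemma emeasure_lebesgue_on_finite: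
  fixes \<Omega> :: "'a::euclidean_space set"
  assumes "\<Omega> \<in> sets borel" "bounded \<Omega>"
  shows "emeasure (lebesgue_on \<Omega>) (space (lebesgue_on \<Omega>)) < \<infinity>"
proof -
  have "emeasure (lebesgue_on \<Omega>) (space (lebesgue_on \<Omega>)) = emeasure lborel \<Omega>"
    using assms(1) by (simp add: emeasure_restrict_space)
  then show ?thesis using emeasure_bounded_finite[OF assms(2)] by simp
qed

lemma bounded_imp_L2:
  fixes f :: "'a::euclidean_space \<Rightarrow> 'b::euclidean_space"
  assumes "finite_measure M" and [measurable]: "f \<in> borel_measurable M" and "AE x in M. norm (f x) \<le> B"
  shows "f \<in> L2 M"
proof (rule L2_I)
  interpret finite_measure M by fact
  show "integrable M (\<lambda>x. (norm (f x))\<^sup>2)"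
  proof (rule integrable_const_bound[where B="B\<^sup>2"])
    show "AE x in M. norm ((norm (f x))\<^sup>2) \<le> B\<^sup>2"
      using assms(3) by eventually_elim (simp add: power_mono)
  qed simp
qed simp

lemma finite_measure_lebesgue_on:
  fixes \<Omega> :: "'a::euclidean_space set"
  assumes "\<Omega> \<in> sets borel" "bounded \<Omega>"
  shows "finite_measure (lebesgue_on \<Omega>)"
  by (rule finite_measureI) (use emeasure_lebesgue_on_finite[OF assms] in auto)

lemma continuous_imp_L2:
  fixes f :: "'a::euclidean_space \<Rightarrow> 'b::euclidean_space"
  assumes "\<Omega> \<in> sets borel" "bounded \<Omega>" and f: "continuous_on UNIV f"
  shows "f \<in> L2 (lebesgue_on \<Omega>)"
proof -
  have "compact (closure \<Omega>)" using assms by (simp add: compact_closure)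
  then have "compact (f ` closure \<Omega>)"
    by (rule compact_continuous_image[rotated]) (use f continuous_on_subset in blast)
  then obtain B where B: "\<And>x. x \<in> closure \<Omega> \<Longrightarrow> norm (f x) \<le> B"
    by (meson bounded_iff compact_imp_bounded imageI)
  show ?thesis
  proof (rule bounded_imp_L2[OF finite_measure_lebesgue_on[OF assms(1,2)]])
    show "f \<in> borel_measurable (lebesgue_on \<Omega>)"
      by (intro borel_lebesgue_on borel_measurable_continuous_onI f)
    show "AE x in lebesgue_on \<Omega>. norm (f x) \<le> B"
      by (rule AE_I2) (use B closure_subset in \<open>auto simp: space_restrict_space\<close>)
  qed
qed

text \<open>On a bounded set the constant 1 is square integrable, so f is integrable as a product of
  two square integrable functions.\<close>

lemma L2_imp_locally_integrable:
  fixes f :: "real^'d \<Rightarrow> 'b::euclidean_space"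
  assumes O: "\<Omega> \<in> sets borel" "bounded \<Omega>" and f: "f \<in> L2 (lebesgue_on \<Omega>)"
  shows "locally_integrable \<Omega> f"
  unfolding locally_integrable_def
proof (intro allI impI)
  fix K assume K: "compact K" "K \<subseteq> \<Omega>"
  have [measurable]: "K \<in> sets borel" using K by (simp add: compact_imp_closed borel_closed)
  note [measurable] = L2_measurable[OF f] O(1)
  have "(\<lambda>x. 1::real) \<in> L2 (lebesgue_on \<Omega>)"
    by (rule continuous_imp_L2[OF O]) simp
  have "(\<lambda>x. norm (f x)) \<in> L2 (lebesgue_on \<Omega>)"
    by (rule L2_dominated[OF _ f]) (use L2_measurable[OF f] in measurable)
  from L2_mult_integrable[OF this \<open>(\<lambda>x. 1::real) \<in> _\<close>] have "integrable (lebesgue_on \<Omega>) f" 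
    by (simp add: integrable_norm_iff)
  then have "integrable lebesgue (\<lambda>x. indicator \<Omega> x *\<^sub>R f x)"
    by (subst (asm) integrable_restrict_space) auto
  then have "integrable lebesgue (\<lambda>x. indicator K x *\<^sub>R (indicator \<Omega> x *\<^sub>R f x))"
    by (rule integrable_mult_indicator[rotated]) auto
  also have "(\<lambda>x. indicator K x *\<^sub>R (indicator \<Omega> x *\<^sub>R f x)) = (\<lambda>x. indicator K x *\<^sub>R f x)"
    using K by (auto simp: indicator_def fun_eq_iff)
  finally show "integrable (lebesgue_on K) f"
    by (subst integrable_restrict_space) auto
qed

section \<open>Difference quotients\<close>

lemma C1_compact_support_bounds:
  fixes f :: "real^'d \<Rightarrow> real"
  assumes "Ck 1 f" and R: "\<And>x. x \<notin> cball 0 R \<Longrightarrow> f x = 0"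
  obtains B where "0 \<le> B" "\<And>x. norm (f x) \<le> B" "\<And>x. norm (grad f x) \<le> B" "\<And>x. x \<notin> cball 0 R \<Longrightarrow> grad f x = 0"
    "\<And>x y. \<bar>f x - f y\<bar> \<le> B * norm (x - y)"
proof -
  have gz: "grad f x = 0" if "x \<notin> cball 0 R" for x
  proof -
    have "grad f x = grad (\<lambda>x. 0) x"
      by (rule grad_cong_open[where S="- cball 0 R"]) (use that R in auto)
    then show ?thesis by simp
  qed
  have "bounded (f ` cball 0 R)" "bounded (grad f ` cball 0 R)"
    by (intro compact_imp_bounded compact_continuous_image compact_cball
        continuous_on_subset[OF C1_continuous[OF assms(1)]] continuous_on_subset[OF C1_grad(2)[OF assms(1)]] subset_UNIV)+
  then obtain B1 B2 where B12: "\<And>x. x \<in> cball 0 R \<Longrightarrow> norm (f x) \<le> B1" "\<And>x. x \<in> cball 0 R \<Longrightarrow> norm (grad f x) \<le> B2"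
    by (fastforce simp: bounded_iff simp del: mem_cball mem_cball_0)
  define B where "B = max 0 (max B1 B2)"
  have B: "0 \<le> B" "norm (f x) \<le> B" "norm (grad f x) \<le> B" for x
    using B12[of x] R[of x] gz[of x] by (cases "x \<in> cball 0 R"; force simp: B_def)+
  have "norm (f x - f y) \<le> B * norm (x - y)" for x y
  proof (rule differentiable_bound[of UNIV f "\<lambda>x v. grad f x \<bullet> v"])
    show "onorm (\<lambda>v. grad f x \<bullet> v) \<le> B" for x
    proof (rule onorm_le)
      fix v
      have "\<bar>grad f x \<bullet> v\<bar> \<le> norm (grad f x) * norm v" by (rule Cauchy_Schwarz_ineq2)
      also have "\<dots> \<le> B * norm v" by (intro mult_right_mono B) auto
      finally show "norm (grad f x \<bullet> v) \<le> B * norm v" by simp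
    qed
  qed (auto intro: has_derivative_at_withinI C1_grad(1)[OF assms(1)])
  then have lip: "\<bar>f x - f y\<bar> \<le> B * norm (x - y)" for x y by simp
  show ?thesis using that[OF B(1,2,3) gz lip] by blast
qed

text \<open>Stated for the steps 1/(k+1) because dominated convergence runs along sequences; all
  later difference quotients use these steps.\<close>

lemma has_derivative_quotient_sequence:
  fixes f :: "'a::real_normed_vector \<Rightarrow> real"
  assumes "(f has_derivative f') (at x)"
  shows "(\<lambda>k. (f (x + (1 / real (Suc k)) *\<^sub>R v) - f x) / (1 / real (Suc k))) \<longlonglongrightarrow> f' v"
proof -
  have 1: "((\<lambda>s. x + s *\<^sub>R v) has_derivative (\<lambda>s. s *\<^sub>R v)) (at 0)"
    by (auto intro!: derivative_eq_intros)
  have "((\<lambda>s. f (x + s *\<^sub>R v)) has_derivative (\<lambda>s. f' (s *\<^sub>R v))) (at 0)"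
    using has_derivative_compose[OF 1, of f f'] assms by simp
  then have "((\<lambda>s. f (x + s *\<^sub>R v)) has_derivative (\<lambda>s. f' v * s)) (at 0)"
    by (simp add: linear_scale[OF has_derivative_linear[OF assms]] mult.commute)
  then have "((\<lambda>s. f (x + s *\<^sub>R v)) has_real_derivative f' v) (at 0)"
    by (rule has_derivative_imp_has_field_derivative) simp
  then have "((\<lambda>s. (f (x + s *\<^sub>R v) - f x) / s) \<longlongrightarrow> f' v) (at 0)"
    by (simp add: DERIV_def)
  moreover have "filterlim (\<lambda>k. 1 / real (Suc k)) (at 0) sequentially"
    by (rule filterlim_atI) (use LIMSEQ_inverse_real_of_nat in \<open>auto simp: inverse_eq_divide\<close>)
  ultimately show ?thesis by (rule filterlim_compose)
qed

lemma C1_diff_quotient_integral: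
  fixes f :: "real^'d \<Rightarrow> real"
  assumes f: "Ck 1 f" and R: "\<And>x. x \<notin> cball 0 R \<Longrightarrow> f x = 0" and [measurable]: "S \<in> sets borel"
  shows "(\<lambda>k. \<integral>x. indicator S x * ((f (x + (1 / real (Suc k)) *\<^sub>R v) - f x) / (1 / real (Suc k))) \<partial>lborel)
    \<longlonglongrightarrow> (\<integral>x. indicator S x * (grad f x \<bullet> v) \<partial>lborel)"
proof -
  obtain B where B: "0 \<le> B" "\<And>x. norm (f x) \<le> B" "\<And>x. norm (grad f x) \<le> B" "\<And>x. x \<notin> cball 0 R \<Longrightarrow> grad f x = 0"
    "\<And>x y. \<bar>f x - f y\<bar> \<le> B * norm (x - y)"
    using C1_compact_support_bounds[OF f R] by blast
  note [measurable] = C1_borel[OF f] C1_grad_borel[OF f]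
  show ?thesis
  \<comment> \<open>The steps are at most 1, so both values of f vanish outside the ball enlarged by
    \<open>norm v\<close>; inside it the Lipschitz bound controls the quotient.\<close>
  proof (rule integral_dominated_convergence[where w="\<lambda>x. indicator (cball 0 (R + norm v)) x *\<^sub>R (B * norm v)"])
    show "integrable lborel (\<lambda>x::real^'d. indicator (cball 0 (R + norm v)) x *\<^sub>R (B * norm v))"
      by (rule integrable_indicator) (use emeasure_bounded_finite[OF bounded_cball] in auto)
    show "AE x in lborel. (\<lambda>k. indicator S x * ((f (x + (1 / real (Suc k)) *\<^sub>R v) - f x) / (1 / real (Suc k))))
        \<longlonglongrightarrow> indicator S x * (grad f x \<bullet> v)"
      by (intro AE_I2 tendsto_mult tendsto_const has_derivative_quotient_sequence C1_grad(1)[OF f])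
    fix k
    have s: "0 < 1 / real (Suc k)" "1 / real (Suc k) \<le> 1" by auto
    define s where "s = 1 / real (Suc k)"
    have "norm (indicator S x * ((f (x + s *\<^sub>R v) - f x) / s)) \<le> indicator (cball 0 (R + norm v)) x *\<^sub>R (B * norm v)" for x
    proof (cases "x \<in> cball 0 (R + norm v)")
      case True
      have "\<bar>f (x + s *\<^sub>R v) - f x\<bar> \<le> s * (B * norm v)"
        using B(5)[of "x + s *\<^sub>R v" x] s unfolding s_def[symmetric] by (simp add: mult_ac)
      then have "\<bar>(f (x + s *\<^sub>R v) - f x) / s\<bar> \<le> B * norm v"
        using s unfolding s_def[symmetric] by (simp add: field_simps)
      then show ?thesis using True by (auto simp: indicator_def B(1))
    next
      case False
      have "norm (s *\<^sub>R v) \<le> norm v" using s unfolding s_def[symmetric] by (simp add: mult_left_le_one_le)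
      then have "R < norm (x + s *\<^sub>R v)" using False norm_triangle_ineq4[of "x + s *\<^sub>R v" "s *\<^sub>R v"] by simp
      moreover have "R < norm x" 
      proof -
        have "R + norm v < norm x" using False by simp
        then show ?thesis using norm_ge_zero[of v] by linarith
      qed
      ultimately show ?thesis using R B(1) by simp
    qed
    then show "AE x in lborel. norm (indicator S x * ((f (x + (1 / real (Suc k)) *\<^sub>R v) - f x) / (1 / real (Suc k))))
        \<le> indicator (cball 0 (R + norm v)) x *\<^sub>R (B * norm v)" by (simp add: s_def)
  qed measurable
qed

text \<open>By translation invariance every difference quotient has integral zero, and these
  integrals converge to that of the derivative.\<close>

lemma C1_integral_grad_eq_0:
  fixes f :: "real^'d \<Rightarrow> real"
  assumes f: "Ck 1 f" and R: "\<And>x. x \<notin> cball 0 R \<Longrightarrow> f x = 0"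
  shows "(\<integral>x. grad f x \<bullet> v \<partial>lborel) = 0"
proof -
  obtain B where B: "0 \<le> B" "\<And>x. norm (f x) \<le> B"
    using C1_compact_support_bounds[OF f R] by metis
  note [measurable] = C1_borel[OF f]
  have i: "integrable lborel f" by (rule bounded_lborel_integrable[OF _ B(2) R]) auto
  have z: "(\<integral>x. indicator UNIV x * ((f (x + s *\<^sub>R v) - f x) / s) \<partial>lborel) = 0" for s
  proof -
    have "(\<integral>x. f (x + s *\<^sub>R v) - f x \<partial>lborel) = (\<integral>x. f (s *\<^sub>R v + x) \<partial>lborel) - (\<integral>x. f x \<partial>lborel)"
      using lborel_integrable_translation[OF i, of "s *\<^sub>R v"] i by (simp add: add.commute)
    then show ?thesis by (simp add: lborel_integral_translation)
  qed
  have "(\<lambda>k. \<integral>x. indicator UNIV x * ((f (x + (1 / real (Suc k)) *\<^sub>R v) - f x) / (1 / real (Suc k))) \<partial>lborel)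
    \<longlonglongrightarrow> (\<integral>x. indicator UNIV x * (grad f x \<bullet> v) \<partial>lborel)"
    by (rule C1_diff_quotient_integral[OF f R]) auto
  then show ?thesis unfolding z by (simp add: LIMSEQ_const_iff)
qed

lemma test_functions_D:
  assumes "\<psi> \<in> test_functions \<Omega>"
  shows "Ck 1 \<psi>" "\<And>x. x \<notin> \<Omega> \<Longrightarrow> \<psi> x = 0" "\<And>x. x \<notin> \<Omega> \<Longrightarrow> grad \<psi> x = 0" "\<exists>R. \<forall>x. x \<notin> cball 0 R \<longrightarrow> \<psi> x = 0"
    "\<exists>K. compact K \<and> K \<subseteq> \<Omega> \<and> (\<forall>x. x \<notin> K \<longrightarrow> \<psi> x = 0)" "Ck k \<psi>"
proof -
  let ?K = "closure {x. \<psi> x \<noteq> 0}"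
  have C: "\<And>k. Ck k \<psi>" and K: "compact ?K" "?K \<subseteq> \<Omega>" using assms by (auto simp: test_functions_def)
  have z: "\<psi> x = 0" if "x \<notin> ?K" for x using that closure_subset[of "{x. \<psi> x \<noteq> 0}"] by auto
  show 1: "Ck 1 \<psi>" "Ck k \<psi>" by (rule C)+
  show "\<psi> x = 0" if "x \<notin> \<Omega>" for x using z[of x] K(2) that by blast
  show "grad \<psi> x = 0" if "x \<notin> \<Omega>" for x
  proof -
    have "grad \<psi> x = grad (\<lambda>x. 0) x"
    proof (rule grad_cong_open[where S="- ?K"])
      show "\<And>y. y \<in> - ?K \<Longrightarrow> 0 = \<psi> y" using z by (metis ComplD)
    qed (use that K(2) in auto)
    then show ?thesis by simp
  qed
  obtain R where "?K \<subseteq> cball 0 R" using compact_imp_bounded[OF K(1)] by (auto simp: bounded_iff subset_iff)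
  then show "\<exists>R. \<forall>x. x \<notin> cball 0 R \<longrightarrow> \<psi> x = 0" using z by blast
  show "\<exists>K. compact K \<and> K \<subseteq> \<Omega> \<and> (\<forall>x. x \<notin> K \<longrightarrow> \<psi> x = 0)" using K z by blast
qed

text \<open>The product \<open>q * \<psi>\<close> is C^1 with compact support, so its derivative
  integrates to zero over the whole space; as \<open>\<psi>\<close> and its gradient vanish off
  \<open>\<Omega>\<close>, only the integral over \<open>\<Omega>\<close> remains.\<close>

lemma C1_integration_by_parts:
  fixes q :: "real^'d \<Rightarrow> real"
  assumes O: "open \<Omega>" "bounded \<Omega>" and q: "Ck 1 q" and \<psi>: "\<psi> \<in> test_functions \<Omega>"
  shows "(\<integral>x. q x * (grad \<psi> x \<bullet> v) \<partial>lebesgue_on \<Omega>) = - (\<integral>x. (grad q x \<bullet> v) * \<psi> x \<partial>lebesgue_on \<Omega>)"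
proof -
  note \<psi>' = test_functions_D[OF \<psi>]
  note [measurable] = C1_borel[OF q] C1_borel[OF \<psi>'(1)] C1_grad_borel[OF q] C1_grad_borel[OF \<psi>'(1)]
  have O': "\<Omega> \<in> sets borel" using O by simp
  note L = continuous_imp_L2[OF O' O(2)]
  note C = C1_grad(2)[OF q] C1_grad(2)[OF \<psi>'(1)] C1_continuous[OF q] C1_continuous[OF \<psi>'(1)]
  have i: "integrable (lebesgue_on \<Omega>) (\<lambda>x. q x * (grad \<psi> x \<bullet> v))" "integrable (lebesgue_on \<Omega>) (\<lambda>x. (grad q x \<bullet> v) * \<psi> x)"
    by (intro L2_mult_integrable L continuous_intros C)+
  obtain R where R: "\<And>x. x \<notin> cball 0 R \<Longrightarrow> \<psi> x = 0" using \<psi>'(4) by blast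
  have "0 = (\<integral>x. grad (\<lambda>x. q x * \<psi> x) x \<bullet> v \<partial>lborel)"
    by (rule C1_integral_grad_eq_0[OF Ck_mult[OF q \<psi>'(1)], where R=R, symmetric]) (simp add: R del: mem_cball_0)
  also have "\<dots> = (\<integral>x. indicator \<Omega> x *\<^sub>R (q x * (grad \<psi> x \<bullet> v) + (grad q x \<bullet> v) * \<psi> x) \<partial>lborel)"
    by (intro Bochner_Integration.integral_cong refl)
      (auto simp: grad_mult[OF q \<psi>'(1)] inner_simps indicator_def \<psi>'(2,3))
  also have "\<dots> = (\<integral>x. q x * (grad \<psi> x \<bullet> v) + (grad q x \<bullet> v) * \<psi> x \<partial>lebesgue_on \<Omega>)"
    by (rule lebesgue_on_integral[symmetric]) (use O in auto)
  also have "\<dots> = (\<integral>x. q x * (grad \<psi> x \<bullet> v) \<partial>lebesgue_on \<Omega>) + (\<integral>x. (grad q x \<bullet> v) * \<psi> x \<partial>lebesgue_on \<Omega>)"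
    using i by simp
  finally show ?thesis by linarith
qed

lemma C1_has_weak_gradient:
  fixes q :: "real^'d \<Rightarrow> real"
  assumes O: "open \<Omega>" "bounded \<Omega>" and q: "Ck 1 q"
  shows "has_weak_gradient \<Omega> q (grad q)"
proof -
  have O': "\<Omega> \<in> sets borel" using O by simp
  show ?thesis unfolding has_weak_gradient_def
    using C1_integration_by_parts[OF O q, where v="axis _ 1"]
    by (auto simp: inner_axis intro!: L2_imp_locally_integrable[OF O' O(2)] continuous_imp_L2[OF O' O(2)] C1_grad(2)[OF q] C1_continuous[OF q])
qed

lemma C1_has_weak_divergence:
  fixes w :: "real^'d \<Rightarrow> real^'d"
  assumes O: "open \<Omega>" "bounded \<Omega>" and w: "Ck 1 w"
  shows "has_weak_divergence \<Omega> w (divg w)"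
proof -
  have O': "\<Omega> \<in> sets borel" using O by simp
  note L = continuous_imp_L2[OF O' O(2)]
  have "(\<integral>x. w x \<bullet> grad \<psi> x \<partial>lebesgue_on \<Omega>) = - (\<integral>x. divg w x * \<psi> x \<partial>lebesgue_on \<Omega>)"
    if \<psi>: "\<psi> \<in> test_functions \<Omega>" for \<psi>
  proof -
    note \<psi>' = test_functions_D[OF \<psi>]
    note C = C1_grad(2)[OF Ck_component[OF w]] C1_grad(2)[OF \<psi>'(1)] C1_continuous[OF w] C1_continuous[OF \<psi>'(1)]
    have i: "integrable (lebesgue_on \<Omega>) (\<lambda>x. w x $ i * grad \<psi> x $ i)"
      "integrable (lebesgue_on \<Omega>) (\<lambda>x. (grad (\<lambda>x. w x $ i) x $ i) * \<psi> x)" for i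
      by (intro L2_mult_integrable L continuous_intros C)+
    have "(\<integral>x. w x \<bullet> grad \<psi> x \<partial>lebesgue_on \<Omega>) = (\<Sum>i\<in>UNIV. \<integral>x. w x $ i * grad \<psi> x $ i \<partial>lebesgue_on \<Omega>)"
      using i by (simp add: inner_vec_def)
    also have "\<dots> = (\<Sum>i\<in>UNIV. - (\<integral>x. (grad (\<lambda>x. w x $ i) x $ i) * \<psi> x \<partial>lebesgue_on \<Omega>))"
      using C1_integration_by_parts[OF O Ck_component[OF w] \<psi>, where v="axis _ 1"] by (simp add: inner_axis)
    also have "\<dots> = - (\<integral>x. divg w x * \<psi> x \<partial>lebesgue_on \<Omega>)"
      using i by (simp add: divg_def sum_distrib_right sum_negf)
    finally show ?thesis .
  qed
  then show ?thesis unfolding has_weak_divergence_def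
    by (auto intro!: L2_imp_locally_integrable[OF O' O(2)] L C1_divg_continuous[OF w] C1_continuous[OF w])
qed

section \<open>The fundamental lemma of the calculus of variations\<close>

text \<open>The positive and the negative part of G are densities of finite measures that agree on
  all boxes, an intersection-stable generator, hence everywhere; densities are unique. The measure
  is kept general because both Lebesgue measure and the surface measure are meant.\<close>

lemma AE_zero_if_box_integrals_zero_borel:
  fixes G :: "'a::euclidean_space \<Rightarrow> real"
  assumes M: "sigma_finite_measure M" and sets_M[measurable_cong]: "sets M = sets borel" and G: "integrable M G"
    and z: "\<And>c d. (\<integral>x. indicator (box c d) x * G x \<partial>M) = 0"
  shows "AE x in M. G x = 0"
proof -
  have [measurable]: "G \<in> borel_measurable M" using G by blast
  let ?P = "density M (\<lambda>x. ennreal (G x))" and ?N = "density M (\<lambda>x. ennreal (- G x))"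
  have box: "box c d \<in> sets M" for c d by (simp add: sets_M)
  have fin: "(\<integral>\<^sup>+x. ennreal (G x) \<partial>M) < \<infinity>" "(\<integral>\<^sup>+x. ennreal (- G x) \<partial>M) < \<infinity>"
    using G real_integrable_def by (auto simp: less_top)
  have eq: "emeasure ?P (box c d) = emeasure ?N (box c d)" for c d
  proof -
    have i: "integrable M (\<lambda>x. indicator (box c d) x * G x)"
      using integrable_mult_indicator[OF box G, of c d] by simp
    have fP: "(\<integral>\<^sup>+x. ennreal (indicator (box c d) x * G x) \<partial>M) < \<infinity>"
      and fN: "(\<integral>\<^sup>+x. ennreal (- (indicator (box c d) x * G x)) \<partial>M) < \<infinity>"
      using i real_integrable_def by (auto simp: less_top)
    have "enn2real (\<integral>\<^sup>+x. ennreal (indicator (box c d) x * G x) \<partial>M)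
        = enn2real (\<integral>\<^sup>+x. ennreal (- (indicator (box c d) x * G x)) \<partial>M)"
      using real_lebesgue_integral_def[OF i] z[of c d] by simp
    then have "(\<integral>\<^sup>+x. ennreal (indicator (box c d) x * G x) \<partial>M)
        = (\<integral>\<^sup>+x. ennreal (- (indicator (box c d) x * G x)) \<partial>M)"
      using fP fN by (metis ennreal_enn2real infinity_ennreal_def)
    moreover have "emeasure ?P (box c d) = (\<integral>\<^sup>+x. ennreal (indicator (box c d) x * G x) \<partial>M)"
      by (subst emeasure_density) (auto intro!: nn_integral_cong simp: indicator_def box)
    moreover have "emeasure ?N (box c d) = (\<integral>\<^sup>+x. ennreal (- (indicator (box c d) x * G x)) \<partial>M)"
      by (subst emeasure_density) (auto intro!: nn_integral_cong simp: indicator_def box)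
    ultimately show ?thesis by simp
  qed
  have "?P = ?N"
  proof (rule measure_eqI_generator_eq)
    let ?E = "range (\<lambda>(a, b). box a b::'a set)"
    show "Int_stable ?E" by (auto simp: Int_stable_def box_Int_box)
    show "?E \<subseteq> Pow UNIV" "sets ?P = sigma_sets UNIV ?E" "sets ?N = sigma_sets UNIV ?E"
      by (simp_all add: sets_M borel_eq_box)
    let ?A = "\<lambda>n::nat. box (- (real n *\<^sub>R One)) (real n *\<^sub>R One) :: 'a set"
    show "range ?A \<subseteq> ?E" "(\<Union>i. ?A i) = UNIV"
      unfolding UN_box_eq_UNIV by auto
    show "emeasure ?P (?A i) \<noteq> \<infinity>" for i
    proof -
      have "emeasure ?P (?A i) \<le> emeasure ?P (space ?P)" by (rule emeasure_space)
      also have "\<dots> = (\<integral>\<^sup>+x. ennreal (G x) \<partial>M)"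
        by (subst emeasure_density) (auto intro!: nn_integral_cong)
      finally show ?thesis using fin(1) by auto
    qed
    show "\<And>X. X \<in> ?E \<Longrightarrow> emeasure ?P X = emeasure ?N X" using eq by auto
  qed
  then have "AE x in M. ennreal (G x) = ennreal (- G x)"
    by (subst (asm) sigma_finite_measure.density_unique_iff[OF M]) auto
  then show ?thesis
    by eventually_elim (metis ennreal_eq_0_iff ennreal_neg linorder_linear neg_0_le_iff_le neg_le_0_iff_le order_antisym)
qed

lemma AE_zero_if_box_integrals_zero:
  fixes F :: "'a::euclidean_space \<Rightarrow> real"
  assumes F: "integrable lebesgue F" and z: "\<And>c d. (\<integral>x. indicator (box c d) x * F x \<partial>lebesgue) = 0"
  shows "AE x in lebesgue. F x = 0"
proof -
  obtain G where G[measurable]: "G \<in> borel_measurable lborel" and FG: "AE x in lborel. F x = G x"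
    using completion_ex_borel_measurable_real[OF borel_measurable_integrable[OF F]] by blast
  have FG': "AE x in lebesgue. F x = G x" by (rule AE_completion[OF FG])
  have Gi: "integrable lborel G"
  proof -
    have "integrable lebesgue G"
      by (rule integrable_cong_AE_imp[OF F _ FG']) (intro measurable_completion G)
    then show ?thesis by (simp add: integrable_completion)
  qed
  have zG: "(\<integral>x. indicator (box c d) x * G x \<partial>lborel) = 0" for c d
  proof -
    have "(\<integral>x. indicator (box c d) x * G x \<partial>lborel) = (\<integral>x. indicator (box c d) x * G x \<partial>lebesgue)"
      by (rule integral_completion[symmetric]) measurable
    also have "\<dots> = (\<integral>x. indicator (box c d) x * F x \<partial>lebesgue)"
    proof (rule integral_cong_AE)
      show "AE x in lebesgue. indicator (box c d) x * G x = indicator (box c d) x * F x"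
        using FG' by eventually_elim simp
      show "(\<lambda>x. indicator (box c d) x * G x) \<in> borel_measurable lebesgue"
        by (intro measurable_completion) measurable
      show "(\<lambda>x. indicator (box c d) x * F x) \<in> borel_measurable lebesgue"
        by (intro borel_measurable_times borel_measurable_integrable[OF F] borel_measurable_indicator) auto
    qed
    finally show ?thesis using z by simp
  qed
  have "AE x in lborel. G x = 0"
    by (rule AE_zero_if_box_integrals_zero_borel[OF sigma_finite_lborel _ Gi zG]) simp
  then have "AE x in lborel. F x = 0" using FG by eventually_elim simp
  then show ?thesis by (rule AE_completion)
qed

text \<open>Test functions tending boundedly to the indicator of a box show that H has integral zero
  over every box whose closure lies in \<open>\<Omega>\<close>. Inside one such box this determines
  H almost everywhere, and countably many closed boxes fill \<open>\<Omega>\<close>.\<close>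

lemma fundamental_lemma:
  fixes H :: "real^'d \<Rightarrow> real"
  assumes O: "open \<Omega>" and H: "locally_integrable \<Omega> H"
    and z: "\<And>\<psi>. \<psi> \<in> test_functions \<Omega> \<Longrightarrow> (\<integral>x. H x * \<psi> x \<partial>lebesgue_on \<Omega>) = 0"
  shows "AE x in lebesgue_on \<Omega>. H x = 0"
proof -
  have O': "\<Omega> \<in> sets lebesgue" using O by auto
  have Hi: "integrable lebesgue (\<lambda>x. indicator (cbox a b) x * H x)" if "cbox a b \<subseteq> \<Omega>" for a b
  proof -
    have "integrable (lebesgue_on (cbox a b)) H"
      using H that compact_cbox[of a b] unfolding locally_integrable_def by blast
    then show ?thesis by (subst (asm) integrable_restrict_space) auto
  qed
  have box0: "(\<integral>x. indicator (box a b) x * H x \<partial>lebesgue) = 0" if ab: "cbox a b \<subseteq> \<Omega>" for a b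
  proof -
    let ?\<psi> = "\<lambda>k x. 1 - (1 - box_bump a b x) ^ k"
    have "?\<psi> k \<in> test_functions \<Omega>" for k
    proof (rule test_functionsI[OF _ compact_cbox ab])
      show "Ck j (?\<psi> k)" for j by (intro Ck_diff Ck_const Ck_power Ck_box_bump)
      show "?\<psi> k x = 0" if "x \<notin> cbox a b" for x
        using that box_subset_cbox[of a b] by (subst box_bump_zero) auto
    qed
    from z[OF this] have z0: "(\<integral>x. indicator \<Omega> x * (H x * ?\<psi> k x) \<partial>lebesgue) = 0" for k
      using O' by (simp add: integral_restrict_space)
    have eq: "indicator \<Omega> x * (H x * ?\<psi> k x) = (indicator (cbox a b) x * H x) * ?\<psi> k x" for x k
      using ab box_subset_cbox[of a b]
      by (cases "x \<in> box a b") (auto simp: indicator_def box_bump_zero subset_iff)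
    have "(\<lambda>k. \<integral>x. (indicator (cbox a b) x * H x) * ?\<psi> k x \<partial>lebesgue) \<longlonglongrightarrow> (\<integral>x. indicator (box a b) x * H x \<partial>lebesgue)"
    proof (rule integral_dominated_convergence[where w="\<lambda>x. \<bar>indicator (cbox a b) x * H x\<bar>"])
      show "integrable lebesgue (\<lambda>x. \<bar>indicator (cbox a b) x * H x\<bar>)" using Hi[OF ab] by simp
      have mH: "(\<lambda>x. indicator (cbox a b) x * H x) \<in> borel_measurable lebesgue"
        using Hi[OF ab] by blast
      have mb: "box_bump a b \<in> borel_measurable lebesgue"
        by (intro measurable_completion) (simp add: borel_measurable_continuous_onI Ck_imp_continuous[OF Ck_box_bump])
      show "(\<lambda>x. (indicator (cbox a b) x * H x) * ?\<psi> k x) \<in> borel_measurable lebesgue" for k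
        by (intro borel_measurable_times borel_measurable_diff borel_measurable_power borel_measurable_const mb mH)
      have "(\<lambda>x. indicator (box a b) x * (indicator (cbox a b) x * H x)) \<in> borel_measurable lebesgue"
        by (intro borel_measurable_times mH borel_measurable_indicator) auto
      also have "(\<lambda>x. indicator (box a b) x * (indicator (cbox a b) x * H x)) = (\<lambda>x. indicator (box a b) x * H x)"
        using box_subset_cbox[of a b] by (auto simp: indicator_def fun_eq_iff)
      finally show "(\<lambda>x. indicator (box a b) x * H x) \<in> borel_measurable lebesgue" .
      have "\<bar>?\<psi> k x\<bar> \<le> 1" for k x
        using box_bump_nonneg[of a b x] box_bump_le_1[of a b x]
        by (auto simp: abs_le_iff power_le_one intro: order_trans[OF _ zero_le_power])
      then show "AE x in lebesgue. norm ((indicator (cbox a b) x * H x) * ?\<psi> k x) \<le> \<bar>indicator (cbox a b) x * H x\<bar>" for k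
        by (auto simp: abs_mult intro!: mult_left_le)
      show "AE x in lebesgue. (\<lambda>k. (indicator (cbox a b) x * H x) * ?\<psi> k x) \<longlonglongrightarrow> indicator (box a b) x * H x"
      proof (rule AE_I2)
        fix x
        show "(\<lambda>k. (indicator (cbox a b) x * H x) * ?\<psi> k x) \<longlonglongrightarrow> indicator (box a b) x * H x"
        proof (cases "x \<in> box a b")
          case True
          then have "x \<in> cbox a b" using box_subset_cbox by blast
          have "(\<lambda>k. (1 - box_bump a b x) ^ k) \<longlonglongrightarrow> 0"
          proof (rule LIMSEQ_power_zero)
            show "norm (1 - box_bump a b x) < 1"
              using box_bump_pos[OF True] box_bump_le_1[of a b x] unfolding real_norm_def by linarith
          qed
          then have "(\<lambda>k. (indicator (cbox a b) x * H x) * ?\<psi> k x) \<longlonglongrightarrow> (indicator (cbox a b) x * H x) * (1 - 0)"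
            by (intro tendsto_mult tendsto_diff tendsto_const)
          then show ?thesis using True \<open>x \<in> cbox a b\<close> by simp
        qed (simp add: box_bump_zero)
      qed
    qed
    then show ?thesis using z0 eq by (simp add: LIMSEQ_const_iff)
  qed
  have cbox0: "AE x in lebesgue. x \<in> cbox a b \<longrightarrow> H x = 0" if ab: "cbox a b \<subseteq> \<Omega>" for a b
  proof -
    have bi: "integrable lebesgue (\<lambda>x. indicator (box a b) x * H x)"
    proof -
      have "integrable lebesgue (\<lambda>x. indicator (box a b) x *\<^sub>R (indicator (cbox a b) x * H x))"
        by (rule integrable_mult_indicator[OF _ Hi[OF ab]]) auto
      also have "(\<lambda>x. indicator (box a b) x *\<^sub>R (indicator (cbox a b) x * H x)) = (\<lambda>x. indicator (box a b) x * H x)"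
        using box_subset_cbox[of a b] by (auto simp: indicator_def fun_eq_iff)
      finally show ?thesis .
    qed
    have "AE x in lebesgue. indicator (box a b) x * H x = 0"
    proof (rule AE_zero_if_box_integrals_zero[OF bi])
      fix c d
      obtain a' b' where a'b': "box c d \<inter> box a b = box a' b'" using box_Int_box[of c d a b] by blast
      have "(\<integral>x. indicator (box c d) x * (indicator (box a b) x * H x) \<partial>lebesgue) = (\<integral>x. indicator (box a' b') x * H x \<partial>lebesgue)"
        unfolding a'b'[symmetric] by (simp add: indicator_inter_arith mult.assoc)
      also have "\<dots> = 0"
      \<comment> \<open>For a nonempty box the closed box is its closure and stays inside
        \<open>cbox a b\<close>. If the open box is empty, \<open>cbox a' b'\<close> may lie
        anywhere, but the integrand is zero.\<close>
      proof (cases "box a' b' = {}")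
        case False
        then have "cbox a' b' = closure (box a' b')" by (simp add: closure_box)
        also have "\<dots> \<subseteq> cbox a b" unfolding a'b'[symmetric]
          by (rule closure_minimal) (use box_subset_cbox[of a b] in auto)
        finally show ?thesis using box0[of a' b'] ab by blast
      qed simp
      finally show "(\<integral>x. indicator (box c d) x * (indicator (box a b) x * H x) \<partial>lebesgue) = 0" .
    qed
    moreover have "AE x in lebesgue. x \<notin> cbox a b - box a b"
      using negligible_frontier_interval[of a b] unfolding negligible_iff_null_sets by (rule AE_not_in)
    ultimately show ?thesis by eventually_elim (auto simp: indicator_def split: if_splits)
  qed
  obtain D where D: "countable D" "\<And>X. X \<in> D \<Longrightarrow> \<exists>a b. X = cbox a b" "\<Union>D = \<Omega>"
    using open_countable_Union_open_cbox[OF O] by metis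
  have "AE x in lebesgue. \<forall>X\<in>D. x \<in> X \<longrightarrow> H x = 0"
    unfolding AE_ball_countable[OF D(1)]
  proof
    fix X assume "X \<in> D"
    then obtain a b where "X = cbox a b" using D(2) by blast
    moreover have "X \<subseteq> \<Omega>" using D(3) \<open>X \<in> D\<close> by blast
    ultimately show "AE x in lebesgue. x \<in> X \<longrightarrow> H x = 0" using cbox0 by blast
  qed
  then have "AE x in lebesgue. x \<in> \<Omega> \<longrightarrow> H x = 0"
    by eventually_elim (use D(3) in blast)
  then show ?thesis by (subst AE_restrict_space_iff) (use O' in auto)
qed

section \<open>Convolution\<close>

text \<open>The variable x sits in the kernel, so differentiability comes from \<open>\<rho>\<close>
  alone and f may be merely integrable; estimates by translations of f use the reflected
  form.\<close>

definition conv :: "('a::euclidean_space \<Rightarrow> real) \<Rightarrow> ('a \<Rightarrow> real) \<Rightarrow> 'a \<Rightarrow> real" where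
  "conv \<rho> f x = (\<integral>y. \<rho> (x - y) * f y \<partial>lborel)"

lemma lborel_distr_reflect:
  fixes c :: "'a::euclidean_space"
  shows "distr lborel borel (\<lambda>x. c - x) = lborel"
  using lborel_affine[of "-1" c] by (simp add: density_1)

lemma lborel_integral_reflect:
  fixes f :: "'a::euclidean_space \<Rightarrow> 'b::{banach, second_countable_topology}"
  assumes [measurable]: "f \<in> borel_measurable borel"
  shows "(\<integral>x. f (c - x) \<partial>lborel) = (\<integral>x. f x \<partial>lborel)"
proof -
  have "(\<integral>x. f x \<partial>lborel) = (\<integral>x. f x \<partial>distr lborel borel (\<lambda>x. c - x))" by (simp add: lborel_distr_reflect)
  also have "\<dots> = (\<integral>x. f (c - x) \<partial>lborel)" by (subst integral_distr) auto
  finally show ?thesis by simp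
qed

text \<open>The supporting box is arbitrary and not centred at the origin: kernels will be placed
  off centre, inside a cone.\<close>

lemma mollifier_exists:
  fixes a b :: "'a::euclidean_space"
  assumes "box a b \<noteq> {}"
  obtains \<rho> :: "'a \<Rightarrow> real" where "\<And>k. Ck k \<rho>" "\<And>z. 0 \<le> \<rho> z" "integrable lborel \<rho>" "(\<integral>z. \<rho> z \<partial>lborel) = 1"
    "\<And>z. z \<notin> cbox a b \<Longrightarrow> \<rho> z = 0"
proof -
  let ?b = "box_bump a b" and ?c = "\<integral>z. box_bump a b z \<partial>lborel"
  have [measurable]: "?b \<in> borel_measurable borel"
    by (rule borel_measurable_continuous_onI) (rule Ck_imp_continuous[OF Ck_box_bump])
  have z: "?b z = 0" if "z \<notin> cbox a b" for z
    using that box_subset_cbox[of a b] by (intro box_bump_zero) auto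
  obtain R where R: "cbox a b \<subseteq> cball 0 R" using bounded_cbox[of a b] by (auto simp: bounded_iff subset_iff)
  have i: "integrable lborel ?b"
  proof (rule bounded_lborel_integrable[where B=1 and R=R])
    show "norm (?b x) \<le> 1" for x using box_bump_nonneg[of a b x] box_bump_le_1[of a b x] by simp
    show "\<And>x. x \<notin> cball 0 R \<Longrightarrow> ?b x = 0" using z R by blast
  qed simp
  have "?c \<noteq> 0"
  proof
    assume "?c = 0"
    then have "AE x in lborel. ?b x = 0"
      by (subst (asm) integral_nonneg_eq_0_iff_AE[OF i]) (auto simp: box_bump_nonneg)
    then have "AE x in lborel. x \<notin> box a b"
      by eventually_elim (use box_bump_pos[of _ a b] in fastforce)
    then have "box a b \<in> null_sets lborel"
      by (subst AE_iff_null_sets) auto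
    then have "negligible (box a b)" by (simp add: negligible_iff_null_sets null_sets_completionI)
    then show False using assms open_not_negligible[OF open_box] by blast
  qed
  moreover have "0 \<le> ?c" by (simp add: box_bump_nonneg)
  ultimately have c: "0 < ?c" by simp
  show ?thesis
  proof (rule that[of "\<lambda>z. ?b z * (1 / ?c)"])
    show "Ck k (\<lambda>z. ?b z * (1 / ?c))" for k by (intro Ck_mult Ck_box_bump Ck_const)
    show "0 \<le> ?b z * (1 / ?c)" for z using c by (simp add: box_bump_nonneg)
    show "integrable lborel (\<lambda>z. ?b z * (1 / ?c))" using i by simp
    show "(\<integral>z. ?b z * (1 / ?c) \<partial>lborel) = 1" using c by simp
    show "z \<notin> cbox a b \<Longrightarrow> ?b z * (1 / ?c) = 0" for z using z by simp
  qed
qed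

text \<open>A quadratic remainder uniform in z lets the derivative pass under convolution with an
  integrable function. It is the mean value inequality for
  \<open>\<kappa> w - grad \<kappa> z \<bullet> w\<close> on the ball of radius |h| around z, where
  the gradient of \<open>\<kappa>\<close> varies by at most C |h|.\<close>

lemma C2_Taylor_bound:
  fixes \<kappa> :: "real^'d \<Rightarrow> real"
  assumes \<kappa>: "\<And>k. Ck k \<kappa>" and R: "\<And>x. x \<notin> cball 0 R \<Longrightarrow> \<kappa> x = 0"
  obtains C where "0 \<le> C" "\<And>z h. \<bar>\<kappa> (z + h) - \<kappa> z - grad \<kappa> z \<bullet> h\<bar> \<le> C * (norm h)\<^sup>2"
proof -
  have gC: "Ck 1 (\<lambda>x. grad \<kappa> x \<bullet> b)" for b using Ck_grad[OF \<kappa>[of "Suc 1"]] .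
  obtain B0 where B0: "\<And>x. x \<notin> cball 0 R \<Longrightarrow> grad \<kappa> x = 0"
    using C1_compact_support_bounds[OF \<kappa> R] by metis
  have "\<exists>B. \<forall>x y. \<bar>grad \<kappa> x \<bullet> b - grad \<kappa> y \<bullet> b\<bar> \<le> B * norm (x - y)" for b
  proof -
    have z: "grad \<kappa> x \<bullet> b = 0" if "x \<notin> cball 0 R" for x using B0[OF that] by simp
    show ?thesis by (rule C1_compact_support_bounds[OF gC[of b] z]) auto
  qed
  then obtain B where B: "\<And>b x y. \<bar>grad \<kappa> x \<bullet> b - grad \<kappa> y \<bullet> b\<bar> \<le> B b * norm (x - y)" by metis
  define C where "C = (\<Sum>b\<in>Basis. \<bar>B b\<bar>)"
  have C0: "0 \<le> C" by (simp add: C_def sum_nonneg)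
  have lip: "norm (grad \<kappa> x - grad \<kappa> y) \<le> C * norm (x - y)" for x y
  proof -
    have "norm (grad \<kappa> x - grad \<kappa> y) \<le> (\<Sum>b\<in>Basis. \<bar>(grad \<kappa> x - grad \<kappa> y) \<bullet> b\<bar>)" by (rule norm_le_l1)
    also have "\<dots> \<le> (\<Sum>b\<in>Basis. \<bar>B b\<bar> * norm (x - y))"
    proof (rule sum_mono)
      fix b
      have "B b * norm (x - y) \<le> \<bar>B b\<bar> * norm (x - y)" by (intro mult_right_mono) auto
      then show "\<bar>(grad \<kappa> x - grad \<kappa> y) \<bullet> b\<bar> \<le> \<bar>B b\<bar> * norm (x - y)"
        using B[of x b y] by (simp add: inner_diff_left)
    qed
    finally show ?thesis by (simp add: C_def sum_distrib_right)
  qed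
  have "\<bar>\<kappa> (z + h) - \<kappa> z - grad \<kappa> z \<bullet> h\<bar> \<le> C * (norm h)\<^sup>2" for z h
  proof -
    have "norm ((\<kappa> (z + h) - grad \<kappa> z \<bullet> (z + h)) - (\<kappa> z - grad \<kappa> z \<bullet> z)) \<le> (C * norm h) * norm ((z + h) - z)"
    proof (rule differentiable_bound[of "cball z (norm h)" "\<lambda>w. \<kappa> w - grad \<kappa> z \<bullet> w" "\<lambda>w v. (grad \<kappa> w - grad \<kappa> z) \<bullet> v"])
      show "((\<lambda>w. \<kappa> w - grad \<kappa> z \<bullet> w) has_derivative (\<lambda>v. (grad \<kappa> w - grad \<kappa> z) \<bullet> v)) (at w within cball z (norm h))" for w
        by (rule has_derivative_at_withinI)
          (auto intro!: derivative_eq_intros C1_grad(1)[OF \<kappa>] simp: inner_simps)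
      show "onorm (\<lambda>v. (grad \<kappa> w - grad \<kappa> z) \<bullet> v) \<le> C * norm h" if "w \<in> cball z (norm h)" for w
      proof (rule onorm_le)
        fix v
        have "norm ((grad \<kappa> w - grad \<kappa> z) \<bullet> v) \<le> norm (grad \<kappa> w - grad \<kappa> z) * norm v"
          using Cauchy_Schwarz_ineq2[of "grad \<kappa> w - grad \<kappa> z" v] by simp
        also have "\<dots> \<le> (C * norm (w - z)) * norm v" by (intro mult_right_mono lip) auto
        also have "\<dots> \<le> (C * norm h) * norm v"
          using that by (intro mult_right_mono mult_left_mono C0) (auto simp: dist_norm norm_minus_commute)
        finally show "norm ((grad \<kappa> w - grad \<kappa> z) \<bullet> v) \<le> (C * norm h) * norm v" .
      qed
    qed (auto simp: dist_norm)
    then show ?thesis by (simp add: inner_simps power2_eq_square algebra_simps)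
  qed
  with C0 show ?thesis by (rule that)
qed

lemma conv_integrable:
  fixes \<kappa> :: "'a::euclidean_space \<Rightarrow> real"
  assumes "continuous_on UNIV \<kappa>" "\<And>x. \<bar>\<kappa> x\<bar> \<le> B" "integrable lborel f"
  shows "integrable lborel (\<lambda>y. \<kappa> (x - y) * f y)"
proof (rule Bochner_Integration.integrable_bound[OF integrable_mult_right[OF assms(3), of B]])
  have [measurable]: "\<kappa> \<in> borel_measurable borel" by (rule borel_measurable_continuous_onI[OF assms(1)])
  have [measurable]: "f \<in> borel_measurable lborel" using assms by blast
  show "(\<lambda>y. \<kappa> (x - y) * f y) \<in> borel_measurable lborel" by measurable
  show "AE y in lborel. norm (\<kappa> (x - y) * f y) \<le> norm (B * f y)"
  proof (rule AE_I2)
    fix y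
    have "\<bar>\<kappa> (x - y)\<bar> * \<bar>f y\<bar> \<le> \<bar>B\<bar> * \<bar>f y\<bar>"
      using assms(2)[of "x - y"] by (intro mult_right_mono) auto
    then show "norm (\<kappa> (x - y) * f y) \<le> norm (B * f y)" by (simp add: abs_mult)
  qed
qed

lemma conv_has_derivative:
  fixes \<kappa> :: "real^'d \<Rightarrow> real"
  assumes \<kappa>: "\<And>k. Ck k \<kappa>" and R: "\<And>x. x \<notin> cball 0 R \<Longrightarrow> \<kappa> x = 0" and f: "integrable lborel f"
  shows "(conv \<kappa> f has_derivative (\<lambda>v. conv (\<lambda>z. grad \<kappa> z \<bullet> v) f x)) (at x)"
proof -
  obtain C where C: "0 \<le> C" "\<And>z h. \<bar>\<kappa> (z + h) - \<kappa> z - grad \<kappa> z \<bullet> h\<bar> \<le> C * (norm h)\<^sup>2"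
    using C2_Taylor_bound[OF \<kappa> R] by blast
  obtain B where B: "\<And>x. norm (\<kappa> x) \<le> B" "\<And>x. norm (grad \<kappa> x) \<le> B"
    using C1_compact_support_bounds[OF \<kappa> R] by metis
  have Bv: "\<bar>grad \<kappa> x \<bullet> v\<bar> \<le> B * norm v" for x v
    using Cauchy_Schwarz_ineq2[of "grad \<kappa> x" v] mult_right_mono[OF B(2)[of x] norm_ge_zero[of v]] by linarith
  have cg: "continuous_on UNIV (\<lambda>z. grad \<kappa> z \<bullet> v)" for v by (intro continuous_intros C1_grad(2)[OF \<kappa>])
  have i1: "integrable lborel (\<lambda>y. \<kappa> (x - y) * f y)" for x
    by (rule conv_integrable[OF Ck_imp_continuous[OF \<kappa>]]) (use B f in auto)
  have i2: "integrable lborel (\<lambda>y. (grad \<kappa> (x - y) \<bullet> v) * f y)" for x v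
    using conv_integrable[OF cg Bv f] .
  have bd: "norm (conv \<kappa> f y - conv \<kappa> f x - conv (\<lambda>z. grad \<kappa> z \<bullet> (y - x)) f x) \<le> C * (norm (y - x))\<^sup>2 * (\<integral>y. \<bar>f y\<bar> \<partial>lborel)" for y
  proof -
    have "conv \<kappa> f y - conv \<kappa> f x - conv (\<lambda>z. grad \<kappa> z \<bullet> (y - x)) f x
      = (\<integral>w. (\<kappa> (y - w) - \<kappa> (x - w) - grad \<kappa> (x - w) \<bullet> (y - x)) * f w \<partial>lborel)"
      unfolding conv_def left_diff_distrib using i1 i2 by simp
    also have "norm \<dots> \<le> (\<integral>w. C * (norm (y - x))\<^sup>2 * \<bar>f w\<bar> \<partial>lborel)"
    proof (rule order_trans[OF integral_norm_bound], rule integral_mono)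
      show "integrable lborel (\<lambda>w. norm ((\<kappa> (y - w) - \<kappa> (x - w) - grad \<kappa> (x - w) \<bullet> (y - x)) * f w))"
        unfolding left_diff_distrib using i1 i2 by (intro integrable_norm) simp
      show "integrable lborel (\<lambda>w. C * (norm (y - x))\<^sup>2 * \<bar>f w\<bar>)" using f by simp
      show "norm ((\<kappa> (y - w) - \<kappa> (x - w) - grad \<kappa> (x - w) \<bullet> (y - x)) * f w) \<le> C * (norm (y - x))\<^sup>2 * \<bar>f w\<bar>" for w
      proof -
        have "\<bar>\<kappa> (y - w) - \<kappa> (x - w) - grad \<kappa> (x - w) \<bullet> (y - x)\<bar> \<le> C * (norm (y - x))\<^sup>2"
          using C(2)[of "x - w" "y - x"] by (simp add: algebra_simps)
        then show ?thesis unfolding real_norm_def abs_mult by (rule mult_right_mono) simp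
      qed
    qed
    finally show ?thesis by simp
  qed
  show ?thesis
  proof (subst has_derivative_iff_norm, intro conjI)
    have "linear (\<lambda>v. conv (\<lambda>z. grad \<kappa> z \<bullet> v) f x)"
      unfolding conv_def using i2 by (intro linearI) (simp_all add: inner_simps distrib_right mult.assoc)
    then show "bounded_linear (\<lambda>v. conv (\<lambda>z. grad \<kappa> z \<bullet> v) f x)" by (simp add: linear_conv_bounded_linear)
    show "((\<lambda>y. norm (conv \<kappa> f y - conv \<kappa> f x - conv (\<lambda>z. grad \<kappa> z \<bullet> (y - x)) f x) / norm (y - x)) \<longlongrightarrow> 0) (at x)"
    proof (rule Lim_null_comparison)
      let ?b = "\<lambda>y. C * norm (y - x) * (\<integral>y. \<bar>f y\<bar> \<partial>lborel)"
      show "\<forall>\<^sub>F y in at x. norm (norm (conv \<kappa> f y - conv \<kappa> f x - conv (\<lambda>z. grad \<kappa> z \<bullet> (y - x)) f x) / norm (y - x)) \<le> ?b y"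
        using bd by (intro eventually_at_topological[THEN iffD2] exI[of _ UNIV])
          (auto simp: divide_le_eq power2_eq_square mult_ac)
      have "(?b \<longlongrightarrow> C * norm (x - x) * (\<integral>y. \<bar>f y\<bar> \<partial>lborel)) (at x)" by (intro tendsto_intros)
      then show "(?b \<longlongrightarrow> 0) (at x)" by simp
    qed
  qed
qed

text \<open>The derivative in direction v is again a convolution, with kernel
  \<open>grad \<kappa> z \<bullet> v\<close>, so the induction runs over all smooth kernels with the
  same support ball.\<close>

lemma conv_Ck:
  fixes \<kappa> :: "real^'d \<Rightarrow> real"
  assumes f: "integrable lborel f"
  shows "(\<And>k. Ck k \<kappa>) \<Longrightarrow> (\<And>x. x \<notin> cball 0 R \<Longrightarrow> \<kappa> x = 0) \<Longrightarrow> Ck k (conv \<kappa> f)"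
proof (induction k arbitrary: \<kappa>)
  case 0
  then show ?case
    using has_derivative_continuous[OF conv_has_derivative[OF 0(1) 0(2) f]] by (simp add: continuous_at_imp_continuous_on)
next
  case (Suc k)
  have "grad \<kappa> x = 0" if "x \<notin> cball 0 R" for x
    using C1_compact_support_bounds[OF Suc.prems(1) Suc.prems(2)] that by metis
  then show ?case
    by (intro Ck_SucI[OF conv_has_derivative[OF Suc.prems(1) Suc.prems(2) f]] Suc.IH Ck_grad Suc.prems(1)) simp_all
qed

lemma grad_conv:
  fixes \<kappa> :: "real^'d \<Rightarrow> real"
  assumes \<kappa>: "\<And>k. Ck k \<kappa>" and R: "\<And>x. x \<notin> cball 0 R \<Longrightarrow> \<kappa> x = 0" and f: "integrable lborel f"
  shows "grad (conv \<kappa> f) x $ i = conv (\<lambda>z. grad \<kappa> z $ i) f x"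
  using grad_unique[OF conv_has_derivative[OF \<kappa> R f], where v="axis i 1" and x=x] by (simp add: inner_axis)

section \<open>Continuity of translations in L2\<close>

lemma L2_lborel_translation:
  fixes f :: "'a::euclidean_space \<Rightarrow> 'b::euclidean_space"
  assumes "f \<in> L2 lborel"
  shows "(\<lambda>x. f (x - z)) \<in> L2 lborel" "L2_norm lborel (\<lambda>x. f (x - z)) = L2_norm lborel f"
proof -
  have [measurable]: "f \<in> borel_measurable borel" using L2_measurable[OF assms] by simp
  have "integrable lborel (\<lambda>x. (norm (f (- z + x)))\<^sup>2)"
    using lborel_integrable_translation[OF L2_integrable_sq[OF assms], of "- z"] .
  then show "(\<lambda>x. f (x - z)) \<in> L2 lborel" by (intro L2_I) simp_all
  have "(\<integral>x. (norm (f (- z + x)))\<^sup>2 \<partial>lborel) = (\<integral>x. (norm (f x))\<^sup>2 \<partial>lborel)"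
    by (rule lborel_integral_translation) measurable
  then show "L2_norm lborel (\<lambda>x. f (x - z)) = L2_norm lborel f" by (simp add: L2_norm_def)
qed

lemma L2_norm_tendsto_0:
  fixes g :: "nat \<Rightarrow> 'x \<Rightarrow> 'b::euclidean_space"
  assumes [measurable]: "\<And>n. g n \<in> borel_measurable M" and w: "integrable M w"
    and lim: "AE x in M. (\<lambda>n. g n x) \<longlonglongrightarrow> 0" and le: "\<And>n. AE x in M. (norm (g n x))\<^sup>2 \<le> w x"
  shows "(\<lambda>n. L2_norm M (g n)) \<longlonglongrightarrow> 0"
proof -
  have "(\<lambda>n. \<integral>x. (norm (g n x))\<^sup>2 \<partial>M) \<longlonglongrightarrow> (\<integral>x. 0 \<partial>M)"
  proof (rule integral_dominated_convergence[OF _ _ w])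
    show "AE x in M. (\<lambda>n. (norm (g n x))\<^sup>2) \<longlonglongrightarrow> 0"
      using lim by eventually_elim (auto intro!: tendsto_eq_intros)
  qed (use le in auto)
  then have "(\<lambda>n. sqrt (\<integral>x. (norm (g n x))\<^sup>2 \<partial>M)) \<longlonglongrightarrow> sqrt 0" by (intro tendsto_intros) simp
  then show ?thesis by (simp add: L2_norm_def)
qed

text \<open>Truncation of the values first makes f bounded. A measurable function is an almost
  everywhere limit of continuous ones; truncating these at the same level and cutting them off in
  space gives a common dominating function.\<close>

lemma continuous_dense_L2:
  fixes f :: "'a::euclidean_space \<Rightarrow> real"
  assumes f: "f \<in> L2 lborel" and R: "\<And>x. x \<notin> cball 0 R \<Longrightarrow> f x = 0" and e: "e > 0"
  obtains h S where "continuous_on UNIV h" "h \<in> L2 lborel" "\<And>x. x \<notin> cball 0 S \<Longrightarrow> h x = 0" "L2_norm lborel (\<lambda>x. f x - h x) < e"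
proof -
  note [measurable] = L2_measurable[OF f]
  define T where "T B y = max (- B) (min B y)" for B y :: real
  have T: "\<bar>T B y\<bar> \<le> B" if "0 \<le> B" for B y using that by (auto simp: T_def)
  have Tid: "T B y = y" if "\<bar>y\<bar> \<le> B" for B y using that by (auto simp: T_def)
  have T0: "T B 0 = 0" if "0 \<le> B" for B using that by (auto simp: T_def)
  have Tc: "continuous_on UNIV (T B)" for B unfolding T_def by (intro continuous_intros)
  have Tl: "\<bar>y - T B y\<bar> \<le> \<bar>y\<bar>" if "0 \<le> B" for B y using that by (auto simp: T_def)
  have [measurable]: "T B \<in> borel_measurable borel" for B by (rule borel_measurable_continuous_onI[OF Tc])
  have "(\<lambda>n. L2_norm lborel (\<lambda>x. f x - T (real n) (f x))) \<longlonglongrightarrow> 0"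
  proof (rule L2_norm_tendsto_0)
    show "integrable lborel (\<lambda>x. (norm (f x))\<^sup>2)" using L2_integrable_sq[OF f] .
    show "AE x in lborel. (\<lambda>n. f x - T (real n) (f x)) \<longlonglongrightarrow> 0"
    proof (rule AE_I2, rule tendsto_eventually)
      fix x
      show "\<forall>\<^sub>F n in sequentially. f x - T (real n) (f x) = 0"
        using eventually_ge_at_top[of "nat \<lceil>\<bar>f x\<bar>\<rceil>"] by eventually_elim (simp add: Tid nat_ceiling_le_eq)
    qed
    show "AE x in lborel. (norm (f x - T (real n) (f x)))\<^sup>2 \<le> (norm (f x))\<^sup>2" for n
      using Tl[of "real n"] by (intro AE_I2 power_mono) auto
  qed simp
  from order_tendstoD(2)[OF this, of "e / 2"] e
  obtain B where B: "L2_norm lborel (\<lambda>x. f x - T (real B) (f x)) < e / 2"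
    using eventually_happens'[OF sequentially_bot] by force
  define b where "b = real B"
  have b: "0 \<le> b" by (simp add: b_def)
  define F where "F x = T b (f x)" for x
  have [measurable]: "F \<in> borel_measurable borel" unfolding F_def by measurable
  have "F measurable_on UNIV"
    by (rule lebesgue_measurable_imp_measurable_on_real) (auto intro: measurable_completion)
  then obtain N g where N: "negligible N" and g: "\<And>n. continuous_on UNIV (g n)" "\<And>x. x \<notin> N \<Longrightarrow> (\<lambda>n. g n x) \<longlonglongrightarrow> F x"
    by (auto simp: measurable_on_def)
  \<comment> \<open>The cutoff equals 1 only on the ball of radius r/2, which must contain
    \<open>cball 0 R\<close>, where f may be nonzero.\<close>
  define r where "r = 2 * (\<bar>R\<bar> + 1)"
  have r: "0 < r" "R < r / 2" "3/4 * r \<le> r" by (auto simp: r_def)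
  obtain c :: "'a \<Rightarrow> real" where c: "Ck 1 c" "\<And>x. 0 \<le> c x" "\<And>x. c x \<le> 1" "\<And>x. x \<in> ball 0 (r/2) \<Longrightarrow> c x = 1"
    "\<And>x. x \<notin> cball 0 (3/4 * r) \<Longrightarrow> c x = 0" using C1_cutoff[OF r(1)] by blast
  have cr: "c x = 0" if "x \<notin> cball 0 r" for x using c(5)[of x] that r by auto
  have cF: "c x * F x = F x" for x
  proof (cases "x \<in> cball 0 R")
    case True
    then show ?thesis using c(4)[of x] r by simp
  qed (simp add: F_def R T0 b)
  define h where "h n x = c x * T b (g n x)" for n x
  have hc: "continuous_on UNIV (h n)" for n
    unfolding h_def by (intro continuous_intros C1_continuous[OF c(1)] continuous_on_compose2[OF Tc g(1)]) auto
  have [measurable]: "h n \<in> borel_measurable borel" for n by (rule borel_measurable_continuous_onI[OF hc])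
  have hz: "h n x = 0" if "x \<notin> cball 0 r" for x n using cr[OF that] by (simp add: h_def)
  have Fz: "F x = 0" if "x \<notin> cball 0 r" for x using cF[of x] cr[OF that] by simp
  have hb: "\<bar>h n x\<bar> \<le> b" for n x
  proof -
    have "\<bar>h n x\<bar> = c x * \<bar>T b (g n x)\<bar>" using c(2) by (simp add: h_def abs_mult)
    also have "\<dots> \<le> 1 * b" by (intro mult_mono c T b) auto
    finally show ?thesis by simp
  qed
  have "(\<lambda>n. L2_norm lborel (\<lambda>x. F x - h n x)) \<longlonglongrightarrow> 0"
  proof (rule L2_norm_tendsto_0)
    show "integrable lborel (\<lambda>x. indicator (cball (0::'a) r) x *\<^sub>R (2 * b)\<^sup>2)"
      by (rule integrable_indicator) (use emeasure_bounded_finite[OF bounded_cball] in auto)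
    have "AE x in lebesgue. x \<notin> N" using N unfolding negligible_iff_null_sets by (rule AE_not_in)
    then have "AE x in lebesgue. (\<lambda>n. F x - h n x) \<longlonglongrightarrow> 0"
    proof eventually_elim
      case (elim x)
      have "(\<lambda>n. T b (g n x)) \<longlonglongrightarrow> T b (F x)"
        by (rule continuous_on_tendsto_compose[OF Tc g(2)[OF elim]]) auto
      then have "(\<lambda>n. F x - h n x) \<longlonglongrightarrow> F x - c x * T b (F x)" unfolding h_def by (intro tendsto_intros)
      moreover have "T b (F x) = F x" using Tid T[OF b] by (simp add: F_def)
      ultimately show ?case using cF by simp
    qed
    then show "AE x in lborel. (\<lambda>n. F x - h n x) \<longlonglongrightarrow> 0" by (simp add: AE_completion_iff)
    have "(norm (F x - h n x))\<^sup>2 \<le> indicator (cball 0 r) x *\<^sub>R (2 * b)\<^sup>2" for x n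
    proof (cases "x \<in> cball 0 r")
      case True
      have "\<bar>F x\<bar> \<le> b" using T[OF b] by (simp add: F_def)
      then have "\<bar>F x - h n x\<bar> \<le> 2 * b" using hb[of n x] by linarith
      then have "(norm (F x - h n x))\<^sup>2 \<le> (2 * b)\<^sup>2" by (intro power_mono) auto
      then show ?thesis using True by simp
    qed (simp add: hz Fz)
    then show "AE x in lborel. (norm (F x - h n x))\<^sup>2 \<le> indicator (cball 0 r) x *\<^sub>R (2 * b)\<^sup>2" for n by simp
  qed simp
  from order_tendstoD(2)[OF this, of "e / 2"] e
  obtain n where n: "L2_norm lborel (\<lambda>x. F x - h n x) < e / 2"
    using eventually_happens'[OF sequentially_bot] by force
  have FL: "F \<in> L2 lborel"
  proof (rule L2_dominated[OF _ f])
    show "AE x in lborel. norm (F x) \<le> norm (f x)"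
      using b by (intro AE_I2) (auto simp: F_def T_def)
  qed simp
  have hL: "h n \<in> L2 lborel"
  proof (rule L2_I)
    show "integrable lborel (\<lambda>x. (norm (h n x))\<^sup>2)"
    proof (rule bounded_lborel_integrable[where B="b\<^sup>2" and R=r])
      show "norm ((norm (h n x))\<^sup>2) \<le> b\<^sup>2" for x using power_mono[OF hb[of n x], of 2] by simp
    qed (use hz in auto)
  qed simp
  have "L2_norm lborel (\<lambda>x. f x - h n x) < e"
    using L2_norm_triangle_diff[OF f FL hL] B n by (simp add: F_def b_def)
  then show ?thesis using that[OF hc hL hz] by blast
qed

lemma L2_translation_continuous:
  fixes f :: "'a::euclidean_space \<Rightarrow> real"
  assumes f: "f \<in> L2 lborel" and R: "\<And>x. x \<notin> cball 0 R \<Longrightarrow> f x = 0" and e: "e > 0"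
  obtains \<delta> where "\<delta> > 0" "\<And>z. norm z \<le> \<delta> \<Longrightarrow> L2_norm lborel (\<lambda>x. f (x - z) - f x) \<le> e"
proof -
  obtain h S where h: "continuous_on UNIV h" "h \<in> L2 lborel" "\<And>x. x \<notin> cball 0 S \<Longrightarrow> h x = 0"
    and fh: "L2_norm lborel (\<lambda>x. f x - h x) < e / 3"
    by (rule continuous_dense_L2[OF f R, where e="e/3"]) (use e in auto)
  define V where "V = measure lborel (cball (0::'a) (S + 1))"
  have V: "0 \<le> V" by (simp add: V_def)
  \<comment> \<open>Uniform closeness e' on a ball of volume V costs e' sqrt V in the L^2 norm, and
    this has to stay below e/3. The radius S + 1 of that ball contains the support of h and of its
    translates by vectors of length at most 1.\<close>
  define e' where "e' = e / (3 * (1 + sqrt V))"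
  have e': "0 < e'" using e V by (simp add: e'_def add_pos_nonneg)
  have "uniformly_continuous_on (cball 0 (S + 2)) h"
    by (rule compact_uniformly_continuous[OF continuous_on_subset[OF h(1)] compact_cball]) auto
  then obtain d where d: "d > 0" "\<And>x y. x \<in> cball 0 (S+2) \<Longrightarrow> y \<in> cball 0 (S+2) \<Longrightarrow> dist x y < d \<Longrightarrow> dist (h x) (h y) < e'"
    unfolding uniformly_continuous_on_def using e' by metis
  define \<delta> where "\<delta> = min (d/2) 1"
  have \<delta>: "\<delta> > 0" using d by (simp add: \<delta>_def)
  have hz: "L2_norm lborel (\<lambda>x. h (x - z) - h x) \<le> e / 3" if z: "norm z \<le> \<delta>" for z
  proof -
    have z1: "norm z \<le> 1" "norm z < d" using z d by (auto simp: \<delta>_def)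
    have hm: "(\<lambda>x. h (x - z) - h x) \<in> L2 lborel" by (intro L2_diff L2_lborel_translation h)
    have pt: "(norm (h (x - z) - h x))\<^sup>2 \<le> indicator (cball 0 (S + 1)) x *\<^sub>R e'\<^sup>2" for x
    proof (cases "x \<in> cball 0 (S + 1)")
      case True
      have "norm (x - z) \<le> S + 2" using True z1 norm_triangle_ineq4[of x z] by simp
      then have "dist (h (x - z)) (h x) < e'" using True z1 by (intro d(2)) (auto simp: dist_norm norm_minus_commute)
      then have "(norm (h (x - z) - h x))\<^sup>2 \<le> e'\<^sup>2" by (intro power_mono) (auto simp: dist_norm)
      then show ?thesis using True by simp
    next
      case False
      have "S < norm x" using False by simp
      moreover have "S < norm (x - z)" using False z1 norm_triangle_ineq2[of x z] by simp
      ultimately show ?thesis using h(3) by simp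
    qed
    have ii: "integrable lborel (\<lambda>x. indicator (cball (0::'a) (S + 1)) x *\<^sub>R e'\<^sup>2)"
      by (rule integrable_indicator) (use emeasure_bounded_finite[OF bounded_cball] in auto)
    have "(L2_norm lborel (\<lambda>x. h (x - z) - h x))\<^sup>2 \<le> (\<integral>x. indicator (cball (0::'a) (S + 1)) x *\<^sub>R e'\<^sup>2 \<partial>lborel)"
      unfolding L2_norm_power2 by (rule integral_mono[OF L2_integrable_sq[OF hm] ii pt])
    also have "\<dots> = (e' * sqrt V)\<^sup>2" using V by (simp add: V_def power_mult_distrib)
    finally have "L2_norm lborel (\<lambda>x. h (x - z) - h x) \<le> e' * sqrt V"
      using e' V by (simp add: power2_le_iff_abs_le)
    also have "\<dots> \<le> e / 3" using e V unfolding e'_def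
      by (simp add: field_simps add_pos_nonneg)
    finally show ?thesis .
  qed
  show ?thesis
  proof (rule that[OF \<delta>])
    fix z :: 'a assume z: "norm z \<le> \<delta>"
    note L = L2_lborel_translation(1)[OF f, of z] L2_lborel_translation(1)[OF h(2), of z]
    have "L2_norm lborel (\<lambda>x. f (x - z) - f x)
       \<le> L2_norm lborel (\<lambda>x. f (x - z) - h (x - z)) + L2_norm lborel (\<lambda>x. h (x - z) - f x)"
      by (rule L2_norm_triangle_diff[OF L f])
    also have "L2_norm lborel (\<lambda>x. h (x - z) - f x) \<le> L2_norm lborel (\<lambda>x. h (x - z) - h x) + L2_norm lborel (\<lambda>x. h x - f x)"
      by (rule L2_norm_triangle_diff[OF L(2) h(2) f])
    also have "L2_norm lborel (\<lambda>x. f (x - z) - h (x - z)) = L2_norm lborel (\<lambda>x. f x - h x)"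
      by (rule L2_lborel_translation(2)[OF L2_diff[OF f h(2)]])
    also have "L2_norm lborel (\<lambda>x. h x - f x) = L2_norm lborel (\<lambda>x. f x - h x)" by (rule L2_norm_minus_commute)
    finally show "L2_norm lborel (\<lambda>x. f (x - z) - f x) \<le> e" using hz[OF z] fh by linarith
  qed
qed

lemma conv_reflect:
  fixes f :: "'a::euclidean_space \<Rightarrow> real"
  assumes [measurable]: "\<rho> \<in> borel_measurable borel" "f \<in> borel_measurable borel"
  shows "conv \<rho> f x = (\<integral>z. \<rho> z * f (x - z) \<partial>lborel)"
  using lborel_integral_reflect[of "\<lambda>z. \<rho> z * f (x - z)" x] by (simp add: conv_def)

text \<open>Since \<open>\<rho>\<close> is a probability density, Cauchy-Schwarz bounds |conv \<rho>
  f - f|^2 at x by the \<open>\<rho>\<close>-average Q x of |f (x - z) - f x|^2. Tonelli's theorem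
  reduces the integral of Q to the L^2 moduli of translation for z in the support of
  \<open>\<rho>\<close>.\<close>

lemma conv_L2_close:
  fixes f :: "'a::euclidean_space \<Rightarrow> real"
  assumes f: "f \<in> L2 lborel" "integrable lborel f"
    and \<rho>: "continuous_on UNIV \<rho>" "\<And>z. 0 \<le> \<rho> z" "\<And>z. \<rho> z \<le> B" "integrable lborel \<rho>" "(\<integral>z. \<rho> z \<partial>lborel) = 1"
    and cc: "conv \<rho> f \<in> borel_measurable borel"
    and tr: "\<And>z. \<rho> z \<noteq> 0 \<Longrightarrow> L2_norm lborel (\<lambda>x. f (x - z) - f x) \<le> e" and e: "0 \<le> e"
  shows "(\<lambda>x. conv \<rho> f x - f x) \<in> L2 lborel" "L2_norm lborel (\<lambda>x. conv \<rho> f x - f x) \<le> e"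
proof -
  have [measurable]: "f \<in> borel_measurable borel" using L2_measurable[OF f(1)] by simp
  have [measurable]: "\<rho> \<in> borel_measurable borel" by (rule borel_measurable_continuous_onI[OF \<rho>(1)])
  note [measurable] = cc
  define Q where "Q x = (\<integral>\<^sup>+z. ennreal (\<rho> z * (f (x - z) - f x)\<^sup>2) \<partial>lborel)" for x
  have pt: "ennreal ((norm (conv \<rho> f x - f x))\<^sup>2) \<le> Q x" for x
  proof (cases "Q x = \<infinity>")
    case False
    \<comment> \<open>The weight is split as sqrt \<open>\<rho>\<close> times sqrt
      \<open>\<rho>\<close>; the factor s has norm 1 and g carries the difference of the
      translates.\<close>
    define s where "s z = sqrt (\<rho> z)" for z
    define g where "g z = sqrt (\<rho> z) * (f (x - z) - f x)" for z
    have [measurable]: "s \<in> borel_measurable borel" "g \<in> borel_measurable borel" unfolding s_def g_def by measurable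
    have s2: "(norm (s z))\<^sup>2 = \<rho> z" for z using \<rho>(2) by (simp add: s_def)
    have g2: "(norm (g z))\<^sup>2 = \<rho> z * (f (x - z) - f x)\<^sup>2" for z using \<rho>(2) by (simp add: g_def power_mult_distrib)
    have sL: "s \<in> L2 lborel" by (rule L2_I) (use s2 \<rho>(4) in simp_all)
    have sn: "L2_norm lborel s = 1" unfolding L2_norm_def s2 \<rho>(5) by simp
    have Qg: "(\<integral>\<^sup>+z. ennreal ((norm (g z))\<^sup>2) \<partial>lborel) = Q x" unfolding g2 Q_def ..
    obtain q where q: "Q x = ennreal q" using False by (cases "Q x") auto
    have gL: "g \<in> L2 lborel" by (rule L2_I_nn[where c=q]) (use Qg q in auto)
    have Qn: "Q x = ennreal ((L2_norm lborel g)\<^sup>2)" using nn_integral_L2[OF gL] Qg by simp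
    have i1: "integrable lborel (\<lambda>z. \<rho> z * f (x - z))"
    proof -
      have "integrable lborel (\<lambda>z. f (x - z))"
      proof -
        have "integrable (distr lborel borel (\<lambda>z. x - z)) f" using f(2) by (simp add: lborel_distr_reflect)
        then show ?thesis by (subst (asm) integrable_distr_eq) auto
      qed
      then have "integrable lborel (\<lambda>z. B * f (x - z))" by simp
      then show ?thesis
      proof (rule Bochner_Integration.integrable_bound)
        have "norm (\<rho> z * f (x - z)) \<le> norm (B * f (x - z))" for z
          using \<rho>(2)[of z] \<rho>(3)[of z] by (auto simp: abs_mult intro!: mult_right_mono)
        then show "AE z in lborel. norm (\<rho> z * f (x - z)) \<le> norm (B * f (x - z))" by simp
      qed measurable
    qed
    have "conv \<rho> f x - f x = (\<integral>z. \<rho> z * f (x - z) \<partial>lborel) - (\<integral>z. \<rho> z * f x \<partial>lborel)"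
      using \<rho>(5) by (simp add: conv_reflect)
    also have "\<dots> = (\<integral>z. \<rho> z * f (x - z) - \<rho> z * f x \<partial>lborel)"
      using i1 \<rho>(4) by simp
    also have "\<dots> = (\<integral>z. s z \<bullet> g z \<partial>lborel)"
      using \<rho>(2) by (intro Bochner_Integration.integral_cong) (auto simp: s_def g_def algebra_simps)
    finally have "\<bar>conv \<rho> f x - f x\<bar> \<le> L2_norm lborel g"
      using L2_Cauchy_Schwarz[OF sL gL] sn by simp
    then have "(norm (conv \<rho> f x - f x))\<^sup>2 \<le> (L2_norm lborel g)\<^sup>2" by (intro power_mono) auto
    then show ?thesis unfolding Qn by (rule ennreal_leI)
  qed simp
  have "(\<integral>\<^sup>+x. ennreal ((norm (conv \<rho> f x - f x))\<^sup>2) \<partial>lborel) \<le> (\<integral>\<^sup>+x. Q x \<partial>lborel)"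
    by (intro nn_integral_mono pt)
  also have "\<dots> = (\<integral>\<^sup>+z. \<integral>\<^sup>+x. ennreal (\<rho> z * (f (x - z) - f x)\<^sup>2) \<partial>lborel \<partial>lborel)"
    unfolding Q_def by (rule lborel_pair.Fubini') measurable
  also have "\<dots> \<le> (\<integral>\<^sup>+z. ennreal (\<rho> z) * ennreal (e\<^sup>2) \<partial>lborel)"
  proof (rule nn_integral_mono)
    fix z
    show "(\<integral>\<^sup>+x. ennreal (\<rho> z * (f (x - z) - f x)\<^sup>2) \<partial>lborel) \<le> ennreal (\<rho> z) * ennreal (e\<^sup>2)"
    proof (cases "\<rho> z = 0")
      case False
      have "(\<integral>\<^sup>+x. ennreal (\<rho> z * (f (x - z) - f x)\<^sup>2) \<partial>lborel)
        = ennreal (\<rho> z) * (\<integral>\<^sup>+x. ennreal ((norm (f (x - z) - f x))\<^sup>2) \<partial>lborel)"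
        using \<rho>(2) by (subst nn_integral_cmult[symmetric]) (auto simp: ennreal_mult)
      also have "\<dots> = ennreal (\<rho> z) * ennreal ((L2_norm lborel (\<lambda>x. f (x - z) - f x))\<^sup>2)"
        by (simp only: nn_integral_L2[OF L2_diff[OF L2_lborel_translation(1)[OF f(1)] f(1)]])
      also have "\<dots> \<le> ennreal (\<rho> z) * ennreal (e\<^sup>2)"
        by (intro mult_left_mono ennreal_leI power_mono tr[OF False]) auto
      finally show ?thesis .
    qed simp
  qed
  also have "\<dots> = (\<integral>\<^sup>+z. ennreal (\<rho> z) \<partial>lborel) * ennreal (e\<^sup>2)"
    by (rule nn_integral_multc) measurable
  also have "(\<integral>\<^sup>+z. ennreal (\<rho> z) \<partial>lborel) = 1"
    using nn_integral_eq_integral[OF \<rho>(4)] \<rho>(2,5) by simp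
  finally have *: "(\<integral>\<^sup>+x. ennreal ((norm (conv \<rho> f x - f x))\<^sup>2) \<partial>lborel) \<le> ennreal (e\<^sup>2)" by simp
  show "(\<lambda>x. conv \<rho> f x - f x) \<in> L2 lborel" by (rule L2_I_nn[OF _ *]) measurable
  show "L2_norm lborel (\<lambda>x. conv \<rho> f x - f x) \<le> e" by (rule L2_norm_le_nn[OF _ * e]) measurable
qed

section \<open>The cone property\<close>

text \<open>A uniform interior cone condition on the part of \<open>\<Omega>\<close> near x0. The
  sign matches convolution, which evaluates functions at x - z: the truncated cone is the set of
  admissible positions for the support of a kernel.\<close>

definition cone_at :: "(real^'d) set \<Rightarrow> real^'d \<Rightarrow> real \<Rightarrow> bool" where
  "cone_at \<Omega> x0 r \<longleftrightarrow> (\<exists>e \<delta> \<tau>. \<delta> > 0 \<and> \<tau> > 0 \<and>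
     (\<forall>x \<in> \<Omega> \<inter> ball x0 r. \<forall>t. 0 < t \<longrightarrow> t \<le> \<tau> \<longrightarrow> (\<forall>z \<in> cball e \<delta>. x - t *\<^sub>R z \<in> \<Omega>)))"

lemma cone_at_interior:
  fixes x0 :: "real^'d"
  assumes "ball x0 r \<subseteq> \<Omega>" "r > 0"
  shows "cone_at \<Omega> x0 (r/2)"
  unfolding cone_at_def
\<comment> \<open>Near an interior point the axis may be 0, in which case the cone becomes a full
  ball.\<close>
proof (rule exI[of _ 0], rule exI[of _ 1], rule exI[of _ "r/2"], intro conjI ballI allI impI)
  fix x t and z :: "real^'d"
  assume x: "x \<in> \<Omega> \<inter> ball x0 (r/2)" and t: "0 < t" "t \<le> r / 2" and z: "z \<in> cball 0 1"
  have "t * norm z \<le> (r / 2) * 1" using t z by (intro mult_mono) auto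
  then have "norm (t *\<^sub>R z) \<le> r / 2" using t by simp
  moreover have "dist x0 (x - t *\<^sub>R z) \<le> dist x0 x + norm (t *\<^sub>R z)"
    using dist_triangle[of x0 "x - t *\<^sub>R z" x] by (simp add: dist_norm)
  ultimately have "x - t *\<^sub>R z \<in> ball x0 r" using x by simp
  then show "x - t *\<^sub>R z \<in> \<Omega>" using assms by blast
qed (use assms in auto)

lemma lipschitz_chart_imp_cone_at:
  assumes ch: "lipschitz_chart \<Omega> x0 r e \<phi>"
  shows "cone_at \<Omega> x0 (r/2)"
proof -
  from ch obtain C where r: "r > 0" and e: "norm e = 1" and C: "C-lipschitz_on UNIV \<phi>"
    and inv: "\<And>x t. \<phi> (x + t *\<^sub>R e) = \<phi> x" and O: "\<Omega> \<inter> ball x0 r = {y \<in> ball x0 r. y \<bullet> e < \<phi> y}"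
    unfolding lipschitz_chart_def by blast
  have C0: "0 \<le> C" using C by (rule lipschitz_on_nonneg)
  \<comment> \<open>Moving by -t z with |z - e| \<le> \<open>\<delta>\<close> lowers the height by
    at least t (1 - \<open>\<delta>\<close>), while \<open>\<phi>\<close> drops by at most t C
    \<open>\<delta>\<close>. The choice makes the two equal, and the strict inequality at x
    survives. As |z| is at most 2, heights up to r/4 keep the point in the chart.\<close>
  define \<delta> where "\<delta> = 1 / (1 + C)"
  have "(1 + C) * \<delta> = 1" using C0 by (simp add: \<delta>_def)
  then have "C * \<delta> + \<delta> = 1" by (simp only: distrib_right mult_1_left add.commute)
  moreover have "0 < \<delta>" "\<delta> \<le> 1" using C0 by (auto simp: \<delta>_def)
  ultimately have \<delta>: "0 < \<delta>" "\<delta> \<le> 1" "C * \<delta> + \<delta> = 1" by blast+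
  show ?thesis unfolding cone_at_def
  proof (rule exI[of _ e], rule exI[of _ \<delta>], rule exI[of _ "r/4"], intro conjI ballI allI impI)
    fix x t z assume x: "x \<in> \<Omega> \<inter> ball x0 (r/2)" and t: "0 < t" "t \<le> r / 4" and z: "z \<in> cball e \<delta>"
    have ze: "norm (z - e) \<le> \<delta>" using z by (simp add: dist_norm norm_minus_commute)
    have "norm z \<le> norm e + norm (z - e)" using norm_triangle_ineq[of e "z - e"] by simp
    then have "norm z \<le> 2" using ze \<delta> e by simp
    then have "t * norm z \<le> (r / 4) * 2" using t by (intro mult_mono) auto
    then have "norm (t *\<^sub>R z) \<le> r / 2" using t by simp
    moreover have "dist x0 (x - t *\<^sub>R z) \<le> dist x0 x + norm (t *\<^sub>R z)"
      using dist_triangle[of x0 "x - t *\<^sub>R z" x] by (simp add: dist_norm)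
    ultimately have b: "x - t *\<^sub>R z \<in> ball x0 r" using x by simp
    have "x \<in> ball x0 r" using x r by simp
    then have xe: "x \<bullet> e < \<phi> x" using x O by blast
    have "\<phi> (x - t *\<^sub>R z) = \<phi> (x - t *\<^sub>R (z - e))"
      using inv[of "x - t *\<^sub>R z" t] by (simp add: algebra_simps)
    moreover have "\<bar>\<phi> (x - t *\<^sub>R (z - e)) - \<phi> x\<bar> \<le> C * norm (t *\<^sub>R (z - e))"
      using lipschitz_onD[OF C, of "x - t *\<^sub>R (z - e)" x] by (simp add: dist_norm)
    moreover have "C * norm (t *\<^sub>R (z - e)) \<le> C * (t * \<delta>)"
      using ze t by (intro mult_left_mono C0) auto
    ultimately have 1: "\<phi> x - t * (C * \<delta>) \<le> \<phi> (x - t *\<^sub>R z)" by (simp add: mult_ac)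
    have "(z - e) \<bullet> e \<ge> - \<delta>"
      using Cauchy_Schwarz_ineq2[of "z - e" e] e ze by simp
    then have "z \<bullet> e \<ge> 1 - \<delta>" using e by (simp add: inner_simps power2_norm_eq_inner[symmetric])
    then have "z \<bullet> e \<ge> C * \<delta>" using \<delta> by simp
    then have "t * (C * \<delta>) \<le> t * (z \<bullet> e)" using t by (intro mult_left_mono) auto
    then have "(x - t *\<^sub>R z) \<bullet> e < \<phi> (x - t *\<^sub>R z)" using 1 xe by (simp add: inner_simps)
    then show "x - t *\<^sub>R z \<in> \<Omega>" using O b by blast
  qed (use \<delta> r in auto)
qed

lemma lipschitz_domain_cone:
  assumes "lipschitz_domain \<Omega>" "x0 \<in> closure \<Omega>"
  obtains r where "r > 0" "cone_at \<Omega> x0 r"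
proof (cases "x0 \<in> \<Omega>")
  case True
  then obtain r where "r > 0" "ball x0 r \<subseteq> \<Omega>"
    using assms(1) unfolding lipschitz_domain_def open_contains_ball by blast
  then show ?thesis using that[of "r/2"] cone_at_interior[of x0 r \<Omega>] by simp
next
  case False
  have "open \<Omega>" using assms(1) by (simp add: lipschitz_domain_def)
  then have "x0 \<in> frontier \<Omega>" using assms(2) False by (simp add: frontier_def interior_open)
  then obtain r e \<phi> where "lipschitz_chart \<Omega> x0 r e \<phi>" using assms(1) unfolding lipschitz_domain_def by blast
  then show ?thesis using that[of "r/2"] lipschitz_chart_imp_cone_at[of \<Omega> x0 r e \<phi>] by (auto simp: lipschitz_chart_def)
qed

text \<open>The sum equals 1 on an open neighbourhood of S and not merely on S, so that the
  gradients add up to zero there. Supports within 3/4 of the radius leave room inside the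
  balls.\<close>

lemma C1_partition_of_unity:
  fixes S :: "'a::euclidean_space set"
  assumes S: "compact S" and r: "\<And>x. x \<in> S \<Longrightarrow> r x > 0"
  obtains I \<psi> O' where "finite I" "I \<subseteq> S" "\<And>i. i \<in> I \<Longrightarrow> Ck 1 (\<psi> i)" "\<And>i x. i \<in> I \<Longrightarrow> (0::real) \<le> \<psi> i x"
    "\<And>i x. i \<in> I \<Longrightarrow> x \<notin> cball i (3/4 * r i) \<Longrightarrow> \<psi> i x = 0"
    "open O'" "S \<subseteq> O'" "\<And>x. x \<in> O' \<Longrightarrow> (\<Sum>i\<in>I. \<psi> i x) = 1"
proof -
  obtain I where I: "I \<subseteq> S" "finite I" "S \<subseteq> (\<Union>x\<in>I. ball x (r x / 2))"
    by (rule compactE_image[OF S, of S "\<lambda>x. ball x (r x / 2)"]) (use r in auto)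
  have "\<forall>i\<in>I. \<exists>\<theta>. Ck 1 \<theta> \<and> (\<forall>x. 0 \<le> \<theta> x \<and> \<theta> x \<le> (1::real)) \<and> (\<forall>x\<in>ball i (r i/2). \<theta> x = 1) \<and> (\<forall>x. x \<notin> cball i (3/4 * r i) \<longrightarrow> \<theta> x = 0)"
  proof
    fix i assume "i \<in> I"
    then have "r i > 0" using I(1) r by blast
    from C1_cutoff[OF this, of i] show "\<exists>\<theta>. Ck 1 \<theta> \<and> (\<forall>x. 0 \<le> \<theta> x \<and> \<theta> x \<le> (1::real)) \<and> (\<forall>x\<in>ball i (r i/2). \<theta> x = 1) \<and> (\<forall>x. x \<notin> cball i (3/4 * r i) \<longrightarrow> \<theta> x = 0)"
      by metis
  qed
  from bchoice[OF this]
  obtain \<theta> where \<theta>: "\<And>i. i \<in> I \<Longrightarrow> Ck 1 (\<theta> i)" "\<And>i x. i \<in> I \<Longrightarrow> 0 \<le> \<theta> i x" "\<And>i x. i \<in> I \<Longrightarrow> \<theta> i x \<le> (1::real)"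
    "\<And>i x. i \<in> I \<Longrightarrow> x \<in> ball i (r i/2) \<Longrightarrow> \<theta> i x = 1" "\<And>i x. i \<in> I \<Longrightarrow> x \<notin> cball i (3/4 * r i) \<Longrightarrow> \<theta> i x = 0"
    by blast
  obtain \<psi> where \<psi>: "\<And>i. i \<in> I \<Longrightarrow> Ck 1 (\<psi> i)" "\<And>i x. i \<in> I \<Longrightarrow> 0 \<le> \<psi> i x" "\<And>i x. i \<in> I \<Longrightarrow> \<theta> i x = 0 \<Longrightarrow> \<psi> i x = 0"
    "\<And>x. (\<Sum>i\<in>I. \<psi> i x) = 1 - (\<Prod>i\<in>I. 1 - \<theta> i x)"
  proof -
    have "\<exists>\<psi>. (\<forall>i\<in>I. Ck 1 (\<psi> i) \<and> (\<forall>x. 0 \<le> \<psi> i x) \<and> (\<forall>x. \<theta> i x = 0 \<longrightarrow> \<psi> i x = 0)) \<and>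
     (\<forall>x. (\<Sum>i\<in>I. \<psi> i x) = 1 - (\<Prod>i\<in>I. 1 - \<theta> i x))"
      by (rule partition_of_unity_telescope[OF I(2)]) (use \<theta> in auto)
    then show ?thesis using that by blast
  qed
  show ?thesis
  proof (rule that[OF I(2,1) \<psi>(1,2)])
    show "open (\<Union>x\<in>I. ball x (r x / 2))" by auto
    show "S \<subseteq> (\<Union>x\<in>I. ball x (r x / 2))" by (rule I)
    show "(\<Sum>i\<in>I. \<psi> i x) = 1" if "x \<in> (\<Union>x\<in>I. ball x (r x / 2))" for x
    proof -
      from that obtain i where "i \<in> I" "x \<in> ball i (r i / 2)" by blast
      then have "(\<Prod>i\<in>I. 1 - \<theta> i x) = 0" using I(2) \<theta>(4) by (intro prod_zero) auto
      then show ?thesis by (simp add: \<psi>(4))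
    qed
  qed (use \<psi>(3) \<theta>(5) in auto)
qed

section \<open>Extension by zero\<close>

text \<open>Convolutions are taken over the whole space with respect to \<open>lborel\<close>; this
  calls for a Borel representative, which agrees with f only almost everywhere.\<close>

lemma L2_zero_extension:
  fixes f :: "'a::euclidean_space \<Rightarrow> real"
  assumes O: "\<Omega> \<in> sets borel" "bounded \<Omega>" and f: "f \<in> L2 (lebesgue_on \<Omega>)"
  obtains F where "F \<in> borel_measurable borel" "F \<in> L2 lborel" "integrable lborel F" "\<And>x. x \<notin> \<Omega> \<Longrightarrow> F x = 0"
    "AE x in lebesgue_on \<Omega>. F x = f x"
proof -
  have O': "\<Omega> \<in> sets lebesgue" using O by auto
  have "(\<lambda>x. indicator \<Omega> x *\<^sub>R f x) \<in> borel_measurable lebesgue"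
    using L2_measurable[OF f] by (subst (asm) borel_measurable_restrict_space_iff) (use O' in auto)
  then obtain F0 where F0: "F0 \<in> borel_measurable lborel" "AE x in lborel. indicator \<Omega> x *\<^sub>R f x = F0 x"
    using completion_ex_borel_measurable_real by blast
  define F where "F x = indicator \<Omega> x * F0 x" for x
  note [measurable] = F0(1) O(1)
  have Fm[measurable]: "F \<in> borel_measurable borel" unfolding F_def by measurable
  have z: "F x = 0" if "x \<notin> \<Omega>" for x using that by (simp add: F_def)
  have ae: "AE x in lebesgue_on \<Omega>. F x = f x"
  proof (subst AE_restrict_space_iff)
    show "AE x in lebesgue. x \<in> \<Omega> \<longrightarrow> F x = f x"
      using AE_completion[OF F0(2)] by eventually_elim (auto simp: F_def)
  qed (use O' in auto)
  have FL: "F \<in> L2 (lebesgue_on \<Omega>)"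
    by (rule L2_cong_AE[OF f borel_lebesgue_on[OF Fm]]) (use ae in \<open>auto elim: eventually_mono\<close>)
  have iF: "indicator \<Omega> x * F x = F x" for x using z by (auto simp: indicator_def)
  have i2: "indicator \<Omega> x * (F x)\<^sup>2 = (F x)\<^sup>2" for x using z by (auto simp: indicator_def)
  have "integrable lborel (\<lambda>x. (norm (F x))\<^sup>2)"
    using L2_integrable_sq[OF FL] by (subst (asm) lebesgue_on_integrable) (auto simp: i2 O)
  then have L: "F \<in> L2 lborel" by (intro L2_I) auto
  have "integrable (lebesgue_on \<Omega>) (\<lambda>x. F x * 1)"
    by (rule L2_mult_integrable[OF FL continuous_imp_L2[OF O]]) simp
  then have "integrable lborel F"
    by (subst (asm) lebesgue_on_integrable) (auto simp: iF O)
  then show ?thesis using that[OF Fm L _ z ae] by blast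
qed

lemma zero_extension_integral:
  fixes f :: "'a::euclidean_space \<Rightarrow> real"
  assumes O: "\<Omega> \<in> sets borel" and f: "f \<in> borel_measurable (lebesgue_on \<Omega>)" and [measurable]: "F \<in> borel_measurable borel" "k \<in> borel_measurable borel"
    and z: "\<And>x. x \<notin> \<Omega> \<Longrightarrow> F x = 0" and ae: "AE x in lebesgue_on \<Omega>. F x = f x"
  shows "(\<integral>x. f x * k x \<partial>lebesgue_on \<Omega>) = (\<integral>x. F x * k x \<partial>lborel)"
proof -
  have "(\<integral>x. f x * k x \<partial>lebesgue_on \<Omega>) = (\<integral>x. F x * k x \<partial>lebesgue_on \<Omega>)"
  proof (rule integral_cong_AE)
    show "(\<lambda>x. f x * k x) \<in> borel_measurable (lebesgue_on \<Omega>)" "(\<lambda>x. F x * k x) \<in> borel_measurable (lebesgue_on \<Omega>)"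
      by (intro borel_measurable_times f borel_lebesgue_on; measurable)+
    show "AE x in lebesgue_on \<Omega>. f x * k x = F x * k x" using ae by eventually_elim simp
  qed
  also have "\<dots> = (\<integral>x. indicator \<Omega> x *\<^sub>R (F x * k x) \<partial>lborel)"
    by (rule lebesgue_on_integral) (use O in measurable)
  also have "\<dots> = (\<integral>x. F x * k x \<partial>lborel)"
    by (intro Bochner_Integration.integral_cong refl) (use z in \<open>auto simp: indicator_def\<close>)
  finally show ?thesis .
qed

lemma L2_norm_lebesgue_on_le:
  fixes f :: "'a::euclidean_space \<Rightarrow> 'b::euclidean_space"
  assumes O: "\<Omega> \<in> sets borel" and f: "f \<in> L2 lborel"
  shows "f \<in> L2 (lebesgue_on \<Omega>)" "L2_norm (lebesgue_on \<Omega>) f \<le> L2_norm lborel f"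
proof -
  have [measurable]: "f \<in> borel_measurable borel" using L2_measurable[OF f] by simp
  note [measurable] = O
  have i: "integrable lborel (\<lambda>x. indicator \<Omega> x *\<^sub>R (norm (f x))\<^sup>2)"
    by (rule integrable_mult_indicator[OF _ L2_integrable_sq[OF f]]) simp
  show "f \<in> L2 (lebesgue_on \<Omega>)"
  proof (intro L2_I borel_lebesgue_on)
    show "integrable (lebesgue_on \<Omega>) (\<lambda>x. (norm (f x))\<^sup>2)"
      by (subst lebesgue_on_integrable[OF O]) (measurable, rule i)
  qed measurable
  have "(\<integral>x. (norm (f x))\<^sup>2 \<partial>lebesgue_on \<Omega>) \<le> (\<integral>x. (norm (f x))\<^sup>2 \<partial>lborel)"
  proof -
    have "(\<integral>x. (norm (f x))\<^sup>2 \<partial>lebesgue_on \<Omega>) = (\<integral>x. indicator \<Omega> x *\<^sub>R (norm (f x))\<^sup>2 \<partial>lborel)"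
      by (rule lebesgue_on_integral) measurable
    also have "\<dots> \<le> (\<integral>x. (norm (f x))\<^sup>2 \<partial>lborel)"
      by (rule integral_mono[OF i L2_integrable_sq[OF f]]) (auto simp: indicator_def)
    finally show ?thesis .
  qed
  then show "L2_norm (lebesgue_on \<Omega>) f \<le> L2_norm lborel f" by (simp add: L2_norm_def)
qed

section \<open>Density of smooth functions\<close>

text \<open>The support of \<open>\<rho>\<close> is put inside a scaled copy of the cone, so for
  every x in \<open>\<Omega>\<close> near x0, arbitrarily close to the boundary, the function y
  \<mapsto> \<rho> (x - y) is a test function on \<open>\<Omega>\<close>. Weak derivatives can thus
  be moved under the convolution without a boundary term. One kernel serves the whole finite family,
  because a function and its weak derivatives must be mollified alike.\<close>

lemma adapted_kernel_exists:
  fixes \<F> :: "(real^'d \<Rightarrow> real) set"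
  assumes c: "cone_at \<Omega> x0 r" and fin: "finite \<F>"
    and all: "\<forall>F\<in>\<F>. F \<in> L2 lborel \<and> integrable lborel F \<and> (\<forall>x. x \<notin> cball 0 R \<longrightarrow> F x = 0)" and \<epsilon>: "\<epsilon> > 0"
  obtains \<rho> S where "\<And>k. Ck k \<rho>" "\<And>x. x \<notin> cball 0 S \<Longrightarrow> \<rho> x = 0"
    "\<And>F. F \<in> \<F> \<Longrightarrow> (\<lambda>x. conv \<rho> F x - F x) \<in> L2 lborel" "\<And>F. F \<in> \<F> \<Longrightarrow> L2_norm lborel (\<lambda>x. conv \<rho> F x - F x) \<le> \<epsilon>"
    "\<And>x. x \<in> \<Omega> \<inter> ball x0 r \<Longrightarrow> (\<lambda>y. \<rho> (x - y)) \<in> test_functions \<Omega>"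
proof -
  have \<F>: "finite \<F>" "\<And>F. F \<in> \<F> \<Longrightarrow> F \<in> L2 lborel" "\<And>F. F \<in> \<F> \<Longrightarrow> integrable lborel F"
      "\<And>F x. F \<in> \<F> \<Longrightarrow> x \<notin> cball 0 R \<Longrightarrow> F x = 0" using fin all by blast+
  obtain e \<delta> \<tau> where c: "\<delta> > 0" "\<tau> > 0" "\<And>x t z. x \<in> \<Omega> \<inter> ball x0 r \<Longrightarrow> 0 < t \<Longrightarrow> t \<le> \<tau> \<Longrightarrow> z \<in> cball e \<delta> \<Longrightarrow> x - t *\<^sub>R z \<in> \<Omega>"
    using c unfolding cone_at_def by blast
  have "\<forall>F\<in>\<F>. \<exists>\<eta>>0. \<forall>z. norm z \<le> \<eta> \<longrightarrow> L2_norm lborel (\<lambda>x. F (x - z) - F x) \<le> \<epsilon>"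
  proof
    fix F assume "F \<in> \<F>"
    show "\<exists>\<eta>>0. \<forall>z. norm z \<le> \<eta> \<longrightarrow> L2_norm lborel (\<lambda>x. F (x - z) - F x) \<le> \<epsilon>"
      by (rule L2_translation_continuous[OF \<F>(2) \<F>(4) \<epsilon>]) (use \<open>F \<in> \<F>\<close> in auto)
  qed
  then obtain \<eta>F where \<eta>F: "\<And>F. F \<in> \<F> \<Longrightarrow> \<eta>F F > 0"
    "\<And>F z. F \<in> \<F> \<Longrightarrow> norm z \<le> \<eta>F F \<Longrightarrow> L2_norm lborel (\<lambda>x. F (x - z) - F x) \<le> \<epsilon>" by metis
  define \<eta> where "\<eta> = Min (insert 1 (\<eta>F ` \<F>))"
  have \<eta>: "\<eta> > 0" "\<And>F. F \<in> \<F> \<Longrightarrow> \<eta> \<le> \<eta>F F" using \<F>(1) \<eta>F(1) by (auto simp: \<eta>_def)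
  \<comment> \<open>The scale respects the height of the cone and also keeps the whole support
    within the radius \<open>\<eta>\<close>, for which all translations are
    \<open>\<epsilon>\<close>-close.\<close>
  define t where "t = min \<tau> (\<eta> / (norm e + \<delta>))"
  have ned: "0 < norm e + \<delta>" using c(1) by (simp add: add_nonneg_pos)
  have t: "0 < t" "t \<le> \<tau>" "t * (norm e + \<delta>) \<le> \<eta>"
  proof -
    show "0 < t" "t \<le> \<tau>" using c(2) \<eta>(1) ned by (auto simp: t_def)
    have "t * (norm e + \<delta>) \<le> (\<eta> / (norm e + \<delta>)) * (norm e + \<delta>)" using ned by (intro mult_right_mono) (auto simp: t_def)
    then show "t * (norm e + \<delta>) \<le> \<eta>" using ned by simp
  qed
  obtain a b where ab: "cbox a b \<subseteq> ball (t *\<^sub>R e) (t * \<delta>)" "t *\<^sub>R e \<in> box a b"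
    by (rule open_contains_cbox[OF open_ball, of "t *\<^sub>R e" "t *\<^sub>R e" "t * \<delta>"]) (use t c in \<open>auto intro: that\<close>)
  have sc: "\<exists>w\<in>cball e \<delta>. z = t *\<^sub>R w" if "z \<in> cbox a b" for z
  proof (intro bexI)
    show "z = t *\<^sub>R (z /\<^sub>R t)" using t by simp
    have "norm (t *\<^sub>R e - z) \<le> t * \<delta>" using that ab(1) by (auto simp: dist_norm subset_iff less_imp_le)
    also have "t *\<^sub>R e - z = t *\<^sub>R (e - z /\<^sub>R t)" using t by (simp add: algebra_simps)
    finally have "norm (e - z /\<^sub>R t) \<le> \<delta>" using t by simp
    then show "z /\<^sub>R t \<in> cball e \<delta>" by (simp add: dist_norm)
  qed
  have small: "norm z \<le> \<eta>" if z: "z \<in> cbox a b" for z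
  proof -
    obtain w where w: "w \<in> cball e \<delta>" "z = t *\<^sub>R w" using sc[OF z] by blast
    have "norm w \<le> norm e + \<delta>" using w(1) norm_triangle_sub[of w e] by (simp add: dist_norm norm_minus_commute)
    then have "t * norm w \<le> t * (norm e + \<delta>)" using t by (intro mult_left_mono) auto
    moreover have "norm z = t * norm w" using t w(2) by simp
    ultimately show ?thesis using t(3) by linarith
  qed
  have "box a b \<noteq> {}" using ab(2) by blast
  then obtain \<rho> :: "real^'d \<Rightarrow> real" where \<rho>: "\<And>k. Ck k \<rho>" "\<And>z. 0 \<le> \<rho> z" "integrable lborel \<rho>" "(\<integral>z. \<rho> z \<partial>lborel) = 1"
    "\<And>z. z \<notin> cbox a b \<Longrightarrow> \<rho> z = 0" using mollifier_exists by blast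
  have \<rho>S: "\<rho> z = 0" if "z \<notin> cball 0 \<eta>" for z using small[of z] \<rho>(5)[of z] that by auto
  obtain B where B: "\<And>x. norm (\<rho> x) \<le> B" using C1_compact_support_bounds[OF \<rho>(1) \<rho>S] by metis
  show ?thesis
  proof (rule that[OF \<rho>(1) \<rho>S])
    fix F assume F: "F \<in> \<F>"
    have 1: "continuous_on UNIV \<rho>" using Ck_imp_continuous[OF \<rho>(1)] .
    have 2: "\<rho> z \<le> B" for z using B[of z] by simp
    have 3: "conv \<rho> F \<in> borel_measurable borel"
      by (rule borel_measurable_continuous_onI, rule Ck_imp_continuous[OF conv_Ck[OF \<F>(3)[OF F] \<rho>(1) \<rho>S]]) auto
    have 4: "L2_norm lborel (\<lambda>x. F (x - z) - F x) \<le> \<epsilon>" if "\<rho> z \<noteq> 0" for z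
    proof (rule \<eta>F(2)[OF F])
      have "norm z \<le> \<eta>" using \<rho>S[of z] that by (cases "z \<in> cball 0 \<eta>") auto
      then show "norm z \<le> \<eta>F F" using \<eta>(2)[OF F] by simp
    qed
    note * = conv_L2_close[OF \<F>(2)[OF F] \<F>(3)[OF F] 1 \<rho>(2) 2 \<rho>(3,4) 3 4 less_imp_le[OF \<epsilon>]]
    show "(\<lambda>x. conv \<rho> F x - F x) \<in> L2 lborel" "L2_norm lborel (\<lambda>x. conv \<rho> F x - F x) \<le> \<epsilon>"
      using * by blast+
  next
    fix x assume x: "x \<in> \<Omega> \<inter> ball x0 r"
    show "(\<lambda>y. \<rho> (x - y)) \<in> test_functions \<Omega>"
    proof (rule test_functionsI)
      show "Ck k (\<lambda>y. \<rho> (x - y))" for k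
        using Ck_compose_linear[OF bounded_linear_minus[OF bounded_linear_ident] \<rho>(1), of k x] by simp
      show "compact ((\<lambda>z. x - z) ` cbox a b)"
        by (intro compact_continuous_image continuous_intros compact_cbox)
      show "(\<lambda>z. x - z) ` cbox a b \<subseteq> \<Omega>" using sc c(3)[OF x t(1,2)] by blast
      show "\<rho> (x - y) = 0" if "y \<notin> (\<lambda>z. x - z) ` cbox a b" for y
      proof (rule \<rho>(5))
        show "x - y \<notin> cbox a b" using that by (auto simp: image_iff)
      qed
    qed
  qed
qed

lemma grad_reflect:
  fixes \<rho> :: "real^'d \<Rightarrow> real"
  assumes "Ck 1 \<rho>"
  shows "grad (\<lambda>y. \<rho> (x - y)) y = - grad \<rho> (x - y)"
proof (rule grad_eqI)
  have "((\<lambda>y. x - y) has_derivative (\<lambda>v. - v)) (at y)" by (auto intro!: derivative_eq_intros)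
  from has_derivative_compose[OF this C1_grad(1)[OF assms]]
  show "((\<lambda>y. \<rho> (x - y)) has_derivative (\<lambda>v. - grad \<rho> (x - y) \<bullet> v)) (at y)" by simp
qed

lemma L2_norm_sum_products:
  fixes a c :: "'i \<Rightarrow> real^'d \<Rightarrow> real"
  assumes I: "finite I" and O: "\<Omega> \<in> sets borel" and a: "\<And>i. i \<in> I \<Longrightarrow> a i \<in> borel_measurable borel" "\<And>i x. i \<in> I \<Longrightarrow> \<bar>a i x\<bar> \<le> B" "0 \<le> B"
    and c: "\<And>i. i \<in> I \<Longrightarrow> c i \<in> L2 lborel" "\<And>i. i \<in> I \<Longrightarrow> L2_norm lborel (c i) \<le> \<epsilon>"
  shows "(\<lambda>x. \<Sum>i\<in>I. a i x * c i x) \<in> L2 (lebesgue_on \<Omega>)"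
    "L2_norm (lebesgue_on \<Omega>) (\<lambda>x. \<Sum>i\<in>I. a i x * c i x) \<le> real (card I) * (B * \<epsilon>)"
proof -
  have 1: "(\<lambda>x. a i x * c i x) \<in> L2 lborel" if "i \<in> I" for i
    by (rule L2_bounded_mult[OF c(1)[OF that], of _ B]) (use a that in auto)
  have 2: "L2_norm lborel (\<lambda>x. a i x * c i x) \<le> B * \<epsilon>" if "i \<in> I" for i
  proof -
    have "L2_norm lborel (\<lambda>x. a i x * c i x) \<le> L2_norm lborel (\<lambda>x. B * c i x)"
    proof (rule L2_norm_mono[OF L2_measurable[OF 1[OF that]] L2_cmult[OF c(1)[OF that]]])
      show "AE x in lborel. norm (a i x * c i x) \<le> norm (B * c i x)"
        using a(2)[OF that] a(3) by (auto simp: abs_mult intro!: mult_right_mono)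
    qed
    also have "\<dots> = B * L2_norm lborel (c i)" using a(3) by (simp add: L2_norm_cmult)
    also have "\<dots> \<le> B * \<epsilon>" using c(2)[OF that] a(3) by (intro mult_left_mono)
    finally show ?thesis .
  qed
  have 3: "(\<lambda>x. \<Sum>i\<in>I. a i x * c i x) \<in> L2 lborel" by (rule L2_sum[OF 1])
  show "(\<lambda>x. \<Sum>i\<in>I. a i x * c i x) \<in> L2 (lebesgue_on \<Omega>)" by (rule L2_norm_lebesgue_on_le(1)[OF O 3])
  have "L2_norm (lebesgue_on \<Omega>) (\<lambda>x. \<Sum>i\<in>I. a i x * c i x) \<le> L2_norm lborel (\<lambda>x. \<Sum>i\<in>I. a i x * c i x)"
    by (rule L2_norm_lebesgue_on_le(2)[OF O 3])
  also have "\<dots> \<le> (\<Sum>i\<in>I. L2_norm lborel (\<lambda>x. a i x * c i x))" by (rule L2_norm_sum[OF I 1])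
  also have "\<dots> \<le> (\<Sum>i\<in>I. B * \<epsilon>)" by (intro sum_mono 2)
  finally show "L2_norm (lebesgue_on \<Omega>) (\<lambda>x. \<Sum>i\<in>I. a i x * c i x) \<le> real (card I) * (B * \<epsilon>)" by simp
qed

text \<open>The approximations are \<open>\<Sum>i. \<psi> i * conv (\<rho> i) F\<close>: cutting off after the convolution avoids the product
  rule for weak derivatives.\<close>

lemma domain_approximation:
  fixes \<F> :: "(real^'d \<Rightarrow> real) set"
  assumes dom: "lipschitz_domain \<Omega>" and fin: "finite \<F>"
    and all: "\<forall>F\<in>\<F>. F \<in> L2 lborel \<and> integrable lborel F \<and> (\<forall>x. x \<notin> cball 0 R \<longrightarrow> F x = 0)" and \<epsilon>: "\<epsilon> > 0"
  obtains I :: "(real^'d) set" and \<psi> \<rho> where "finite I" "\<And>i. i \<in> I \<Longrightarrow> Ck 1 (\<psi> i)"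
    "\<And>i F. i \<in> I \<Longrightarrow> F \<in> \<F> \<Longrightarrow> Ck 1 (conv (\<rho> i) F)"
    "\<And>i F x j. i \<in> I \<Longrightarrow> F \<in> \<F> \<Longrightarrow> grad (conv (\<rho> i) F) x $ j = conv (\<lambda>z. grad (\<rho> i) z $ j) F x"
    "\<And>i. i \<in> I \<Longrightarrow> Ck 1 (\<rho> i)"
    "\<And>i x. i \<in> I \<Longrightarrow> x \<in> \<Omega> \<Longrightarrow> \<psi> i x \<noteq> 0 \<Longrightarrow> (\<lambda>y. \<rho> i (x - y)) \<in> test_functions \<Omega>"
    "\<And>x. x \<in> \<Omega> \<Longrightarrow> (\<Sum>i\<in>I. \<psi> i x) = 1" "\<And>x j. x \<in> \<Omega> \<Longrightarrow> (\<Sum>i\<in>I. grad (\<psi> i) x $ j) = 0"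
    "\<And>F. F \<in> \<F> \<Longrightarrow> (\<lambda>x. \<Sum>i\<in>I. \<psi> i x * (conv (\<rho> i) F x - F x)) \<in> L2 (lebesgue_on \<Omega>)"
    "\<And>F. F \<in> \<F> \<Longrightarrow> L2_norm (lebesgue_on \<Omega>) (\<lambda>x. \<Sum>i\<in>I. \<psi> i x * (conv (\<rho> i) F x - F x)) \<le> \<epsilon>"
    "\<And>F j. F \<in> \<F> \<Longrightarrow> (\<lambda>x. \<Sum>i\<in>I. grad (\<psi> i) x $ j * (conv (\<rho> i) F x - F x)) \<in> L2 (lebesgue_on \<Omega>)"
    "\<And>F j. F \<in> \<F> \<Longrightarrow> L2_norm (lebesgue_on \<Omega>) (\<lambda>x. \<Sum>i\<in>I. grad (\<psi> i) x $ j * (conv (\<rho> i) F x - F x)) \<le> \<epsilon>"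
proof -
  have \<F>: "finite \<F>" "\<And>F. F \<in> \<F> \<Longrightarrow> F \<in> L2 lborel" "\<And>F. F \<in> \<F> \<Longrightarrow> integrable lborel F"
      "\<And>F x. F \<in> \<F> \<Longrightarrow> x \<notin> cball 0 R \<Longrightarrow> F x = 0" using fin all by blast+
  have O: "open \<Omega>" "bounded \<Omega>" using dom by (auto simp: lipschitz_domain_def)
  have O': "\<Omega> \<in> sets borel" using O by simp
  have "\<forall>x\<in>closure \<Omega>. \<exists>r>0. cone_at \<Omega> x r" using lipschitz_domain_cone[OF dom] by metis
  then obtain r where r: "\<And>x. x \<in> closure \<Omega> \<Longrightarrow> r x > 0" "\<And>x. x \<in> closure \<Omega> \<Longrightarrow> cone_at \<Omega> x (r x)" by metis
  have cO: "compact (closure \<Omega>)" using O by (simp add: compact_closure)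
  obtain I \<psi> O' where I: "finite I" "I \<subseteq> closure \<Omega>" and \<psi>: "\<And>i. i \<in> I \<Longrightarrow> Ck 1 (\<psi> i)"
    "\<And>i x. i \<in> I \<Longrightarrow> (0::real) \<le> \<psi> i x" "\<And>i x. i \<in> I \<Longrightarrow> x \<notin> cball i (3/4 * r i) \<Longrightarrow> \<psi> i x = 0"
    and P: "open O'" "closure \<Omega> \<subseteq> O'" "\<And>x. x \<in> O' \<Longrightarrow> (\<Sum>i\<in>I. \<psi> i x) = (1::real)"
    by (rule C1_partition_of_unity[where r=r, OF cO r(1)]) (assumption, rule that)
  have "\<forall>i\<in>I. \<exists>B\<ge>0. \<forall>x. norm (\<psi> i x) \<le> B \<and> norm (grad (\<psi> i) x) \<le> B"
  proof
    fix i assume i: "i \<in> I"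
    have "\<psi> i x = 0" if "x \<notin> cball 0 (norm i + 3/4 * r i)" for x
      using that norm_triangle_sub[of x i] by (intro \<psi>(3)[OF i]) (auto simp: dist_norm norm_minus_commute)
    then show "\<exists>B\<ge>0. \<forall>x. norm (\<psi> i x) \<le> B \<and> norm (grad (\<psi> i) x) \<le> B"
      using C1_compact_support_bounds[OF \<psi>(1)[OF i]] by metis
  qed
  then obtain B0 where B0: "\<And>i. i \<in> I \<Longrightarrow> 0 \<le> B0 i" "\<And>i x. i \<in> I \<Longrightarrow> norm (\<psi> i x) \<le> B0 i" "\<And>i x. i \<in> I \<Longrightarrow> norm (grad (\<psi> i) x) \<le> B0 i"
    by metis
  define B where "B = (\<Sum>i\<in>I. B0 i)"
  have B0B: "B0 i \<le> B" if "i \<in> I" for i unfolding B_def using that I(1) B0(1) by (intro member_le_sum) auto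
  have B: "0 \<le> B" "\<And>i x. i \<in> I \<Longrightarrow> \<bar>\<psi> i x\<bar> \<le> B" "\<And>i x j. i \<in> I \<Longrightarrow> \<bar>grad (\<psi> i) x $ j\<bar> \<le> B"
  proof -
    show "0 \<le> B" unfolding B_def by (intro sum_nonneg B0)
    show "\<bar>\<psi> i x\<bar> \<le> B" if "i \<in> I" for i x using B0(2)[OF that, of x] B0B[OF that] by simp
    show "\<bar>grad (\<psi> i) x $ j\<bar> \<le> B" if "i \<in> I" for i x j
      using B0(3)[OF that, of x] B0B[OF that] component_le_norm_cart[of "grad (\<psi> i) x" j] by simp
  qed
  \<comment> \<open>There are \<open>card I\<close> error terms, each multiplied by a coefficient
    bounded by B; the summand 1 keeps the denominator positive.\<close>
  define \<epsilon>' where "\<epsilon>' = \<epsilon> / (1 + real (card I) * B)"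
  have den: "0 < 1 + real (card I) * B" using B(1) by (intro add_pos_nonneg mult_nonneg_nonneg) auto
  have \<epsilon>': "0 < \<epsilon>'" using \<epsilon> den by (simp add: \<epsilon>'_def)
  have \<epsilon>'': "real (card I) * (B * \<epsilon>') \<le> \<epsilon>"
  proof -
    have "(real (card I) * B) * \<epsilon>' \<le> (1 + real (card I) * B) * \<epsilon>'" using \<epsilon>' by (intro mult_right_mono) auto
    also have "\<dots> = \<epsilon>" using den by (simp add: \<epsilon>'_def)
    finally show ?thesis by (simp add: mult.assoc)
  qed
  have "\<forall>i\<in>I. \<exists>\<rho> S. (\<forall>k. Ck k \<rho>) \<and> (\<forall>x. x \<notin> cball 0 S \<longrightarrow> \<rho> x = 0) \<and>
    (\<forall>F\<in>\<F>. (\<lambda>x. conv \<rho> F x - F x) \<in> L2 lborel \<and> L2_norm lborel (\<lambda>x. conv \<rho> F x - F x) \<le> \<epsilon>') \<and>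
    (\<forall>x \<in> \<Omega> \<inter> ball i (r i). (\<lambda>y. \<rho> (x - y)) \<in> test_functions \<Omega>)"
  proof
    fix i assume "i \<in> I"
    then have "cone_at \<Omega> i (r i)" using r I by blast
    obtain \<rho> S where "\<And>k. Ck k \<rho>" "\<And>x. x \<notin> cball 0 S \<Longrightarrow> \<rho> x = 0"
      "\<And>F. F \<in> \<F> \<Longrightarrow> (\<lambda>x. conv \<rho> F x - F x) \<in> L2 lborel" "\<And>F. F \<in> \<F> \<Longrightarrow> L2_norm lborel (\<lambda>x. conv \<rho> F x - F x) \<le> \<epsilon>'"
      "\<And>x. x \<in> \<Omega> \<inter> ball i (r i) \<Longrightarrow> (\<lambda>y. \<rho> (x - y)) \<in> test_functions \<Omega>"
      by (rule adapted_kernel_exists[OF \<open>cone_at \<Omega> i (r i)\<close> fin all \<epsilon>']) (rule that)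
    then show "\<exists>\<rho> S. (\<forall>k. Ck k \<rho>) \<and> (\<forall>x. x \<notin> cball 0 S \<longrightarrow> \<rho> x = 0) \<and>
    (\<forall>F\<in>\<F>. (\<lambda>x. conv \<rho> F x - F x) \<in> L2 lborel \<and> L2_norm lborel (\<lambda>x. conv \<rho> F x - F x) \<le> \<epsilon>') \<and>
    (\<forall>x \<in> \<Omega> \<inter> ball i (r i). (\<lambda>y. \<rho> (x - y)) \<in> test_functions \<Omega>)" by blast
  qed
  from bchoice[OF this] obtain \<rho> where "\<forall>i\<in>I. \<exists>S. (\<forall>k. Ck k (\<rho> i)) \<and> (\<forall>x. x \<notin> cball 0 S \<longrightarrow> \<rho> i x = 0) \<and>
    (\<forall>F\<in>\<F>. (\<lambda>x. conv (\<rho> i) F x - F x) \<in> L2 lborel \<and> L2_norm lborel (\<lambda>x. conv (\<rho> i) F x - F x) \<le> \<epsilon>') \<and>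
    (\<forall>x \<in> \<Omega> \<inter> ball i (r i). (\<lambda>y. \<rho> i (x - y)) \<in> test_functions \<Omega>)" ..
  from bchoice[OF this] obtain S where \<rho>: "\<And>i k. i \<in> I \<Longrightarrow> Ck k (\<rho> i)" "\<And>i x. i \<in> I \<Longrightarrow> x \<notin> cball 0 (S i) \<Longrightarrow> \<rho> i x = 0"
    "\<And>i F. i \<in> I \<Longrightarrow> F \<in> \<F> \<Longrightarrow> (\<lambda>x. conv (\<rho> i) F x - F x) \<in> L2 lborel"
    "\<And>i F. i \<in> I \<Longrightarrow> F \<in> \<F> \<Longrightarrow> L2_norm lborel (\<lambda>x. conv (\<rho> i) F x - F x) \<le> \<epsilon>'"
    "\<And>i x. i \<in> I \<Longrightarrow> x \<in> \<Omega> \<inter> ball i (r i) \<Longrightarrow> (\<lambda>y. \<rho> i (x - y)) \<in> test_functions \<Omega>"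
    by blast
  show ?thesis
  proof (rule that[OF I(1) \<psi>(1)])
    fix i F x j assume i: "i \<in> I" and F: "F \<in> \<F>"
    show "Ck 1 (conv (\<rho> i) F)" by (rule conv_Ck[OF \<F>(3)[OF F] \<rho>(1)[OF i] \<rho>(2)[OF i]]) auto
    show "grad (conv (\<rho> i) F) x $ j = conv (\<lambda>z. grad (\<rho> i) z $ j) F x"
      by (rule grad_conv[OF \<rho>(1)[OF i] \<rho>(2)[OF i] \<F>(3)[OF F]])
  next
    show "Ck 1 (\<rho> i)" if "i \<in> I" for i by (rule \<rho>(1)[OF that])
    show "(\<lambda>y. \<rho> i (x - y)) \<in> test_functions \<Omega>" if "i \<in> I" "x \<in> \<Omega>" "\<psi> i x \<noteq> 0" for i x
    proof (rule \<rho>(5)[OF that(1)])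
      have "x \<in> cball i (3/4 * r i)" using \<psi>(3) that by blast
      moreover have "r i > 0" using that I r by blast
      ultimately show "x \<in> \<Omega> \<inter> ball i (r i)" using that by simp
    qed
    show "(\<Sum>i\<in>I. \<psi> i x) = 1" if "x \<in> \<Omega>" for x using P that closure_subset by blast
    \<comment> \<open>The partition sums to 1 on the open set O', so differentiating the constant
      gives 0.\<close>
    show "(\<Sum>i\<in>I. grad (\<psi> i) x $ j) = 0" if "x \<in> \<Omega>" for x j
    proof -
      have "grad (\<lambda>x. \<Sum>i\<in>I. \<psi> i x) x = grad (\<lambda>x. 1) x"
        by (rule grad_cong_open[where S=O']) (use P that closure_subset in auto)
      then have "(\<Sum>i\<in>I. grad (\<psi> i) x) = 0" by (simp add: grad_sum[OF I(1) \<psi>(1)])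
      then show ?thesis by (metis sum_component zero_index)
    qed
  next
    fix F j assume F: "F \<in> \<F>"
    have m: "\<psi> i \<in> borel_measurable borel" "(\<lambda>x. grad (\<psi> i) x $ j) \<in> borel_measurable borel" if "i \<in> I" for i
      using C1_borel[OF \<psi>(1)[OF that]]
      by (auto intro!: borel_measurable_continuous_onI continuous_on_component C1_grad(2) \<psi>(1)[OF that])
    show "(\<lambda>x. \<Sum>i\<in>I. \<psi> i x * (conv (\<rho> i) F x - F x)) \<in> L2 (lebesgue_on \<Omega>)"
      by (rule L2_norm_sum_products(1)[where B=B and \<epsilon>=\<epsilon>', OF I(1) O']) (use m B \<rho>(3,4) F in auto)
    show "(\<lambda>x. \<Sum>i\<in>I. grad (\<psi> i) x $ j * (conv (\<rho> i) F x - F x)) \<in> L2 (lebesgue_on \<Omega>)"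
      by (rule L2_norm_sum_products(1)[where B=B and \<epsilon>=\<epsilon>', OF I(1) O']) (use m B \<rho>(3,4) F in auto)
    have "L2_norm (lebesgue_on \<Omega>) (\<lambda>x. \<Sum>i\<in>I. \<psi> i x * (conv (\<rho> i) F x - F x)) \<le> real (card I) * (B * \<epsilon>')"
      by (rule L2_norm_sum_products(2)[OF I(1) O']) (use m B \<rho>(3,4) F in auto)
    then show "L2_norm (lebesgue_on \<Omega>) (\<lambda>x. \<Sum>i\<in>I. \<psi> i x * (conv (\<rho> i) F x - F x)) \<le> \<epsilon>"
      using \<epsilon>'' by simp
    have "L2_norm (lebesgue_on \<Omega>) (\<lambda>x. \<Sum>i\<in>I. grad (\<psi> i) x $ j * (conv (\<rho> i) F x - F x)) \<le> real (card I) * (B * \<epsilon>')"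
      by (rule L2_norm_sum_products(2)[OF I(1) O']) (use m B \<rho>(3,4) F in auto)
    then show "L2_norm (lebesgue_on \<Omega>) (\<lambda>x. \<Sum>i\<in>I. grad (\<psi> i) x $ j * (conv (\<rho> i) F x - F x)) \<le> \<epsilon>"
      using \<epsilon>'' by simp
  qed
qed

lemma L2_component:
  fixes f :: "'x \<Rightarrow> real^'d"
  assumes "f \<in> L2 M"
  shows "(\<lambda>x. f x $ j) \<in> L2 M"
proof (rule L2_dominated[OF _ assms])
  have "(\<lambda>x. f x \<bullet> axis j 1) \<in> borel_measurable M"
    by (intro borel_measurable_inner L2_measurable[OF assms]) simp
  then show "(\<lambda>x. f x $ j) \<in> borel_measurable M" by (simp add: inner_axis)
  show "AE x in M. norm (f x $ j) \<le> norm (f x)" by (simp add: component_le_norm_cart)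
qed

lemma L2_vec:
  fixes f :: "'x \<Rightarrow> real^'d"
  assumes "\<And>j. (\<lambda>x. f x $ j) \<in> L2 M"
  shows "f \<in> L2 M" "L2_norm M f \<le> (\<Sum>j\<in>UNIV. L2_norm M (\<lambda>x. f x $ j))"
proof -
  have f: "f = (\<lambda>x. \<Sum>j\<in>UNIV. (f x $ j) *\<^sub>R axis j (1::real))"
    using basis_expansion[of "f _"] by (simp add: scalar_mult_eq_scaleR)
  have c: "(\<lambda>x. (f x $ j) *\<^sub>R (axis j (1::real) :: real^'d)) \<in> L2 M" for j
  proof (rule L2_dominated[OF _ assms[of j]])
    show "(\<lambda>x. (f x $ j) *\<^sub>R (axis j (1::real) :: real^'d)) \<in> borel_measurable M"
      by (intro borel_measurable_scaleR L2_measurable[OF assms]) simp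
  qed (simp add: norm_axis_1)
  show "f \<in> L2 M" by (subst f) (rule L2_sum[OF c])
  have "L2_norm M f \<le> (\<Sum>j\<in>UNIV. L2_norm M (\<lambda>x. (f x $ j) *\<^sub>R (axis j (1::real) :: real^'d)))"
    by (subst f) (rule L2_norm_sum[OF finite c])
  also have "\<dots> = (\<Sum>j\<in>UNIV. L2_norm M (\<lambda>x. f x $ j))"
    by (simp add: L2_norm_def norm_axis_1)
  finally show "L2_norm M f \<le> (\<Sum>j\<in>UNIV. L2_norm M (\<lambda>x. f x $ j))" .
qed

lemma L2_zero_extension_components:
  fixes u :: "real^'d \<Rightarrow> real^'d"
  assumes O: "\<Omega> \<in> sets borel" "bounded \<Omega>" and u: "u \<in> L2 (lebesgue_on \<Omega>)"
  obtains Q where "\<And>j. Q j \<in> borel_measurable borel" "\<And>j. Q j \<in> L2 lborel" "\<And>j. integrable lborel (Q j)"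
    "\<And>j x. x \<notin> \<Omega> \<Longrightarrow> Q j x = 0" "\<And>j. AE x in lebesgue_on \<Omega>. Q j x = u x $ j"
proof -
  have "\<exists>Q. Q \<in> borel_measurable borel \<and> Q \<in> L2 lborel \<and> integrable lborel Q \<and> (\<forall>x. x \<notin> \<Omega> \<longrightarrow> Q x = 0) \<and>
    (AE x in lebesgue_on \<Omega>. Q x = u x $ j)" for j
  proof -
    obtain F where "F \<in> borel_measurable borel" "F \<in> L2 lborel" "integrable lborel F" "\<And>x. x \<notin> \<Omega> \<Longrightarrow> F x = 0"
      "AE x in lebesgue_on \<Omega>. F x = u x $ j"
      by (rule L2_zero_extension[OF O L2_component[OF u, of j]]) (rule that)
    then show ?thesis by blast
  qed
  then have "\<forall>j. \<exists>Q. Q \<in> borel_measurable borel \<and> Q \<in> L2 lborel \<and> integrable lborel Q \<and> (\<forall>x. x \<notin> \<Omega> \<longrightarrow> Q x = 0) \<and>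
    (AE x in lebesgue_on \<Omega>. Q x = u x $ j)" ..
  from choice[OF this] show ?thesis using that by blast
qed

text \<open>The product rule for the approximation produces terms with
  \<open>grad (\<psi> i)\<close> times a mollified p and terms with \<open>\<psi> i\<close> times a
  mollified G. Because the \<open>\<psi> i\<close> sum to 1 and their gradients to 0, subtracting G
  leaves only mollification errors, including those multiplied by
  \<open>grad (\<psi> i)\<close>.\<close>

lemma H1_dense:
  fixes p :: "real^'d \<Rightarrow> real"
  assumes dom: "lipschitz_domain \<Omega>" and p: "p \<in> L2 (lebesgue_on \<Omega>)" and wg: "has_weak_gradient \<Omega> p G"
    and G: "G \<in> L2 (lebesgue_on \<Omega>)" and \<epsilon>: "\<epsilon> > 0"
  obtains q where "Ck 1 q" "L2_norm (lebesgue_on \<Omega>) (\<lambda>x. q x - p x) \<le> \<epsilon>" "L2_norm (lebesgue_on \<Omega>) (\<lambda>x. grad q x - G x) \<le> \<epsilon>"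
proof -
  have O: "open \<Omega>" "bounded \<Omega>" using dom by (auto simp: lipschitz_domain_def)
  have O': "\<Omega> \<in> sets borel" using O by simp
  obtain R where R: "\<Omega> \<subseteq> cball 0 R" using O(2) by (auto simp: bounded_iff subset_iff)
  obtain P where P: "P \<in> borel_measurable borel" "P \<in> L2 lborel" "integrable lborel P" "\<And>x. x \<notin> \<Omega> \<Longrightarrow> P x = 0"
    "AE x in lebesgue_on \<Omega>. P x = p x" using L2_zero_extension[OF O' O(2) p] by blast
  obtain Q where Q: "\<And>j. Q j \<in> borel_measurable borel" "\<And>j. Q j \<in> L2 lborel" "\<And>j. integrable lborel (Q j)" "\<And>j x. x \<notin> \<Omega> \<Longrightarrow> Q j x = 0"
    "\<And>j. AE x in lebesgue_on \<Omega>. Q j x = G x $ j"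
    by (rule L2_zero_extension_components[OF O' O(2) G]) (rule that)
  define d where "d = real CARD('d)"
  have d: "d > 0" by (simp add: d_def)
  \<comment> \<open>Each of the d components of the gradient carries two error sums.\<close>
  define \<epsilon>' where "\<epsilon>' = \<epsilon> / (2 * d + 1)"
  have \<epsilon>': "\<epsilon>' > 0" "\<epsilon>' \<le> \<epsilon>" "d * (2 * \<epsilon>') \<le> \<epsilon>" using \<epsilon> d by (auto simp: \<epsilon>'_def field_simps)
  let ?F = "insert P (range Q)"
  have F: "finite ?F" "\<forall>F\<in>?F. F \<in> L2 lborel \<and> integrable lborel F \<and> (\<forall>x. x \<notin> cball 0 R \<longrightarrow> F x = 0)"
    using P(2-4) Q(2-4) R by (simp, blast)
  obtain I :: "(real^'d) set" and \<psi> \<rho> where I: "finite I" and \<psi>: "\<And>i. i \<in> I \<Longrightarrow> Ck 1 (\<psi> i)"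
    and c1: "\<And>i F. i \<in> I \<Longrightarrow> F \<in> ?F \<Longrightarrow> Ck 1 (conv (\<rho> i) F)"
    and gc: "\<And>i F x j. i \<in> I \<Longrightarrow> F \<in> ?F \<Longrightarrow> grad (conv (\<rho> i) F) x $ j = conv (\<lambda>z. grad (\<rho> i) z $ j) F x"
    and \<rho>: "\<And>i. i \<in> I \<Longrightarrow> Ck 1 (\<rho> i)"
    and tf: "\<And>i x. i \<in> I \<Longrightarrow> x \<in> \<Omega> \<Longrightarrow> \<psi> i x \<noteq> 0 \<Longrightarrow> (\<lambda>y. \<rho> i (x - y)) \<in> test_functions \<Omega>"
    and s1: "\<And>x. x \<in> \<Omega> \<Longrightarrow> (\<Sum>i\<in>I. \<psi> i x) = 1" and s0: "\<And>x j. x \<in> \<Omega> \<Longrightarrow> (\<Sum>i\<in>I. grad (\<psi> i) x $ j) = 0"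
    and a1: "\<And>F. F \<in> ?F \<Longrightarrow> (\<lambda>x. \<Sum>i\<in>I. \<psi> i x * (conv (\<rho> i) F x - F x)) \<in> L2 (lebesgue_on \<Omega>)"
    and a2: "\<And>F. F \<in> ?F \<Longrightarrow> L2_norm (lebesgue_on \<Omega>) (\<lambda>x. \<Sum>i\<in>I. \<psi> i x * (conv (\<rho> i) F x - F x)) \<le> \<epsilon>'"
    and a3: "\<And>F j. F \<in> ?F \<Longrightarrow> (\<lambda>x. \<Sum>i\<in>I. grad (\<psi> i) x $ j * (conv (\<rho> i) F x - F x)) \<in> L2 (lebesgue_on \<Omega>)"
    and a4: "\<And>F j. F \<in> ?F \<Longrightarrow> L2_norm (lebesgue_on \<Omega>) (\<lambda>x. \<Sum>i\<in>I. grad (\<psi> i) x $ j * (conv (\<rho> i) F x - F x)) \<le> \<epsilon>'"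
    apply (rule domain_approximation[OF dom F \<epsilon>'(1)])
    subgoal premises prems for I \<psi> \<rho> by (rule that[of I \<psi> \<rho>]; fact prems)
    done
  define q where "q x = (\<Sum>i\<in>I. \<psi> i x * conv (\<rho> i) P x)" for x
  have qC: "Ck 1 q" unfolding q_def by (intro Ck_sum Ck_mult \<psi> c1) auto
  \<comment> \<open>Reflecting the kernel changes the sign of its gradient, and the weak gradient
    changes it back: convolving p with a derivative of the kernel is convolving G with the kernel.
    Where \<open>\<psi> i x\<close> vanishes the identity may fail, but there it is multiplied by
    0.\<close>
  have transfer: "conv (\<lambda>z. grad (\<rho> i) z $ j) P x = conv (\<rho> i) (Q j) x" if i: "i \<in> I" and x: "x \<in> \<Omega>" "\<psi> i x \<noteq> 0" for i x j
  proof -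
    note t = tf[OF i x]
    note tC = test_functions_D(1)[OF t]
    have gt: "grad (\<lambda>y. \<rho> i (x - y)) y $ j = - (grad (\<rho> i) (x - y) $ j)" for y
      by (simp add: grad_reflect[OF \<rho>[OF i]])
    have "conv (\<lambda>z. grad (\<rho> i) z $ j) P x = - (\<integral>y. P y * grad (\<lambda>y. \<rho> i (x - y)) y $ j \<partial>lborel)"
      unfolding conv_def gt by (simp add: mult.commute)
    also have "(\<integral>y. P y * grad (\<lambda>y. \<rho> i (x - y)) y $ j \<partial>lborel) = (\<integral>y. p y * grad (\<lambda>y. \<rho> i (x - y)) y $ j \<partial>lebesgue_on \<Omega>)"
      by (rule zero_extension_integral[symmetric, OF O' L2_measurable[OF p] P(1) _ P(4,5)])
        (intro borel_measurable_continuous_onI continuous_on_component C1_grad(2)[OF tC])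
    also have "\<dots> = - (\<integral>y. G y $ j * \<rho> i (x - y) \<partial>lebesgue_on \<Omega>)"
      using wg t unfolding has_weak_gradient_def by blast
    also have "(\<integral>y. G y $ j * \<rho> i (x - y) \<partial>lebesgue_on \<Omega>) = (\<integral>y. Q j y * \<rho> i (x - y) \<partial>lborel)"
      by (rule zero_extension_integral[OF O' L2_measurable[OF L2_component[OF G]] Q(1) C1_borel[OF tC] Q(4,5)])
    finally show ?thesis by (simp add: conv_def mult.commute)
  qed
  have gq: "grad q x $ j = (\<Sum>i\<in>I. grad (\<psi> i) x $ j * conv (\<rho> i) P x + \<psi> i x * conv (\<rho> i) (Q j) x)" if "x \<in> \<Omega>" for x j
  proof -
    have "grad q x = (\<Sum>i\<in>I. \<psi> i x *\<^sub>R grad (conv (\<rho> i) P) x + conv (\<rho> i) P x *\<^sub>R grad (\<psi> i) x)"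
      unfolding q_def[abs_def] by (subst grad_sum[OF I]) (auto intro!: Ck_mult \<psi> c1 sum.cong simp: grad_mult \<psi> c1 simp del: One_nat_def)
    then have "grad q x $ j = (\<Sum>i\<in>I. \<psi> i x * grad (conv (\<rho> i) P) x $ j + conv (\<rho> i) P x * grad (\<psi> i) x $ j)"
      by simp
    also have "\<dots> = (\<Sum>i\<in>I. grad (\<psi> i) x $ j * conv (\<rho> i) P x + \<psi> i x * conv (\<rho> i) (Q j) x)"
    proof (rule sum.cong[OF refl])
      fix i assume i: "i \<in> I"
      show "\<psi> i x * grad (conv (\<rho> i) P) x $ j + conv (\<rho> i) P x * grad (\<psi> i) x $ j
        = grad (\<psi> i) x $ j * conv (\<rho> i) P x + \<psi> i x * conv (\<rho> i) (Q j) x"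
        using transfer[OF i that, of j] gc[OF i, of P x j] by (cases "\<psi> i x = 0") auto
    qed
    finally show ?thesis .
  qed
  have qL: "q \<in> L2 (lebesgue_on \<Omega>)" "grad q \<in> L2 (lebesgue_on \<Omega>)"
    by (intro continuous_imp_L2[OF O' O(2)] C1_continuous C1_grad(2) qC)+
  have inO: "AE x in lebesgue_on \<Omega>. x \<in> \<Omega>" by (rule AE_I2) (simp add: space_restrict_space)
  show ?thesis
  proof (rule that[OF qC])
    have "L2_norm (lebesgue_on \<Omega>) (\<lambda>x. q x - p x) = L2_norm (lebesgue_on \<Omega>) (\<lambda>x. \<Sum>i\<in>I. \<psi> i x * (conv (\<rho> i) P x - P x))"
    proof (rule L2_norm_cong_AE[OF L2_measurable[OF L2_diff[OF qL(1) p]] L2_measurable[OF a1]])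
      show "AE x in lebesgue_on \<Omega>. q x - p x = (\<Sum>i\<in>I. \<psi> i x * (conv (\<rho> i) P x - P x))"
        using P(5) inO
      proof eventually_elim
        case (elim x)
        have "(\<Sum>i\<in>I. \<psi> i x * (conv (\<rho> i) P x - P x)) = q x - (\<Sum>i\<in>I. \<psi> i x) * P x"
          by (simp add: q_def right_diff_distrib sum_subtractf sum_distrib_right)
        then show ?case using elim s1 by simp
      qed
    qed simp
    then show "L2_norm (lebesgue_on \<Omega>) (\<lambda>x. q x - p x) \<le> \<epsilon>" using a2[of P] \<epsilon>'(2) by simp
    have comp: "L2_norm (lebesgue_on \<Omega>) (\<lambda>x. (grad q x - G x) $ j) \<le> 2 * \<epsilon>'" for j
    proof -
      let ?A = "\<lambda>x. \<Sum>i\<in>I. grad (\<psi> i) x $ j * (conv (\<rho> i) P x - P x)"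
      let ?B = "\<lambda>x. \<Sum>i\<in>I. \<psi> i x * (conv (\<rho> i) (Q j) x - Q j x)"
      have AB: "?A \<in> L2 (lebesgue_on \<Omega>)" "?B \<in> L2 (lebesgue_on \<Omega>)" "L2_norm (lebesgue_on \<Omega>) ?A \<le> \<epsilon>'" "L2_norm (lebesgue_on \<Omega>) ?B \<le> \<epsilon>'"
        using a1[of "Q j"] a2[of "Q j"] a3[of P j] a4[of P j] by auto
      have "L2_norm (lebesgue_on \<Omega>) (\<lambda>x. (grad q x - G x) $ j) = L2_norm (lebesgue_on \<Omega>) (\<lambda>x. ?A x + ?B x)"
      proof (rule L2_norm_cong_AE[OF L2_measurable[OF L2_component[OF L2_diff[OF qL(2) G]]] L2_measurable[OF L2_add[OF AB(1,2)]]])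
        show "AE x in lebesgue_on \<Omega>. (grad q x - G x) $ j = ?A x + ?B x"
          using Q(5)[of j] inO
        proof eventually_elim
          case (elim x)
          have "?A x + ?B x = grad q x $ j - (\<Sum>i\<in>I. grad (\<psi> i) x $ j) * P x - (\<Sum>i\<in>I. \<psi> i x) * Q j x"
            unfolding gq[OF elim(2)] by (simp add: right_diff_distrib sum_subtractf sum_distrib_right sum.distrib)
          then show ?case using elim s1 s0 by simp
        qed
      qed
      also have "\<dots> \<le> L2_norm (lebesgue_on \<Omega>) ?A + L2_norm (lebesgue_on \<Omega>) ?B" by (rule L2_norm_triangle[OF AB(1,2)])
      finally show ?thesis using AB(3,4) by simp
    qed
    have "L2_norm (lebesgue_on \<Omega>) (\<lambda>x. grad q x - G x) \<le> (\<Sum>j\<in>UNIV. L2_norm (lebesgue_on \<Omega>) (\<lambda>x. (grad q x - G x) $ j))"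
      by (rule L2_vec(2)[OF L2_component[OF L2_diff[OF qL(2) G]]])
    also have "\<dots> \<le> (\<Sum>j\<in>(UNIV::'d set). 2 * \<epsilon>')" by (intro sum_mono comp)
    also have "\<dots> \<le> \<epsilon>" using \<epsilon>'(3) by (simp add: d_def)
    finally show "L2_norm (lebesgue_on \<Omega>) (\<lambda>x. grad q x - G x) \<le> \<epsilon>" .
  qed
qed

text \<open>Single partial derivatives of u have no weak meaning here, only their sum does. The
  derivative is therefore transferred after summation over the components, which forces the same
  kernel for all components of u.\<close>

lemma Hdiv_dense:
  fixes u :: "real^'d \<Rightarrow> real^'d"
  assumes dom: "lipschitz_domain \<Omega>" and u: "u \<in> L2 (lebesgue_on \<Omega>)" and wd: "has_weak_divergence \<Omega> u D"
    and D: "D \<in> L2 (lebesgue_on \<Omega>)" and \<epsilon>: "\<epsilon> > 0"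
  obtains w where "Ck 1 w" "L2_norm (lebesgue_on \<Omega>) (\<lambda>x. w x - u x) \<le> \<epsilon>" "L2_norm (lebesgue_on \<Omega>) (\<lambda>x. divg w x - D x) \<le> \<epsilon>"
proof -
  have O: "open \<Omega>" "bounded \<Omega>" using dom by (auto simp: lipschitz_domain_def)
  have O': "\<Omega> \<in> sets borel" using O by simp
  obtain R where R: "\<Omega> \<subseteq> cball 0 R" using O(2) by (auto simp: bounded_iff subset_iff)
  obtain E where E: "E \<in> borel_measurable borel" "E \<in> L2 lborel" "integrable lborel E" "\<And>x. x \<notin> \<Omega> \<Longrightarrow> E x = 0"
    "AE x in lebesgue_on \<Omega>. E x = D x" using L2_zero_extension[OF O' O(2) D] by blast
  obtain Q where Q: "\<And>j. Q j \<in> borel_measurable borel" "\<And>j. Q j \<in> L2 lborel" "\<And>j. integrable lborel (Q j)" "\<And>j x. x \<notin> \<Omega> \<Longrightarrow> Q j x = 0"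
    "\<And>j. AE x in lebesgue_on \<Omega>. Q j x = u x $ j"
    by (rule L2_zero_extension_components[OF O' O(2) u]) (rule that)
  define d where "d = real CARD('d)"
  have d: "d > 0" by (simp add: d_def)
  \<comment> \<open>The divergence error consists of d sums with derivatives of the partition and
    one sum with the partition itself.\<close>
  define \<epsilon>' where "\<epsilon>' = \<epsilon> / (d + 1)"
  have "\<epsilon>' > 0" using \<epsilon> d by (simp add: \<epsilon>'_def)
  moreover have "(d + 1) * \<epsilon>' = \<epsilon>" using d by (simp add: \<epsilon>'_def)
  ultimately have \<epsilon>': "\<epsilon>' > 0" "d * \<epsilon>' + \<epsilon>' \<le> \<epsilon>" "d * \<epsilon>' \<le> \<epsilon>" by (auto simp: distrib_right)
  let ?F = "insert E (range Q)"
  have F: "finite ?F" "\<forall>F\<in>?F. F \<in> L2 lborel \<and> integrable lborel F \<and> (\<forall>x. x \<notin> cball 0 R \<longrightarrow> F x = 0)"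
    using E(2-4) Q(2-4) R by (simp, blast)
  obtain I :: "(real^'d) set" and \<psi> \<rho> where I: "finite I" and \<psi>: "\<And>i. i \<in> I \<Longrightarrow> Ck 1 (\<psi> i)"
    and c1: "\<And>i F. i \<in> I \<Longrightarrow> F \<in> ?F \<Longrightarrow> Ck 1 (conv (\<rho> i) F)"
    and gc: "\<And>i F x j. i \<in> I \<Longrightarrow> F \<in> ?F \<Longrightarrow> grad (conv (\<rho> i) F) x $ j = conv (\<lambda>z. grad (\<rho> i) z $ j) F x"
    and \<rho>: "\<And>i. i \<in> I \<Longrightarrow> Ck 1 (\<rho> i)"
    and tf: "\<And>i x. i \<in> I \<Longrightarrow> x \<in> \<Omega> \<Longrightarrow> \<psi> i x \<noteq> 0 \<Longrightarrow> (\<lambda>y. \<rho> i (x - y)) \<in> test_functions \<Omega>"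
    and s1: "\<And>x. x \<in> \<Omega> \<Longrightarrow> (\<Sum>i\<in>I. \<psi> i x) = 1" and s0: "\<And>x j. x \<in> \<Omega> \<Longrightarrow> (\<Sum>i\<in>I. grad (\<psi> i) x $ j) = 0"
    and a1: "\<And>F. F \<in> ?F \<Longrightarrow> (\<lambda>x. \<Sum>i\<in>I. \<psi> i x * (conv (\<rho> i) F x - F x)) \<in> L2 (lebesgue_on \<Omega>)"
    and a2: "\<And>F. F \<in> ?F \<Longrightarrow> L2_norm (lebesgue_on \<Omega>) (\<lambda>x. \<Sum>i\<in>I. \<psi> i x * (conv (\<rho> i) F x - F x)) \<le> \<epsilon>'"
    and a3: "\<And>F j. F \<in> ?F \<Longrightarrow> (\<lambda>x. \<Sum>i\<in>I. grad (\<psi> i) x $ j * (conv (\<rho> i) F x - F x)) \<in> L2 (lebesgue_on \<Omega>)"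
    and a4: "\<And>F j. F \<in> ?F \<Longrightarrow> L2_norm (lebesgue_on \<Omega>) (\<lambda>x. \<Sum>i\<in>I. grad (\<psi> i) x $ j * (conv (\<rho> i) F x - F x)) \<le> \<epsilon>'"
    apply (rule domain_approximation[OF dom F \<epsilon>'(1)])
    subgoal premises prems for I \<psi> \<rho> by (rule that[of I \<psi> \<rho>]; fact prems)
    done
  define w :: "real^'d \<Rightarrow> real^'d" where "w x = (\<chi> j. \<Sum>i\<in>I. \<psi> i x * conv (\<rho> i) (Q j) x)" for x
  have wj: "(\<lambda>x. w x $ j) = (\<lambda>x. \<Sum>i\<in>I. \<psi> i x * conv (\<rho> i) (Q j) x)" for j by (simp add: w_def fun_eq_iff)
  have wC: "Ck 1 w" by (rule Ck_vec) (unfold wj, intro Ck_sum Ck_mult \<psi> c1, auto)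
  have transfer: "(\<Sum>j\<in>UNIV. conv (\<lambda>z. grad (\<rho> i) z $ j) (Q j) x) = conv (\<rho> i) E x" if i: "i \<in> I" and x: "x \<in> \<Omega>" "\<psi> i x \<noteq> 0" for i x
  proof -
    note t = tf[OF i x]
    note tC = test_functions_D(1)[OF t]
    have gt: "grad (\<lambda>y. \<rho> i (x - y)) y $ j = - (grad (\<rho> i) (x - y) $ j)" for y j
      by (simp add: grad_reflect[OF \<rho>[OF i]])
    have gL: "(\<lambda>y. grad (\<lambda>y. \<rho> i (x - y)) y $ j) \<in> L2 (lebesgue_on \<Omega>)" for j
      by (intro continuous_imp_L2[OF O' O(2)] continuous_on_component C1_grad(2)[OF tC])
    have "conv (\<lambda>z. grad (\<rho> i) z $ j) (Q j) x = - (\<integral>y. u y $ j * grad (\<lambda>y. \<rho> i (x - y)) y $ j \<partial>lebesgue_on \<Omega>)" for j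
    proof -
      have "conv (\<lambda>z. grad (\<rho> i) z $ j) (Q j) x = - (\<integral>y. Q j y * grad (\<lambda>y. \<rho> i (x - y)) y $ j \<partial>lborel)"
        unfolding conv_def gt by (simp add: mult.commute)
      also have "(\<integral>y. Q j y * grad (\<lambda>y. \<rho> i (x - y)) y $ j \<partial>lborel) = (\<integral>y. u y $ j * grad (\<lambda>y. \<rho> i (x - y)) y $ j \<partial>lebesgue_on \<Omega>)"
        by (rule zero_extension_integral[symmetric, OF O' L2_measurable[OF L2_component[OF u]] Q(1) _ Q(4,5)])
            (intro borel_measurable_continuous_onI continuous_on_component C1_grad(2)[OF tC])
      finally show ?thesis .
    qed
    then have "(\<Sum>j\<in>UNIV. conv (\<lambda>z. grad (\<rho> i) z $ j) (Q j) x)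
      = - (\<Sum>j\<in>UNIV. \<integral>y. u y $ j * grad (\<lambda>y. \<rho> i (x - y)) y $ j \<partial>lebesgue_on \<Omega>)"
      by (simp add: sum_negf)
    also have "\<dots> = - (\<integral>y. u y \<bullet> grad (\<lambda>y. \<rho> i (x - y)) y \<partial>lebesgue_on \<Omega>)"
      unfolding inner_vec_def
      by (subst Bochner_Integration.integral_sum) (auto intro!: L2_mult_integrable L2_component[OF u] gL)
    also have "(\<integral>y. u y \<bullet> grad (\<lambda>y. \<rho> i (x - y)) y \<partial>lebesgue_on \<Omega>) = - (\<integral>y. D y * \<rho> i (x - y) \<partial>lebesgue_on \<Omega>)"
      using wd t unfolding has_weak_divergence_def by blast
    also have "(\<integral>y. D y * \<rho> i (x - y) \<partial>lebesgue_on \<Omega>) = (\<integral>y. E y * \<rho> i (x - y) \<partial>lborel)"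
      by (rule zero_extension_integral[OF O' L2_measurable[OF D] E(1) C1_borel[OF tC] E(4,5)])
    finally show ?thesis by (simp add: conv_def mult.commute)
  qed
  have dw: "divg w x = (\<Sum>j\<in>UNIV. \<Sum>i\<in>I. grad (\<psi> i) x $ j * conv (\<rho> i) (Q j) x) + (\<Sum>i\<in>I. \<psi> i x * conv (\<rho> i) E x)"
    if x: "x \<in> \<Omega>" for x
  proof -
    have "grad (\<lambda>x. w x $ j) x = (\<Sum>i\<in>I. \<psi> i x *\<^sub>R grad (conv (\<rho> i) (Q j)) x + conv (\<rho> i) (Q j) x *\<^sub>R grad (\<psi> i) x)" for j
      unfolding wj by (subst grad_sum[OF I]) (auto intro!: Ck_mult \<psi> c1 sum.cong simp: grad_mult \<psi> c1 simp del: One_nat_def)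
    then have "divg w x = (\<Sum>j\<in>UNIV. \<Sum>i\<in>I. \<psi> i x * grad (conv (\<rho> i) (Q j)) x $ j + conv (\<rho> i) (Q j) x * grad (\<psi> i) x $ j)"
      by (simp add: divg_def)
    also have "\<dots> = (\<Sum>j\<in>UNIV. \<Sum>i\<in>I. grad (\<psi> i) x $ j * conv (\<rho> i) (Q j) x)
       + (\<Sum>i\<in>I. \<psi> i x * (\<Sum>j\<in>UNIV. grad (conv (\<rho> i) (Q j)) x $ j))"
      unfolding sum.distrib sum_distrib_left
      by (subst (2) sum.swap) (simp add: mult.commute)
    also have "(\<Sum>i\<in>I. \<psi> i x * (\<Sum>j\<in>UNIV. grad (conv (\<rho> i) (Q j)) x $ j)) = (\<Sum>i\<in>I. \<psi> i x * conv (\<rho> i) E x)"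
    proof (rule sum.cong[OF refl])
      fix i assume i: "i \<in> I"
      show "\<psi> i x * (\<Sum>j\<in>UNIV. grad (conv (\<rho> i) (Q j)) x $ j) = \<psi> i x * conv (\<rho> i) E x"
        using transfer[OF i x] gc[OF i, of "Q _" x] by (cases "\<psi> i x = 0") auto
    qed
    finally show ?thesis .
  qed
  have wL: "w \<in> L2 (lebesgue_on \<Omega>)" "divg w \<in> L2 (lebesgue_on \<Omega>)"
    by (intro continuous_imp_L2[OF O' O(2)] C1_continuous C1_divg_continuous wC)+
  have inO: "AE x in lebesgue_on \<Omega>. x \<in> \<Omega>" by (rule AE_I2) (simp add: space_restrict_space)
  show ?thesis
  proof (rule that[OF wC])
    have comp: "L2_norm (lebesgue_on \<Omega>) (\<lambda>x. (w x - u x) $ j) \<le> \<epsilon>'" for j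
    proof -
      have "L2_norm (lebesgue_on \<Omega>) (\<lambda>x. (w x - u x) $ j) = L2_norm (lebesgue_on \<Omega>) (\<lambda>x. \<Sum>i\<in>I. \<psi> i x * (conv (\<rho> i) (Q j) x - Q j x))"
      proof (rule L2_norm_cong_AE[OF L2_measurable[OF L2_component[OF L2_diff[OF wL(1) u]]] L2_measurable[OF a1]])
        show "AE x in lebesgue_on \<Omega>. (w x - u x) $ j = (\<Sum>i\<in>I. \<psi> i x * (conv (\<rho> i) (Q j) x - Q j x))"
          using Q(5)[of j] inO
        proof eventually_elim
          case (elim x)
          have "(\<Sum>i\<in>I. \<psi> i x * (conv (\<rho> i) (Q j) x - Q j x)) = w x $ j - (\<Sum>i\<in>I. \<psi> i x) * Q j x"
            by (simp add: w_def right_diff_distrib sum_subtractf sum_distrib_right)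
          then show ?case using elim s1 by simp
        qed
      qed simp
      then show ?thesis using a2[of "Q j"] by simp
    qed
    have "L2_norm (lebesgue_on \<Omega>) (\<lambda>x. w x - u x) \<le> (\<Sum>j\<in>UNIV. L2_norm (lebesgue_on \<Omega>) (\<lambda>x. (w x - u x) $ j))"
      by (rule L2_vec(2)[OF L2_component[OF L2_diff[OF wL(1) u]]])
    also have "\<dots> \<le> (\<Sum>j\<in>(UNIV::'d set). \<epsilon>')" by (intro sum_mono comp)
    also have "\<dots> \<le> \<epsilon>" using \<epsilon>'(3) by (simp add: d_def)
    finally show "L2_norm (lebesgue_on \<Omega>) (\<lambda>x. w x - u x) \<le> \<epsilon>" .
    let ?A = "\<lambda>j x. \<Sum>i\<in>I. grad (\<psi> i) x $ j * (conv (\<rho> i) (Q j) x - Q j x)"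
    let ?B = "\<lambda>x. \<Sum>i\<in>I. \<psi> i x * (conv (\<rho> i) E x - E x)"
    have AB: "?A j \<in> L2 (lebesgue_on \<Omega>)" "?B \<in> L2 (lebesgue_on \<Omega>)" "L2_norm (lebesgue_on \<Omega>) (?A j) \<le> \<epsilon>'" "L2_norm (lebesgue_on \<Omega>) ?B \<le> \<epsilon>'" for j
      using a1[of E] a2[of E] a3[of "Q j" j] a4[of "Q j" j] by auto
    have AS: "(\<lambda>x. \<Sum>j\<in>UNIV. ?A j x) \<in> L2 (lebesgue_on \<Omega>)" by (rule L2_sum[OF AB(1)])
    have "L2_norm (lebesgue_on \<Omega>) (\<lambda>x. divg w x - D x) = L2_norm (lebesgue_on \<Omega>) (\<lambda>x. (\<Sum>j\<in>UNIV. ?A j x) + ?B x)"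
    proof (rule L2_norm_cong_AE[OF L2_measurable[OF L2_diff[OF wL(2) D]] L2_measurable[OF L2_add[OF AS AB(2)]]])
      show "AE x in lebesgue_on \<Omega>. divg w x - D x = (\<Sum>j\<in>UNIV. ?A j x) + ?B x"
        using E(5) inO
      proof eventually_elim
        case (elim x)
        have "?A j x = (\<Sum>i\<in>I. grad (\<psi> i) x $ j * conv (\<rho> i) (Q j) x)" for j
        proof -
          have "?A j x = (\<Sum>i\<in>I. grad (\<psi> i) x $ j * conv (\<rho> i) (Q j) x) - (\<Sum>i\<in>I. grad (\<psi> i) x $ j) * Q j x"
            by (simp add: right_diff_distrib sum_subtractf sum_distrib_right)
          then show ?thesis using s0[OF elim(2)] by simp
        qed
        moreover have "?B x = (\<Sum>i\<in>I. \<psi> i x * conv (\<rho> i) E x) - (\<Sum>i\<in>I. \<psi> i x) * E x"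
          by (simp add: right_diff_distrib sum_subtractf sum_distrib_right)
        ultimately show ?case unfolding dw[OF elim(2)] using elim s1 by simp
      qed
    qed
    also have "\<dots> \<le> L2_norm (lebesgue_on \<Omega>) (\<lambda>x. \<Sum>j\<in>UNIV. ?A j x) + L2_norm (lebesgue_on \<Omega>) ?B"
      by (rule L2_norm_triangle[OF AS AB(2)])
    also have "L2_norm (lebesgue_on \<Omega>) (\<lambda>x. \<Sum>j\<in>UNIV. ?A j x) \<le> (\<Sum>j\<in>UNIV. L2_norm (lebesgue_on \<Omega>) (?A j))"
      by (rule L2_norm_sum[OF finite AB(1)])
    also have "\<dots> \<le> (\<Sum>j\<in>(UNIV::'d set). \<epsilon>')" by (intro sum_mono AB)
    finally show "L2_norm (lebesgue_on \<Omega>) (\<lambda>x. divg w x - D x) \<le> \<epsilon>" using AB(4) \<epsilon>'(2) by (simp add: d_def)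
  qed
qed

section \<open>Slicing along a direction\<close>

text \<open>The layer of height 1 by which the surface measure expresses the (d-1)-dimensional
  Lebesgue measure of the hyperplane orthogonal to e.\<close>

definition slab :: "'a::euclidean_space \<Rightarrow> 'a set" where
  "slab e = {x. 0 \<le> x \<bullet> e \<and> x \<bullet> e \<le> 1}"

lemma slab_borel [measurable]: "slab e \<in> sets borel"
  unfolding slab_def by measurable

lemma slab_slice:
  fixes e :: "'a::euclidean_space"
  assumes "norm e = 1"
  shows "(\<integral>\<^sup>+t. indicator (slab e) (y - t *\<^sub>R e) \<partial>lborel) = (1::ennreal)"
    "integrable lborel (\<lambda>t. indicator (slab e) (y - t *\<^sub>R e) :: real)"
    "(\<integral>t. indicator (slab e) (y - t *\<^sub>R e) \<partial>lborel) = (1::real)"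
proof -
  have "e \<bullet> e = 1" using assms by (simp add: power2_norm_eq_inner[symmetric])
  then have *: "indicator (slab e) (y - t *\<^sub>R e) = (indicator {y \<bullet> e - 1..y \<bullet> e} t :: 'b::zero_neq_one)" for t
    by (auto simp: indicator_def slab_def inner_simps)
  show "(\<integral>\<^sup>+t. indicator (slab e) (y - t *\<^sub>R e) \<partial>lborel) = (1::ennreal)" unfolding * by simp
  show "integrable lborel (\<lambda>t. indicator (slab e) (y - t *\<^sub>R e) :: real)" unfolding * by simp
  show "(\<integral>t. indicator (slab e) (y - t *\<^sub>R e) \<partial>lborel) = (1::real)" unfolding * by simp
qed

text \<open>Fubini in the direction \<open>e\<close>, without rotating coordinates: translating by \<open>t e\<close> before integrating
  over \<open>t\<close> gives every point total weight one.\<close>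

lemma nn_integral_slab:
  fixes e :: "'a::euclidean_space" and h :: "'a \<Rightarrow> ennreal"
  assumes e: "norm e = 1" and [measurable]: "h \<in> borel_measurable borel"
  shows "(\<integral>\<^sup>+x. indicator (slab e) x * (\<integral>\<^sup>+t. h (x + t *\<^sub>R e) \<partial>lborel) \<partial>lborel) = (\<integral>\<^sup>+y. h y \<partial>lborel)"
proof -
  have "(\<integral>\<^sup>+x. indicator (slab e) x * (\<integral>\<^sup>+t. h (x + t *\<^sub>R e) \<partial>lborel) \<partial>lborel)
    = (\<integral>\<^sup>+x. (\<integral>\<^sup>+t. indicator (slab e) x * h (x + t *\<^sub>R e) \<partial>lborel) \<partial>lborel)"
    by (intro nn_integral_cong nn_integral_cmult[symmetric]) measurable
  also have "\<dots> = (\<integral>\<^sup>+t. (\<integral>\<^sup>+x. indicator (slab e) x * h (x + t *\<^sub>R e) \<partial>lborel) \<partial>lborel)"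
    by (rule lborel_pair.Fubini') measurable
  also have "\<dots> = (\<integral>\<^sup>+t. (\<integral>\<^sup>+y. indicator (slab e) (y - t *\<^sub>R e) * h y \<partial>lborel) \<partial>lborel)"
  proof (rule nn_integral_cong)
    fix t
    show "(\<integral>\<^sup>+x. indicator (slab e) x * h (x + t *\<^sub>R e) \<partial>lborel) = (\<integral>\<^sup>+y. indicator (slab e) (y - t *\<^sub>R e) * h y \<partial>lborel)"
      using lborel_nn_integral_translation[of "\<lambda>y. indicator (slab e) (y - t *\<^sub>R e) * h y" "t *\<^sub>R e"]
      by (simp add: add.commute)
  qed
  also have "\<dots> = (\<integral>\<^sup>+y. (\<integral>\<^sup>+t. indicator (slab e) (y - t *\<^sub>R e) * h y \<partial>lborel) \<partial>lborel)"
    by (rule lborel_pair.Fubini'[symmetric]) measurable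
  also have "\<dots> = (\<integral>\<^sup>+y. h y \<partial>lborel)"
    by (subst nn_integral_multc) (auto simp: slab_slice[OF e])
  finally show ?thesis .
qed

text \<open>The signed version; the nonnegative computation provides the integrability on the
  product that Fubini's theorem asks for, before and after the translation.\<close>

lemma integral_slab:
  fixes e :: "'a::euclidean_space" and h :: "'a \<Rightarrow> real"
  assumes e: "norm e = 1" and h: "integrable lborel h"
  shows "(\<integral>x. indicator (slab e) x * (\<integral>t. h (x + t *\<^sub>R e) \<partial>lborel) \<partial>lborel) = (\<integral>y. h y \<partial>lborel)"
proof -
  have [measurable]: "h \<in> borel_measurable borel" using h by auto
  have hfin: "(\<integral>\<^sup>+y. ennreal (norm (h y)) \<partial>lborel) < \<infinity>" using h by (simp add: integrable_iff_bounded)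
  have i1: "integrable (lborel \<Otimes>\<^sub>M lborel) (\<lambda>(x, t). indicator (slab e) x * h (x + t *\<^sub>R e))"
  proof (rule integrableI_bounded)
    have "(\<integral>\<^sup>+z. ennreal (norm (case z of (x, t) \<Rightarrow> indicator (slab e) x * h (x + t *\<^sub>R e))) \<partial>(lborel \<Otimes>\<^sub>M lborel))
      = (\<integral>\<^sup>+x. \<integral>\<^sup>+t. ennreal (norm (indicator (slab e) x * h (x + t *\<^sub>R e))) \<partial>lborel \<partial>lborel)"
      by (subst lborel.nn_integral_fst[symmetric]) (auto simp: case_prod_beta)
    also have "\<dots> = (\<integral>\<^sup>+x. indicator (slab e) x * (\<integral>\<^sup>+t. ennreal (norm (h (x + t *\<^sub>R e))) \<partial>lborel) \<partial>lborel)"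
      by (intro nn_integral_cong) (auto simp: indicator_def)
    also have "\<dots> = (\<integral>\<^sup>+y. ennreal (norm (h y)) \<partial>lborel)" by (rule nn_integral_slab[OF e]) measurable
    finally show "(\<integral>\<^sup>+z. ennreal (norm (case z of (x, t) \<Rightarrow> indicator (slab e) x * h (x + t *\<^sub>R e))) \<partial>(lborel \<Otimes>\<^sub>M lborel)) < \<infinity>"
      using hfin by simp
  qed measurable
  have i2: "integrable (lborel \<Otimes>\<^sub>M lborel) (\<lambda>(t, y). indicator (slab e) (y - t *\<^sub>R e) * h y)"
  proof (rule integrableI_bounded)
    have "(\<integral>\<^sup>+z. ennreal (norm (case z of (t, y) \<Rightarrow> indicator (slab e) (y - t *\<^sub>R e) * h y)) \<partial>(lborel \<Otimes>\<^sub>M lborel))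
      = (\<integral>\<^sup>+y. \<integral>\<^sup>+t. ennreal (norm (indicator (slab e) (y - t *\<^sub>R e) * h y)) \<partial>lborel \<partial>lborel)"
      by (subst lborel_pair.nn_integral_snd[symmetric]) (auto simp: case_prod_beta)
    also have "\<dots> = (\<integral>\<^sup>+y. \<integral>\<^sup>+t. indicator (slab e) (y - t *\<^sub>R e) * ennreal (norm (h y)) \<partial>lborel \<partial>lborel)"
      by (intro nn_integral_cong) (auto simp: indicator_def)
    also have "\<dots> = (\<integral>\<^sup>+y. ennreal (norm (h y)) \<partial>lborel)"
      by (subst nn_integral_multc) (auto simp: slab_slice[OF e])
    finally show "(\<integral>\<^sup>+z. ennreal (norm (case z of (t, y) \<Rightarrow> indicator (slab e) (y - t *\<^sub>R e) * h y)) \<partial>(lborel \<Otimes>\<^sub>M lborel)) < \<infinity>"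
      using hfin by simp
  qed measurable
  have "(\<integral>x. indicator (slab e) x * (\<integral>t. h (x + t *\<^sub>R e) \<partial>lborel) \<partial>lborel)
    = (\<integral>x. (\<integral>t. indicator (slab e) x * h (x + t *\<^sub>R e) \<partial>lborel) \<partial>lborel)"
    by simp
  also have "\<dots> = (\<integral>t. (\<integral>x. indicator (slab e) x * h (x + t *\<^sub>R e) \<partial>lborel) \<partial>lborel)"
    by (rule lborel_pair.Fubini_integral[OF i1, symmetric])
  also have "\<dots> = (\<integral>t. (\<integral>y. indicator (slab e) (y - t *\<^sub>R e) * h y \<partial>lborel) \<partial>lborel)"
  proof (rule Bochner_Integration.integral_cong[OF refl])
    fix t
    show "(\<integral>x. indicator (slab e) x * h (x + t *\<^sub>R e) \<partial>lborel) = (\<integral>y. indicator (slab e) (y - t *\<^sub>R e) * h y \<partial>lborel)"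
      using lborel_integral_translation[of "\<lambda>y. indicator (slab e) (y - t *\<^sub>R e) * h y" "t *\<^sub>R e"]
      by (simp add: add.commute)
  qed
  also have "\<dots> = (\<integral>y. (\<integral>t. indicator (slab e) (y - t *\<^sub>R e) * h y \<partial>lborel) \<partial>lborel)"
    by (rule lborel_pair.Fubini_integral[OF i2, symmetric])
  also have "\<dots> = (\<integral>y. h y \<partial>lborel)"
    by (simp add: slab_slice[OF e])
  finally show ?thesis .
qed

text \<open>The oriented integral from b to b'. The difference of indicators has the right sign for
  either order of the endpoints and is exactly how a line cuts the difference of two
  subgraphs.\<close>

definition seg_integral :: "(real \<Rightarrow> real) \<Rightarrow> real \<Rightarrow> real \<Rightarrow> real" where
  "seg_integral g b b' = (\<integral>t. (indicator {..<b'} t - indicator {..<b} t) * g t \<partial>lborel)"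

lemma indicator_lessThan_diff:
  fixes t :: real
  shows "indicator {..<b'} t - indicator {..<b} t = (if b \<le> b' then indicator {b..<b'} t else - indicator {b'..<b} t :: real)"
  by (auto simp: indicator_def)

lemma seg_integrable:
  fixes g :: "real \<Rightarrow> real"
  assumes "continuous_on UNIV g"
  shows "integrable lborel (\<lambda>t. (indicator {..<b'} t - indicator {..<b} t) * g t :: real)"
proof -
  have 1: "integrable lborel (\<lambda>t. indicator {c..<d} t * g t)" for c d
  proof -
    have "integrable lborel (\<lambda>t. indicator {c..d} t *\<^sub>R g t)"
      by (rule borel_integrable_compact[OF compact_Icc]) (rule continuous_on_subset[OF assms subset_UNIV])
    then have "integrable lborel (\<lambda>t. indicator {c..<d} t *\<^sub>R (indicator {c..d} t *\<^sub>R g t))"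
      by (rule integrable_mult_indicator[rotated]) auto
    also have "(\<lambda>t. indicator {c..<d} t *\<^sub>R (indicator {c..d} t *\<^sub>R g t)) = (\<lambda>t. indicator {c..<d} t * g t)"
      by (auto simp: indicator_def fun_eq_iff)
    finally show ?thesis .
  qed
  show ?thesis unfolding indicator_lessThan_diff using 1 by (cases "b \<le> b'") simp_all
qed

lemma seg_integral_const: "seg_integral (\<lambda>t. c) b b' = (b' - b) * c"
  unfolding seg_integral_def indicator_lessThan_diff by (cases "b \<le> b'") (auto simp: algebra_simps)

lemma seg_integral_bound:
  assumes g: "continuous_on UNIV g" and le: "\<And>t. min b b' \<le> t \<Longrightarrow> t \<le> max b b' \<Longrightarrow> \<bar>g t\<bar> \<le> B" and B: "0 \<le> B"
  shows "\<bar>seg_integral g b b'\<bar> \<le> \<bar>b' - b\<bar> * B"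
proof -
  have "\<bar>seg_integral g b b'\<bar> \<le> (\<integral>t. indicator {min b b'..max b b'} t * B \<partial>lborel)"
    unfolding seg_integral_def real_norm_def[symmetric]
  proof (rule order_trans[OF integral_norm_bound], rule integral_mono)
    show "integrable lborel (\<lambda>t. norm ((indicator {..<b'} t - indicator {..<b} t) * g t))"
      by (intro integrable_norm seg_integrable g)
    show "norm ((indicator {..<b'} t - indicator {..<b} t) * g t) \<le> indicator {min b b'..max b b'} t * B" for t
      using le[of t] B by (auto simp: indicator_def abs_mult)
  qed auto
  also have "\<dots> = \<bar>b' - b\<bar> * B" by (auto simp: abs_real_def min_def max_def)
  finally show ?thesis .
qed

text \<open>The fundamental theorem of calculus: after subtracting the constant \<open>g b\<close>,
  the remainder is at most |h| times the oscillation of g on the segment.\<close>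

lemma seg_integral_deriv:
  assumes g: "continuous_on UNIV g"
  shows "((\<lambda>b'. seg_integral g b b') has_real_derivative g b) (at b)"
  unfolding DERIV_def
proof (rule LIM_I)
  fix \<epsilon> :: real assume \<epsilon>: "0 < \<epsilon>"
  have "isCont g b" using g by (simp add: continuous_on_eq_continuous_at)
  then obtain d where d: "d > 0" "\<And>t. \<bar>t - b\<bar> < d \<Longrightarrow> \<bar>g t - g b\<bar> < \<epsilon> / 2"
    using \<epsilon> unfolding continuous_at_real_range real_norm_def by (metis half_gt_zero)
  have s0: "seg_integral g b b = 0" by (simp add: seg_integral_def)
  have "norm ((seg_integral g b (b + h) - seg_integral g b b) / h - g b) < \<epsilon>" if h: "h \<noteq> 0" "norm h < d" for h
  proof -
    have "seg_integral g b (b + h) - h * g b = seg_integral (\<lambda>t. g t - g b) b (b + h)"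
    proof -
      have "seg_integral (\<lambda>t. g t - g b) b (b + h) = seg_integral g b (b + h) - seg_integral (\<lambda>t. g b) b (b + h)"
        unfolding seg_integral_def right_diff_distrib
        by (intro Bochner_Integration.integral_diff seg_integrable g continuous_on_const)
      then show ?thesis by (simp add: seg_integral_const)
    qed
    also have "\<bar>\<dots>\<bar> \<le> \<bar>(b + h) - b\<bar> * (\<epsilon> / 2)"
    proof (rule seg_integral_bound)
      show "\<bar>g t - g b\<bar> \<le> \<epsilon> / 2" if "min b (b + h) \<le> t" "t \<le> max b (b + h)" for t
        using d(2)[of t] that h by (auto simp: min_def max_def split: if_splits)
    qed (use \<epsilon> in \<open>auto intro: continuous_intros g\<close>)
    finally have "\<bar>seg_integral g b (b + h) - h * g b\<bar> \<le> \<bar>h\<bar> * (\<epsilon> / 2)" by simp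
    moreover have "(seg_integral g b (b + h) - seg_integral g b b) / h - g b = (seg_integral g b (b + h) - h * g b) / h"
      using h by (simp add: s0 field_simps)
    ultimately have "norm ((seg_integral g b (b + h) - seg_integral g b b) / h - g b) \<le> \<epsilon> / 2"
      using h by (simp add: abs_div divide_le_eq mult.commute)
    then show ?thesis using \<epsilon> by simp
  qed
  then show "\<exists>s>0. \<forall>h. h \<noteq> 0 \<and> norm (h - 0) < s \<longrightarrow> norm ((seg_integral g b (b + h) - seg_integral g b b) / h - g b) < \<epsilon>"
    using d(1) by auto
qed

section \<open>Lipschitz graphs\<close>

locale lipschitz_graph =
  fixes e :: "real^'d" and \<phi> :: "real^'d \<Rightarrow> real" and C :: real
  assumes e: "norm e = 1" and lip: "C-lipschitz_on UNIV \<phi>" and inv: "\<phi> (x + t *\<^sub>R e) = \<phi> x"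
begin

abbreviation gp :: "real^'d \<Rightarrow> real^'d" where "gp \<equiv> graph_point e \<phi>"

lemma C_nonneg: "0 \<le> C" using lip by (rule lipschitz_on_nonneg)

lemma ee: "e \<bullet> e = 1" using e by (simp add: power2_norm_eq_inner[symmetric])

lemma \<phi>_lip: "\<bar>\<phi> x - \<phi> y\<bar> \<le> C * norm (x - y)"
  using lipschitz_onD[OF lip, of x y] by (simp add: dist_norm)

lemma \<phi>_continuous: "continuous_on UNIV \<phi>"
  using lip by (rule lipschitz_on_continuous_on)

lemma \<phi>_borel [measurable]: "\<phi> \<in> borel_measurable borel"
  by (rule borel_measurable_continuous_onI[OF \<phi>_continuous])

lemma gp_continuous: "continuous_on UNIV gp"
  unfolding graph_point_def[abs_def] by (intro continuous_intros \<phi>_continuous)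

lemma gp_borel [measurable]: "gp \<in> borel_measurable borel"
  by (rule borel_measurable_continuous_onI[OF gp_continuous])

lemma \<phi>_gp: "\<phi> (gp x) = \<phi> x" unfolding graph_point_def by (rule inv)

lemma gp_inner: "gp x \<bullet> e = \<phi> x" unfolding graph_point_def by (simp add: inner_simps ee)

text \<open>D is orthogonal to e because \<open>\<phi>\<close> is constant along e; this makes the
  length of e - D equal to the area factor.\<close>

lemma gderiv_facts:
  assumes "GDERIV \<phi> x :> D"
  shows "grad \<phi> x = D" "D \<bullet> e = 0" "norm D \<le> C" "norm (e - D) = sqrt (1 + (norm D)\<^sup>2)"
proof -
  have d: "(\<phi> has_derivative (\<lambda>v. D \<bullet> v)) (at x)" using assms by (simp add: gderiv_def inner_commute)
  show "grad \<phi> x = D" by (rule grad_eqI[OF d])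
  have "(\<lambda>k. (\<phi> (x + (1 / real (Suc k)) *\<^sub>R e) - \<phi> x) / (1 / real (Suc k))) \<longlonglongrightarrow> D \<bullet> e"
    by (rule has_derivative_quotient_sequence[OF d])
  then show De: "D \<bullet> e = 0" by (simp add: inv LIMSEQ_const_iff)
  \<comment> \<open>The Lipschitz bound is applied to difference quotients in the direction D
    itself.\<close>
  have "D \<bullet> D \<le> C * norm D"
  proof (rule LIMSEQ_le_const2[OF has_derivative_quotient_sequence[OF d]], intro exI allI impI)
    fix k
    have "\<phi> (x + (1 / real (Suc k)) *\<^sub>R D) - \<phi> x \<le> C * norm ((1 / real (Suc k)) *\<^sub>R D)"
      using \<phi>_lip[of "x + (1 / real (Suc k)) *\<^sub>R D" x] by simp
    also have "\<dots> = (C * norm D) * (1 / real (Suc k))" by simp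
    finally show "(\<phi> (x + (1 / real (Suc k)) *\<^sub>R D) - \<phi> x) / (1 / real (Suc k)) \<le> C * norm D"
      by (simp add: field_simps del: of_nat_Suc)
  qed
  then have "norm D * norm D \<le> C * norm D" by (simp add: power2_norm_eq_inner[symmetric] power2_eq_square)
  then show "norm D \<le> C" using C_nonneg by (cases "norm D = 0") auto
  have "(norm (e - D))\<^sup>2 = 1 + (norm D)\<^sup>2"
    by (simp add: power2_norm_eq_inner inner_simps ee De inner_commute)
  then show "norm (e - D) = sqrt (1 + (norm D)\<^sup>2)" by (metis norm_ge_zero real_sqrt_unique)
qed

definition sub :: "(real^'d) set" where "sub = {y. y \<bullet> e < \<phi> y}"

lemma sub_borel [measurable]: "sub \<in> sets borel"
  unfolding sub_def by measurable

text \<open>Vertical lines are unbounded, yet the slab integrals have compact support: a point of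
  the slab differs from a point of the ball on its vertical line only in the e-component, which is
  bounded for both.\<close>

lemma slab_bounded:
  assumes "x \<in> slab e" "x + t *\<^sub>R e \<in> cball 0 R"
  shows "norm x \<le> 2 * R + 1"
proof -
  have x: "x = (x + t *\<^sub>R e) - (((x + t *\<^sub>R e) \<bullet> e) - x \<bullet> e) *\<^sub>R e"
    by (simp add: inner_simps ee)
  have "\<bar>(x + t *\<^sub>R e) \<bullet> e\<bar> \<le> R" using Cauchy_Schwarz_ineq2[of "x + t *\<^sub>R e" e] e assms(2) by simp
  moreover have "\<bar>x \<bullet> e\<bar> \<le> 1" using assms(1) by (simp add: slab_def)
  ultimately have "norm ((((x + t *\<^sub>R e) \<bullet> e) - x \<bullet> e) *\<^sub>R e) \<le> R + 1" using e by simp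
  moreover have "norm x \<le> norm (x + t *\<^sub>R e) + norm ((((x + t *\<^sub>R e) \<bullet> e) - x \<bullet> e) *\<^sub>R e)"
    by (subst x) (rule norm_triangle_ineq4)
  ultimately show ?thesis using assms(2) by simp
qed

text \<open>The difference quotient of \<open>f\<close>, integrated over the subgraph, is an integral over
  the symmetric difference of the subgraph and its translate; slicing along \<open>e\<close> and letting the
  step tend to zero gives the boundary term.\<close>

lemma graph_gauss:
  fixes f :: "real^'d \<Rightarrow> real"
  assumes f: "Ck 1 f" and fR: "\<And>x. x \<notin> cball 0 R \<Longrightarrow> f x = 0" and fK: "closed K" "\<And>x. x \<notin> K \<Longrightarrow> f x = 0"
    and D: "AE x in lebesgue. gp x \<in> K \<longrightarrow> (\<exists>D. GDERIV \<phi> x :> D)"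
  shows "(\<integral>x. indicator sub x * (grad f x \<bullet> v) \<partial>lborel)
    = (\<integral>x. indicator (slab e) x * (f (gp x) * (e \<bullet> v - grad \<phi> x \<bullet> v)) \<partial>lebesgue)"
proof -
  obtain B where B: "0 \<le> B" "\<And>x. norm (f x) \<le> B"
    using C1_compact_support_bounds[OF f fR] by metis
  note [measurable] = C1_borel[OF f]
  have fi: "integrable lborel f" by (rule bounded_lborel_integrable[OF _ B(2) fR]) measurable
  have fc: "continuous_on UNIV (\<lambda>t. f (x + t *\<^sub>R e))" for x
    by (intro continuous_on_compose2[OF C1_continuous[OF f]] continuous_intros) auto
  define s where "s k = 1 / real (Suc k)" for k
  have s: "0 < s k" "s k \<le> 1" for k by (auto simp: s_def)
  \<comment> \<open>\<open>b x\<close> and \<open>\<beta> k x\<close> are the values of t at which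
    the line x + t e leaves the subgraph and its translate by
    \<open>s k *\<^sub>R v\<close>.\<close>
  define b where "b x = \<phi> x - x \<bullet> e" for x
  define \<beta> where "\<beta> k x = \<phi> (x - s k *\<^sub>R v) + s k * (v \<bullet> e) - x \<bullet> e" for k x
  define J where "J k x = seg_integral (\<lambda>t. f (x + t *\<^sub>R e)) (b x) (\<beta> k x) / s k" for k x
  have gpb: "gp x = x + b x *\<^sub>R e" for x by (simp add: graph_point_def b_def)
  have ind: "indicator sub (x + t *\<^sub>R e - s k *\<^sub>R v) = (indicator {..<\<beta> k x} t :: real)"
    "indicator sub (x + t *\<^sub>R e) = (indicator {..<b x} t :: real)" for x t k
  proof -
    have "\<phi> (x + t *\<^sub>R e - s k *\<^sub>R v) = \<phi> (x - s k *\<^sub>R v)"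
      using inv[of "x - s k *\<^sub>R v" t] by (simp add: algebra_simps)
    then show "indicator sub (x + t *\<^sub>R e - s k *\<^sub>R v) = (indicator {..<\<beta> k x} t :: real)"
      by (auto simp: indicator_def sub_def \<beta>_def inner_simps ee)
    show "indicator sub (x + t *\<^sub>R e) = (indicator {..<b x} t :: real)"
      by (auto simp: indicator_def sub_def b_def inner_simps ee inv)
  qed
  have quot: "(\<integral>x. indicator sub x * ((f (x + s k *\<^sub>R v) - f x) / s k) \<partial>lborel) = (\<integral>x. indicator (slab e) x * J k x \<partial>lebesgue)" for k
  proof -
    have i1: "integrable lborel (\<lambda>x. indicator sub x * f (x + s k *\<^sub>R v))"
      using integrable_mult_indicator[OF _ lborel_integrable_translation[OF fi, of "s k *\<^sub>R v"], of sub]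
      by (simp add: add.commute)
    have i2: "integrable lborel (\<lambda>x. indicator sub x * f x)"
      using integrable_mult_indicator[OF _ fi, of sub] by simp
    have i3: "integrable lborel (\<lambda>x. indicator sub (x - s k *\<^sub>R v) * f x)"
      using lborel_integrable_translation[OF i1, of "- s k *\<^sub>R v"] by (simp add: add.commute)
    have t: "(\<integral>x. indicator sub x * f (x + s k *\<^sub>R v) \<partial>lborel) = (\<integral>x. indicator sub (x - s k *\<^sub>R v) * f x \<partial>lborel)"
      using lborel_integral_translation[of "\<lambda>x. indicator sub (x - s k *\<^sub>R v) * f x" "s k *\<^sub>R v"] by (simp add: add.commute)
    have "(\<integral>x. indicator sub x * ((f (x + s k *\<^sub>R v) - f x) / s k) \<partial>lborel)
      = (\<integral>x. indicator sub x * f (x + s k *\<^sub>R v) - indicator sub x * f x \<partial>lborel) / s k"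
      by (subst integral_divide_zero[symmetric]) (simp add: right_diff_distrib)
    also have "\<dots> = (\<integral>x. (indicator sub (x - s k *\<^sub>R v) - indicator sub x) * f x \<partial>lborel) / s k"
      using i1 i2 i3 t by (simp add: left_diff_distrib)
    also have "(\<integral>x. (indicator sub (x - s k *\<^sub>R v) - indicator sub x) * f x \<partial>lborel)
      = (\<integral>x. indicator (slab e) x * (\<integral>t. (indicator sub (x + t *\<^sub>R e - s k *\<^sub>R v) - indicator sub (x + t *\<^sub>R e)) * f (x + t *\<^sub>R e) \<partial>lborel) \<partial>lborel)"
      by (rule integral_slab[OF e, symmetric]) (use i2 i3 in \<open>simp add: left_diff_distrib\<close>)
    also have "\<dots> = (\<integral>x. indicator (slab e) x * seg_integral (\<lambda>t. f (x + t *\<^sub>R e)) (b x) (\<beta> k x) \<partial>lborel)"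
      unfolding ind seg_integral_def ..
    also have "\<dots> / s k = (\<integral>x. indicator (slab e) x * J k x \<partial>lborel)"
      by (subst integral_divide_zero[symmetric]) (simp add: J_def)
    also have "\<dots> = (\<integral>x. indicator (slab e) x * J k x \<partial>lebesgue)"
    proof (rule integral_completion[symmetric])
      show "(\<lambda>x. indicator (slab e) x * J k x) \<in> borel_measurable lborel"
        unfolding J_def seg_integral_def ind[symmetric] by measurable
    qed
    finally show ?thesis .
  qed
  have Jm: "(\<lambda>x. indicator (slab e) x * J k x) \<in> borel_measurable lebesgue" for k
    unfolding J_def seg_integral_def ind[symmetric] by (rule measurable_completion) measurable
  \<comment> \<open>By the Lipschitz bound the layer between the graph and its translate has
    thickness of the order of the step, so the quotients \<open>J k\<close> stay bounded.\<close>
  have bd: "\<bar>\<beta> k x - b x\<bar> \<le> s k * ((C + 1) * norm v)" for k x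
  proof -
    have "\<bar>\<phi> (x - s k *\<^sub>R v) - \<phi> x\<bar> \<le> C * norm (s k *\<^sub>R v)" using \<phi>_lip[of "x - s k *\<^sub>R v" x] by simp
    moreover have "\<bar>v \<bullet> e\<bar> \<le> norm v" using Cauchy_Schwarz_ineq2[of v e] e by simp
    then have "\<bar>s k * (v \<bullet> e)\<bar> \<le> s k * norm v" using s[of k] by (simp add: abs_mult)
    ultimately show ?thesis unfolding \<beta>_def b_def using s[of k] by (simp add: algebra_simps)
  qed
  have Jb: "\<bar>indicator (slab e) x * J k x\<bar> \<le> indicator (cball 0 (2 * R + 1)) x *\<^sub>R ((C + 1) * norm v * B)" for k x
  proof (cases "x \<in> slab e \<and> x \<in> cball 0 (2 * R + 1)")
    case True
    have "\<bar>seg_integral (\<lambda>t. f (x + t *\<^sub>R e)) (b x) (\<beta> k x)\<bar> \<le> \<bar>\<beta> k x - b x\<bar> * B"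
      by (rule seg_integral_bound[OF fc _ B(1)]) (use B(2) in auto)
    also have "\<dots> \<le> (s k * ((C + 1) * norm v)) * B" by (intro mult_right_mono bd B)
    finally have "\<bar>J k x\<bar> \<le> (C + 1) * norm v * B" unfolding J_def using s[of k] by (simp add: abs_div divide_le_eq mult_ac)
    then show ?thesis using True by (simp add: abs_mult)
  next
    case False
    show ?thesis
    proof (cases "x \<in> slab e")
      case True
      then have "f (x + t *\<^sub>R e) = 0" for t
        using False slab_bounded[OF True, of t R] fR[of "x + t *\<^sub>R e"] by fastforce
      then have "J k x = 0" by (simp add: J_def seg_integral_def)
      then show ?thesis using C_nonneg B(1) by (simp add: indicator_def)
    qed (use C_nonneg B(1) in \<open>simp add: indicator_def\<close>)
  qed
  have Jlim: "AE x in lebesgue. (\<lambda>k. J k x) \<longlonglongrightarrow> f (gp x) * (e \<bullet> v - grad \<phi> x \<bullet> v)"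
    using D
  proof eventually_elim
    case (elim x)
    let ?g = "\<lambda>t. f (x + t *\<^sub>R e)"
    show ?case
    \<comment> \<open>Differentiability of \<open>\<phi>\<close> is given only where the graph point
      lies in K. Elsewhere f vanishes near that point, and \<open>J k x\<close> is 0 as soon as the
      layer is thin enough.\<close>
    proof (cases "gp x \<in> K")
      case True
      then obtain D where "GDERIV \<phi> x :> D" using elim by blast
      then have d: "(\<phi> has_derivative (\<lambda>v. D \<bullet> v)) (at x)" and g: "grad \<phi> x = D" using gderiv_facts(1) by (auto simp: gderiv_def inner_commute)
      have 1: "((\<lambda>t. x - t *\<^sub>R v) has_derivative (\<lambda>t. - (t *\<^sub>R v))) (at 0)" by (auto intro!: derivative_eq_intros)
      have "((\<lambda>t. \<phi> (x - t *\<^sub>R v)) has_derivative (\<lambda>t. D \<bullet> (- (t *\<^sub>R v)))) (at 0)"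
        using has_derivative_compose[OF 1, of \<phi> "\<lambda>v. D \<bullet> v"] d by simp
      then have "((\<lambda>t. \<phi> (x - t *\<^sub>R v)) has_derivative (\<lambda>t. (- (D \<bullet> v)) * t)) (at 0)" by (simp add: mult.commute)
      then have 2: "((\<lambda>t. \<phi> (x - t *\<^sub>R v)) has_real_derivative - (D \<bullet> v)) (at 0)"
        by (rule has_derivative_imp_has_field_derivative) simp
      have 3: "((\<lambda>t. \<phi> (x - t *\<^sub>R v) + t * (v \<bullet> e) - x \<bullet> e) has_real_derivative (v \<bullet> e - D \<bullet> v)) (at 0)"
        by (rule derivative_eq_intros 2 refl | simp)+
      have 4: "((\<lambda>b'. seg_integral ?g (b x) b') has_real_derivative ?g (b x)) (at (\<phi> (x - 0 *\<^sub>R v) + 0 * (v \<bullet> e) - x \<bullet> e))"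
        using seg_integral_deriv[OF fc] by (simp add: b_def)
      \<comment> \<open>The chain rule combines the derivative of the oriented integral in its
        endpoint with the speed at which the translated graph moves along e.\<close>
      have "((\<lambda>t. seg_integral ?g (b x) (\<phi> (x - t *\<^sub>R v) + t * (v \<bullet> e) - x \<bullet> e)) has_real_derivative ?g (b x) * (v \<bullet> e - D \<bullet> v)) (at 0)"
        using DERIV_chain2[OF 4 3] .
      then have "((\<lambda>t. seg_integral ?g (b x) (\<phi> (x - t *\<^sub>R v) + t * (v \<bullet> e) - x \<bullet> e) / t) \<longlongrightarrow> ?g (b x) * (v \<bullet> e - D \<bullet> v)) (at 0)"
        unfolding DERIV_def by (simp add: b_def[symmetric] seg_integral_def)
      moreover have "filterlim s (at 0) sequentially"
        by (rule filterlim_atI) (use LIMSEQ_inverse_real_of_nat in \<open>auto simp: inverse_eq_divide s_def[abs_def]\<close>)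
      ultimately have "(\<lambda>k. J k x) \<longlonglongrightarrow> ?g (b x) * (v \<bullet> e - D \<bullet> v)"
        unfolding J_def \<beta>_def by (rule filterlim_compose)
      then show ?thesis by (simp add: gpb g inner_commute)
    next
      case False
      have op: "open ((\<lambda>t. x + t *\<^sub>R e) -` (- K))"
        by (rule open_vimage) (use fK in \<open>auto intro!: continuous_intros\<close>)
      have bx: "b x \<in> (\<lambda>t. x + t *\<^sub>R e) -` (- K)" using False by (simp add: gpb)
      obtain d where d: "d > 0" "\<And>t. \<bar>t - b x\<bar> < d \<Longrightarrow> ?g t = 0"
      proof -
        obtain d where "d > 0" "\<And>t. dist t (b x) < d \<Longrightarrow> t \<in> (\<lambda>t. x + t *\<^sub>R e) -` (- K)"
          using op bx unfolding open_dist by blast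
        then show ?thesis using that[of d] fK(2) by (simp add: dist_real_def)
      qed
      have "(\<lambda>k. s k * ((C + 1) * norm v)) \<longlonglongrightarrow> 0 * ((C + 1) * norm v)"
        by (intro tendsto_intros) (use LIMSEQ_inverse_real_of_nat in \<open>auto simp: inverse_eq_divide s_def[abs_def]\<close>)
      then have "\<forall>\<^sub>F k in sequentially. s k * ((C + 1) * norm v) < d" using d(1) by (intro order_tendstoD) auto
      then have "\<forall>\<^sub>F k in sequentially. J k x = 0"
      proof eventually_elim
        case (elim k)
        have "\<bar>seg_integral ?g (b x) (\<beta> k x)\<bar> \<le> \<bar>\<beta> k x - b x\<bar> * 0"
        proof (rule seg_integral_bound[OF fc])
          fix t assume "min (b x) (\<beta> k x) \<le> t" "t \<le> max (b x) (\<beta> k x)"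
          then have "\<bar>t - b x\<bar> \<le> \<bar>\<beta> k x - b x\<bar>" by (auto simp: min_def max_def split: if_splits)
          then show "\<bar>?g t\<bar> \<le> 0" using d(2)[of t] bd[of k x] elim by simp
        qed simp
        then show ?case by (simp add: J_def)
      qed
      then have "(\<lambda>k. J k x) \<longlonglongrightarrow> 0" by (rule tendsto_eventually)
      then show ?thesis using fK(2)[OF False] by simp
    qed
  qed
  have Llim: "AE x in lebesgue. (\<lambda>k. indicator (slab e) x * J k x) \<longlonglongrightarrow> indicator (slab e) x * (f (gp x) * (e \<bullet> v - grad \<phi> x \<bullet> v))"
    using Jlim by eventually_elim (intro tendsto_mult tendsto_const)
  \<comment> \<open>The integrand contains \<open>grad \<phi>\<close>, a choice without evident
    measurability; it is measurable as an almost everywhere limit with respect to a complete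
    measure.\<close>
  have Lm: "(\<lambda>x. indicator (slab e) x * (f (gp x) * (e \<bullet> v - grad \<phi> x \<bullet> v))) \<in> borel_measurable lebesgue"
  proof (rule borel_measurable_AE)
    show "(\<lambda>x. lim (\<lambda>k. indicator (slab e) x * J k x)) \<in> borel_measurable lebesgue"
      by (rule borel_measurable_lim_metric) (rule Jm)
    show "AE x in lebesgue. lim (\<lambda>k. indicator (slab e) x * J k x) = indicator (slab e) x * (f (gp x) * (e \<bullet> v - grad \<phi> x \<bullet> v))"
      using Llim by eventually_elim (rule limI)
  qed
  have "(\<lambda>k. \<integral>x. indicator (slab e) x * J k x \<partial>lebesgue) \<longlonglongrightarrow> (\<integral>x. indicator (slab e) x * (f (gp x) * (e \<bullet> v - grad \<phi> x \<bullet> v)) \<partial>lebesgue)"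
  proof (rule integral_dominated_convergence[OF Lm Jm _ Llim])
    show "integrable lebesgue (\<lambda>x::real^'d. indicator (cball 0 (2 * R + 1)) x *\<^sub>R ((C + 1) * norm v * B))"
      by (rule integrable_indicator) (use emeasure_bounded_finite[OF bounded_cball] in auto)
    show "AE x in lebesgue. norm (indicator (slab e) x * J k x) \<le> indicator (cball 0 (2 * R + 1)) x *\<^sub>R ((C + 1) * norm v * B)" for k
      using Jb by (intro AE_I2) (simp only: real_norm_def)
  qed
  moreover have "(\<lambda>k. \<integral>x. indicator (slab e) x * J k x \<partial>lebesgue) \<longlonglongrightarrow> (\<integral>x. indicator sub x * (grad f x \<bullet> v) \<partial>lborel)"
    unfolding quot[symmetric] s_def by (rule C1_diff_quotient_integral[OF f fR]) auto
  ultimately show ?thesis by (rule LIMSEQ_unique[symmetric])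
qed

end

section \<open>Boundary charts\<close>

locale boundary_chart = lipschitz_graph e \<phi> C
  for e :: "real^'d" and \<phi> C +
  fixes \<Omega> :: "(real^'d) set" and \<sigma> :: "(real^'d) measure" and n :: "real^'d \<Rightarrow> real^'d" and x0 :: "real^'d" and r :: real
  assumes r: "r > 0" and \<Omega>_ball: "\<Omega> \<inter> ball x0 r = {y \<in> ball x0 r. y \<bullet> e < \<phi> y}" and \<Omega>_open: "open \<Omega>"
    and sets_\<sigma>: "sets \<sigma> = sets borel" and null_\<sigma>: "emeasure \<sigma> (- frontier \<Omega>) = 0"
    and surface: "\<And>A. A \<in> sets borel \<Longrightarrow> A \<subseteq> frontier \<Omega> \<inter> ball x0 r \<Longrightarrow> emeasure \<sigma> A =
             (\<integral>\<^sup>+ x. indicator {x. 0 \<le> x \<bullet> e \<and> x \<bullet> e \<le> 1 \<and> graph_point e \<phi> x \<in> A} x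
                    * ennreal (sqrt (1 + (norm (grad \<phi> x))\<^sup>2)) \<partial>lebesgue)"
    and n_borel: "n \<in> borel_measurable borel"
    and normal: "AE x in lebesgue. graph_point e \<phi> x \<in> ball x0 r \<longrightarrow>
           (\<exists>D. GDERIV \<phi> x :> D \<and> n (graph_point e \<phi> x) = (1 / sqrt (1 + (norm D)\<^sup>2)) *\<^sub>R (e - D))"
begin

lemma ball_borel [measurable]: "ball x0 r \<in> sets borel"
  by simp

text \<open>A graph point satisfies the defining inequality with equality, so it is outside
  \<open>\<Omega>\<close>, while an arbitrarily small shift along -e enters
  \<open>\<Omega>\<close>.\<close>

lemma gp_frontier:
  assumes g: "gp x \<in> ball x0 r"
  shows "gp x \<in> frontier \<Omega>"
proof -
  have "gp x \<notin> \<Omega>"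
  proof
    assume "gp x \<in> \<Omega>"
    then have "gp x \<in> {y \<in> ball x0 r. y \<bullet> e < \<phi> y}" using \<Omega>_ball g by blast
    then show False by (simp add: gp_inner \<phi>_gp)
  qed
  moreover have "gp x \<in> closure \<Omega>"
  proof (subst closure_approachable, intro allI impI)
    fix \<epsilon> :: real assume "\<epsilon> > 0"
    define \<delta> where "\<delta> = min \<epsilon> (r - dist x0 (gp x)) / 2"
    have \<delta>: "0 < \<delta>" "\<delta> < \<epsilon>" "\<delta> < r - dist x0 (gp x)" using \<open>\<epsilon> > 0\<close> g by (auto simp: \<delta>_def)
    let ?y = "gp x + (- \<delta>) *\<^sub>R e"
    have d: "dist ?y (gp x) = \<delta>" using \<delta> e by (simp add: dist_norm)
    have "dist x0 ?y \<le> dist x0 (gp x) + dist (gp x) ?y" by (rule dist_triangle)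
    then have "?y \<in> ball x0 r" using d \<delta> by (simp add: dist_commute)
    moreover have "?y \<bullet> e < \<phi> ?y" unfolding inv \<phi>_gp using \<delta> by (simp add: inner_simps ee gp_inner)
    ultimately have "?y \<in> \<Omega>" using \<Omega>_ball by blast
    then show "\<exists>y\<in>\<Omega>. dist y (gp x) < \<epsilon>" using d \<delta>(2) by (intro bexI[of _ ?y]) simp
  qed
  ultimately show ?thesis using \<Omega>_open by (simp add: frontier_def interior_open)
qed

text \<open>A Borel version of the area density, as \<open>grad \<phi>\<close> is only almost everywhere a limit of
  difference quotients.\<close>

definition grad_sq :: "real^'d \<Rightarrow> real" where
  "grad_sq x = (\<Sum>i\<in>UNIV. (lim (\<lambda>k. (\<phi> (x + (1 / real (Suc k)) *\<^sub>R axis i 1) - \<phi> x) / (1 / real (Suc k))))\<^sup>2)"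

definition area :: "real^'d \<Rightarrow> real" where
  "area x = indicator (slab e) x * indicator (ball x0 r) (gp x) * sqrt (1 + grad_sq x)"

lemma grad_sq_nonneg: "0 \<le> grad_sq x"
  unfolding grad_sq_def by (intro sum_nonneg) auto

lemma area_nonneg: "0 \<le> area x"
  using grad_sq_nonneg[of x] by (simp add: area_def indicator_def)

lemma grad_sq_borel [measurable]: "grad_sq \<in> borel_measurable borel"
  unfolding grad_sq_def by (intro borel_measurable_sum borel_measurable_power borel_measurable_lim_metric) measurable

lemma area_borel [measurable]: "area \<in> borel_measurable borel"
  unfolding area_def by measurable

lemma grad_sq_eq:
  assumes "GDERIV \<phi> x :> D"
  shows "grad_sq x = (norm D)\<^sup>2"
proof -
  have d: "(\<phi> has_derivative (\<lambda>v. D \<bullet> v)) (at x)" using assms by (simp add: gderiv_def inner_commute)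
  have "lim (\<lambda>k. (\<phi> (x + (1 / real (Suc k)) *\<^sub>R axis i 1) - \<phi> x) / (1 / real (Suc k))) = D $ i" for i
    using limI[OF has_derivative_quotient_sequence[OF d], of "axis i 1"] by (simp add: inner_axis)
  then have "grad_sq x = (\<Sum>i\<in>UNIV. (D $ i)\<^sup>2)" by (simp only: grad_sq_def)
  then show ?thesis unfolding power2_norm_eq_inner inner_vec_def by (simp add: power2_eq_square)
qed

lemma normal_AE:
  "AE x in lborel. gp x \<in> ball x0 r \<longrightarrow> (\<exists>D. GDERIV \<phi> x :> D \<and> n (gp x) = (1 / sqrt (1 + (norm D)\<^sup>2)) *\<^sub>R (e - D))"
  using normal by (simp only: AE_completion_iff)

text \<open>The given formula concerns subsets of the frontier. The remaining part of the set is
  null, graph points in the ball lie on the frontier, and \<open>area\<close> agrees with the given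
  density wherever \<open>\<phi>\<close> is differentiable.\<close>

lemma \<sigma>_eq:
  assumes A[measurable]: "A \<in> sets borel"
  shows "emeasure \<sigma> (A \<inter> ball x0 r) = (\<integral>\<^sup>+x. ennreal (area x) * indicator A (gp x) \<partial>lborel)"
proof -
  have fr: "frontier \<Omega> \<in> sets borel" by (rule borel_closed) (rule frontier_closed)
  let ?A = "A \<inter> ball x0 r \<inter> frontier \<Omega>"
  have N: "A \<inter> ball x0 r - frontier \<Omega> \<in> null_sets \<sigma>"
    by (rule null_sets_subset[of "- frontier \<Omega>"]) (use null_\<sigma> fr sets_\<sigma> in \<open>auto simp: null_sets_def\<close>)
  have "emeasure \<sigma> (A \<inter> ball x0 r) = emeasure \<sigma> ((A \<inter> ball x0 r) - (A \<inter> ball x0 r - frontier \<Omega>))"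
    by (rule emeasure_Diff_null_set[symmetric, OF N]) (simp add: sets_\<sigma>)
  also have "(A \<inter> ball x0 r) - (A \<inter> ball x0 r - frontier \<Omega>) = ?A" by blast
  also have "emeasure \<sigma> ?A = (\<integral>\<^sup>+ x. indicator {x. 0 \<le> x \<bullet> e \<and> x \<bullet> e \<le> 1 \<and> graph_point e \<phi> x \<in> ?A} x
                    * ennreal (sqrt (1 + (norm (grad \<phi> x))\<^sup>2)) \<partial>lebesgue)"
    by (rule surface) (use fr in auto)
  also have "\<dots> = (\<integral>\<^sup>+ x. indicator {x. 0 \<le> x \<bullet> e \<and> x \<bullet> e \<le> 1 \<and> graph_point e \<phi> x \<in> ?A} x
                    * ennreal (sqrt (1 + (norm (grad \<phi> x))\<^sup>2)) \<partial>lborel)"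
    by (rule nn_integral_completion)
  also have "\<dots> = (\<integral>\<^sup>+x. ennreal (area x) * indicator A (gp x) \<partial>lborel)"
  proof (rule nn_integral_cong_AE)
    show "AE x in lborel. indicator {x. 0 \<le> x \<bullet> e \<and> x \<bullet> e \<le> 1 \<and> graph_point e \<phi> x \<in> ?A} x
                    * ennreal (sqrt (1 + (norm (grad \<phi> x))\<^sup>2)) = ennreal (area x) * indicator A (gp x)"
      using normal_AE
    proof eventually_elim
      case (elim x)
      show ?case
      proof (cases "gp x \<in> ball x0 r")
        case True
        then obtain D where "GDERIV \<phi> x :> D" using elim by blast
        then have "grad_sq x = (norm (grad \<phi> x))\<^sup>2" using grad_sq_eq gderiv_facts(1) by auto
        then show ?thesis using True gp_frontier[OF True] by (auto simp: area_def indicator_def slab_def)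
      qed (auto simp: area_def indicator_def)
    qed
  qed
  finally show ?thesis .
qed

text \<open>Identifying the restricted surface measure as the image of a density under the graph map
  makes the general transformation formula for integrals available.\<close>

lemma \<sigma>_ball_eq: "density \<sigma> (indicator (ball x0 r)) = distr (density lborel (\<lambda>x. ennreal (area x))) borel gp"
proof (rule measure_eqI)
  show "sets (density \<sigma> (indicator (ball x0 r))) = sets (distr (density lborel (\<lambda>x. ennreal (area x))) borel gp)"
    by (simp add: sets_\<sigma>)
  fix A assume "A \<in> sets (density \<sigma> (indicator (ball x0 r)))"
  then have A[measurable]: "A \<in> sets borel" by (simp add: sets_\<sigma>)
  note [measurable_cong] = sets_\<sigma>
  have "emeasure (density \<sigma> (indicator (ball x0 r))) A = (\<integral>\<^sup>+x. indicator (A \<inter> ball x0 r) x \<partial>\<sigma>)"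
  proof (subst emeasure_density)
    show "indicator (ball x0 r) \<in> borel_measurable \<sigma>" by (rule borel_measurable_indicator) (simp add: sets_\<sigma>)
    show "A \<in> sets \<sigma>" by (simp add: sets_\<sigma>)
    show "(\<integral>\<^sup>+x. indicator (ball x0 r) x * indicator A x \<partial>\<sigma>) = (\<integral>\<^sup>+x. indicator (A \<inter> ball x0 r) x \<partial>\<sigma>)"
      by (simp only: indicator_inter_arith mult.commute)
  qed
  also have "\<dots> = emeasure \<sigma> (A \<inter> ball x0 r)" by (rule nn_integral_indicator) (simp add: sets_\<sigma>)
  also have "\<dots> = (\<integral>\<^sup>+x. ennreal (area x) * indicator A (gp x) \<partial>lborel)" by (rule \<sigma>_eq[OF A])
  also have "\<dots> = (\<integral>\<^sup>+x. ennreal (area x) * indicator (gp -` A) x \<partial>lborel)" by (simp add: indicator_def)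
  also have "\<dots> = emeasure (distr (density lborel (\<lambda>x. ennreal (area x))) borel gp) A"
  proof -
    have "gp -` A \<in> sets borel" using measurable_sets[OF gp_borel A] by simp
    then show ?thesis by (subst emeasure_distr) (auto simp: emeasure_density)
  qed
  finally show "emeasure (density \<sigma> (indicator (ball x0 r))) A = emeasure (distr (density lborel (\<lambda>x. ennreal (area x))) borel gp) A" .
qed

lemma \<sigma>_integral:
  fixes h :: "real^'d \<Rightarrow> real"
  assumes [measurable]: "h \<in> borel_measurable borel" and z: "\<And>y. y \<notin> ball x0 r \<Longrightarrow> h y = 0"
  shows "(\<integral>y. h y \<partial>\<sigma>) = (\<integral>x. area x * h (gp x) \<partial>lborel)"
proof -
  have hm: "h \<in> borel_measurable \<sigma>" by (simp add: measurable_cong_sets[OF sets_\<sigma> refl])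
  have bm: "(\<lambda>x. indicator (ball x0 r) x :: real) \<in> borel_measurable \<sigma>"
    by (rule borel_measurable_indicator) (simp add: sets_\<sigma>)
  have "(\<integral>y. h y \<partial>\<sigma>) = (\<integral>y. indicator (ball x0 r) y *\<^sub>R h y \<partial>\<sigma>)"
    by (intro Bochner_Integration.integral_cong refl) (use z in \<open>auto simp: indicator_def\<close>)
  also have "\<dots> = (\<integral>y. h y \<partial>density \<sigma> (\<lambda>x. ennreal (indicator (ball x0 r) x)))"
    by (rule integral_density[symmetric, OF hm bm]) simp
  also have "(\<lambda>x. ennreal (indicator (ball x0 r) x)) = indicator (ball x0 r)" by (auto simp: indicator_def fun_eq_iff)
  also have "(\<integral>y. h y \<partial>density \<sigma> (indicator (ball x0 r))) = (\<integral>x. h (gp x) \<partial>density lborel (\<lambda>x. ennreal (area x)))"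
    unfolding \<sigma>_ball_eq by (rule integral_distr) simp_all
  also have "\<dots> = (\<integral>x. area x *\<^sub>R h (gp x) \<partial>lborel)"
    by (rule integral_density) (simp_all add: area_nonneg)
  finally show ?thesis by simp
qed

lemma \<sigma>_AE:
  assumes P[measurable]: "{y. P y} \<in> sets borel" and ae: "AE x in lborel. gp x \<in> ball x0 r \<longrightarrow> P (gp x)"
  shows "AE y in \<sigma>. y \<in> ball x0 r \<longrightarrow> P y"
proof -
  have m: "- {y. P y} \<in> sets borel" using P by (rule borel_comp)
  have "emeasure \<sigma> (- {y. P y} \<inter> ball x0 r) = (\<integral>\<^sup>+x. ennreal (area x) * indicator (- {y. P y}) (gp x) \<partial>lborel)"
    by (rule \<sigma>_eq[OF m])
  also have "\<dots> = (\<integral>\<^sup>+x. 0 \<partial>(lborel :: (real^'d) measure))"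
  proof (rule nn_integral_cong_AE)
    show "AE x in lborel. ennreal (area x) * indicator (- {y. P y}) (gp x) = 0"
      using ae by eventually_elim (auto simp: area_def indicator_def)
  qed
  finally have "- {y. P y} \<inter> ball x0 r \<in> null_sets \<sigma>" using m by (auto simp: null_sets_def sets_\<sigma>)
  from AE_not_in[OF this] show ?thesis by eventually_elim auto
qed

text \<open>The inner product with e is the reciprocal of the area factor, which the Lipschitz
  constant bounds. This uniform positivity is the source of a transversal field.\<close>

lemma normal_facts: "AE y in \<sigma>. y \<in> ball x0 r \<longrightarrow> norm (n y) = 1 \<and> 1 / sqrt (1 + C\<^sup>2) \<le> n y \<bullet> e"
proof (rule \<sigma>_AE)
  note [measurable] = n_borel
  show "{y. norm (n y) = 1 \<and> 1 / sqrt (1 + C\<^sup>2) \<le> n y \<bullet> e} \<in> sets borel"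
    by measurable
  show "AE x in lborel. gp x \<in> ball x0 r \<longrightarrow> norm (n (gp x)) = 1 \<and> 1 / sqrt (1 + C\<^sup>2) \<le> n (gp x) \<bullet> e"
    using normal_AE
  proof eventually_elim
    case (elim x)
    show ?case
    proof
      assume "gp x \<in> ball x0 r"
      then obtain D where D: "GDERIV \<phi> x :> D" and n: "n (gp x) = (1 / sqrt (1 + (norm D)\<^sup>2)) *\<^sub>R (e - D)" using elim by blast
      have pos: "0 < sqrt (1 + (norm D)\<^sup>2)" by (simp add: add_pos_nonneg)
      have "norm (n (gp x)) = 1" unfolding n norm_scaleR gderiv_facts(4)[OF D] using pos by simp
      moreover have "n (gp x) \<bullet> e = 1 / sqrt (1 + (norm D)\<^sup>2)" unfolding n using gderiv_facts(2)[OF D] by (simp add: inner_simps ee)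
      moreover have "1 / sqrt (1 + C\<^sup>2) \<le> 1 / sqrt (1 + (norm D)\<^sup>2)"
        using gderiv_facts(3)[OF D] pos
        by (intro divide_left_mono real_sqrt_le_mono add_left_mono power_mono mult_pos_pos)
          (auto simp: add_pos_nonneg)
      ultimately show "norm (n (gp x)) = 1 \<and> 1 / sqrt (1 + C\<^sup>2) \<le> n (gp x) \<bullet> e" by simp
    qed
  qed
qed

lemma \<sigma>_ball_finite: "emeasure \<sigma> (ball x0 r) < \<infinity>"
proof -
  let ?R = "norm x0 + r"
  have "emeasure \<sigma> (ball x0 r) = (\<integral>\<^sup>+x. ennreal (area x) \<partial>lborel)" using \<sigma>_eq[of UNIV] by simp
  also have "\<dots> \<le> (\<integral>\<^sup>+x. ennreal (sqrt (1 + C\<^sup>2)) * indicator (cball 0 (2 * ?R + 1)) x \<partial>(lborel :: (real^'d) measure))"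
  proof (rule nn_integral_mono_AE)
    show "AE x in lborel. ennreal (area x) \<le> ennreal (sqrt (1 + C\<^sup>2)) * indicator (cball 0 (2 * ?R + 1)) x"
      using normal_AE
    proof eventually_elim
      case (elim x)
      show ?case
      proof (cases "x \<in> slab e \<and> gp x \<in> ball x0 r")
        case True
        then obtain D where D: "GDERIV \<phi> x :> D" using elim by blast
        have "grad_sq x \<le> C\<^sup>2" unfolding grad_sq_eq[OF D] using gderiv_facts(3)[OF D] by (intro power_mono) auto
        then have "area x \<le> sqrt (1 + C\<^sup>2)" using True by (simp add: area_def)
        moreover have "x \<in> cball 0 (2 * ?R + 1)"
        proof -
          have "gp x \<in> cball 0 ?R" using True norm_triangle_sub[of "gp x" x0] by (simp add: dist_norm norm_minus_commute)
          then show ?thesis using slab_bounded[of x "\<phi> x - x \<bullet> e" ?R] True by (simp add: graph_point_def)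
        qed
        ultimately show ?thesis by (simp add: ennreal_leI)
      qed (auto simp: area_def indicator_def)
    qed
  qed
  also have "\<dots> = ennreal (sqrt (1 + C\<^sup>2)) * emeasure lborel (cball (0::real^'d) (2 * ?R + 1))"
    by (rule nn_integral_cmult_indicator) simp
  also have "\<dots> < \<infinity>"
    using emeasure_bounded_finite[OF bounded_cball, of "0::real^'d" "2 * ?R + 1"] by (simp add: ennreal_mult_less_top)
  finally show ?thesis .
qed

text \<open>In the ball \<open>\<Omega>\<close> is the subgraph, and both integrands vanish outside
  it. On the graph, the factor sqrt (1 + |D|^2) in \<open>area\<close> cancels the normalisation of
  n and leaves e - D, the vector in the boundary term for the subgraph.\<close>

lemma local_gauss:
  fixes f :: "real^'d \<Rightarrow> real"
  assumes f: "Ck 1 f" and r': "r' < r" and z: "\<And>x. x \<notin> cball x0 r' \<Longrightarrow> f x = 0"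
  shows "(\<integral>x. grad f x \<bullet> v \<partial>lebesgue_on \<Omega>) = (\<integral>y. f y * (n y \<bullet> v) \<partial>\<sigma>)"
proof -
  note [measurable] = n_borel C1_borel[OF f] C1_grad_borel[OF f]
  have zR: "f x = 0" if "x \<notin> cball 0 (norm x0 + r')" for x
    using that norm_triangle_sub[of x x0] by (intro z) (auto simp: dist_norm norm_minus_commute)
  have gz: "grad f x = 0" if "x \<notin> ball x0 r" for x
  proof -
    have "grad f x = grad (\<lambda>x. 0) x"
    proof (rule grad_cong_open[where S="- cball x0 r'"])
      show "x \<in> - cball x0 r'" using that r' by auto
      show "0 = f y" if "y \<in> - cball x0 r'" for y using z[of y] that by (simp del: mem_cball)
    qed auto
    then show ?thesis by simp
  qed
  have fz: "f y = 0" if "y \<notin> ball x0 r" for y using that r' by (intro z) auto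
  have "(\<integral>x. grad f x \<bullet> v \<partial>lebesgue_on \<Omega>) = (\<integral>x. indicator \<Omega> x *\<^sub>R (grad f x \<bullet> v) \<partial>lborel)"
    by (rule lebesgue_on_integral) (use \<Omega>_open in auto)
  also have "\<dots> = (\<integral>x. indicator sub x * (grad f x \<bullet> v) \<partial>lborel)"
  proof (intro Bochner_Integration.integral_cong refl)
    fix x
    show "indicator \<Omega> x *\<^sub>R (grad f x \<bullet> v) = indicator sub x * (grad f x \<bullet> v)"
    proof (cases "x \<in> ball x0 r")
      case True
      then have "x \<in> \<Omega> \<longleftrightarrow> x \<in> sub" using \<Omega>_ball unfolding sub_def by blast
      then show ?thesis by (simp add: indicator_def)
    qed (simp add: gz)
  qed
  also have "\<dots> = (\<integral>x. indicator (slab e) x * (f (gp x) * (e \<bullet> v - grad \<phi> x \<bullet> v)) \<partial>lebesgue)"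
  proof (rule graph_gauss[OF f zR closed_cball z])
    show "AE x in lebesgue. gp x \<in> cball x0 r' \<longrightarrow> (\<exists>D. GDERIV \<phi> x :> D)"
      using normal by eventually_elim (use r' in auto)
  qed
  also have "\<dots> = (\<integral>x. area x * (f (gp x) * (n (gp x) \<bullet> v)) \<partial>lebesgue)"
  proof -
    have m: "(\<lambda>x. area x * (f (gp x) * (n (gp x) \<bullet> v))) \<in> borel_measurable lebesgue"
      by (rule measurable_completion) measurable
    have ae: "AE x in lebesgue. area x * (f (gp x) * (n (gp x) \<bullet> v)) = indicator (slab e) x * (f (gp x) * (e \<bullet> v - grad \<phi> x \<bullet> v))"
      using normal
    proof eventually_elim
      case (elim x)
      show ?case
      proof (cases "gp x \<in> ball x0 r")
        case True
        then obtain D where D: "GDERIV \<phi> x :> D" and n: "n (gp x) = (1 / sqrt (1 + (norm D)\<^sup>2)) *\<^sub>R (e - D)" using elim by blast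
        have pos: "0 < sqrt (1 + (norm D)\<^sup>2)" by (simp add: add_pos_nonneg)
        have "sqrt (1 + (norm D)\<^sup>2) * (n (gp x) \<bullet> v) = e \<bullet> v - D \<bullet> v" unfolding n using pos by (simp add: inner_simps)
        then have "f (gp x) * (sqrt (1 + (norm D)\<^sup>2) * (n (gp x) \<bullet> v)) = f (gp x) * (e \<bullet> v - D \<bullet> v)" by simp
        then show ?thesis using True gderiv_facts(1)[OF D] grad_sq_eq[OF D] by (simp add: area_def mult_ac)
      qed (simp add: fz)
    qed
    show ?thesis
      by (rule integral_cong_AE[symmetric, OF m borel_measurable_AE[OF m ae] ae])
  qed
  also have "\<dots> = (\<integral>x. area x * (f (gp x) * (n (gp x) \<bullet> v)) \<partial>lborel)"
    by (rule integral_completion) measurable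
  also have "\<dots> = (\<integral>y. f y * (n y \<bullet> v) \<partial>\<sigma>)"
    by (rule \<sigma>_integral[symmetric]) (measurable, simp add: fz)
  finally show ?thesis .
qed

end

section \<open>Gauss's theorem\<close>

locale lip_dom =
  fixes \<Omega> :: "(real^'d) set" and \<sigma> :: "(real^'d) measure" and n :: "real^'d \<Rightarrow> real^'d"
  assumes dom: "lipschitz_domain \<Omega>" and surf: "is_surface_measure \<Omega> \<sigma>" and nor: "is_outward_unit_normal \<Omega> n"
begin

lemma \<Omega>_open: "open \<Omega>" and \<Omega>_bounded: "bounded \<Omega>" and \<Omega>_borel [measurable]: "\<Omega> \<in> sets borel"
  using dom by (auto simp: lipschitz_domain_def)

lemma sets_\<sigma> [measurable_cong]: "sets \<sigma> = sets borel" and null_\<sigma>: "emeasure \<sigma> (- frontier \<Omega>) = 0"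
  using surf by (auto simp: is_surface_measure_def)

lemma space_\<sigma> [simp]: "space \<sigma> = UNIV"
  using sets_eq_imp_space_eq[OF sets_\<sigma>] by simp

lemma borel_\<sigma>: "f \<in> borel_measurable borel \<Longrightarrow> f \<in> borel_measurable \<sigma>"
  by (simp add: measurable_cong_sets[OF sets_\<sigma> refl])

lemma n_borel [measurable]: "n \<in> borel_measurable borel"
  using nor by (simp add: is_outward_unit_normal_def)

lemma AE_frontier: "AE y in \<sigma>. y \<in> frontier \<Omega>"
proof -
  have "- frontier \<Omega> \<in> null_sets \<sigma>"
    using null_\<sigma> by (auto simp: null_sets_def sets_\<sigma> intro!: borel_comp borel_closed frontier_closed)
  from AE_not_in[OF this] show ?thesis by simp
qed

lemma chart_boundary_chart:
  assumes "lipschitz_chart \<Omega> x0 r e \<phi>"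
  obtains C where "boundary_chart e \<phi> C \<Omega> \<sigma> n x0 r"
proof -
  from assms obtain C where "r > 0" "norm e = 1" "C-lipschitz_on UNIV \<phi>"
    "\<And>x t. \<phi> (x + t *\<^sub>R e) = \<phi> x" "\<Omega> \<inter> ball x0 r = {y \<in> ball x0 r. y \<bullet> e < \<phi> y}"
    unfolding lipschitz_chart_def by blast
  then have "boundary_chart e \<phi> C \<Omega> \<sigma> n x0 r"
    using surf nor assms unfolding is_surface_measure_def is_outward_unit_normal_def
    by unfold_locales (blast intro: \<Omega>_open)+
  then show ?thesis by (rule that)
qed

text \<open>Interior and boundary points are given one common form, so that a single partition of
  unity on the closure suffices. A ball inside \<open>\<Omega>\<close> is null for
  \<open>\<sigma>\<close>, and Gauss's formula there says that both sides are zero.\<close>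

lemma local_data:
  assumes x0: "x0 \<in> closure \<Omega>"
  shows "\<exists>r>0. \<exists>e. \<exists>c>0. emeasure \<sigma> (ball x0 r) < \<infinity> \<and> (AE y in \<sigma>. y \<in> ball x0 r \<longrightarrow> norm (n y) = 1 \<and> c \<le> n y \<bullet> e) \<and>
    (\<forall>f r' v. Ck 1 f \<longrightarrow> r' < r \<longrightarrow> (\<forall>x. x \<notin> cball x0 r' \<longrightarrow> f x = 0) \<longrightarrow>
       (\<integral>x. grad f x \<bullet> v \<partial>lebesgue_on \<Omega>) = (\<integral>y. f y * (n y \<bullet> v) \<partial>\<sigma>))"
proof (cases "x0 \<in> \<Omega>")
  case True
  then obtain r where r: "r > 0" "ball x0 r \<subseteq> \<Omega>" using \<Omega>_open by (auto simp: open_contains_ball)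
  have "\<Omega> \<subseteq> - frontier \<Omega>" using \<Omega>_open by (auto simp: frontier_def interior_open)
  then have sub: "ball x0 r \<subseteq> - frontier \<Omega>" using r by blast
  have "- frontier \<Omega> \<in> null_sets \<sigma>"
    using null_\<sigma> by (auto simp: null_sets_def sets_\<sigma> intro!: borel_comp borel_closed frontier_closed)
  then have N: "ball x0 r \<in> null_sets \<sigma>" by (rule null_sets_subset[OF _ _ sub]) (simp add: sets_\<sigma>)
  have N0: "emeasure \<sigma> (ball x0 r) = 0" using N by (simp add: null_sets_def)
  have ae: "AE y in \<sigma>. y \<notin> ball x0 r" by (rule AE_not_in[OF N])
  have gauss: "(\<integral>x. grad f x \<bullet> v \<partial>lebesgue_on \<Omega>) = (\<integral>y. f y * (n y \<bullet> v) \<partial>\<sigma>)"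
    if f: "Ck 1 f" and r': "r' < r" and z: "\<And>x. x \<notin> cball x0 r' \<Longrightarrow> f x = 0" for f r' v
  proof -
    have zR: "f x = 0" if "x \<notin> cball 0 (norm x0 + r')" for x
      using that norm_triangle_sub[of x x0] by (intro z) (auto simp: dist_norm norm_minus_commute)
    have gz: "grad f x = 0" if "x \<notin> \<Omega>" for x
    proof -
      have xz: "x \<notin> cball x0 r'"
      proof
        assume "x \<in> cball x0 r'"
        then have "x \<in> ball x0 r" using r' by simp
        then show False using r(2) that by blast
      qed
      have "grad f x = grad (\<lambda>x. 0) x"
      proof (rule grad_cong_open[where S="- cball x0 r'"])
        show "x \<in> - cball x0 r'" using xz by simp
        show "0 = f y" if "y \<in> - cball x0 r'" for y using z[of y] that by (simp del: mem_cball)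
      qed auto
      then show ?thesis by simp
    qed
    have "(\<integral>x. grad f x \<bullet> v \<partial>lebesgue_on \<Omega>) = (\<integral>x. indicator \<Omega> x *\<^sub>R (grad f x \<bullet> v) \<partial>lborel)"
      by (rule lebesgue_on_integral[OF \<Omega>_borel]) (use C1_grad_borel[OF f] in measurable)
    also have "\<dots> = (\<integral>x. grad f x \<bullet> v \<partial>lborel)"
      by (intro Bochner_Integration.integral_cong refl) (auto simp: indicator_def gz)
    also have "\<dots> = 0" by (rule C1_integral_grad_eq_0[OF f zR])
    also have "0 = (\<integral>y. f y * (n y \<bullet> v) \<partial>\<sigma>)"
    proof -
      have "AE y in \<sigma>. f y * (n y \<bullet> v) = 0"
        using ae
      proof eventually_elim
        case (elim y)
        then have "f y = 0" using r' by (intro z) auto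
        then show ?case by simp
      qed
      then show ?thesis by (simp add: integral_eq_zero_AE)
    qed
    finally show ?thesis .
  qed
  \<comment> \<open>On a null ball the condition on the normal holds vacuously; the direction 0 and
    the constant 1 are placeholders.\<close>
  show ?thesis
    using r N0 ae gauss by (intro exI[of _ r] conjI exI[of _ 0] exI[of _ "1::real"]) (auto elim!: eventually_mono)
next
  case False
  then have "x0 \<in> frontier \<Omega>" using x0 \<Omega>_open by (simp add: frontier_def interior_open)
  then obtain r e \<phi> where "lipschitz_chart \<Omega> x0 r e \<phi>" using dom unfolding lipschitz_domain_def by blast
  then obtain C where "boundary_chart e \<phi> C \<Omega> \<sigma> n x0 r" by (rule chart_boundary_chart)
  then interpret boundary_chart e \<phi> C \<Omega> \<sigma> n x0 r .
  have c: "1 / sqrt (1 + C\<^sup>2) > 0" by (simp add: add_pos_nonneg)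
  show ?thesis
    using r \<sigma>_ball_finite normal_facts local_gauss c by blast
qed

text \<open>Collects the chart information for one finite partition of unity; Gauss's formula is
  recorded for \<open>\<psi> i\<close> times an arbitrary C^1 function, whose support stays well
  inside the i-th ball.\<close>

lemma global_data:
  obtains I :: "(real^'d) set" and \<psi> e c r O' where "finite I" "\<And>i. i \<in> I \<Longrightarrow> Ck 1 (\<psi> i)" "\<And>i x. i \<in> I \<Longrightarrow> (0::real) \<le> \<psi> i x"
    "open O'" "closure \<Omega> \<subseteq> O'" "\<And>x. x \<in> O' \<Longrightarrow> (\<Sum>i\<in>I. \<psi> i x) = 1" "\<And>i x. i \<in> I \<Longrightarrow> \<psi> i x \<noteq> 0 \<Longrightarrow> x \<in> ball i (r i)"
    "\<And>i. i \<in> I \<Longrightarrow> c i > (0::real)" "\<And>i. i \<in> I \<Longrightarrow> emeasure \<sigma> (ball i (r i)) < \<infinity>"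
    "\<And>i. i \<in> I \<Longrightarrow> AE y in \<sigma>. y \<in> ball i (r i) \<longrightarrow> norm (n y) = 1 \<and> c i \<le> n y \<bullet> e i"
    "\<And>i f v. i \<in> I \<Longrightarrow> Ck 1 f \<Longrightarrow> (\<integral>x. grad (\<lambda>x. \<psi> i x * f x) x \<bullet> v \<partial>lebesgue_on \<Omega>) = (\<integral>y. \<psi> i y * f y * (n y \<bullet> v) \<partial>\<sigma>)"
proof -
  have "\<forall>x0\<in>closure \<Omega>. \<exists>r>0. \<exists>e. \<exists>c>0. emeasure \<sigma> (ball x0 r) < \<infinity> \<and> (AE y in \<sigma>. y \<in> ball x0 r \<longrightarrow> norm (n y) = 1 \<and> c \<le> n y \<bullet> e) \<and>
    (\<forall>f r' v. Ck 1 f \<longrightarrow> r' < r \<longrightarrow> (\<forall>x. x \<notin> cball x0 r' \<longrightarrow> f x = 0) \<longrightarrow>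
       (\<integral>x. grad f x \<bullet> v \<partial>lebesgue_on \<Omega>) = (\<integral>y. f y * (n y \<bullet> v) \<partial>\<sigma>))"
    using local_data by blast
  from bchoice[OF this] obtain r where r0: "\<forall>x0\<in>closure \<Omega>. r x0 > 0 \<and> (\<exists>e. \<exists>c>0. emeasure \<sigma> (ball x0 (r x0)) < \<infinity> \<and> (AE y in \<sigma>. y \<in> ball x0 (r x0) \<longrightarrow> norm (n y) = 1 \<and> c \<le> n y \<bullet> e) \<and>
    (\<forall>f r' v. Ck 1 f \<longrightarrow> r' < r x0 \<longrightarrow> (\<forall>x. x \<notin> cball x0 r' \<longrightarrow> f x = 0) \<longrightarrow>
       (\<integral>x. grad f x \<bullet> v \<partial>lebesgue_on \<Omega>) = (\<integral>y. f y * (n y \<bullet> v) \<partial>\<sigma>)))" ..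
  then have r: "\<And>x. x \<in> closure \<Omega> \<Longrightarrow> r x > 0" by blast
  have "\<forall>x0\<in>closure \<Omega>. \<exists>e. \<exists>c>0. emeasure \<sigma> (ball x0 (r x0)) < \<infinity> \<and> (AE y in \<sigma>. y \<in> ball x0 (r x0) \<longrightarrow> norm (n y) = 1 \<and> c \<le> n y \<bullet> e) \<and>
    (\<forall>f r' v. Ck 1 f \<longrightarrow> r' < r x0 \<longrightarrow> (\<forall>x. x \<notin> cball x0 r' \<longrightarrow> f x = 0) \<longrightarrow>
       (\<integral>x. grad f x \<bullet> v \<partial>lebesgue_on \<Omega>) = (\<integral>y. f y * (n y \<bullet> v) \<partial>\<sigma>))" using r0 by blast
  from bchoice[OF this] obtain e where "\<forall>x0\<in>closure \<Omega>. \<exists>c>0. emeasure \<sigma> (ball x0 (r x0)) < \<infinity> \<and> (AE y in \<sigma>. y \<in> ball x0 (r x0) \<longrightarrow> norm (n y) = 1 \<and> c \<le> n y \<bullet> e x0) \<and>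
    (\<forall>f r' v. Ck 1 f \<longrightarrow> r' < r x0 \<longrightarrow> (\<forall>x. x \<notin> cball x0 r' \<longrightarrow> f x = 0) \<longrightarrow>
       (\<integral>x. grad f x \<bullet> v \<partial>lebesgue_on \<Omega>) = (\<integral>y. f y * (n y \<bullet> v) \<partial>\<sigma>))" ..
  from bchoice[OF this] obtain c where D: "\<forall>x0\<in>closure \<Omega>. c x0 > 0 \<and> emeasure \<sigma> (ball x0 (r x0)) < \<infinity> \<and> (AE y in \<sigma>. y \<in> ball x0 (r x0) \<longrightarrow> norm (n y) = 1 \<and> c x0 \<le> n y \<bullet> e x0) \<and>
    (\<forall>f r' v. Ck 1 f \<longrightarrow> r' < r x0 \<longrightarrow> (\<forall>x. x \<notin> cball x0 r' \<longrightarrow> f x = 0) \<longrightarrow>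
       (\<integral>x. grad f x \<bullet> v \<partial>lebesgue_on \<Omega>) = (\<integral>y. f y * (n y \<bullet> v) \<partial>\<sigma>))" ..
  have cO: "compact (closure \<Omega>)" using \<Omega>_bounded by (simp add: compact_closure)
  obtain I \<psi> O' where I: "finite I" "I \<subseteq> closure \<Omega>" and \<psi>: "\<And>i. i \<in> I \<Longrightarrow> Ck 1 (\<psi> i)"
    "\<And>i x. i \<in> I \<Longrightarrow> (0::real) \<le> \<psi> i x" "\<And>i x. i \<in> I \<Longrightarrow> x \<notin> cball i (3/4 * r i) \<Longrightarrow> \<psi> i x = 0"
    and P: "open O'" "closure \<Omega> \<subseteq> O'" "\<And>x. x \<in> O' \<Longrightarrow> (\<Sum>i\<in>I. \<psi> i x) = (1::real)"
    by (rule C1_partition_of_unity[where r=r, OF cO r]) (assumption, rule that)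
  show ?thesis
  proof (rule that[of I \<psi> O' r c e, OF I(1) \<psi>(1,2) P])
    fix i assume i: "i \<in> I"
    then have ri: "r i > 0" and Di: "c i > 0" "emeasure \<sigma> (ball i (r i)) < \<infinity>" "AE y in \<sigma>. y \<in> ball i (r i) \<longrightarrow> norm (n y) = 1 \<and> c i \<le> n y \<bullet> e i"
       "\<And>f r' v. Ck 1 f \<Longrightarrow> r' < r i \<Longrightarrow> (\<forall>x. x \<notin> cball i r' \<longrightarrow> f x = 0) \<Longrightarrow>
       (\<integral>x. grad f x \<bullet> v \<partial>lebesgue_on \<Omega>) = (\<integral>y. f y * (n y \<bullet> v) \<partial>\<sigma>)"
      using I(2) D r by blast+
    show "x \<in> ball i (r i)" if "\<psi> i x \<noteq> 0" for x
    proof -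
      have "x \<in> cball i (3/4 * r i)" using \<psi>(3)[OF i] that by blast
      then show ?thesis using ri by simp
    qed
    show "c i > 0" "emeasure \<sigma> (ball i (r i)) < \<infinity>" "AE y in \<sigma>. y \<in> ball i (r i) \<longrightarrow> norm (n y) = 1 \<and> c i \<le> n y \<bullet> e i"
      by (fact Di)+
    show "(\<integral>x. grad (\<lambda>x. \<psi> i x * f x) x \<bullet> v \<partial>lebesgue_on \<Omega>) = (\<integral>y. \<psi> i y * f y * (n y \<bullet> v) \<partial>\<sigma>)" if f: "Ck 1 f" for f v
      by (rule Di(4)[OF Ck_mult[OF \<psi>(1)[OF i] f], of "3/4 * r i"]) (use ri \<psi>(3)[OF i] in auto)
  qed
qed

text \<open>Where the partition sums to 1 some member is nonzero, so finitely many balls of finite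
  measure cover the frontier; its complement is null.\<close>

lemma \<sigma>_finite: "finite_measure \<sigma>"
proof (rule finite_measureI)
  obtain I :: "(real^'d) set" and \<psi> e c r O' where I: "finite I" "\<And>i x. i \<in> I \<Longrightarrow> (0::real) \<le> \<psi> i x"
    "closure \<Omega> \<subseteq> O'" "\<And>x. x \<in> O' \<Longrightarrow> (\<Sum>i\<in>I. \<psi> i x) = 1" "\<And>i x. i \<in> I \<Longrightarrow> \<psi> i x \<noteq> 0 \<Longrightarrow> x \<in> ball i (r i)"
    "\<And>i. i \<in> I \<Longrightarrow> emeasure \<sigma> (ball i (r i)) < \<infinity>"
    by (rule global_data) (rule that)
  have cov: "frontier \<Omega> \<subseteq> (\<Union>i\<in>I. ball i (r i))"
  proof
    fix x assume "x \<in> frontier \<Omega>"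
    then have "(\<Sum>i\<in>I. \<psi> i x) \<noteq> 0" using I(3,4) by (auto simp: frontier_def)
    then obtain i where "i \<in> I" "\<psi> i x \<noteq> 0" using sum.not_neutral_contains_not_neutral by blast
    then show "x \<in> (\<Union>i\<in>I. ball i (r i))" using I(5) by blast
  qed
  have "emeasure \<sigma> (space \<sigma>) = emeasure \<sigma> (frontier \<Omega> \<union> - frontier \<Omega>)" by (simp add: Un_commute)
  also have "\<dots> \<le> emeasure \<sigma> (frontier \<Omega>) + emeasure \<sigma> (- frontier \<Omega>)"
    by (rule emeasure_subadditive) (auto simp: sets_\<sigma> intro!: borel_comp borel_closed frontier_closed)
  also have "\<dots> \<le> emeasure \<sigma> (\<Union>i\<in>I. ball i (r i))"
    using cov by (simp add: null_\<sigma>) (rule emeasure_mono, auto simp: sets_\<sigma> intro!: borel_open)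
  also have "\<dots> \<le> (\<Sum>i\<in>I. emeasure \<sigma> (ball i (r i)))"
    by (rule emeasure_subadditive_finite[OF I(1)]) (auto simp: sets_\<sigma>)
  also have "\<dots> < \<infinity>" using I(1,6) by (simp add: less_top)
  finally show "emeasure \<sigma> (space \<sigma>) \<noteq> \<infinity>" by simp
qed

lemma normal_unit: "AE y in \<sigma>. norm (n y) = 1"
proof -
  obtain I :: "(real^'d) set" and \<psi> e c r O' where I: "finite I" "\<And>i x. i \<in> I \<Longrightarrow> (0::real) \<le> \<psi> i x"
    "closure \<Omega> \<subseteq> O'" "\<And>x. x \<in> O' \<Longrightarrow> (\<Sum>i\<in>I. \<psi> i x) = 1" "\<And>i x. i \<in> I \<Longrightarrow> \<psi> i x \<noteq> 0 \<Longrightarrow> x \<in> ball i (r i)"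
    "\<And>i. i \<in> I \<Longrightarrow> AE y in \<sigma>. y \<in> ball i (r i) \<longrightarrow> norm (n y) = 1 \<and> (c::_\<Rightarrow>real) i \<le> n y \<bullet> e i"
    by (rule global_data) (rule that)
  have "AE y in \<sigma>. \<forall>i\<in>I. y \<in> ball i (r i) \<longrightarrow> norm (n y) = 1 \<and> c i \<le> n y \<bullet> e i"
    using I(6) by (subst AE_finite_all[OF I(1)]) blast
  with AE_frontier show ?thesis
  proof eventually_elim
    case (elim y)
    then have "(\<Sum>i\<in>I. \<psi> i y) \<noteq> 0" using I(3,4) by (auto simp: frontier_def)
    then obtain i where "i \<in> I" "\<psi> i y \<noteq> 0" using sum.not_neutral_contains_not_neutral by blast
    then show ?case using elim I(5) by blast
  qed
qed

lemma continuous_L2_\<sigma>: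
  fixes f :: "real^'d \<Rightarrow> 'b::euclidean_space"
  assumes f: "continuous_on UNIV f"
  shows "f \<in> L2 \<sigma>"
proof -
  have "bounded (frontier \<Omega>)" 
    by (rule bounded_subset[OF bounded_closure[OF \<Omega>_bounded]]) (simp add: frontier_def)
  then have "compact (frontier \<Omega>)" by (simp add: compact_eq_bounded_closed frontier_closed)
  then have "compact (f ` frontier \<Omega>)"
    by (rule compact_continuous_image[OF continuous_on_subset[OF f subset_UNIV]])
  then obtain B where B: "\<And>x. x \<in> frontier \<Omega> \<Longrightarrow> norm (f x) \<le> B"
    by (meson bounded_iff compact_imp_bounded imageI)
  show ?thesis
  proof (rule bounded_imp_L2[OF \<sigma>_finite])
    show "f \<in> borel_measurable \<sigma>" by (rule borel_\<sigma>[OF borel_measurable_continuous_onI[OF f]])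
    show "AE x in \<sigma>. norm (f x) \<le> B" using AE_frontier by eventually_elim (rule B)
  qed
qed

lemma normal_inner_L2:
  assumes w: "continuous_on UNIV w"
  shows "(\<lambda>y. n y \<bullet> w y) \<in> L2 \<sigma>"
proof (rule L2_dominated[OF _ continuous_L2_\<sigma>[OF w]])
  have [measurable]: "w \<in> borel_measurable borel" by (rule borel_measurable_continuous_onI[OF w])
  show "(\<lambda>y. n y \<bullet> w y) \<in> borel_measurable \<sigma>" by (rule borel_\<sigma>) measurable
  show "AE y in \<sigma>. norm (n y \<bullet> w y) \<le> norm (w y)"
    using normal_unit
  proof eventually_elim
    case (elim y)
    then show ?case using Cauchy_Schwarz_ineq2[of "n y" "w y"] by simp
  qed
qed

lemma continuous_L2_\<Omega>:
  fixes f :: "real^'d \<Rightarrow> 'b::euclidean_space"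
  assumes f: "continuous_on UNIV f"
  shows "f \<in> L2 (lebesgue_on \<Omega>)"
  by (rule continuous_imp_L2[OF \<Omega>_borel \<Omega>_bounded f])

lemma AE_\<Omega>: "AE x in lebesgue_on \<Omega>. x \<in> \<Omega>"
  by (rule AE_I2) (simp add: space_restrict_space)

text \<open>The local formulas are added. As the partition sums to 1 on an open set around the
  closure, the gradients of the products add up to that of f on \<open>\<Omega>\<close>, and the
  boundary integrands add up on the frontier.\<close>

lemma gauss:
  assumes f: "Ck 1 f"
  shows "(\<integral>x. grad f x \<bullet> v \<partial>lebesgue_on \<Omega>) = (\<integral>y. f y * (n y \<bullet> v) \<partial>\<sigma>)"
proof -
  obtain I :: "(real^'d) set" and \<psi> e c r O' where I: "finite I" and \<psi>: "\<And>i. i \<in> I \<Longrightarrow> Ck 1 (\<psi> i)"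
    and P: "open O'" "closure \<Omega> \<subseteq> O'" "\<And>x. x \<in> O' \<Longrightarrow> (\<Sum>i\<in>I. \<psi> i x) = (1::real)"
    and G: "\<And>i f v. i \<in> I \<Longrightarrow> Ck 1 f \<Longrightarrow> (\<integral>x. grad (\<lambda>x. \<psi> i x * f x) x \<bullet> v \<partial>lebesgue_on \<Omega>) = (\<integral>y. \<psi> i y * f y * (n y \<bullet> v) \<partial>\<sigma>)"
    by (rule global_data) (rule that)
  have \<psi>f: "Ck 1 (\<lambda>x. \<psi> i x * f x)" if "i \<in> I" for i by (rule Ck_mult[OF \<psi>[OF that] f])
  have i1: "integrable (lebesgue_on \<Omega>) (\<lambda>x. grad (\<lambda>x. \<psi> i x * f x) x \<bullet> v)" if "i \<in> I" for i
    using L2_inner_integrable[OF continuous_L2_\<Omega>[OF C1_grad(2)[OF \<psi>f[OF that]]] continuous_L2_\<Omega>[OF continuous_on_const[of UNIV v]]] .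
  have i2: "integrable \<sigma> (\<lambda>y. \<psi> i y * f y * (n y \<bullet> v))" if "i \<in> I" for i
    using L2_mult_integrable[OF continuous_L2_\<sigma>[OF C1_continuous[OF \<psi>f[OF that]]] normal_inner_L2[OF continuous_on_const[of UNIV v]]] .
  have "(\<integral>x. grad f x \<bullet> v \<partial>lebesgue_on \<Omega>) = (\<integral>x. (\<Sum>i\<in>I. grad (\<lambda>x. \<psi> i x * f x) x \<bullet> v) \<partial>lebesgue_on \<Omega>)"
  proof (rule Bochner_Integration.integral_cong[OF refl])
    fix x assume "x \<in> space (lebesgue_on \<Omega>)"
    then have "x \<in> \<Omega>" by (simp add: space_restrict_space)
    then have x: "x \<in> O'" using P(2) closure_subset by blast
    have "grad (\<lambda>x. \<Sum>i\<in>I. \<psi> i x * f x) x = grad f x"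
      by (rule grad_cong_open[OF f P(1) x]) (simp add: sum_distrib_right[symmetric] P(3))
    then have "grad f x = (\<Sum>i\<in>I. grad (\<lambda>x. \<psi> i x * f x) x)" by (simp add: grad_sum[OF I \<psi>f])
    then show "grad f x \<bullet> v = (\<Sum>i\<in>I. grad (\<lambda>x. \<psi> i x * f x) x \<bullet> v)" by (simp add: inner_sum_left)
  qed
  also have "\<dots> = (\<Sum>i\<in>I. \<integral>x. grad (\<lambda>x. \<psi> i x * f x) x \<bullet> v \<partial>lebesgue_on \<Omega>)"
    by (rule Bochner_Integration.integral_sum) (rule i1)
  also have "\<dots> = (\<Sum>i\<in>I. \<integral>y. \<psi> i y * f y * (n y \<bullet> v) \<partial>\<sigma>)" by (intro sum.cong refl G f)
  also have "\<dots> = (\<integral>y. (\<Sum>i\<in>I. \<psi> i y * f y * (n y \<bullet> v)) \<partial>\<sigma>)"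
    by (rule Bochner_Integration.integral_sum[symmetric]) (rule i2)
  also have "\<dots> = (\<integral>y. f y * (n y \<bullet> v) \<partial>\<sigma>)"
  proof (rule integral_cong_AE)
    have "(\<lambda>y. f y * (n y \<bullet> v)) \<in> borel_measurable borel" using C1_borel[OF f] by measurable
    then show "(\<lambda>y. f y * (n y \<bullet> v)) \<in> borel_measurable \<sigma>" by (rule borel_\<sigma>)
    show "(\<lambda>y. \<Sum>i\<in>I. \<psi> i y * f y * (n y \<bullet> v)) \<in> borel_measurable \<sigma>"
      by (rule borel_measurable_sum) (use i2 in blast)
    show "AE y in \<sigma>. (\<Sum>i\<in>I. \<psi> i y * f y * (n y \<bullet> v)) = f y * (n y \<bullet> v)"
      using AE_frontier
    proof eventually_elim
      case (elim y)
      then have "y \<in> O'" using P(2) by (auto simp: frontier_def)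
      then show ?case using P(3) by (simp add: sum_distrib_right[symmetric])
    qed
  qed
  finally show ?thesis .
qed

section \<open>Green's formula and the trace inequality\<close>

lemma green_C1:
  assumes w: "Ck 1 w" and q: "Ck 1 q"
  shows "(\<integral>x. w x \<bullet> grad q x + divg w x * q x \<partial>lebesgue_on \<Omega>) = (\<integral>y. (n y \<bullet> w y) * q y \<partial>\<sigma>)"
proof -
  \<comment> \<open>Gauss's formula is applied to the i-th component of q w in the direction of the
    i-th axis and summed over i.\<close>
  have c: "Ck 1 (\<lambda>x. w x $ i * q x)" for i by (intro Ck_mult Ck_component w q)
  have i1: "integrable (lebesgue_on \<Omega>) (\<lambda>x. grad (\<lambda>x. w x $ i * q x) x \<bullet> axis i 1)" for i
    using L2_inner_integrable[OF continuous_L2_\<Omega>[OF C1_grad(2)[OF c]] continuous_L2_\<Omega>[OF continuous_on_const[of UNIV "axis i 1"]]] .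
  have i2: "integrable \<sigma> (\<lambda>y. w y $ i * q y * (n y \<bullet> axis i 1))" for i
    using L2_mult_integrable[OF continuous_L2_\<sigma>[OF C1_continuous[OF c]] normal_inner_L2[OF continuous_on_const[of UNIV "axis i 1"]]] .
  have "(\<integral>x. w x \<bullet> grad q x + divg w x * q x \<partial>lebesgue_on \<Omega>)
    = (\<integral>x. (\<Sum>i\<in>UNIV. grad (\<lambda>x. w x $ i * q x) x \<bullet> axis i 1) \<partial>lebesgue_on \<Omega>)"
  proof (rule Bochner_Integration.integral_cong[OF refl])
    fix x
    have "grad (\<lambda>x. w x $ i * q x) x \<bullet> axis i 1 = w x $ i * grad q x $ i + grad (\<lambda>x. w x $ i) x $ i * q x" for i
      by (simp add: grad_mult[OF Ck_component[OF w] q] inner_axis)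
    then show "w x \<bullet> grad q x + divg w x * q x = (\<Sum>i\<in>UNIV. grad (\<lambda>x. w x $ i * q x) x \<bullet> axis i 1)"
      by (simp add: inner_vec_def divg_def sum.distrib sum_distrib_right)
  qed
  also have "\<dots> = (\<Sum>i\<in>UNIV. \<integral>x. grad (\<lambda>x. w x $ i * q x) x \<bullet> axis i 1 \<partial>lebesgue_on \<Omega>)"
    by (rule Bochner_Integration.integral_sum) (rule i1)
  also have "\<dots> = (\<Sum>i\<in>UNIV. \<integral>y. w y $ i * q y * (n y \<bullet> axis i 1) \<partial>\<sigma>)"
    by (intro sum.cong refl gauss c)
  also have "\<dots> = (\<integral>y. (\<Sum>i\<in>UNIV. w y $ i * q y * (n y \<bullet> axis i 1)) \<partial>\<sigma>)"
    by (rule Bochner_Integration.integral_sum[symmetric]) (rule i2)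
  also have "\<dots> = (\<integral>y. (n y \<bullet> w y) * q y \<partial>\<sigma>)"
  proof (rule Bochner_Integration.integral_cong[OF refl])
    fix y
    have "n y \<bullet> axis i 1 = n y $ i" for i by (simp add: inner_axis)
    then show "(\<Sum>i\<in>UNIV. w y $ i * q y * (n y \<bullet> axis i 1)) = (n y \<bullet> w y) * q y"
      unfolding inner_vec_def[of "n y" "w y"] by (simp add: sum_distrib_left mult_ac)
  qed
  finally show ?thesis .
qed

text \<open>The trace inequality follows from Green's formula for a \<open>C^1\<close> field that is uniformly transversal to
  the boundary.\<close>

lemma transversal_field:
  obtains w c where "Ck 1 w" "c > 0" "AE y in \<sigma>. c \<le> n y \<bullet> w y"
proof -
  obtain I :: "(real^'d) set" and \<psi> e c r O' where I: "finite I" and \<psi>: "\<And>i. i \<in> I \<Longrightarrow> Ck 1 (\<psi> i)" "\<And>i x. i \<in> I \<Longrightarrow> (0::real) \<le> \<psi> i x"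
    and P: "closure \<Omega> \<subseteq> O'" "\<And>x. x \<in> O' \<Longrightarrow> (\<Sum>i\<in>I. \<psi> i x) = (1::real)"
    and B: "\<And>i x. i \<in> I \<Longrightarrow> \<psi> i x \<noteq> 0 \<Longrightarrow> x \<in> ball i (r i)" and c: "\<And>i. i \<in> I \<Longrightarrow> c i > (0::real)"
    and N: "\<And>i. i \<in> I \<Longrightarrow> AE y in \<sigma>. y \<in> ball i (r i) \<longrightarrow> norm (n y) = 1 \<and> c i \<le> n y \<bullet> e i"
    by (rule global_data) (rule that)
  define c0 where "c0 = Min (insert 1 (c ` I))"
  have c0: "c0 > 0" "\<And>i. i \<in> I \<Longrightarrow> c0 \<le> c i" using I c by (auto simp: c0_def)
  have AE_I: "AE y in \<sigma>. \<forall>i\<in>I. y \<in> ball i (r i) \<longrightarrow> norm (n y) = 1 \<and> c i \<le> n y \<bullet> e i"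
    using N by (subst AE_finite_all[OF I]) blast
  show ?thesis
  proof (rule that[of "\<lambda>x. \<Sum>i\<in>I. \<psi> i x *\<^sub>R e i" c0])
    show "Ck 1 (\<lambda>x. \<Sum>i\<in>I. \<psi> i x *\<^sub>R e i)" by (intro Ck_sum Ck_scaleR \<psi> Ck_const)
    show "AE y in \<sigma>. c0 \<le> n y \<bullet> (\<Sum>i\<in>I. \<psi> i y *\<^sub>R e i)"
      using AE_I AE_frontier
    proof eventually_elim
      case (elim y)
      \<comment> \<open>On the frontier the weights sum to 1, and only directions whose ball
        contains y contribute, so the average keeps the lower bound.\<close>
      have "c0 = (\<Sum>i\<in>I. \<psi> i y * c0)" using P elim(2) by (auto simp: sum_distrib_right[symmetric] frontier_def)
      also have "\<dots> \<le> (\<Sum>i\<in>I. \<psi> i y * (n y \<bullet> e i))"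
      proof (rule sum_mono)
        fix i assume i: "i \<in> I"
        show "\<psi> i y * c0 \<le> \<psi> i y * (n y \<bullet> e i)"
        proof (cases "\<psi> i y = 0")
          case False
          then have "c i \<le> n y \<bullet> e i" using elim(1) B i by blast
          then show ?thesis using c0(2)[OF i] \<psi>(2)[OF i, of y] by (intro mult_left_mono) auto
        qed simp
      qed
      also have "\<dots> = n y \<bullet> (\<Sum>i\<in>I. \<psi> i y *\<^sub>R e i)" by (simp add: inner_sum_right)
      finally show ?case .
    qed
  qed (rule c0)
qed

lemma trace_inequality:
  obtains K where "0 \<le> K" "\<And>q. Ck 1 q \<Longrightarrow> L2_norm \<sigma> q \<le> K * sqrt ((L2_norm (lebesgue_on \<Omega>) q)\<^sup>2 + (L2_norm (lebesgue_on \<Omega>) (grad q))\<^sup>2)"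
proof -
  obtain w c where w: "Ck 1 w" and c: "c > 0" "AE y in \<sigma>. c \<le> n y \<bullet> w y" by (rule transversal_field)
  have bd: "\<exists>B. \<forall>x\<in>closure \<Omega>. norm (f x) \<le> B" if "continuous_on UNIV f" for f :: "real^'d \<Rightarrow> 'b::real_normed_vector"
  proof -
    have "compact (f ` closure \<Omega>)"
      by (rule compact_continuous_image[OF continuous_on_subset[OF that subset_UNIV]]) (use \<Omega>_bounded in \<open>simp add: compact_closure\<close>)
    then show ?thesis by (meson bounded_iff compact_imp_bounded imageI)
  qed
  obtain B1 B2 where B12: "\<And>x. x \<in> closure \<Omega> \<Longrightarrow> norm (w x) \<le> B1" "\<And>x. x \<in> closure \<Omega> \<Longrightarrow> norm (divg w x) \<le> B2"
    using bd[OF C1_continuous[OF w]] bd[OF C1_divg_continuous[OF w]] by blast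
  define B where "B = max 0 (max B1 B2)"
  have B: "0 \<le> B" "\<And>x. x \<in> \<Omega> \<Longrightarrow> norm (w x) \<le> B" "\<And>x. x \<in> \<Omega> \<Longrightarrow> \<bar>divg w x\<bar> \<le> B"
    using B12 closure_subset[of \<Omega>] by (auto simp: B_def subset_iff le_max_iff_disj)
  show ?thesis
  \<comment> \<open>Green's formula for w and q^2 bounds c |q|^2 on the boundary. The term 2 q (w,
    grad q) and the term with the divergence of w are each at most B (q^2 + |grad q|^2), whence 2
    B.\<close>
  proof (rule that[of "sqrt (2 * B / c)"])
    fix q :: "real^'d \<Rightarrow> real" assume q: "Ck 1 q"
    have q2: "Ck 1 (\<lambda>x. q x * q x)" by (rule Ck_mult[OF q q])
    note qL = continuous_L2_\<sigma>[OF C1_continuous[OF q]]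
    note qO = continuous_L2_\<Omega>[OF C1_continuous[OF q]] continuous_L2_\<Omega>[OF C1_grad(2)[OF q]]
    have "c * (L2_norm \<sigma> q)\<^sup>2 = (\<integral>y. c * (norm (q y))\<^sup>2 \<partial>\<sigma>)"
      by (simp add: L2_norm_power2)
    also have "\<dots> \<le> (\<integral>y. (n y \<bullet> w y) * (q y * q y) \<partial>\<sigma>)"
    proof (rule integral_mono_AE)
      show "integrable \<sigma> (\<lambda>y. c * (norm (q y))\<^sup>2)" using L2_integrable_sq[OF qL] by simp
      show "integrable \<sigma> (\<lambda>y. (n y \<bullet> w y) * (q y * q y))"
        by (rule L2_mult_integrable[OF normal_inner_L2[OF C1_continuous[OF w]] continuous_L2_\<sigma>[OF C1_continuous[OF q2]]])
      show "AE y in \<sigma>. c * (norm (q y))\<^sup>2 \<le> (n y \<bullet> w y) * (q y * q y)"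
        using c(2) by eventually_elim (auto simp: power2_eq_square intro!: mult_right_mono)
    qed
    also have "\<dots> = (\<integral>x. w x \<bullet> grad (\<lambda>x. q x * q x) x + divg w x * (q x * q x) \<partial>lebesgue_on \<Omega>)"
      by (rule green_C1[OF w q2, symmetric])
    also have "\<dots> \<le> (\<integral>x. 2 * B * ((norm (q x))\<^sup>2 + (norm (grad q x))\<^sup>2) \<partial>lebesgue_on \<Omega>)"
    proof (rule integral_mono_AE)
      show "integrable (lebesgue_on \<Omega>) (\<lambda>x. w x \<bullet> grad (\<lambda>x. q x * q x) x + divg w x * (q x * q x))"
        by (intro Bochner_Integration.integrable_add L2_inner_integrable L2_mult_integrable continuous_L2_\<Omega> C1_continuous C1_divg_continuous C1_grad(2) w q2)
      show "integrable (lebesgue_on \<Omega>) (\<lambda>x. 2 * B * ((norm (q x))\<^sup>2 + (norm (grad q x))\<^sup>2))"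
        using L2_integrable_sq[OF qO(1)] L2_integrable_sq[OF qO(2)] by simp
      show "AE x in lebesgue_on \<Omega>. w x \<bullet> grad (\<lambda>x. q x * q x) x + divg w x * (q x * q x) \<le> 2 * B * ((norm (q x))\<^sup>2 + (norm (grad q x))\<^sup>2)"
        using AE_\<Omega>
      proof eventually_elim
        case (elim x)
        have "w x \<bullet> grad (\<lambda>x. q x * q x) x = 2 * (q x * (w x \<bullet> grad q x))"
          unfolding grad_mult[OF q q] inner_add_right inner_scaleR_right by (rule mult_2[symmetric])
        also have "\<dots> \<le> 2 * (\<bar>q x\<bar> * (B * norm (grad q x)))"
        proof -
          have "\<bar>w x \<bullet> grad q x\<bar> \<le> B * norm (grad q x)"
            using Cauchy_Schwarz_ineq2[of "w x" "grad q x"] mult_right_mono[OF B(2)[OF elim] norm_ge_zero[of "grad q x"]] by linarith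
          then have "\<bar>q x * (w x \<bullet> grad q x)\<bar> \<le> \<bar>q x\<bar> * (B * norm (grad q x))" by (simp add: abs_mult mult_left_mono)
          then show ?thesis by linarith
        qed
        also have "\<dots> = B * (2 * \<bar>q x\<bar> * norm (grad q x))" by simp
        also have "\<dots> \<le> B * (\<bar>q x\<bar>\<^sup>2 + (norm (grad q x))\<^sup>2)" by (intro mult_left_mono sum_squares_bound B)
        finally have 1: "w x \<bullet> grad (\<lambda>x. q x * q x) x \<le> B * ((norm (q x))\<^sup>2 + (norm (grad q x))\<^sup>2)" by simp
        have "divg w x * (q x * q x) \<le> B * (q x * q x)" using B(3)[OF elim] by (intro mult_right_mono) auto
        also have "\<dots> \<le> B * ((norm (q x))\<^sup>2 + (norm (grad q x))\<^sup>2)"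
          using B(1) by (intro mult_left_mono) (auto simp: power2_eq_square)
        finally show ?case using 1 by simp
      qed
    qed
    also have "\<dots> = 2 * B * ((L2_norm (lebesgue_on \<Omega>) q)\<^sup>2 + (L2_norm (lebesgue_on \<Omega>) (grad q))\<^sup>2)"
      unfolding L2_norm_power2 using L2_integrable_sq[OF qO(1)] L2_integrable_sq[OF qO(2)] by simp
    finally have "(L2_norm \<sigma> q)\<^sup>2 \<le> 2 * B / c * ((L2_norm (lebesgue_on \<Omega>) q)\<^sup>2 + (L2_norm (lebesgue_on \<Omega>) (grad q))\<^sup>2)"
      using c(1) by (simp add: field_simps)
    then have "sqrt ((L2_norm \<sigma> q)\<^sup>2) \<le> sqrt (2 * B / c * ((L2_norm (lebesgue_on \<Omega>) q)\<^sup>2 + (L2_norm (lebesgue_on \<Omega>) (grad q))\<^sup>2))"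
      by (rule real_sqrt_le_mono)
    then show "L2_norm \<sigma> q \<le> sqrt (2 * B / c) * sqrt ((L2_norm (lebesgue_on \<Omega>) q)\<^sup>2 + (L2_norm (lebesgue_on \<Omega>) (grad q))\<^sup>2)"
      by (simp only: real_sqrt_mult real_sqrt_abs abs_of_nonneg L2_norm_nonneg)
  qed (use B(1) c(1) in simp)
qed

end

section \<open>Weak derivatives and traces\<close>

text \<open>Lebesgue measure is complete, so measurability passes to the representatives
  \<open>weak_grad\<close> and \<open>weak_div\<close>, which are known only up to null
  sets.\<close>

lemma lebesgue_on_measurable_AE:
  fixes f g :: "'a::euclidean_space \<Rightarrow> 'b::euclidean_space"
  assumes O: "\<Omega> \<in> sets borel" and f: "f \<in> borel_measurable (lebesgue_on \<Omega>)" and ae: "AE x in lebesgue_on \<Omega>. f x = g x"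
  shows "g \<in> borel_measurable (lebesgue_on \<Omega>)"
proof -
  have O': "\<Omega> \<in> sets lebesgue" using O by auto
  have "(\<lambda>x. indicator \<Omega> x *\<^sub>R f x) \<in> borel_measurable lebesgue"
    using f by (subst (asm) borel_measurable_restrict_space_iff) (use O' in auto)
  moreover have "AE x in lebesgue. indicator \<Omega> x *\<^sub>R f x = indicator \<Omega> x *\<^sub>R g x"
  proof -
    have "AE x in lebesgue. x \<in> \<Omega> \<longrightarrow> f x = g x"
      using ae by (subst (asm) AE_restrict_space_iff) (use O' in auto)
    then show ?thesis by eventually_elim (auto simp: indicator_def)
  qed
  ultimately have "(\<lambda>x. indicator \<Omega> x *\<^sub>R g x) \<in> borel_measurable lebesgue"
    by (rule borel_measurable_AE)
  then show ?thesis by (subst borel_measurable_restrict_space_iff) (use O' in auto)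
qed

text \<open>On the compact support of the test function H is integrable and \<open>\<psi>\<close> is
  bounded.\<close>

lemma locally_integrable_times_test:
  fixes H :: "real^'d \<Rightarrow> real"
  assumes O: "\<Omega> \<in> sets borel" and H: "locally_integrable \<Omega> H" and \<psi>: "\<psi> \<in> test_functions \<Omega>"
  shows "integrable (lebesgue_on \<Omega>) (\<lambda>x. H x * \<psi> x)"
proof -
  obtain K where K: "compact K" "K \<subseteq> \<Omega>" "\<And>x. x \<notin> K \<Longrightarrow> \<psi> x = 0" using test_functions_D(5)[OF \<psi>] by blast
  obtain R where R: "\<And>x. x \<notin> cball 0 R \<Longrightarrow> \<psi> x = 0" using test_functions_D(4)[OF \<psi>] by blast
  obtain B where B: "\<And>x. norm (\<psi> x) \<le> B" using C1_compact_support_bounds[OF test_functions_D(1)[OF \<psi>] R] by metis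
  have Kb: "K \<in> sets lebesgue" using K(1) by (simp add: compact_imp_closed borel_closed)
  have "integrable (lebesgue_on K) H" using H K unfolding locally_integrable_def by blast
  then have Hi: "integrable lebesgue (\<lambda>x. indicator K x *\<^sub>R H x)" by (subst (asm) integrable_restrict_space) (use Kb in auto)
  have "integrable lebesgue (\<lambda>x. (indicator K x *\<^sub>R H x) * \<psi> x)"
  proof (rule Bochner_Integration.integrable_bound[OF integrable_mult_right[OF Hi, of B]])
    show "(\<lambda>x. (indicator K x *\<^sub>R H x) * \<psi> x) \<in> borel_measurable lebesgue"
      by (intro borel_measurable_times borel_measurable_integrable[OF Hi] measurable_completion)
        (simp add: C1_borel[OF test_functions_D(1)[OF \<psi>]])
    have "norm ((indicator K x *\<^sub>R H x) * \<psi> x) \<le> norm (B * (indicator K x *\<^sub>R H x))" for x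
    proof -
      have "\<bar>indicator K x *\<^sub>R H x\<bar> * \<bar>\<psi> x\<bar> \<le> \<bar>indicator K x *\<^sub>R H x\<bar> * \<bar>B\<bar>" using B[of x] by (intro mult_left_mono) auto
      then show ?thesis by (simp add: abs_mult mult.commute)
    qed
    then show "AE x in lebesgue. norm ((indicator K x *\<^sub>R H x) * \<psi> x) \<le> norm (B * (indicator K x *\<^sub>R H x))" by simp
  qed
  also have "(\<lambda>x. (indicator K x *\<^sub>R H x) * \<psi> x) = (\<lambda>x. indicator \<Omega> x *\<^sub>R (H x * \<psi> x))"
    using K by (auto simp: indicator_def fun_eq_iff)
  finally show ?thesis by (subst integrable_restrict_space) (use O in auto)
qed

lemma locally_integrable_component:
  fixes G :: "real^'d \<Rightarrow> real^'d"
  assumes "locally_integrable \<Omega> G"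
  shows "locally_integrable \<Omega> (\<lambda>x. G x $ i)"
  unfolding locally_integrable_def
proof (intro allI impI)
  fix K assume "compact K" "K \<subseteq> \<Omega>"
  then have "integrable (lebesgue_on K) G" using assms by (simp add: locally_integrable_def)
  then have "integrable (lebesgue_on K) (\<lambda>x. G x \<bullet> axis i 1)" by (rule integrable_inner_left) 
  then show "integrable (lebesgue_on K) (\<lambda>x. G x $ i)" by (simp add: inner_axis)
qed

lemma weak_unique:
  fixes H1 H2 :: "real^'d \<Rightarrow> real"
  assumes O: "open \<Omega>" and H: "locally_integrable \<Omega> H1" "locally_integrable \<Omega> H2"
    and eq: "\<And>\<psi>. \<psi> \<in> test_functions \<Omega> \<Longrightarrow> (\<integral>x. H1 x * \<psi> x \<partial>lebesgue_on \<Omega>) = (\<integral>x. H2 x * \<psi> x \<partial>lebesgue_on \<Omega>)"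
  shows "AE x in lebesgue_on \<Omega>. H1 x = H2 x"
proof -
  have O': "\<Omega> \<in> sets borel" using O by simp
  have "locally_integrable \<Omega> (\<lambda>x. H1 x - H2 x)" using H by (auto simp: locally_integrable_def)
  moreover have "(\<integral>x. (H1 x - H2 x) * \<psi> x \<partial>lebesgue_on \<Omega>) = 0" if "\<psi> \<in> test_functions \<Omega>" for \<psi>
    using eq[OF that] locally_integrable_times_test[OF O' H(1) that] locally_integrable_times_test[OF O' H(2) that]
    by (simp add: left_diff_distrib)
  ultimately have "AE x in lebesgue_on \<Omega>. H1 x - H2 x = 0" by (rule fundamental_lemma[OF O])
  then show ?thesis by simp
qed

lemma weak_grad_unique:
  assumes O: "open \<Omega>" and "has_weak_gradient \<Omega> p G" "has_weak_gradient \<Omega> p G'"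
  shows "AE x in lebesgue_on \<Omega>. G x = G' x"
proof -
  have "AE x in lebesgue_on \<Omega>. G x $ i = G' x $ i" for i
  proof (rule weak_unique[OF O])
    fix \<psi> assume "\<psi> \<in> test_functions \<Omega>"
    then have "(\<integral>x. p x * (grad \<psi> x $ i) \<partial>lebesgue_on \<Omega>) = - (\<integral>x. (G x $ i) * \<psi> x \<partial>lebesgue_on \<Omega>)"
      "(\<integral>x. p x * (grad \<psi> x $ i) \<partial>lebesgue_on \<Omega>) = - (\<integral>x. (G' x $ i) * \<psi> x \<partial>lebesgue_on \<Omega>)"
      using assms(2,3) unfolding has_weak_gradient_def by blast+
    then show "(\<integral>x. G x $ i * \<psi> x \<partial>lebesgue_on \<Omega>) = (\<integral>x. G' x $ i * \<psi> x \<partial>lebesgue_on \<Omega>)" by simp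
  qed (use assms(2,3) in \<open>auto simp: has_weak_gradient_def intro: locally_integrable_component\<close>)
  then have "AE x in lebesgue_on \<Omega>. \<forall>i\<in>UNIV. G x $ i = G' x $ i" by (subst AE_finite_all) auto
  then show ?thesis by eventually_elim (simp add: vec_eq_iff)
qed

lemma weak_div_unique:
  assumes O: "open \<Omega>" and "has_weak_divergence \<Omega> u D" "has_weak_divergence \<Omega> u D'"
  shows "AE x in lebesgue_on \<Omega>. D x = D' x"
proof (rule weak_unique[OF O])
  fix \<psi> assume "\<psi> \<in> test_functions \<Omega>"
  then have "(\<integral>x. u x \<bullet> grad \<psi> x \<partial>lebesgue_on \<Omega>) = - (\<integral>x. D x * \<psi> x \<partial>lebesgue_on \<Omega>)"
    "(\<integral>x. u x \<bullet> grad \<psi> x \<partial>lebesgue_on \<Omega>) = - (\<integral>x. D' x * \<psi> x \<partial>lebesgue_on \<Omega>)"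
    using assms(2,3) unfolding has_weak_divergence_def by blast+
  then show "(\<integral>x. D x * \<psi> x \<partial>lebesgue_on \<Omega>) = (\<integral>x. D' x * \<psi> x \<partial>lebesgue_on \<Omega>)" by simp
qed (use assms(2,3) in \<open>auto simp: has_weak_divergence_def\<close>)

lemma has_weak_gradient_weak_grad: "has_weak_gradient \<Omega> p G \<Longrightarrow> has_weak_gradient \<Omega> p (weak_grad \<Omega> p)"
  unfolding weak_grad_def by (rule someI[where P="has_weak_gradient \<Omega> p"])

lemma has_weak_divergence_weak_div: "has_weak_divergence \<Omega> u D \<Longrightarrow> has_weak_divergence \<Omega> u (weak_div \<Omega> u)"
  unfolding weak_div_def by (rule someI[where P="has_weak_divergence \<Omega> u"])

section \<open>Working with the weak derivatives of H^1 and H(div)\<close>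

context lip_dom
begin

abbreviation L where "L \<equiv> lebesgue_on \<Omega>"

lemma L2_locally_integrable: "f \<in> L2 L \<Longrightarrow> locally_integrable \<Omega> f"
  by (rule L2_imp_locally_integrable[OF \<Omega>_borel \<Omega>_bounded])

text \<open>Any square integrable weak gradient may stand in for the chosen one, since the two agree
  almost everywhere.\<close>

lemma H1I:
  assumes p: "p \<in> L2 L" and wg: "has_weak_gradient \<Omega> p G" and G: "G \<in> L2 L"
  shows "p \<in> H1 \<Omega>" "AE x in L. weak_grad \<Omega> p x = G x" "weak_grad \<Omega> p \<in> L2 L"
    "H1_norm \<Omega> p = sqrt ((L2_norm L p)\<^sup>2 + (L2_norm L G)\<^sup>2)"
proof -
  show ae: "AE x in L. weak_grad \<Omega> p x = G x"
    by (rule weak_grad_unique[OF \<Omega>_open has_weak_gradient_weak_grad[OF wg] wg])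
  then have ae': "AE x in L. G x = weak_grad \<Omega> p x" by eventually_elim simp
  show w: "weak_grad \<Omega> p \<in> L2 L"
    by (rule L2_cong_AE[OF G lebesgue_on_measurable_AE[OF \<Omega>_borel L2_measurable[OF G] ae'] ae'])
  show "p \<in> H1 \<Omega>" using p wg w by (auto simp: H1_def)
  show "H1_norm \<Omega> p = sqrt ((L2_norm L p)\<^sup>2 + (L2_norm L G)\<^sup>2)"
    unfolding H1_norm_def L2_norm_cong_AE[OF L2_measurable[OF w] L2_measurable[OF G] ae] ..
qed

lemma H1D:
  assumes "p \<in> H1 \<Omega>"
  shows "p \<in> L2 L" "has_weak_gradient \<Omega> p (weak_grad \<Omega> p)" "weak_grad \<Omega> p \<in> L2 L"
  using assms has_weak_gradient_weak_grad by (auto simp: H1_def)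

lemma HdivI:
  assumes u: "u \<in> L2 L" and wd: "has_weak_divergence \<Omega> u D" and D: "D \<in> L2 L"
  shows "u \<in> Hdiv \<Omega>" "AE x in L. weak_div \<Omega> u x = D x" "weak_div \<Omega> u \<in> L2 L"
    "Hdiv_norm \<Omega> u = sqrt ((L2_norm L u)\<^sup>2 + (L2_norm L D)\<^sup>2)"
proof -
  show ae: "AE x in L. weak_div \<Omega> u x = D x"
    by (rule weak_div_unique[OF \<Omega>_open has_weak_divergence_weak_div[OF wd] wd])
  then have ae': "AE x in L. D x = weak_div \<Omega> u x" by eventually_elim simp
  show w: "weak_div \<Omega> u \<in> L2 L"
    by (rule L2_cong_AE[OF D lebesgue_on_measurable_AE[OF \<Omega>_borel L2_measurable[OF D] ae'] ae'])
  show "u \<in> Hdiv \<Omega>" using u wd w by (auto simp: Hdiv_def)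
  show "Hdiv_norm \<Omega> u = sqrt ((L2_norm L u)\<^sup>2 + (L2_norm L D)\<^sup>2)"
    unfolding Hdiv_norm_def L2_norm_cong_AE[OF L2_measurable[OF w] L2_measurable[OF D] ae] ..
qed

lemma HdivD:
  assumes "u \<in> Hdiv \<Omega>"
  shows "u \<in> L2 L" "has_weak_divergence \<Omega> u (weak_div \<Omega> u)" "weak_div \<Omega> u \<in> L2 L"
  using assms has_weak_divergence_weak_div by (auto simp: Hdiv_def)

lemma test_L2: "\<psi> \<in> test_functions \<Omega> \<Longrightarrow> \<psi> \<in> L2 L" "\<psi> \<in> test_functions \<Omega> \<Longrightarrow> grad \<psi> \<in> L2 L"
  by (auto intro!: continuous_L2_\<Omega> C1_continuous C1_grad(2) dest: test_functions_D(1))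

lemma has_weak_gradient_diff:
  assumes p: "p \<in> L2 L" "G \<in> L2 L" "has_weak_gradient \<Omega> p G" and q: "q \<in> L2 L" "G' \<in> L2 L" "has_weak_gradient \<Omega> q G'"
  shows "has_weak_gradient \<Omega> (\<lambda>x. p x - q x) (\<lambda>x. G x - G' x)"
  unfolding has_weak_gradient_def
proof (intro conjI ballI allI)
  fix \<psi> i assume \<psi>: "\<psi> \<in> test_functions \<Omega>"
  note i = L2_mult_integrable[OF p(1) L2_component[OF test_L2(2)[OF \<psi>], of i]] L2_mult_integrable[OF q(1) L2_component[OF test_L2(2)[OF \<psi>], of i]]
    L2_mult_integrable[OF L2_component[OF p(2), of i] test_L2(1)[OF \<psi>]] L2_mult_integrable[OF L2_component[OF q(2), of i] test_L2(1)[OF \<psi>]]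
  have "(\<integral>x. p x * grad \<psi> x $ i \<partial>L) = - (\<integral>x. G x $ i * \<psi> x \<partial>L)" "(\<integral>x. q x * grad \<psi> x $ i \<partial>L) = - (\<integral>x. G' x $ i * \<psi> x \<partial>L)"
    using p(3) q(3) \<psi> by (auto simp: has_weak_gradient_def)
  then show "(\<integral>x. (p x - q x) * grad \<psi> x $ i \<partial>L) = - (\<integral>x. (G x - G' x) $ i * \<psi> x \<partial>L)"
    using i by (simp add: left_diff_distrib)
qed (intro L2_locally_integrable L2_diff p q)+

lemma has_weak_divergence_diff:
  assumes p: "p \<in> L2 L" "G \<in> L2 L" "has_weak_divergence \<Omega> p G" and q: "q \<in> L2 L" "G' \<in> L2 L" "has_weak_divergence \<Omega> q G'"
  shows "has_weak_divergence \<Omega> (\<lambda>x. p x - q x) (\<lambda>x. G x - G' x)"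
  unfolding has_weak_divergence_def
proof (intro conjI ballI allI)
  fix \<psi> assume \<psi>: "\<psi> \<in> test_functions \<Omega>"
  note i = L2_inner_integrable[OF p(1) test_L2(2)[OF \<psi>]] L2_inner_integrable[OF q(1) test_L2(2)[OF \<psi>]]
    L2_mult_integrable[OF p(2) test_L2(1)[OF \<psi>]] L2_mult_integrable[OF q(2) test_L2(1)[OF \<psi>]]
  have "(\<integral>x. p x \<bullet> grad \<psi> x \<partial>L) = - (\<integral>x. G x * \<psi> x \<partial>L)" "(\<integral>x. q x \<bullet> grad \<psi> x \<partial>L) = - (\<integral>x. G' x * \<psi> x \<partial>L)"
    using p(3) q(3) \<psi> by (auto simp: has_weak_divergence_def)
  then show "(\<integral>x. (p x - q x) \<bullet> grad \<psi> x \<partial>L) = - (\<integral>x. (G x - G' x) * \<psi> x \<partial>L)"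
    using i by (simp add: left_diff_distrib inner_diff_left)
qed (intro L2_locally_integrable L2_diff p q)+

lemma C1_L2:
  assumes "Ck 1 q"
  shows "q \<in> L2 L" "grad q \<in> L2 L" "has_weak_gradient \<Omega> q (grad q)" "q \<in> L2 \<sigma>"
  by (rule continuous_L2_\<Omega>[OF C1_continuous[OF assms]] continuous_L2_\<Omega>[OF C1_grad(2)[OF assms]]
      C1_has_weak_gradient[OF \<Omega>_open \<Omega>_bounded assms] continuous_L2_\<sigma>[OF C1_continuous[OF assms]])+

lemma C1_L2_vec:
  assumes "Ck 1 w"
  shows "w \<in> L2 L" "divg w \<in> L2 L" "has_weak_divergence \<Omega> w (divg w)"
  by (rule continuous_L2_\<Omega>[OF C1_continuous[OF assms]] continuous_L2_\<Omega>[OF C1_divg_continuous[OF assms]]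
      C1_has_weak_divergence[OF \<Omega>_open \<Omega>_bounded assms])+

lemma H1_norm_diff:
  assumes q: "Ck 1 q" and p: "p \<in> L2 L" "has_weak_gradient \<Omega> p G" "G \<in> L2 L"
  shows "H1_norm \<Omega> (\<lambda>x. q x - p x) = sqrt ((L2_norm L (\<lambda>x. q x - p x))\<^sup>2 + (L2_norm L (\<lambda>x. grad q x - G x))\<^sup>2)"
  by (rule H1I(4)[OF L2_diff[OF C1_L2(1)[OF q] p(1)] has_weak_gradient_diff[OF C1_L2(1,2,3)[OF q] p(1,3,2)] L2_diff[OF C1_L2(2)[OF q] p(3)]])

lemma Hdiv_norm_diff:
  assumes w: "Ck 1 w" and u: "u \<in> L2 L" "has_weak_divergence \<Omega> u D" "D \<in> L2 L"
  shows "Hdiv_norm \<Omega> (\<lambda>x. w x - u x) = sqrt ((L2_norm L (\<lambda>x. w x - u x))\<^sup>2 + (L2_norm L (\<lambda>x. divg w x - D x))\<^sup>2)"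
  by (rule HdivI(4)[OF L2_diff[OF C1_L2_vec(1)[OF w] u(1)] has_weak_divergence_diff[OF C1_L2_vec(1,2,3)[OF w] u(1,3,2)] L2_diff[OF C1_L2_vec(2)[OF w] u(3)]])

lemma sqrt_sum_tendsto_0_iff:
  fixes a b :: "nat \<Rightarrow> real"
  assumes "\<And>k. 0 \<le> a k" "\<And>k. 0 \<le> b k"
  shows "(\<lambda>k. sqrt ((a k)\<^sup>2 + (b k)\<^sup>2)) \<longlonglongrightarrow> 0 \<longleftrightarrow> a \<longlonglongrightarrow> 0 \<and> b \<longlonglongrightarrow> 0"
proof
  assume l: "(\<lambda>k. sqrt ((a k)\<^sup>2 + (b k)\<^sup>2)) \<longlonglongrightarrow> 0"
  show "a \<longlonglongrightarrow> 0 \<and> b \<longlonglongrightarrow> 0"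
  proof
    show "a \<longlonglongrightarrow> 0" by (rule tendsto_sandwich[OF _ _ tendsto_const l]) (auto simp: assms intro: real_le_rsqrt)
    show "b \<longlonglongrightarrow> 0" by (rule tendsto_sandwich[OF _ _ tendsto_const l]) (auto simp: assms intro: real_le_rsqrt)
  qed
next
  assume "a \<longlonglongrightarrow> 0 \<and> b \<longlonglongrightarrow> 0"
  then have "(\<lambda>k. sqrt ((a k)\<^sup>2 + (b k)\<^sup>2)) \<longlonglongrightarrow> sqrt (0\<^sup>2 + 0\<^sup>2)" by (intro tendsto_intros) auto
  then show "(\<lambda>k. sqrt ((a k)\<^sup>2 + (b k)\<^sup>2)) \<longlonglongrightarrow> 0" by simp
qed

text \<open>The H^1 norm of a difference involves a weak gradient chosen for that difference. Here
  it is replaced by L^2 norms of differences of known gradients, which suit limit arguments.\<close>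

lemma has_trace_iff:
  "has_trace \<Omega> \<sigma> p t \<longleftrightarrow> p \<in> H1 \<Omega> \<and> t \<in> L2 \<sigma> \<and> (\<exists>q. (\<forall>k. Ck 1 (q k)) \<and> (\<lambda>k. L2_norm L (\<lambda>x. q k x - p x)) \<longlonglongrightarrow> 0 \<and>
    (\<lambda>k. L2_norm L (\<lambda>x. grad (q k) x - weak_grad \<Omega> p x)) \<longlonglongrightarrow> 0 \<and> (\<lambda>k. L2_norm \<sigma> (\<lambda>x. q k x - t x)) \<longlonglongrightarrow> 0)"
proof -
  have eq: "(\<lambda>k. H1_norm \<Omega> (\<lambda>x. q k x - p x)) \<longlonglongrightarrow> 0 \<longleftrightarrow> (\<lambda>k. L2_norm L (\<lambda>x. q k x - p x)) \<longlonglongrightarrow> 0 \<and>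
    (\<lambda>k. L2_norm L (\<lambda>x. grad (q k) x - weak_grad \<Omega> p x)) \<longlonglongrightarrow> 0" if "p \<in> H1 \<Omega>" "\<And>k. Ck 1 (q k)" for q
    using H1_norm_diff[OF that(2) H1D(1,2,3)[OF that(1)]] by (simp add: sqrt_sum_tendsto_0_iff)
  show ?thesis unfolding has_trace_def
  proof (rule conj_cong[OF refl], rule conj_cong[OF refl], rule ex_cong1, rule conj_cong[OF refl])
    fix q :: "nat \<Rightarrow> real^'d \<Rightarrow> real"
    assume "p \<in> H1 \<Omega>" and q: "\<forall>k. Ck 1 (q k)"
    then show "((\<lambda>k. H1_norm \<Omega> (\<lambda>x. q k x - p x)) \<longlonglongrightarrow> 0 \<and> (\<lambda>k. L2_norm \<sigma> (\<lambda>x. q k x - t x)) \<longlonglongrightarrow> 0) =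
      ((\<lambda>k. L2_norm L (\<lambda>x. q k x - p x)) \<longlonglongrightarrow> 0 \<and> (\<lambda>k. L2_norm L (\<lambda>x. grad (q k) x - weak_grad \<Omega> p x)) \<longlonglongrightarrow> 0 \<and>
       (\<lambda>k. L2_norm \<sigma> (\<lambda>x. q k x - t x)) \<longlonglongrightarrow> 0)"
      using eq[of q] by blast
  qed
qed

section \<open>Traces of H^1 functions\<close>

lemma H1_C1_sequence:
  assumes p: "p \<in> H1 \<Omega>"
  obtains q where "\<And>k::nat. Ck 1 (q k)" "(\<lambda>k. L2_norm L (\<lambda>x. q k x - p x)) \<longlonglongrightarrow> 0"
    "(\<lambda>k. L2_norm L (\<lambda>x. grad (q k) x - weak_grad \<Omega> p x)) \<longlonglongrightarrow> 0"
proof -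
  have "\<forall>k. \<exists>q. Ck 1 q \<and> L2_norm L (\<lambda>x. q x - p x) \<le> inverse (real (Suc k)) \<and>
     L2_norm L (\<lambda>x. grad q x - weak_grad \<Omega> p x) \<le> inverse (real (Suc k))"
  proof
    fix k
    show "\<exists>q. Ck 1 q \<and> L2_norm L (\<lambda>x. q x - p x) \<le> inverse (real (Suc k)) \<and>
     L2_norm L (\<lambda>x. grad q x - weak_grad \<Omega> p x) \<le> inverse (real (Suc k))"
      by (rule H1_dense[OF dom H1D(1,2,3)[OF p], of "inverse (real (Suc k))"]) auto
  qed
  from choice[OF this] obtain q where q: "\<And>k. Ck 1 (q k)" "\<And>k. L2_norm L (\<lambda>x. q k x - p x) \<le> inverse (real (Suc k))"
     "\<And>k. L2_norm L (\<lambda>x. grad (q k) x - weak_grad \<Omega> p x) \<le> inverse (real (Suc k))" by blast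
  show ?thesis
  proof (rule that[OF q(1)])
    show "(\<lambda>k. L2_norm L (\<lambda>x. q k x - p x)) \<longlonglongrightarrow> 0"
      by (rule tendsto_sandwich[OF _ _ tendsto_const LIMSEQ_inverse_real_of_nat]) (use q in auto)
    show "(\<lambda>k. L2_norm L (\<lambda>x. grad (q k) x - weak_grad \<Omega> p x)) \<longlonglongrightarrow> 0"
      by (rule tendsto_sandwich[OF _ _ tendsto_const LIMSEQ_inverse_real_of_nat]) (use q in auto)
  qed
qed

text \<open>By the trace inequality an approximating C^1 sequence that converges in H^1 is Cauchy in
  L^2 of the boundary; its limit there is a trace.\<close>

lemma trace_exists:
  assumes p: "p \<in> H1 \<Omega>"
  shows "\<exists>t. has_trace \<Omega> \<sigma> p t"
proof -
  obtain q where q: "\<And>k::nat. Ck 1 (q k)" "(\<lambda>k. L2_norm L (\<lambda>x. q k x - p x)) \<longlonglongrightarrow> 0"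
    "(\<lambda>k. L2_norm L (\<lambda>x. grad (q k) x - weak_grad \<Omega> p x)) \<longlonglongrightarrow> 0" by (rule H1_C1_sequence[OF p]) (rule that)
  obtain K where K: "0 \<le> K" "\<And>q. Ck 1 q \<Longrightarrow> L2_norm \<sigma> q \<le> K * sqrt ((L2_norm L q)\<^sup>2 + (L2_norm L (grad q))\<^sup>2)"
    by (rule trace_inequality) (rule that)
  have "\<exists>t\<in>L2 \<sigma>. (\<lambda>k. L2_norm \<sigma> (\<lambda>x. q k x - t x)) \<longlonglongrightarrow> 0"
  proof (rule L2_complete[OF C1_L2(4)[OF q(1)]])
    fix \<epsilon> :: real assume \<epsilon>: "\<epsilon> > 0"
    \<comment> \<open>The increments of q and of its gradient contribute at most K (\<delta> +
      \<delta>); the summand 1 covers K = 0.\<close>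
    define \<delta> where "\<delta> = \<epsilon> / (2 * K + 1)"
    have \<delta>: "\<delta> > 0" "K * (2 * \<delta>) < \<epsilon>" using \<epsilon> K(1) by (auto simp: \<delta>_def field_simps)
    obtain N1 where N1: "\<forall>m\<ge>N1. \<forall>n\<ge>N1. L2_norm L (\<lambda>x. q m x - q n x) < \<delta>"
      using L2_tendsto_imp_Cauchy[OF C1_L2(1)[OF q(1)] H1D(1)[OF p] q(2) \<delta>(1)] by blast
    obtain N2 where N2: "\<forall>m\<ge>N2. \<forall>n\<ge>N2. L2_norm L (\<lambda>x. grad (q m) x - grad (q n) x) < \<delta>"
      using L2_tendsto_imp_Cauchy[OF C1_L2(2)[OF q(1)] H1D(3)[OF p] q(3) \<delta>(1)] by blast
    have "L2_norm \<sigma> (\<lambda>x. q m x - q n x) < \<epsilon>" if m: "m \<ge> max N1 N2" and n: "n \<ge> max N1 N2" for m n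
    proof -
      let ?a = "L2_norm L (\<lambda>x. q m x - q n x)" and ?b = "L2_norm L (\<lambda>x. grad (q m) x - grad (q n) x)"
      have "L2_norm \<sigma> (\<lambda>x. q m x - q n x) \<le> K * sqrt (?a\<^sup>2 + ?b\<^sup>2)"
        using K(2)[OF Ck_diff[OF q(1) q(1)], of m n] by (simp add: grad_diff[OF q(1) q(1), abs_def] cong: if_cong)
      also have "sqrt (?a\<^sup>2 + ?b\<^sup>2) \<le> ?a + ?b" by (rule sqrt_sum_squares_le_sum) auto
      also have "?a + ?b \<le> 2 * \<delta>"
      proof -
        have "?a < \<delta>" "?b < \<delta>" using N1 N2 m n by simp_all
        then show ?thesis by linarith
      qed
      finally show ?thesis using \<delta>(2) K(1) by (simp add: mult_left_mono)
    qed
    then show "\<exists>N. \<forall>m\<ge>N. \<forall>n\<ge>N. L2_norm \<sigma> (\<lambda>x. q m x - q n x) < \<epsilon>" by blast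
  qed
  then show ?thesis using p q unfolding has_trace_iff by blast
qed

lemma has_trace_bdry_trace: "p \<in> H1 \<Omega> \<Longrightarrow> has_trace \<Omega> \<sigma> p (bdry_trace \<Omega> \<sigma> p)"
  unfolding bdry_trace_def using trace_exists by (rule someI_ex)

text \<open>Two C^1 sequences approximating the same p differ by a null sequence in H^1, to which
  the trace inequality applies.\<close>

lemma has_trace_unique:
  assumes t: "has_trace \<Omega> \<sigma> p t" "has_trace \<Omega> \<sigma> p t'"
  shows "AE y in \<sigma>. t y = t' y"
proof -
  have p: "p \<in> H1 \<Omega>" and tL: "t \<in> L2 \<sigma>" "t' \<in> L2 \<sigma>" using t by (auto simp: has_trace_def)
  obtain q where q: "\<And>k. Ck 1 (q k)" "(\<lambda>k. L2_norm L (\<lambda>x. q k x - p x)) \<longlonglongrightarrow> 0"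
    "(\<lambda>k. L2_norm L (\<lambda>x. grad (q k) x - weak_grad \<Omega> p x)) \<longlonglongrightarrow> 0" "(\<lambda>k. L2_norm \<sigma> (\<lambda>x. q k x - t x)) \<longlonglongrightarrow> 0"
    using t(1) unfolding has_trace_iff by blast
  obtain q' where q': "\<And>k. Ck 1 (q' k)" "(\<lambda>k. L2_norm L (\<lambda>x. q' k x - p x)) \<longlonglongrightarrow> 0"
    "(\<lambda>k. L2_norm L (\<lambda>x. grad (q' k) x - weak_grad \<Omega> p x)) \<longlonglongrightarrow> 0" "(\<lambda>k. L2_norm \<sigma> (\<lambda>x. q' k x - t' x)) \<longlonglongrightarrow> 0"
    using t(2) unfolding has_trace_iff by blast
  obtain K where K: "0 \<le> K" "\<And>q. Ck 1 q \<Longrightarrow> L2_norm \<sigma> q \<le> K * sqrt ((L2_norm L q)\<^sup>2 + (L2_norm L (grad q))\<^sup>2)"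
    by (rule trace_inequality) (rule that)
  let ?b = "\<lambda>k. L2_norm \<sigma> (\<lambda>x. q k x - t x) + K * ((L2_norm L (\<lambda>x. q k x - p x) + L2_norm L (\<lambda>x. q' k x - p x))
     + (L2_norm L (\<lambda>x. grad (q k) x - weak_grad \<Omega> p x) + L2_norm L (\<lambda>x. grad (q' k) x - weak_grad \<Omega> p x))) + L2_norm \<sigma> (\<lambda>x. q' k x - t' x)"
  have "L2_norm \<sigma> (\<lambda>x. t x - t' x) \<le> ?b k" for k
  proof -
    note qL = C1_L2[OF q(1)[of k]] and qL' = C1_L2[OF q'(1)[of k]]
    have "L2_norm \<sigma> (\<lambda>x. t x - t' x) \<le> L2_norm \<sigma> (\<lambda>x. t x - q k x) + L2_norm \<sigma> (\<lambda>x. q k x - t' x)"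
      by (rule L2_norm_triangle_diff[OF tL(1) qL(4) tL(2)])
    also have "L2_norm \<sigma> (\<lambda>x. q k x - t' x) \<le> L2_norm \<sigma> (\<lambda>x. q k x - q' k x) + L2_norm \<sigma> (\<lambda>x. q' k x - t' x)"
      by (rule L2_norm_triangle_diff[OF qL(4) qL'(4) tL(2)])
    also have "L2_norm \<sigma> (\<lambda>x. q k x - q' k x) \<le> K * sqrt ((L2_norm L (\<lambda>x. q k x - q' k x))\<^sup>2 + (L2_norm L (\<lambda>x. grad (q k) x - grad (q' k) x))\<^sup>2)"
      using K(2)[OF Ck_diff[OF q(1) q'(1)], of k k] by (simp add: grad_diff[OF q(1) q'(1), abs_def] cong: if_cong)
    also have "\<dots> \<le> K * (L2_norm L (\<lambda>x. q k x - q' k x) + L2_norm L (\<lambda>x. grad (q k) x - grad (q' k) x))"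
      by (intro mult_left_mono sqrt_sum_squares_le_sum K) auto
    also have "\<dots> \<le> K * ((L2_norm L (\<lambda>x. q k x - p x) + L2_norm L (\<lambda>x. q' k x - p x))
     + (L2_norm L (\<lambda>x. grad (q k) x - weak_grad \<Omega> p x) + L2_norm L (\<lambda>x. grad (q' k) x - weak_grad \<Omega> p x)))"
      using L2_norm_triangle_diff[OF qL(1) H1D(1)[OF p] qL'(1)] L2_norm_triangle_diff[OF qL(2) H1D(3)[OF p] qL'(2)]
      by (intro mult_left_mono add_mono K) (simp_all add: L2_norm_minus_commute[of L p] L2_norm_minus_commute[of L "weak_grad \<Omega> p"])
    finally show ?thesis by (simp add: L2_norm_minus_commute[of \<sigma> t])
  qed
  moreover have "?b \<longlonglongrightarrow> 0 + K * ((0 + 0) + (0 + 0)) + 0"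
    by (intro tendsto_intros q q')
  ultimately have "L2_norm \<sigma> (\<lambda>x. t x - t' x) \<le> 0"
    using LIMSEQ_le_const[of ?b 0] by auto
  then have "L2_norm \<sigma> (\<lambda>x. t x - t' x) = 0" by (simp add: antisym)
  from L2_norm_eq_0[OF L2_diff[OF tL] this] show ?thesis by simp
qed

text \<open>The chosen trace of a difference is unrelated to the chosen traces of its parts;
  subtracting the approximating sequences shows that the relation itself is additive.\<close>

lemma has_trace_diff:
  assumes t: "has_trace \<Omega> \<sigma> p t" "has_trace \<Omega> \<sigma> p' t'"
  shows "has_trace \<Omega> \<sigma> (\<lambda>x. p x - p' x) (\<lambda>x. t x - t' x)"
    "AE x in L. weak_grad \<Omega> (\<lambda>x. p x - p' x) x = weak_grad \<Omega> p x - weak_grad \<Omega> p' x"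
proof -
  have p: "p \<in> H1 \<Omega>" "p' \<in> H1 \<Omega>" and tL: "t \<in> L2 \<sigma>" "t' \<in> L2 \<sigma>" using t by (auto simp: has_trace_def)
  note D = H1I[OF L2_diff[OF H1D(1)[OF p(1)] H1D(1)[OF p(2)]]
      has_weak_gradient_diff[OF H1D(1)[OF p(1)] H1D(3)[OF p(1)] H1D(2)[OF p(1)] H1D(1)[OF p(2)] H1D(3)[OF p(2)] H1D(2)[OF p(2)]]
      L2_diff[OF H1D(3)[OF p(1)] H1D(3)[OF p(2)]]]
  show ae: "AE x in L. weak_grad \<Omega> (\<lambda>x. p x - p' x) x = weak_grad \<Omega> p x - weak_grad \<Omega> p' x" by (rule D(2))
  obtain q where q: "\<And>k. Ck 1 (q k)" "(\<lambda>k. L2_norm L (\<lambda>x. q k x - p x)) \<longlonglongrightarrow> 0"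
    "(\<lambda>k. L2_norm L (\<lambda>x. grad (q k) x - weak_grad \<Omega> p x)) \<longlonglongrightarrow> 0" "(\<lambda>k. L2_norm \<sigma> (\<lambda>x. q k x - t x)) \<longlonglongrightarrow> 0"
    using t(1) unfolding has_trace_iff by blast
  obtain q' where q': "\<And>k. Ck 1 (q' k)" "(\<lambda>k. L2_norm L (\<lambda>x. q' k x - p' x)) \<longlonglongrightarrow> 0"
    "(\<lambda>k. L2_norm L (\<lambda>x. grad (q' k) x - weak_grad \<Omega> p' x)) \<longlonglongrightarrow> 0" "(\<lambda>k. L2_norm \<sigma> (\<lambda>x. q' k x - t' x)) \<longlonglongrightarrow> 0"
    using t(2) unfolding has_trace_iff by blast
  have lim: "(\<lambda>k. L2_norm M (\<lambda>x. (a k x - a' k x) - (b x - b' x))) \<longlonglongrightarrow> 0"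
    if "\<And>k. a k \<in> L2 M" "\<And>k. a' k \<in> L2 M" "b \<in> L2 M" "b' \<in> L2 M" "(\<lambda>k. L2_norm M (\<lambda>x. a k x - b x)) \<longlonglongrightarrow> 0" "(\<lambda>k. L2_norm M (\<lambda>x. a' k x - b' x)) \<longlonglongrightarrow> 0"
    for M :: "'x measure" and a a' :: "nat \<Rightarrow> 'x \<Rightarrow> 'y::euclidean_space" and b b'
  proof (rule tendsto_sandwich[OF _ _ tendsto_const])
    show "(\<lambda>k. L2_norm M (\<lambda>x. a k x - b x) + L2_norm M (\<lambda>x. a' k x - b' x)) \<longlonglongrightarrow> 0"
      using tendsto_add[OF that(5,6)] by simp
    show "\<forall>\<^sub>F k in sequentially. L2_norm M (\<lambda>x. (a k x - a' k x) - (b x - b' x)) \<le> L2_norm M (\<lambda>x. a k x - b x) + L2_norm M (\<lambda>x. a' k x - b' x)"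
    proof (rule always_eventually, rule allI)
      fix k
      have "L2_norm M (\<lambda>x. (a k x - b x) + - (a' k x - b' x)) \<le> L2_norm M (\<lambda>x. a k x - b x) + L2_norm M (\<lambda>x. - (a' k x - b' x))"
        by (rule L2_norm_triangle[OF L2_diff[OF that(1,3)] L2_uminus[OF L2_diff[OF that(2,4)]]])
      then show "L2_norm M (\<lambda>x. (a k x - a' k x) - (b x - b' x)) \<le> L2_norm M (\<lambda>x. a k x - b x) + L2_norm M (\<lambda>x. a' k x - b' x)"
        unfolding L2_norm_uminus by (simp add: algebra_simps)
    qed
  qed auto
  have gd: "L2_norm L (\<lambda>x. grad (\<lambda>x. q k x - q' k x) x - weak_grad \<Omega> (\<lambda>x. p x - p' x) x)
     = L2_norm L (\<lambda>x. (grad (q k) x - grad (q' k) x) - (weak_grad \<Omega> p x - weak_grad \<Omega> p' x))" for k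
  proof (rule L2_norm_cong_AE)
    show "(\<lambda>x. grad (\<lambda>x. q k x - q' k x) x - weak_grad \<Omega> (\<lambda>x. p x - p' x) x) \<in> borel_measurable L"
      by (intro L2_measurable L2_diff C1_L2(2)[OF Ck_diff[OF q(1) q'(1)]] D(3))
    show "(\<lambda>x. (grad (q k) x - grad (q' k) x) - (weak_grad \<Omega> p x - weak_grad \<Omega> p' x)) \<in> borel_measurable L"
      by (intro L2_measurable L2_diff C1_L2(2) q(1) q'(1) H1D(3) p)
    show "AE x in L. grad (\<lambda>x. q k x - q' k x) x - weak_grad \<Omega> (\<lambda>x. p x - p' x) x = (grad (q k) x - grad (q' k) x) - (weak_grad \<Omega> p x - weak_grad \<Omega> p' x)"
      using ae by eventually_elim (simp add: grad_diff[OF q(1) q'(1)])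
  qed
  show "has_trace \<Omega> \<sigma> (\<lambda>x. p x - p' x) (\<lambda>x. t x - t' x)"
    unfolding has_trace_iff
  proof (intro conjI exI[of _ "\<lambda>k x. q k x - q' k x"] allI)
    show "Ck 1 (\<lambda>x. q k x - q' k x)" for k by (rule Ck_diff[OF q(1) q'(1)])
    show "(\<lambda>k. L2_norm L (\<lambda>x. (q k x - q' k x) - (p x - p' x))) \<longlonglongrightarrow> 0"
      by (rule lim[OF C1_L2(1)[OF q(1)] C1_L2(1)[OF q'(1)] H1D(1)[OF p(1)] H1D(1)[OF p(2)] q(2) q'(2)])
    show "(\<lambda>k. L2_norm L (\<lambda>x. grad (\<lambda>x. q k x - q' k x) x - weak_grad \<Omega> (\<lambda>x. p x - p' x) x)) \<longlonglongrightarrow> 0"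
      unfolding gd by (rule lim[OF C1_L2(2)[OF q(1)] C1_L2(2)[OF q'(1)] H1D(3)[OF p(1)] H1D(3)[OF p(2)] q(3) q'(3)])
    show "(\<lambda>k. L2_norm \<sigma> (\<lambda>x. (q k x - q' k x) - (t x - t' x))) \<longlonglongrightarrow> 0"
      by (rule lim[OF C1_L2(4)[OF q(1)] C1_L2(4)[OF q'(1)] tL q(4) q'(4)])
  qed (intro D(1) L2_diff tL)+
qed

lemma green_H1:
  assumes w: "Ck 1 w" and t: "has_trace \<Omega> \<sigma> m \<mu>"
  shows "(\<integral>y. (n y \<bullet> w y) * \<mu> y \<partial>\<sigma>) = (\<integral>x. w x \<bullet> weak_grad \<Omega> m x \<partial>L) + (\<integral>x. divg w x * m x \<partial>L)"
proof -
  have m: "m \<in> H1 \<Omega>" and \<mu>: "\<mu> \<in> L2 \<sigma>" using t by (auto simp: has_trace_def)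
  obtain q where q: "\<And>k. Ck 1 (q k)" "(\<lambda>k. L2_norm L (\<lambda>x. q k x - m x)) \<longlonglongrightarrow> 0"
    "(\<lambda>k. L2_norm L (\<lambda>x. grad (q k) x - weak_grad \<Omega> m x)) \<longlonglongrightarrow> 0" "(\<lambda>k. L2_norm \<sigma> (\<lambda>x. q k x - \<mu> x)) \<longlonglongrightarrow> 0"
    using t unfolding has_trace_iff by blast
  note wL = C1_L2_vec[OF w]
  have "(\<integral>y. q k y * (n y \<bullet> w y) \<partial>\<sigma>) = (\<integral>x. grad (q k) x \<bullet> w x \<partial>L) + (\<integral>x. q k x * divg w x \<partial>L)" for k
    using green_C1[OF w q(1), of k] L2_inner_integrable[OF wL(1) C1_L2(2)[OF q(1)]] L2_mult_integrable[OF wL(2) C1_L2(1)[OF q(1)]]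
    by (simp add: mult.commute inner_commute)
  moreover have "(\<lambda>k. \<integral>y. q k y * (n y \<bullet> w y) \<partial>\<sigma>) \<longlonglongrightarrow> (\<integral>y. \<mu> y * (n y \<bullet> w y) \<partial>\<sigma>)"
    using L2_tendsto_inner_const[OF C1_L2(4)[OF q(1)] \<mu> q(4) normal_inner_L2[OF C1_continuous[OF w]]] by simp
  moreover have "(\<lambda>k. (\<integral>x. grad (q k) x \<bullet> w x \<partial>L) + (\<integral>x. q k x * divg w x \<partial>L)) \<longlonglongrightarrow> (\<integral>x. weak_grad \<Omega> m x \<bullet> w x \<partial>L) + (\<integral>x. m x * divg w x \<partial>L)"
    using L2_tendsto_inner_const[OF C1_L2(2)[OF q(1)] H1D(3)[OF m] q(3) wL(1)]
      L2_tendsto_inner_const[OF C1_L2(1)[OF q(1)] H1D(1)[OF m] q(2) wL(2)]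
    by (intro tendsto_add) simp_all
  ultimately have "(\<integral>y. \<mu> y * (n y \<bullet> w y) \<partial>\<sigma>) = (\<integral>x. weak_grad \<Omega> m x \<bullet> w x \<partial>L) + (\<integral>x. m x * divg w x \<partial>L)"
    using LIMSEQ_unique by simp
  then show ?thesis by (simp add: mult.commute inner_commute)
qed

section \<open>Normal traces of H(div) fields\<close>

lemma Hdiv_C1_sequence:
  assumes u: "u \<in> Hdiv \<Omega>"
  obtains w where "\<And>k::nat. Ck 1 (w k)" "(\<lambda>k. L2_norm L (\<lambda>x. w k x - u x)) \<longlonglongrightarrow> 0"
    "(\<lambda>k. L2_norm L (\<lambda>x. divg (w k) x - weak_div \<Omega> u x)) \<longlonglongrightarrow> 0"
proof -
  have "\<forall>k. \<exists>w. Ck 1 w \<and> L2_norm L (\<lambda>x. w x - u x) \<le> inverse (real (Suc k)) \<and>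
     L2_norm L (\<lambda>x. divg w x - weak_div \<Omega> u x) \<le> inverse (real (Suc k))"
  proof
    fix k
    show "\<exists>w. Ck 1 w \<and> L2_norm L (\<lambda>x. w x - u x) \<le> inverse (real (Suc k)) \<and>
     L2_norm L (\<lambda>x. divg w x - weak_div \<Omega> u x) \<le> inverse (real (Suc k))"
      by (rule Hdiv_dense[OF dom HdivD(1,2,3)[OF u], of "inverse (real (Suc k))"]) auto
  qed
  from choice[OF this] obtain w where w: "\<And>k. Ck 1 (w k)" "\<And>k. L2_norm L (\<lambda>x. w k x - u x) \<le> inverse (real (Suc k))"
     "\<And>k. L2_norm L (\<lambda>x. divg (w k) x - weak_div \<Omega> u x) \<le> inverse (real (Suc k))" by blast
  show ?thesis
  proof (rule that[OF w(1)])
    show "(\<lambda>k. L2_norm L (\<lambda>x. w k x - u x)) \<longlonglongrightarrow> 0"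
      by (rule tendsto_sandwich[OF _ _ tendsto_const LIMSEQ_inverse_real_of_nat]) (use w in auto)
    show "(\<lambda>k. L2_norm L (\<lambda>x. divg (w k) x - weak_div \<Omega> u x)) \<longlonglongrightarrow> 0"
      by (rule tendsto_sandwich[OF _ _ tendsto_const LIMSEQ_inverse_real_of_nat]) (use w in auto)
  qed
qed

lemma green_tendsto:
  assumes u: "u \<in> Hdiv \<Omega>" and w: "\<And>k::nat. Ck 1 (w k)" "(\<lambda>k. L2_norm L (\<lambda>x. w k x - u x)) \<longlonglongrightarrow> 0"
    "(\<lambda>k. L2_norm L (\<lambda>x. divg (w k) x - weak_div \<Omega> u x)) \<longlonglongrightarrow> 0" and t: "has_trace \<Omega> \<sigma> m \<mu>"
  shows "(\<lambda>k. \<integral>y. (n y \<bullet> w k y) * \<mu> y \<partial>\<sigma>) \<longlonglongrightarrow> (\<integral>x. u x \<bullet> weak_grad \<Omega> m x \<partial>L) + (\<integral>x. weak_div \<Omega> u x * m x \<partial>L)"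
proof -
  have m: "m \<in> H1 \<Omega>" using t by (auto simp: has_trace_def)
  show ?thesis unfolding green_H1[OF w(1) t]
    using L2_tendsto_inner_const[OF C1_L2_vec(1)[OF w(1)] HdivD(1)[OF u] w(2) H1D(3)[OF m]]
      L2_tendsto_inner_const[OF C1_L2_vec(2)[OF w(1)] HdivD(3)[OF u] w(3) H1D(1)[OF m]]
    by (intro tendsto_add) simp_all
qed

text \<open>Convergence in the dual norm, used for one fixed \<open>\<mu>\<close>, and Green's
  formula in the limit give the same value. Every admissible functional is thereby determined on the
  boundary functions that are traces.\<close>

lemma has_normal_trace_green:
  assumes h: "has_normal_trace \<Omega> \<sigma> n u h" and t: "has_trace \<Omega> \<sigma> m \<mu>"
  shows "h \<mu> = (\<integral>x. u x \<bullet> weak_grad \<Omega> m x \<partial>L) + (\<integral>x. weak_div \<Omega> u x * m x \<partial>L)"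
proof -
  have u: "u \<in> Hdiv \<Omega>" using h by (simp add: has_normal_trace_def)
  obtain w where w: "\<And>k. Ck 1 (w k)" "(\<lambda>k. Hdiv_norm \<Omega> (\<lambda>x. w k x - u x)) \<longlonglongrightarrow> 0"
    and hw: "\<And>\<epsilon>. \<epsilon> > 0 \<Longrightarrow> \<forall>\<^sub>F k in sequentially. \<forall>\<mu> \<in> Hhalf \<Omega> \<sigma>.
           \<bar>(\<integral>x. (n x \<bullet> w k x) * \<mu> x \<partial>\<sigma>) - h \<mu>\<bar> \<le> \<epsilon> * Hhalf_norm \<Omega> \<sigma> \<mu>"
    using h unfolding has_normal_trace_def by blast
  have \<mu>: "\<mu> \<in> Hhalf \<Omega> \<sigma>" using t by (auto simp: Hhalf_def has_trace_def)
  have w2: "(\<lambda>k. L2_norm L (\<lambda>x. w k x - u x)) \<longlonglongrightarrow> 0" "(\<lambda>k. L2_norm L (\<lambda>x. divg (w k) x - weak_div \<Omega> u x)) \<longlonglongrightarrow> 0"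
    using w(2) unfolding Hdiv_norm_diff[OF w(1) HdivD(1,2,3)[OF u]] by (simp_all add: sqrt_sum_tendsto_0_iff)
  have "(\<lambda>k. \<integral>y. (n y \<bullet> w k y) * \<mu> y \<partial>\<sigma>) \<longlonglongrightarrow> h \<mu>"
  proof (rule LIM_zero_cancel, rule tendstoI)
    fix \<epsilon> :: real assume \<epsilon>: "\<epsilon> > 0"
    \<comment> \<open>The absolute value and the summand 1 keep \<open>\<delta>\<close> positive
      whatever the value of the quotient norm.\<close>
    define \<delta> where "\<delta> = \<epsilon> / (1 + \<bar>Hhalf_norm \<Omega> \<sigma> \<mu>\<bar>)"
    have \<delta>: "\<delta> > 0" using \<epsilon> by (simp add: \<delta>_def add_pos_nonneg)
    have "\<delta> * Hhalf_norm \<Omega> \<sigma> \<mu> \<le> \<delta> * \<bar>Hhalf_norm \<Omega> \<sigma> \<mu>\<bar>" using \<delta> by (intro mult_left_mono) auto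
    also have "\<dots> < \<delta> * (1 + \<bar>Hhalf_norm \<Omega> \<sigma> \<mu>\<bar>)" using \<delta> by simp
    also have "\<dots> = \<epsilon>" by (simp add: \<delta>_def add_pos_nonneg add_nonneg_eq_0_iff)
    finally have lt: "\<delta> * Hhalf_norm \<Omega> \<sigma> \<mu> < \<epsilon>" .
    show "\<forall>\<^sub>F k in sequentially. dist ((\<integral>y. (n y \<bullet> w k y) * \<mu> y \<partial>\<sigma>) - h \<mu>) 0 < \<epsilon>"
      using hw[OF \<delta>]
    proof eventually_elim
      case (elim k)
      then have "\<bar>(\<integral>x. (n x \<bullet> w k x) * \<mu> x \<partial>\<sigma>) - h \<mu>\<bar> \<le> \<delta> * Hhalf_norm \<Omega> \<sigma> \<mu>" using \<mu> by blast
      then show ?case using lt by (simp add: dist_real_def)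
    qed
  qed
  from LIMSEQ_unique[OF this green_tendsto[OF u w(1) w2 t]] show ?thesis .
qed

text \<open>The functional is the pointwise limit of the boundary pairings; Green's formula
  evaluates it by any m whose trace is \<open>\<mu>\<close>. The error is at most the distance in
  H(div) times the H^1 norm of m, and the infimum over all such m gives the quotient norm.\<close>

lemma normal_trace_exists:
  assumes u: "u \<in> Hdiv \<Omega>"
  shows "\<exists>h. has_normal_trace \<Omega> \<sigma> n u h"
proof -
  obtain w where w: "\<And>k::nat. Ck 1 (w k)" "(\<lambda>k. L2_norm L (\<lambda>x. w k x - u x)) \<longlonglongrightarrow> 0"
    "(\<lambda>k. L2_norm L (\<lambda>x. divg (w k) x - weak_div \<Omega> u x)) \<longlonglongrightarrow> 0" by (rule Hdiv_C1_sequence[OF u]) (rule that)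
  define h where "h \<mu> = lim (\<lambda>k. \<integral>y. (n y \<bullet> w k y) * \<mu> y \<partial>\<sigma>)" for \<mu>
  have hm: "h \<mu> = (\<integral>x. u x \<bullet> weak_grad \<Omega> m x \<partial>L) + (\<integral>x. weak_div \<Omega> u x * m x \<partial>L)" if "has_trace \<Omega> \<sigma> m \<mu>" for m \<mu>
    unfolding h_def by (rule limI[OF green_tendsto[OF u w that]])
  have Hn: "(\<lambda>k. Hdiv_norm \<Omega> (\<lambda>x. w k x - u x)) \<longlonglongrightarrow> 0"
    unfolding Hdiv_norm_diff[OF w(1) HdivD(1,2,3)[OF u]] using w(2,3) by (simp add: sqrt_sum_tendsto_0_iff)
  have bound: "\<bar>(\<integral>x. (n x \<bullet> w k x) * \<mu> x \<partial>\<sigma>) - h \<mu>\<bar> \<le> (L2_norm L (\<lambda>x. w k x - u x) + L2_norm L (\<lambda>x. divg (w k) x - weak_div \<Omega> u x)) * H1_norm \<Omega> m"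
    if t: "has_trace \<Omega> \<sigma> m \<mu>" for k m \<mu>
  proof -
    have m: "m \<in> H1 \<Omega>" using t by (auto simp: has_trace_def)
    let ?a = "L2_norm L (\<lambda>x. w k x - u x)" and ?b = "L2_norm L (\<lambda>x. divg (w k) x - weak_div \<Omega> u x)"
    note wL = C1_L2_vec[OF w(1)[of k]] and uL = HdivD[OF u] and mL = H1D[OF m]
    have eq: "(\<integral>x. (n x \<bullet> w k x) * \<mu> x \<partial>\<sigma>) - h \<mu> = (\<integral>x. (w k x - u x) \<bullet> weak_grad \<Omega> m x \<partial>L) + (\<integral>x. (divg (w k) x - weak_div \<Omega> u x) \<bullet> m x \<partial>L)"
      unfolding green_H1[OF w(1) t] hm[OF t]
      using L2_inner_integrable[OF wL(1) mL(3)] L2_inner_integrable[OF uL(1) mL(3)] L2_mult_integrable[OF wL(2) mL(1)] L2_mult_integrable[OF uL(3) mL(1)]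
      by (simp add: inner_diff_left left_diff_distrib)
    have "\<bar>(\<integral>x. (n x \<bullet> w k x) * \<mu> x \<partial>\<sigma>) - h \<mu>\<bar> \<le> ?a * L2_norm L (weak_grad \<Omega> m) + ?b * L2_norm L m"
      unfolding eq using L2_Cauchy_Schwarz[OF L2_diff[OF wL(1) uL(1)] mL(3)] L2_Cauchy_Schwarz[OF L2_diff[OF wL(2) uL(3)] mL(1)] by linarith
    also have "\<dots> \<le> ?a * H1_norm \<Omega> m + ?b * H1_norm \<Omega> m"
      by (intro add_mono mult_left_mono) (auto simp: H1_norm_def intro: real_le_rsqrt)
    finally show ?thesis by (simp add: distrib_right)
  qed
  have "has_normal_trace \<Omega> \<sigma> n u h"
    unfolding has_normal_trace_def
  proof (intro conjI exI[of _ w] allI impI)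
    fix \<epsilon> :: real assume \<epsilon>: "\<epsilon> > 0"
    have "(\<lambda>k. L2_norm L (\<lambda>x. w k x - u x) + L2_norm L (\<lambda>x. divg (w k) x - weak_div \<Omega> u x)) \<longlonglongrightarrow> 0 + 0"
      by (intro tendsto_add w)
    then have "\<forall>\<^sub>F k in sequentially. L2_norm L (\<lambda>x. w k x - u x) + L2_norm L (\<lambda>x. divg (w k) x - weak_div \<Omega> u x) < \<epsilon>"
      using \<epsilon> by (intro order_tendstoD(2)) auto
    then show "\<forall>\<^sub>F k in sequentially. \<forall>\<mu>\<in>Hhalf \<Omega> \<sigma>. \<bar>(\<integral>x. (n x \<bullet> w k x) * \<mu> x \<partial>\<sigma>) - h \<mu>\<bar> \<le> \<epsilon> * Hhalf_norm \<Omega> \<sigma> \<mu>"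
    proof eventually_elim
      case (elim k)
      show ?case
      proof
        fix \<mu> assume \<mu>: "\<mu> \<in> Hhalf \<Omega> \<sigma>"
        let ?S = "{H1_norm \<Omega> p |p. p \<in> H1 \<Omega> \<and> has_trace \<Omega> \<sigma> p \<mu>}"
        let ?d = "\<bar>(\<integral>x. (n x \<bullet> w k x) * \<mu> x \<partial>\<sigma>) - h \<mu>\<bar>"
        have "?d / \<epsilon> \<le> Inf ?S"
        proof (rule cInf_greatest)
          show "?S \<noteq> {}" using \<mu> by (auto simp: Hhalf_def)
          fix s assume "s \<in> ?S"
          then obtain m where m: "s = H1_norm \<Omega> m" "has_trace \<Omega> \<sigma> m \<mu>" by blast
          have "?d \<le> (L2_norm L (\<lambda>x. w k x - u x) + L2_norm L (\<lambda>x. divg (w k) x - weak_div \<Omega> u x)) * H1_norm \<Omega> m"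
            by (rule bound[OF m(2)])
          also have "\<dots> \<le> \<epsilon> * H1_norm \<Omega> m" using elim by (intro mult_right_mono) (auto simp: H1_norm_def)
          finally show "?d / \<epsilon> \<le> s" using \<epsilon> m(1) by (simp add: divide_le_eq mult.commute)
        qed
        then show "?d \<le> \<epsilon> * Hhalf_norm \<Omega> \<sigma> \<mu>" using \<epsilon> by (simp add: Hhalf_norm_def divide_le_eq mult.commute)
      qed
    qed
  qed (use u w(1) Hn in auto)
  then show ?thesis by blast
qed

lemma normal_trace_green:
  assumes u: "u \<in> Hdiv \<Omega>" and t: "has_trace \<Omega> \<sigma> m \<mu>"
  shows "normal_trace \<Omega> \<sigma> n u \<mu> = (\<integral>x. u x \<bullet> weak_grad \<Omega> m x \<partial>L) + (\<integral>x. weak_div \<Omega> u x * m x \<partial>L)"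
proof -
  have "has_normal_trace \<Omega> \<sigma> n u (normal_trace \<Omega> \<sigma> n u)"
    unfolding normal_trace_def using normal_trace_exists[OF u] by (rule someI_ex)
  from has_normal_trace_green[OF this t] show ?thesis .
qed

end

section \<open>Minimisation of a quadratic functional\<close>

text \<open>The discriminant of a nonnegative quadratic is not positive; for A = 0 the function is
  affine and its slope has to vanish.\<close>

lemma quadratic_nonneg_imp:
  fixes A B E :: real
  assumes "\<And>s. 0 \<le> E + s * B + s\<^sup>2 * A" "0 \<le> A"
  shows "B\<^sup>2 \<le> 4 * E * A"
proof (cases "A = 0")
  case True
  have "B = 0"
  proof (rule ccontr)
    assume "B \<noteq> 0"
    then show False using assms(1)[of "- (E + 1) / B"] True by simp
  qed
  then show ?thesis using True by simp
next
  case False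
  then have A: "A > 0" using assms(2) by simp
  have "0 \<le> (E + (- B / (2 * A)) * B + (- B / (2 * A))\<^sup>2 * A) * (4 * A)"
    by (rule mult_nonneg_nonneg[OF assms(1)]) (use A in simp)
  also have "\<dots> = 4 * E * A - B\<^sup>2" using A by (simp add: field_simps power2_eq_square)
  finally show ?thesis by simp
qed

text \<open>\<open>S\<close> is only a pre-Hilbert space here; the completion is taken afterwards, separately in the domain
  and on the boundary.\<close>

lemma minimizing_sequence:
  fixes S :: "('x \<Rightarrow> real) set" and a :: "('x \<Rightarrow> real) \<Rightarrow> ('x \<Rightarrow> real) \<Rightarrow> real"
  assumes S0: "z0 \<in> S" and S: "\<And>q v s. q \<in> S \<Longrightarrow> v \<in> S \<Longrightarrow> (\<lambda>x. q x + s * v x) \<in> S"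
    and lin: "\<And>q v w s. q \<in> S \<Longrightarrow> v \<in> S \<Longrightarrow> w \<in> S \<Longrightarrow> a (\<lambda>x. q x + s * v x) w = a q w + s * a v w"
    and sym: "\<And>q v. q \<in> S \<Longrightarrow> v \<in> S \<Longrightarrow> a q v = a v q" and pos: "\<And>q. q \<in> S \<Longrightarrow> 0 \<le> a q q"
    and l: "\<And>q v s. q \<in> S \<Longrightarrow> v \<in> S \<Longrightarrow> l (\<lambda>x. q x + s * v x) = l q + s * l v"
    and bound: "\<And>v. v \<in> S \<Longrightarrow> \<bar>l v\<bar> \<le> K * sqrt (a v v)"
  obtains q where "\<And>k::nat. q k \<in> S" "\<And>v. v \<in> S \<Longrightarrow> (\<lambda>k. a (q k) v) \<longlonglongrightarrow> l v"
    "\<And>\<epsilon>. \<epsilon> > 0 \<Longrightarrow> \<exists>N. \<forall>j\<ge>N. \<forall>k\<ge>N. a (\<lambda>x. q j x - q k x) (\<lambda>x. q j x - q k x) < \<epsilon>"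
proof -
  define J where "J q = a q q / 2 - l q" for q
  have J_add: "J (\<lambda>x. q x + s * v x) = J q + s * (a q v - l v) + s\<^sup>2 * (a v v / 2)" if q: "q \<in> S" and v: "v \<in> S" for q v s
  proof -
    have w: "(\<lambda>x. q x + s * v x) \<in> S" using S q v .
    have "a (\<lambda>x. q x + s * v x) (\<lambda>x. q x + s * v x) = a q (\<lambda>x. q x + s * v x) + s * a v (\<lambda>x. q x + s * v x)"
      by (rule lin[OF q v w])
    also have "a q (\<lambda>x. q x + s * v x) = a q q + s * a q v"
      using sym[OF q w] lin[OF q v q, of s] sym[OF q v] by simp
    also have "a v (\<lambda>x. q x + s * v x) = a q v + s * a v v"
      using sym[OF v w] lin[OF q v v, of s] by simp
    finally show ?thesis unfolding J_def l[OF q v] by (simp add: algebra_simps power2_eq_square add_divide_distrib)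
  qed
  \<comment> \<open>Young's inequality gives K sqrt (a q q) <= K^2 / 2 + (a q q) / 2, so the energy
    has an infimum.\<close>
  have lower: "- (K\<^sup>2 / 2) \<le> J q" if q: "q \<in> S" for q
  proof -
    have "l q \<le> K * sqrt (a q q)" using bound[OF q] by linarith
    also have "2 * (K * sqrt (a q q)) \<le> K\<^sup>2 + (sqrt (a q q))\<^sup>2" using sum_squares_bound[of K "sqrt (a q q)"] by simp
    then have "K * sqrt (a q q) \<le> K\<^sup>2 / 2 + a q q / 2" using pos[OF q] by simp
    finally show ?thesis by (simp add: J_def)
  qed
  define m where "m = Inf (J ` S)"
  have bdd: "bdd_below (J ` S)" using lower by (intro bdd_belowI2) auto
  have mle: "m \<le> J q" if "q \<in> S" for q unfolding m_def using bdd that by (intro cInf_lower) auto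
  define \<rho> :: "nat \<Rightarrow> real" where "\<rho> k = inverse (real (Suc k))" for k
  have \<rho>: "0 < \<rho> k" "\<rho> \<longlonglongrightarrow> 0" for k
    using LIMSEQ_inverse_real_of_nat by (simp_all add: \<rho>_def[abs_def])
  have "\<exists>q\<in>S. J q < m + \<rho> k" for k
  proof -
    have "Inf (J ` S) < m + \<rho> k" using \<rho>(1)[of k] by (simp add: m_def)
    then show ?thesis using cInf_lessD[of "J ` S"] S0 by blast
  qed
  then have "\<forall>k. \<exists>q. q \<in> S \<and> J q < m + \<rho> k" by blast
  from choice[OF this] obtain q where q: "\<And>k. q k \<in> S" "\<And>k. J (q k) < m + \<rho> k" by blast
  \<comment> \<open>Since \<open>q k\<close> is within \<open>\<rho> k\<close> of the infimum,
    adding \<open>\<rho> k\<close> to the change of energy along v gives a nonnegative quadratic in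
    s; its discriminant bounds the first variation.\<close>
  have euler: "(a (q k) v - l v)\<^sup>2 \<le> 2 * \<rho> k * a v v" if v: "v \<in> S" for k v
  proof -
    have "(a (q k) v - l v)\<^sup>2 \<le> 4 * \<rho> k * (a v v / 2)"
    proof (rule quadratic_nonneg_imp)
      fix s
      show "0 \<le> \<rho> k + s * (a (q k) v - l v) + s\<^sup>2 * (a v v / 2)"
        using mle[OF S[OF q(1)[of k] v, of s]] J_add[OF q(1)[of k] v, of s] q(2)[of k] by linarith
    qed (use pos[OF v] in simp)
    then show ?thesis by (simp add: mult_ac)
  qed
  \<comment> \<open>At the midpoint the energy is the mean of its values at \<open>q j\<close> and
    \<open>q k\<close> minus one eighth of a d d for the difference d; it is at least the infimum,
    which makes the difference small.\<close>
  have cau: "a (\<lambda>x. q j x - q k x) (\<lambda>x. q j x - q k x) \<le> 4 * (\<rho> j + \<rho> k)" for j k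
  proof -
    have d: "(\<lambda>x. q j x + (-1) * q k x) \<in> S" by (rule S[OF q(1) q(1)])
    define d where "d = (\<lambda>x. q j x + (-1) * q k x)"
    have dS: "d \<in> S" using d by (simp add: d_def)
    define A B M where "A = a d d" and "B = a (q k) d - l d" and "M = J (\<lambda>x. q k x + (1/2) * d x)"
    have "m \<le> M" unfolding M_def by (rule mle[OF S[OF q(1) dS]])
    moreover have "M = J (q k) + (1/2) * B + (1/2)\<^sup>2 * (A / 2)"
      unfolding M_def A_def B_def by (rule J_add[OF q(1) dS])
    moreover have "J (\<lambda>x. q k x + 1 * d x) = J (q k) + 1 * B + 1\<^sup>2 * (A / 2)"
      unfolding A_def B_def by (rule J_add[OF q(1) dS])
    then have "J (q j) = J (q k) + B + A / 2" by (simp add: d_def)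
    ultimately have "A \<le> 4 * (\<rho> j + \<rho> k)"
      using q(2)[of j] q(2)[of k] by (simp add: power2_eq_square)
    moreover have "d = (\<lambda>x. q j x - q k x)" by (simp add: d_def)
    ultimately show ?thesis by (simp add: A_def)
  qed
  show ?thesis
  proof (rule that[OF q(1)])
    fix v assume v: "v \<in> S"
    have "(\<lambda>k. (a (q k) v - l v)\<^sup>2) \<longlonglongrightarrow> 0"
    proof (rule tendsto_sandwich[OF _ _ tendsto_const])
      have "(\<lambda>k. 2 * \<rho> k * a v v) \<longlonglongrightarrow> 2 * 0 * a v v"
        by (intro tendsto_intros \<rho>)
      then show "(\<lambda>k. 2 * \<rho> k * a v v) \<longlonglongrightarrow> 0" by simp
    qed (use euler[OF v] in auto)
    then have "(\<lambda>k. a (q k) v - l v) \<longlonglongrightarrow> 0" by (simp only: power_tendsto_0_iff[of 2] zero_less_numeral)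
    then show "(\<lambda>k. a (q k) v) \<longlonglongrightarrow> l v" by (rule LIM_zero_cancel)
  next
    fix \<epsilon> :: real assume \<epsilon>: "\<epsilon> > 0"
    obtain N where N: "\<rho> N < \<epsilon> / 8" using reals_Archimedean[of "\<epsilon>/8"] \<epsilon> by (auto simp: \<rho>_def)
    have "a (\<lambda>x. q j x - q k x) (\<lambda>x. q j x - q k x) < \<epsilon>" if "j \<ge> N" "k \<ge> N" for j k
    proof -
      have "\<rho> j \<le> \<rho> N" "\<rho> k \<le> \<rho> N"
        using that unfolding \<rho>_def by (intro le_imp_inverse_le; simp)+
      then have "4 * (\<rho> j + \<rho> k) \<le> 8 * \<rho> N" by simp
      also have "\<dots> < \<epsilon>" using N by simp
      finally have "4 * (\<rho> j + \<rho> k) < \<epsilon>" .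
      with cau show ?thesis by (rule order_le_less_trans)
    qed
    then show "\<exists>N. \<forall>j\<ge>N. \<forall>k\<ge>N. a (\<lambda>x. q j x - q k x) (\<lambda>x. q j x - q k x) < \<epsilon>" by blast
  qed
qed

section \<open>Pairs\<close>

lemma L2_fst: "f \<in> L2 M \<Longrightarrow> (\<lambda>x. fst (f x)) \<in> L2 M"
  and L2_snd: "f \<in> L2 M \<Longrightarrow> (\<lambda>x. snd (f x)) \<in> L2 M"
  for f :: "'x \<Rightarrow> 'a::euclidean_space \<times> 'b::euclidean_space"
proof -
  assume f: "f \<in> L2 M"
  have c: "(fst :: 'a \<times> 'b \<Rightarrow> 'a) \<in> borel_measurable borel" "(snd :: 'a \<times> 'b \<Rightarrow> 'b) \<in> borel_measurable borel"
    by (auto intro!: borel_measurable_continuous_onI continuous_intros)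
  show "(\<lambda>x. fst (f x)) \<in> L2 M"
    by (rule L2_dominated[OF measurable_compose[OF L2_measurable[OF f] c(1)] f]) (rule AE_I2, metis norm_fst_le prod.collapse)
  show "(\<lambda>x. snd (f x)) \<in> L2 M"
    by (rule L2_dominated[OF measurable_compose[OF L2_measurable[OF f] c(2)] f]) (rule AE_I2, metis norm_snd_le prod.collapse)
qed

lemma L2_Pair:
  fixes f :: "'x \<Rightarrow> 'a::euclidean_space" and g :: "'x \<Rightarrow> 'b::euclidean_space"
  assumes "f \<in> L2 M" "g \<in> L2 M"
  shows "(\<lambda>x. (f x, g x)) \<in> L2 M"
proof (rule L2_I)
  have "(\<lambda>z. z) \<in> borel_measurable (borel :: ('a \<times> 'b) measure)" by simp
  have "(\<lambda>x. (f x, g x)) \<in> measurable M (borel \<Otimes>\<^sub>M borel)"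
    by (intro measurable_Pair L2_measurable assms)
  then show "(\<lambda>x. (f x, g x)) \<in> borel_measurable M" by (simp add: borel_prod)
  show "integrable M (\<lambda>x. (norm (f x, g x))\<^sup>2)"
    using assms by (simp add: norm_Pair L2_def)
qed

context lip_dom
begin

section \<open>Elements of the solution space\<close>

text \<open>A C^1 function is its own trace, with the constant sequence as witness, so the
  difference of two representing functions is orthogonal to all C^1 functions. Smooth functions
  tending boundedly to indicators then give integral zero over every box.\<close>

lemma represents_unique:
  assumes g: "represents_normal_trace \<Omega> \<sigma> n u g" "represents_normal_trace \<Omega> \<sigma> n u g'"
  shows "AE y in \<sigma>. g y = g' y"
proof -
  have gL: "g \<in> L2 \<sigma>" "g' \<in> L2 \<sigma>" using g by (auto simp: represents_normal_trace_def)
  interpret finite_measure \<sigma> by (rule \<sigma>_finite)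
  let ?k = "\<lambda>y. g y - g' y"
  have kL: "?k \<in> L2 \<sigma>" by (rule L2_diff[OF gL])
  have zero: "(\<integral>y. ?k y * q y \<partial>\<sigma>) = 0" if q: "Ck 1 q" for q
  proof -
    have qL: "q \<in> L2 \<sigma>" by (rule C1_L2(4)[OF q])
    have H: "q \<in> H1 \<Omega>" and ae: "AE x in L. weak_grad \<Omega> q x = grad q x"
      using H1I[OF C1_L2(1)[OF q] C1_L2(3)[OF q] C1_L2(2)[OF q]] by blast+
    have n0: "L2_norm L (\<lambda>x. grad q x - weak_grad \<Omega> q x) = 0"
    proof -
      have "L2_norm L (\<lambda>x. grad q x - weak_grad \<Omega> q x) = L2_norm L (\<lambda>x. 0 :: real^'d)"
        by (rule L2_norm_cong_AE) (use ae L2_measurable[OF L2_diff[OF C1_L2(2)[OF q] H1D(3)[OF H]]] in auto)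
      then show ?thesis by simp
    qed
    have "has_trace \<Omega> \<sigma> q q"
      unfolding has_trace_iff using H qL q n0 by (intro conjI exI[of _ "\<lambda>k. q"]) auto
    then have "q \<in> Hhalf \<Omega> \<sigma>" using H by (auto simp: Hhalf_def)
    then have "(\<integral>y. g y * q y \<partial>\<sigma>) = (\<integral>y. g' y * q y \<partial>\<sigma>)" using g by (simp add: represents_normal_trace_def)
    then show ?thesis using L2_mult_integrable[OF gL(1) qL] L2_mult_integrable[OF gL(2) qL] by (simp add: left_diff_distrib)
  qed
  have ki: "integrable \<sigma> ?k"
    using L2_mult_integrable[OF kL continuous_L2_\<sigma>[of "\<lambda>x. 1"]] by simp
  have "AE y in \<sigma>. ?k y = 0"
  proof (rule AE_zero_if_box_integrals_zero_borel[OF _ sets_\<sigma> ki])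
    show "sigma_finite_measure \<sigma>" by (rule sigma_finite_measure_axioms)
    fix c d :: "real^'d"
    let ?\<psi> = "\<lambda>j x. 1 - (1 - box_bump c d x) ^ j"
    have bm: "box_bump c d \<in> borel_measurable \<sigma>"
      by (rule borel_\<sigma>) (rule borel_measurable_continuous_onI[OF Ck_imp_continuous[OF Ck_box_bump]])
    have km: "?k \<in> borel_measurable \<sigma>" using ki by blast
    have "(\<lambda>j. \<integral>y. ?k y * ?\<psi> j y \<partial>\<sigma>) \<longlonglongrightarrow> (\<integral>y. indicator (box c d) y * ?k y \<partial>\<sigma>)"
    proof (rule integral_dominated_convergence[where w="\<lambda>y. \<bar>?k y\<bar>"])
      show "integrable \<sigma> (\<lambda>y. \<bar>?k y\<bar>)" using ki by simp
      show "(\<lambda>y. ?k y * ?\<psi> j y) \<in> borel_measurable \<sigma>" for j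
        by (intro borel_measurable_times borel_measurable_diff borel_measurable_power borel_measurable_const bm L2_measurable gL)
      show "(\<lambda>y. indicator (box c d) y * ?k y) \<in> borel_measurable \<sigma>"
        by (intro borel_measurable_times borel_measurable_indicator km) (simp add: sets_\<sigma>)
      have b: "\<bar>?\<psi> j x\<bar> \<le> 1" for j x
        using box_bump_nonneg[of c d x] box_bump_le_1[of c d x]
        by (auto simp: abs_le_iff power_le_one intro: order_trans[OF _ zero_le_power])
      show "AE y in \<sigma>. norm (?k y * ?\<psi> j y) \<le> \<bar>?k y\<bar>" for j
      proof (rule AE_I2)
        fix y
        show "norm (?k y * ?\<psi> j y) \<le> \<bar>?k y\<bar>"
          unfolding real_norm_def abs_mult by (rule mult_left_le[OF b]) simp
      qed
      show "AE y in \<sigma>. (\<lambda>j. ?k y * ?\<psi> j y) \<longlonglongrightarrow> indicator (box c d) y * ?k y"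
      proof (rule AE_I2)
        fix y
        show "(\<lambda>j. ?k y * ?\<psi> j y) \<longlonglongrightarrow> indicator (box c d) y * ?k y"
        proof (cases "y \<in> box c d")
          case True
          have "(\<lambda>j. (1 - box_bump c d y) ^ j) \<longlonglongrightarrow> 0"
          proof (rule LIMSEQ_power_zero)
            show "norm (1 - box_bump c d y) < 1"
              using box_bump_pos[OF True] box_bump_le_1[of c d y] unfolding real_norm_def by linarith
          qed
          then have "(\<lambda>j. ?k y * ?\<psi> j y) \<longlonglongrightarrow> ?k y * (1 - 0)"
            by (intro tendsto_mult tendsto_diff tendsto_const)
          then show ?thesis using True by simp
        qed (simp add: box_bump_zero)
      qed
    qed
    moreover have "(\<integral>y. ?k y * ?\<psi> j y \<partial>\<sigma>) = 0" for j
      by (rule zero) (intro Ck_diff Ck_const Ck_power Ck_box_bump)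
    ultimately show "(\<integral>y. indicator (box c d) y * ?k y \<partial>\<sigma>) = 0" by (simp add: LIMSEQ_const_iff)
  qed
  then show ?thesis by simp
qed

text \<open>The graph space bounds only \<open>T_op\<close>; subtracting the components of
  \<open>\<xi>\<close> isolates the weak derivatives. For elements of V the duality pairing in
  Green's formula becomes a boundary integral against the chosen normal trace.\<close>

lemma V_space_D:
  assumes V: "\<xi> \<in> V_space \<Omega> \<sigma> n"
  defines "u \<equiv> \<lambda>x. fst (\<xi> x)" and "p \<equiv> \<lambda>x. snd (\<xi> x)"
  shows "\<xi> \<in> L2 L" "T_op \<Omega> \<xi> \<in> L2 L" "p \<in> H1 \<Omega>" "u \<in> Hdiv \<Omega>"
    "normal_trace_fun \<Omega> \<sigma> n u \<in> L2 \<sigma>"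
    "\<And>m \<mu>. has_trace \<Omega> \<sigma> m \<mu> \<Longrightarrow> (\<integral>x. u x \<bullet> weak_grad \<Omega> m x \<partial>L) + (\<integral>x. weak_div \<Omega> u x * m x \<partial>L)
       = (\<integral>y. normal_trace_fun \<Omega> \<sigma> n u y * \<mu> y \<partial>\<sigma>)"
proof -
  have W: "\<xi> \<in> W_space \<Omega>" and U: "u \<in> U_space \<Omega> \<sigma> n" using V by (auto simp: V_space_def u_def)
  show \<xi>: "\<xi> \<in> L2 L" and T: "T_op \<Omega> \<xi> \<in> L2 L" using W by (auto simp: W_space_def)
  have uL: "u \<in> L2 L" and pL: "p \<in> L2 L" unfolding u_def p_def using L2_fst[OF \<xi>] L2_snd[OF \<xi>] by auto
  have "weak_grad \<Omega> p = (\<lambda>x. fst (T_op \<Omega> \<xi> x) - u x)" by (simp add: T_op_def u_def p_def)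
  then have "weak_grad \<Omega> p \<in> L2 L" using L2_diff[OF L2_fst[OF T] uL] by simp
  then show "p \<in> H1 \<Omega>" using W pL by (auto simp: H1_def W_space_def p_def)
  show uH: "u \<in> Hdiv \<Omega>" using U by (simp add: U_space_def)
  have "\<exists>g. represents_normal_trace \<Omega> \<sigma> n u g" using U by (simp add: U_space_def)
  then have r: "represents_normal_trace \<Omega> \<sigma> n u (normal_trace_fun \<Omega> \<sigma> n u)"
    unfolding normal_trace_fun_def by (rule someI_ex)
  then show "normal_trace_fun \<Omega> \<sigma> n u \<in> L2 \<sigma>" by (simp add: represents_normal_trace_def)
  fix m \<mu> assume t: "has_trace \<Omega> \<sigma> m \<mu>"
  then have "\<mu> \<in> Hhalf \<Omega> \<sigma>" by (auto simp: Hhalf_def has_trace_def)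
  then show "(\<integral>x. u x \<bullet> weak_grad \<Omega> m x \<partial>L) + (\<integral>x. weak_div \<Omega> u x * m x \<partial>L)
       = (\<integral>y. normal_trace_fun \<Omega> \<sigma> n u y * \<mu> y \<partial>\<sigma>)"
    using r normal_trace_green[OF uH t] by (simp add: represents_normal_trace_def)
qed

end

context lip_dom
begin

section \<open>The weak Robin problem\<close>

text \<open>The completion of the C^1 functions in the energy norm is described by three limits: p
  and G in the domain and t on the boundary. It remains to identify G as the weak gradient and t as
  the trace of p. The load F is paired with \<open>grad v\<close>, so square integrability of F is
  enough.\<close>

lemma robin_solution:
  fixes F :: "real^'d \<Rightarrow> real^'d" and b \<gamma> \<beta> :: "real^'d \<Rightarrow> real"
  assumes F: "F \<in> L2 L" and b: "b \<in> L2 L" and \<gamma>: "\<gamma> \<in> L2 \<sigma>"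
    and \<beta>: "\<beta> \<in> borel_measurable \<sigma>" "AE y in \<sigma>. 0 \<le> \<beta> y \<and> \<beta> y \<le> B"
  obtains p t where "has_trace \<Omega> \<sigma> p t"
    "\<And>v. Ck 1 v \<Longrightarrow> (\<integral>x. p x * v x \<partial>L) + (\<integral>x. weak_grad \<Omega> p x \<bullet> grad v x \<partial>L) + (\<integral>y. (\<beta> y * t y) * v y \<partial>\<sigma>)
       = (\<integral>x. b x * v x \<partial>L) + (\<integral>x. F x \<bullet> grad v x \<partial>L) + (\<integral>y. \<gamma> y * v y \<partial>\<sigma>)"
proof -
  let ?S = "{q :: real^'d \<Rightarrow> real. Ck 1 q}"
  define a where "a q v = (\<integral>x. q x * v x \<partial>L) + (\<integral>x. grad q x \<bullet> grad v x \<partial>L) + (\<integral>y. (\<beta> y * q y) * v y \<partial>\<sigma>)" for q v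
  define l where "l v = (\<integral>x. b x * v x \<partial>L) + (\<integral>x. F x \<bullet> grad v x \<partial>L) + (\<integral>y. \<gamma> y * v y \<partial>\<sigma>)" for v
  have \<beta>_abs: "AE y in \<sigma>. \<bar>\<beta> y\<bar> \<le> B" using \<beta>(2) by eventually_elim simp
  have \<beta>L: "(\<lambda>y. \<beta> y * q y) \<in> L2 \<sigma>" if "q \<in> L2 \<sigma>" for q
    by (rule L2_bounded_mult[OF that \<beta>(1) \<beta>_abs])
  note C = C1_L2
  have gadd: "grad (\<lambda>x. q x + s * v x) = (\<lambda>x. grad q x + s *\<^sub>R grad v x)" if "Ck 1 q" "Ck 1 v" for q v :: "real^'d \<Rightarrow> real" and s
    by (rule ext) (simp only: grad_add[OF that(1) Ck_mult[OF Ck_const that(2)]] grad_cmult[OF that(2)])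
  have S: "Ck 1 (\<lambda>x. q x + s * v x)" if "Ck 1 q" "Ck 1 v" for q v :: "real^'d \<Rightarrow> real" and s
    by (intro Ck_add Ck_mult Ck_const that)
  have lin: "a (\<lambda>x. q x + s * v x) w = a q w + s * a v w" if q: "Ck 1 q" and v: "Ck 1 v" and w: "Ck 1 w" for q v w s
  proof -
    have "(\<integral>x. (q x + s * v x) * w x \<partial>L) = (\<integral>x. q x * w x \<partial>L) + s * (\<integral>x. v x * w x \<partial>L)"
      using L2_mult_integrable[OF C(1)[OF q] C(1)[OF w]] L2_mult_integrable[OF C(1)[OF v] C(1)[OF w]]
      by (simp add: distrib_right mult.assoc)
    moreover have "(\<integral>x. grad (\<lambda>x. q x + s * v x) x \<bullet> grad w x \<partial>L) = (\<integral>x. grad q x \<bullet> grad w x \<partial>L) + s * (\<integral>x. grad v x \<bullet> grad w x \<partial>L)"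
      unfolding gadd[OF q v]
      using L2_inner_integrable[OF C(2)[OF q] C(2)[OF w]] L2_inner_integrable[OF C(2)[OF v] C(2)[OF w]]
      by (simp add: inner_add_left)
    moreover have "(\<integral>y. (\<beta> y * (q y + s * v y)) * w y \<partial>\<sigma>) = (\<integral>y. (\<beta> y * q y) * w y \<partial>\<sigma>) + s * (\<integral>y. (\<beta> y * v y) * w y \<partial>\<sigma>)"
    proof -
      have "(\<integral>y. (\<beta> y * (q y + s * v y)) * w y \<partial>\<sigma>) = (\<integral>y. (\<beta> y * q y) * w y + s * ((\<beta> y * v y) * w y) \<partial>\<sigma>)"
        by (simp add: algebra_simps)
      then show ?thesis using L2_mult_integrable[OF \<beta>L[OF C(4)[OF q]] C(4)[OF w]] L2_mult_integrable[OF \<beta>L[OF C(4)[OF v]] C(4)[OF w]]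
        by simp
    qed
    ultimately show ?thesis by (simp add: a_def distrib_left)
  qed
  have sym: "a q v = a v q" for q v by (simp add: a_def inner_commute mult_ac)
  have l_lin: "l (\<lambda>x. q x + s * v x) = l q + s * l v" if q: "Ck 1 q" and v: "Ck 1 v" for q v s
  proof -
    have "(\<integral>x. b x * (q x + s * v x) \<partial>L) = (\<integral>x. b x * q x + s * (b x * v x) \<partial>L)" by (simp add: algebra_simps)
    then have "(\<integral>x. b x * (q x + s * v x) \<partial>L) = (\<integral>x. b x * q x \<partial>L) + s * (\<integral>x. b x * v x \<partial>L)"
      using L2_mult_integrable[OF b C(1)[OF q]] L2_mult_integrable[OF b C(1)[OF v]] by simp
    moreover have "(\<integral>x. F x \<bullet> grad (\<lambda>x. q x + s * v x) x \<partial>L) = (\<integral>x. F x \<bullet> grad q x \<partial>L) + s * (\<integral>x. F x \<bullet> grad v x \<partial>L)"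
      unfolding gadd[OF q v]
      using L2_inner_integrable[OF F C(2)[OF q]] L2_inner_integrable[OF F C(2)[OF v]] by (simp add: inner_add_right)
    moreover have "(\<integral>y. \<gamma> y * (q y + s * v y) \<partial>\<sigma>) = (\<integral>y. \<gamma> y * q y + s * (\<gamma> y * v y) \<partial>\<sigma>)" by (simp add: algebra_simps)
    then have "(\<integral>y. \<gamma> y * (q y + s * v y) \<partial>\<sigma>) = (\<integral>y. \<gamma> y * q y \<partial>\<sigma>) + s * (\<integral>y. \<gamma> y * v y \<partial>\<sigma>)"
      using L2_mult_integrable[OF \<gamma> C(4)[OF q]] L2_mult_integrable[OF \<gamma> C(4)[OF v]] by simp
    ultimately show ?thesis by (simp add: l_def distrib_left)
  qed
  have coer: "(L2_norm L q)\<^sup>2 + (L2_norm L (grad q))\<^sup>2 \<le> a q q" for q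
  proof -
    have "0 \<le> (\<integral>y. (\<beta> y * q y) * q y \<partial>\<sigma>)"
    proof (rule integral_nonneg_AE)
      show "AE y in \<sigma>. 0 \<le> (\<beta> y * q y) * q y"
        using \<beta>(2) by eventually_elim (simp add: mult.assoc)
    qed
    moreover have "(L2_norm L q)\<^sup>2 = (\<integral>x. q x * q x \<partial>L)" unfolding L2_norm_power2 by (simp add: power2_eq_square)
    moreover have "(L2_norm L (grad q))\<^sup>2 = (\<integral>x. grad q x \<bullet> grad q x \<partial>L)" unfolding L2_norm_power2 by (simp add: power2_norm_eq_inner)
    ultimately show ?thesis by (simp add: a_def)
  qed
  have le: "L2_norm L q \<le> sqrt (a q q)" "L2_norm L (grad q) \<le> sqrt (a q q)" for q
    using coer[of q] by (auto intro!: real_le_rsqrt simp: add_nonneg_pos order_trans[OF _ coer])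
  obtain K where K: "0 \<le> K" "\<And>q. Ck 1 q \<Longrightarrow> L2_norm \<sigma> q \<le> K * sqrt ((L2_norm L q)\<^sup>2 + (L2_norm L (grad q))\<^sup>2)"
    by (rule trace_inequality) (rule that)
  have le\<sigma>: "L2_norm \<sigma> q \<le> K * sqrt (a q q)" if "Ck 1 q" for q
  proof -
    have "K * sqrt ((L2_norm L q)\<^sup>2 + (L2_norm L (grad q))\<^sup>2) \<le> K * sqrt (a q q)"
      by (intro mult_left_mono real_sqrt_le_mono coer K)
    then show ?thesis using K(2)[OF that] by linarith
  qed
  have bound: "\<bar>l v\<bar> \<le> (L2_norm L b + L2_norm L F + L2_norm \<sigma> \<gamma> * K) * sqrt (a v v)" if v: "Ck 1 v" for v
  proof -
    have "\<bar>\<integral>x. b x * v x \<partial>L\<bar> \<le> L2_norm L b * sqrt (a v v)"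
      using L2_Cauchy_Schwarz[OF b C(1)[OF v]] mult_left_mono[OF le(1)[of v] L2_norm_nonneg[of L b]] by simp
    moreover have "\<bar>\<integral>x. F x \<bullet> grad v x \<partial>L\<bar> \<le> L2_norm L F * sqrt (a v v)"
      using L2_Cauchy_Schwarz[OF F C(2)[OF v]] mult_left_mono[OF le(2)[of v] L2_norm_nonneg[of L F]] by simp
    moreover have "\<bar>\<integral>y. \<gamma> y * v y \<partial>\<sigma>\<bar> \<le> L2_norm \<sigma> \<gamma> * (K * sqrt (a v v))"
      using L2_Cauchy_Schwarz[OF \<gamma> C(4)[OF v]] mult_left_mono[OF le\<sigma>[OF v] L2_norm_nonneg[of \<sigma> \<gamma>]] by simp
    ultimately show ?thesis unfolding l_def distrib_right mult.assoc by linarith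
  qed
  obtain q where q: "\<And>k::nat. Ck 1 (q k)" and lim: "\<And>v. Ck 1 v \<Longrightarrow> (\<lambda>k. a (q k) v) \<longlonglongrightarrow> l v"
    and cau: "\<And>\<epsilon>. \<epsilon> > 0 \<Longrightarrow> \<exists>N. \<forall>j\<ge>N. \<forall>k\<ge>N. a (\<lambda>x. q j x - q k x) (\<lambda>x. q j x - q k x) < \<epsilon>"
  proof (rule minimizing_sequence[of "\<lambda>x. 0" ?S a l "L2_norm L b + L2_norm L F + L2_norm \<sigma> \<gamma> * K"])
    show "0 \<le> a q q" if "q \<in> ?S" for q using coer[of q] by (meson add_nonneg_nonneg order_trans zero_le_power2)
    fix q :: "nat \<Rightarrow> real^'d \<Rightarrow> real"
    assume "\<And>k. q k \<in> ?S" "\<And>v. v \<in> ?S \<Longrightarrow> (\<lambda>k. a (q k) v) \<longlonglongrightarrow> l v"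
      "\<And>\<epsilon>. \<epsilon> > 0 \<Longrightarrow> \<exists>N. \<forall>j\<ge>N. \<forall>k\<ge>N. a (\<lambda>x. q j x - q k x) (\<lambda>x. q j x - q k x) < \<epsilon>"
    then show thesis unfolding mem_Collect_eq by (rule that[of q])
  qed (unfold mem_Collect_eq, (rule Ck_const S lin sym l_lin bound; assumption)+)
  have gdiff: "grad (\<lambda>x. q j x - q k x) = (\<lambda>x. grad (q j) x - grad (q k) x)" for j k
    by (rule ext) (rule grad_diff[OF q q])
  have cauchy: "\<exists>N. \<forall>j\<ge>N. \<forall>k\<ge>N. L2_norm L (\<lambda>x. q j x - q k x) < e \<and> L2_norm L (\<lambda>x. grad (q j) x - grad (q k) x) < e \<and>
    L2_norm \<sigma> (\<lambda>x. q j x - q k x) < e" if e: "e > 0" for e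
  proof -
    \<comment> \<open>With r the energy norm of the difference, r (K + 1) < e makes both r and K r
      smaller than e, which serves the domain norms and the boundary norm at once.\<close>
    obtain N where N: "\<And>j k. j \<ge> N \<Longrightarrow> k \<ge> N \<Longrightarrow> a (\<lambda>x. q j x - q k x) (\<lambda>x. q j x - q k x) < (e / (K + 1))\<^sup>2"
      using cau[of "(e / (K + 1))\<^sup>2"] e K(1) by fastforce
    have "L2_norm L (\<lambda>x. q j x - q k x) < e \<and> L2_norm L (\<lambda>x. grad (q j) x - grad (q k) x) < e \<and>
      L2_norm \<sigma> (\<lambda>x. q j x - q k x) < e" if "j \<ge> N" "k \<ge> N" for j k
    proof -
      let ?d = "\<lambda>x. q j x - q k x"
      define r where "r = sqrt (a ?d ?d)"
      have "r < e / (K + 1)" unfolding r_def using real_sqrt_less_mono[OF N[OF that]] e K(1) by simp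
      then have r: "r * (K + 1) < e" using K(1) by (simp add: pos_less_divide_eq)
      have r0: "0 \<le> r" unfolding r_def using le(1)[of ?d] L2_norm_nonneg[of L ?d] by linarith
      have "r \<le> r * (K + 1)" "K * r \<le> r * (K + 1)" using r0 K(1) by (auto simp: algebra_simps)
      moreover have "L2_norm L ?d \<le> r" "L2_norm L (\<lambda>x. grad (q j) x - grad (q k) x) \<le> r" "L2_norm \<sigma> ?d \<le> K * r"
        using le[of ?d] le\<sigma>[OF Ck_diff[OF q q], of j k] unfolding r_def gdiff by auto
      ultimately show ?thesis using r by linarith
    qed
    then show ?thesis by blast
  qed
  have "\<exists>p\<in>L2 L. (\<lambda>k. L2_norm L (\<lambda>x. q k x - p x)) \<longlonglongrightarrow> 0"
    by (rule L2_complete[OF C(1)[OF q]]) (use cauchy in blast)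
  then obtain p where p: "p \<in> L2 L" "(\<lambda>k. L2_norm L (\<lambda>x. q k x - p x)) \<longlonglongrightarrow> 0" by blast
  have "\<exists>G\<in>L2 L. (\<lambda>k. L2_norm L (\<lambda>x. grad (q k) x - G x)) \<longlonglongrightarrow> 0"
    by (rule L2_complete[OF C(2)[OF q]]) (use cauchy in blast)
  then obtain G where G: "G \<in> L2 L" "(\<lambda>k. L2_norm L (\<lambda>x. grad (q k) x - G x)) \<longlonglongrightarrow> 0" by blast
  have "\<exists>t\<in>L2 \<sigma>. (\<lambda>k. L2_norm \<sigma> (\<lambda>x. q k x - t x)) \<longlonglongrightarrow> 0"
    by (rule L2_complete[OF C(4)[OF q]]) (use cauchy in blast)
  then obtain t where t: "t \<in> L2 \<sigma>" "(\<lambda>k. L2_norm \<sigma> (\<lambda>x. q k x - t x)) \<longlonglongrightarrow> 0" by blast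
  \<comment> \<open>The C^1 functions satisfy integration by parts against test functions, and both
    sides pass to their L^2 limits.\<close>
  have wg: "has_weak_gradient \<Omega> p G"
    unfolding has_weak_gradient_def
  proof (intro conjI ballI allI)
    fix \<psi> i assume \<psi>: "\<psi> \<in> test_functions \<Omega>"
    have 1: "(\<lambda>k. \<integral>x. q k x * (grad \<psi> x $ i) \<partial>L) \<longlonglongrightarrow> (\<integral>x. p x * (grad \<psi> x $ i) \<partial>L)"
      using L2_tendsto_inner_const[OF C(1)[OF q] p L2_component[OF test_L2(2)[OF \<psi>]]] by simp
    have "(\<lambda>x. \<psi> x *\<^sub>R axis i (1::real)) \<in> L2 L"
      by (rule continuous_L2_\<Omega>) (intro continuous_intros C1_continuous test_functions_D(1)[OF \<psi>])
    from L2_tendsto_inner_const[OF C(2)[OF q] G this]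
    have "(\<lambda>k. \<integral>x. (grad (q k) x $ i) * \<psi> x \<partial>L) \<longlonglongrightarrow> (\<integral>x. (G x $ i) * \<psi> x \<partial>L)"
      by (simp add: inner_axis mult.commute)
    then have 2: "(\<lambda>k. - (\<integral>x. (grad (q k) x $ i) * \<psi> x \<partial>L)) \<longlonglongrightarrow> - (\<integral>x. (G x $ i) * \<psi> x \<partial>L)" by (rule tendsto_minus)
    have "(\<integral>x. q k x * (grad \<psi> x $ i) \<partial>L) = - (\<integral>x. (grad (q k) x $ i) * \<psi> x \<partial>L)" for k
      using C(3)[OF q[of k]] \<psi> by (auto simp: has_weak_gradient_def)
    then show "(\<integral>x. p x * (grad \<psi> x $ i) \<partial>L) = - (\<integral>x. (G x $ i) * \<psi> x \<partial>L)"
      using LIMSEQ_unique[OF 1] 2 by simp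
  qed (intro L2_locally_integrable p G)+
  note pH = H1I[OF p(1) wg G(1)]
  have nG: "L2_norm L (\<lambda>x. grad (q k) x - weak_grad \<Omega> p x) = L2_norm L (\<lambda>x. grad (q k) x - G x)" for k
    by (rule L2_norm_cong_AE[OF L2_measurable[OF L2_diff[OF C(2)[OF q] pH(3)]] L2_measurable[OF L2_diff[OF C(2)[OF q] G(1)]]])
      (use pH(2) in eventually_elim, simp)
  have nG0: "(\<lambda>k. L2_norm L (\<lambda>x. grad (q k) x - weak_grad \<Omega> p x)) \<longlonglongrightarrow> 0" using G(2) by (simp only: nG)
  show thesis
  proof (rule that)
    show "has_trace \<Omega> \<sigma> p t" unfolding has_trace_iff using pH(1) t p(2) nG0 q by blast
    fix v :: "real^'d \<Rightarrow> real" assume v: "Ck 1 v"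
    have "(\<lambda>k. a (q k) v) \<longlonglongrightarrow> (\<integral>x. p x * v x \<partial>L) + (\<integral>x. weak_grad \<Omega> p x \<bullet> grad v x \<partial>L) + (\<integral>y. (\<beta> y * t y) * v y \<partial>\<sigma>)"
      unfolding a_def
    proof (intro tendsto_add)
      show "(\<lambda>k. \<integral>x. q k x * v x \<partial>L) \<longlonglongrightarrow> (\<integral>x. p x * v x \<partial>L)"
        using L2_tendsto_inner_const[OF C(1)[OF q] p C(1)[OF v]] by simp
      show "(\<lambda>k. \<integral>x. grad (q k) x \<bullet> grad v x \<partial>L) \<longlonglongrightarrow> (\<integral>x. weak_grad \<Omega> p x \<bullet> grad v x \<partial>L)"
        by (rule L2_tendsto_inner_const[OF C(2)[OF q] pH(3) nG0 C(2)[OF v]])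
      show "(\<lambda>k. \<integral>y. (\<beta> y * q k y) * v y \<partial>\<sigma>) \<longlonglongrightarrow> (\<integral>y. (\<beta> y * t y) * v y \<partial>\<sigma>)"
        using L2_tendsto_inner_const[OF C(4)[OF q] t \<beta>L[OF C(4)[OF v]]] by (simp add: mult_ac)
    qed
    then show "(\<integral>x. p x * v x \<partial>L) + (\<integral>x. weak_grad \<Omega> p x \<bullet> grad v x \<partial>L) + (\<integral>y. (\<beta> y * t y) * v y \<partial>\<sigma>)
       = (\<integral>x. b x * v x \<partial>L) + (\<integral>x. F x \<bullet> grad v x \<partial>L) + (\<integral>y. \<gamma> y * v y \<partial>\<sigma>)"
      using LIMSEQ_unique[OF _ lim[OF v]] by (simp add: l_def)
  qed
qed

end

section \<open>The first-order problem and its pointwise form\<close>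

locale lip_problem = lip_dom \<Omega> \<sigma> n for \<Omega> :: "(real^'d) set" and \<sigma> n +
  fixes \<alpha> :: "real^'d \<Rightarrow> real" and \<alpha>M :: real and f :: "real^'d \<Rightarrow> (real^'d) \<times> real" and g :: "real^'d \<Rightarrow> real"
  assumes \<alpha>M: "0 \<le> \<alpha>M" "\<alpha>M < 1" and \<alpha>_meas [measurable]: "\<alpha> \<in> borel_measurable \<sigma>"
    and \<alpha>_bound: "AE x in \<sigma>. - \<alpha>M \<le> \<alpha> x \<and> \<alpha> x \<le> \<alpha>M"
    and f: "f \<in> L2 (lebesgue_on \<Omega>)" and g: "g \<in> L2 \<sigma>"
begin

lemma bdry_trace_L2: "p \<in> H1 \<Omega> \<Longrightarrow> bdry_trace \<Omega> \<sigma> p \<in> L2 \<sigma>"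
  using has_trace_bdry_trace by (auto simp: has_trace_def)

lemma tr_alpha_L2:
  assumes V: "\<xi> \<in> V_space \<Omega> \<sigma> n"
  shows "tr_alpha \<Omega> \<sigma> n \<alpha> \<xi> \<in> L2 \<sigma>"
  unfolding tr_alpha_def
proof (intro L2_cmult L2_diff)
  show "(\<lambda>x. (1 - \<alpha> x) * bdry_trace \<Omega> \<sigma> (\<lambda>y. snd (\<xi> y)) x) \<in> L2 \<sigma>"
  proof (rule L2_bounded_mult[OF bdry_trace_L2[OF V_space_D(3)[OF V]], of _ 2])
    show "AE x in \<sigma>. \<bar>1 - \<alpha> x\<bar> \<le> 2" using \<alpha>_bound by eventually_elim (use \<alpha>M in auto)
  qed measurable
  show "(\<lambda>x. (1 + \<alpha> x) * normal_trace_fun \<Omega> \<sigma> n (\<lambda>y. fst (\<xi> y)) x) \<in> L2 \<sigma>"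
  proof (rule L2_bounded_mult[OF V_space_D(5)[OF V], of _ 2])
    show "AE x in \<sigma>. \<bar>1 + \<alpha> x\<bar> \<le> 2" using \<alpha>_bound by eventually_elim (use \<alpha>M in auto)
  qed measurable
qed

text \<open>The test space is the full product of L^2 spaces, so each residual is an admissible test
  function; tested with itself it has norm zero.\<close>

lemma solves_problem_iff:
  "solves_problem \<Omega> \<sigma> n \<alpha> f g \<xi> \<longleftrightarrow> \<xi> \<in> V_space \<Omega> \<sigma> n \<and> (AE x in L. T_op \<Omega> \<xi> x = f x) \<and>
    (AE y in \<sigma>. tr_alpha \<Omega> \<sigma> n \<alpha> \<xi> y = sqrt 2 * g y)"
proof (cases "\<xi> \<in> V_space \<Omega> \<sigma> n")
  case V: True
  let ?T = "T_op \<Omega> \<xi>" and ?t = "tr_alpha \<Omega> \<sigma> n \<alpha> \<xi>"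
  note TL = V_space_D(2)[OF V] and tL = tr_alpha_L2[OF V]
  have diff: "form_a \<Omega> \<sigma> n \<alpha> \<eta> \<xi> - form_l \<Omega> \<sigma> f g \<eta> = (\<integral>x. fst \<eta> x \<bullet> (?T x - f x) \<partial>L) + (\<integral>x. snd \<eta> x * (?t x - sqrt 2 * g x) \<partial>\<sigma>)"
    if \<eta>: "\<eta> \<in> L_space \<Omega> \<sigma>" for \<eta>
  proof -
    have e: "fst \<eta> \<in> L2 L" "snd \<eta> \<in> L2 \<sigma>" using \<eta> by (auto simp: L_space_def)
    have "(\<integral>x. fst \<eta> x \<bullet> (?T x - f x) \<partial>L) = (\<integral>x. fst \<eta> x \<bullet> ?T x \<partial>L) - (\<integral>x. fst \<eta> x \<bullet> f x \<partial>L)"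
      using L2_inner_integrable[OF e(1) TL] L2_inner_integrable[OF e(1) f] by (simp add: inner_diff_right)
    moreover have "(\<integral>x. snd \<eta> x * (?t x - sqrt 2 * g x) \<partial>\<sigma>) = (\<integral>x. snd \<eta> x * ?t x \<partial>\<sigma>) - sqrt 2 * (\<integral>x. snd \<eta> x * g x \<partial>\<sigma>)"
    proof -
      have "(\<integral>x. snd \<eta> x * (?t x - sqrt 2 * g x) \<partial>\<sigma>) = (\<integral>x. snd \<eta> x * ?t x - sqrt 2 * (snd \<eta> x * g x) \<partial>\<sigma>)"
        by (simp add: algebra_simps)
      then show ?thesis using L2_mult_integrable[OF e(2) tL] L2_mult_integrable[OF e(2) g] by simp
    qed
    ultimately show ?thesis by (simp add: form_a_def form_l_def)
  qed
  have "(\<forall>\<eta>\<in>L_space \<Omega> \<sigma>. form_a \<Omega> \<sigma> n \<alpha> \<eta> \<xi> = form_l \<Omega> \<sigma> f g \<eta>) \<longleftrightarrow>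
    (AE x in L. ?T x = f x) \<and> (AE y in \<sigma>. ?t y = sqrt 2 * g y)" (is "?A \<longleftrightarrow> ?B \<and> ?C")
  proof (intro iffI conjI)
    assume A: ?A
    have dT: "(\<lambda>x. ?T x - f x) \<in> L2 L" by (rule L2_diff[OF TL f])
    have dt: "(\<lambda>x. ?t x - sqrt 2 * g x) \<in> L2 \<sigma>" by (rule L2_diff[OF tL L2_cmult[OF g]])
    have "(\<lambda>x. ?T x - f x, \<lambda>x. 0) \<in> L_space \<Omega> \<sigma>" using dT by (simp add: L_space_def)
    from diff[OF this] A[rule_format, OF this] have "(L2_norm L (\<lambda>x. ?T x - f x))\<^sup>2 = 0"
      by (simp add: L2_norm_power2 power2_norm_eq_inner)
    then have "AE x in L. ?T x - f x = 0" by (intro L2_norm_eq_0[OF dT]) simp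
    then show ?B by simp
    have "(\<lambda>x. 0, \<lambda>x. ?t x - sqrt 2 * g x) \<in> L_space \<Omega> \<sigma>" using dt by (simp add: L_space_def)
    from diff[OF this] A[rule_format, OF this] have "(\<integral>x. (?t x - sqrt 2 * g x) * (?t x - sqrt 2 * g x) \<partial>\<sigma>) = 0"
      by simp
    then have "(L2_norm \<sigma> (\<lambda>x. ?t x - sqrt 2 * g x))\<^sup>2 = 0"
      unfolding L2_norm_power2 by (simp add: power2_eq_square)
    then have "AE x in \<sigma>. ?t x - sqrt 2 * g x = 0" by (intro L2_norm_eq_0[OF dt]) simp
    then show ?C by simp
  next
    assume BC: "?B \<and> ?C"
    show ?A
    proof
      fix \<eta> assume \<eta>: "\<eta> \<in> L_space \<Omega> \<sigma>"
      have "(\<integral>x. fst \<eta> x \<bullet> (?T x - f x) \<partial>L) = 0"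
        by (rule integral_eq_zero_AE) (use BC in \<open>auto elim: eventually_mono\<close>)
      moreover have "(\<integral>x. snd \<eta> x * (?t x - sqrt 2 * g x) \<partial>\<sigma>) = 0"
        by (rule integral_eq_zero_AE) (use BC in \<open>auto elim: eventually_mono\<close>)
      ultimately show "form_a \<Omega> \<sigma> n \<alpha> \<eta> \<xi> = form_l \<Omega> \<sigma> f g \<eta>" using diff[OF \<eta>] by simp
    qed
  qed
  then show ?thesis using V by (simp add: solves_problem_def)
qed (simp add: solves_problem_def)

lemma solution_facts:
  assumes s: "solves_problem \<Omega> \<sigma> n \<alpha> f g \<xi>"
  defines "u \<equiv> \<lambda>x. fst (\<xi> x)" and "p \<equiv> \<lambda>x. snd (\<xi> x)"
  shows "AE x in L. weak_grad \<Omega> p x = fst (f x) - u x \<and> weak_div \<Omega> u x = snd (f x) - p x"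
    "AE y in \<sigma>. (1 - \<alpha> y) * bdry_trace \<Omega> \<sigma> p y - (1 + \<alpha> y) * normal_trace_fun \<Omega> \<sigma> n u y = 2 * g y"
proof -
  have "AE x in L. T_op \<Omega> \<xi> x = f x" using s by (simp add: solves_problem_iff)
  then show "AE x in L. weak_grad \<Omega> p x = fst (f x) - u x \<and> weak_div \<Omega> u x = snd (f x) - p x"
    by eventually_elim (auto simp: T_op_def u_def p_def prod_eq_iff eq_diff_eq add.commute)
  have "AE y in \<sigma>. tr_alpha \<Omega> \<sigma> n \<alpha> \<xi> y = sqrt 2 * g y" using s by (simp add: solves_problem_iff)
  then show "AE y in \<sigma>. (1 - \<alpha> y) * bdry_trace \<Omega> \<sigma> p y - (1 + \<alpha> y) * normal_trace_fun \<Omega> \<sigma> n u y = 2 * g y"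
  proof eventually_elim
    case (elim y)
    have "sqrt 2 * (1 / sqrt 2 * ((1 - \<alpha> y) * bdry_trace \<Omega> \<sigma> p y - (1 + \<alpha> y) * normal_trace_fun \<Omega> \<sigma> n u y)) = sqrt 2 * (sqrt 2 * g y)"
      using elim by (simp add: tr_alpha_def u_def p_def)
    then show ?case by (simp add: mult.assoc[symmetric])
  qed
qed

section \<open>Uniqueness\<close>

text \<open>The data cancel in the difference of two solutions. Green's formula then gives the
  boundary integral of (h' - h) \<open>\<mu>\<close> as minus the sum of the squared norms of the
  differences, whereas the boundary condition makes the integrand nonnegative.\<close>

lemma solution_unique:
  assumes s: "solves_problem \<Omega> \<sigma> n \<alpha> f g \<xi>" "solves_problem \<Omega> \<sigma> n \<alpha> f g \<zeta>"
  shows "AE x in L. \<zeta> x = \<xi> x"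
proof -
  have V: "\<xi> \<in> V_space \<Omega> \<sigma> n" "\<zeta> \<in> V_space \<Omega> \<sigma> n" using s by (auto simp: solves_problem_def)
  define u p h t where "u x = fst (\<xi> x)" and "p x = snd (\<xi> x)" and "h = normal_trace_fun \<Omega> \<sigma> n u" and "t = bdry_trace \<Omega> \<sigma> p" for x
  define u' p' h' t' where "u' x = fst (\<zeta> x)" and "p' x = snd (\<zeta> x)" and "h' = normal_trace_fun \<Omega> \<sigma> n u'" and "t' = bdry_trace \<Omega> \<sigma> p'" for x
  have uu: "u = (\<lambda>x. fst (\<xi> x))" "p = (\<lambda>x. snd (\<xi> x))" "u' = (\<lambda>x. fst (\<zeta> x))" "p' = (\<lambda>x. snd (\<zeta> x))"
    by (auto simp: u_def p_def u'_def p'_def fun_eq_iff)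
  note D = V_space_D[OF V(1), folded uu, folded u_def] and D' = V_space_D[OF V(2), folded uu, folded u'_def]
  note F = solution_facts[OF s(1), folded uu, folded u_def p_def]
    and F' = solution_facts[OF s(2), folded uu, folded u'_def p'_def]
  \<comment> \<open>Green's formulas for u and for u' are tested with this same m and subtracted, so
    the two chosen normal traces are used separately.\<close>
  define m \<mu> where "m x = p' x - p x" and "\<mu> y = t' y - t y" for x y
  have tr: "has_trace \<Omega> \<sigma> m \<mu>" and gm: "AE x in L. weak_grad \<Omega> m x = weak_grad \<Omega> p' x - weak_grad \<Omega> p x"
    using has_trace_diff[OF has_trace_bdry_trace[OF D'(3)] has_trace_bdry_trace[OF D(3)]]
    unfolding m_def[abs_def] \<mu>_def[abs_def] t_def t'_def by auto
  have mH: "m \<in> H1 \<Omega>" and \<mu>L: "\<mu> \<in> L2 \<sigma>" using tr by (auto simp: has_trace_def)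
  note uL = HdivD[OF D(4)] and uL' = HdivD[OF D'(4)] and mL = H1D[OF mH]
  have hL: "h \<in> L2 \<sigma>" "h' \<in> L2 \<sigma>" using D(5) D'(5) by (auto simp: h_def h'_def)
  have "(\<integral>y. (h' y - h y) * \<mu> y \<partial>\<sigma>) = (\<integral>x. (u' x - u x) \<bullet> weak_grad \<Omega> m x \<partial>L) + (\<integral>x. (weak_div \<Omega> u' x - weak_div \<Omega> u x) * m x \<partial>L)"
    using D(6)[OF tr] D'(6)[OF tr] L2_mult_integrable[OF hL(1) \<mu>L] L2_mult_integrable[OF hL(2) \<mu>L]
      L2_inner_integrable[OF uL(1) mL(3)] L2_inner_integrable[OF uL'(1) mL(3)]
      L2_mult_integrable[OF uL(3) mL(1)] L2_mult_integrable[OF uL'(3) mL(1)]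
    by (simp add: inner_diff_left left_diff_distrib h_def h'_def)
  also have "(\<integral>x. (u' x - u x) \<bullet> weak_grad \<Omega> m x \<partial>L) = (\<integral>x. - (norm (u' x - u x))\<^sup>2 \<partial>L)"
  proof (rule integral_cong_AE)
    show "(\<lambda>x. (u' x - u x) \<bullet> weak_grad \<Omega> m x) \<in> borel_measurable L" "(\<lambda>x. - (norm (u' x - u x))\<^sup>2) \<in> borel_measurable L"
      using L2_measurable[OF uL(1)] L2_measurable[OF uL'(1)] L2_measurable[OF mL(3)] by measurable
    show "AE x in L. (u' x - u x) \<bullet> weak_grad \<Omega> m x = - (norm (u' x - u x))\<^sup>2"
      using gm F(1) F'(1) by eventually_elim (simp add: power2_norm_eq_inner inner_simps)
  qed
  also have "(\<integral>x. (weak_div \<Omega> u' x - weak_div \<Omega> u x) * m x \<partial>L) = (\<integral>x. - (norm (m x))\<^sup>2 \<partial>L)"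
  proof (rule integral_cong_AE)
    show "(\<lambda>x. (weak_div \<Omega> u' x - weak_div \<Omega> u x) * m x) \<in> borel_measurable L" "(\<lambda>x. - (norm (m x))\<^sup>2) \<in> borel_measurable L"
      using L2_measurable[OF uL(3)] L2_measurable[OF uL'(3)] L2_measurable[OF mL(1)] by measurable
    show "AE x in L. (weak_div \<Omega> u' x - weak_div \<Omega> u x) * m x = - (norm (m x))\<^sup>2"
      using F(1) F'(1)
    proof eventually_elim
      case (elim x)
      then have "weak_div \<Omega> u' x - weak_div \<Omega> u x = - m x" by (simp add: m_def)
      then show ?case by (simp add: power2_eq_square)
    qed
  qed
  finally have "(\<integral>y. (h' y - h y) * \<mu> y \<partial>\<sigma>) = - (L2_norm L (\<lambda>x. u' x - u x))\<^sup>2 - (L2_norm L m)\<^sup>2"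
    by (simp add: L2_norm_power2)
  moreover have "0 \<le> (\<integral>y. (h' y - h y) * \<mu> y \<partial>\<sigma>)"
  proof (rule integral_nonneg_AE)
    show "AE y in \<sigma>. 0 \<le> (h' y - h y) * \<mu> y"
      using F(2) F'(2) \<alpha>_bound
    proof eventually_elim
      case (elim y)
      \<comment> \<open>Both boundary conditions contain the same g; as 1 + \<alpha> is positive,
        the product of the differences has the sign of (1 - \<alpha>) times a square.\<close>
      have "(1 + \<alpha> y) * (h' y - h y) = (1 - \<alpha> y) * \<mu> y"
        using elim(1,2) by (simp add: h_def h'_def t_def t'_def \<mu>_def algebra_simps)
      then have "(1 + \<alpha> y) * ((h' y - h y) * \<mu> y) = (1 - \<alpha> y) * (\<mu> y * \<mu> y)" by (simp add: mult.assoc[symmetric])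
      moreover have "0 \<le> (1 - \<alpha> y) * (\<mu> y * \<mu> y)" using elim(3) \<alpha>M by (intro mult_nonneg_nonneg zero_le_square) auto
      ultimately have "0 \<le> (1 + \<alpha> y) * ((h' y - h y) * \<mu> y)" by (simp only:)
      then show ?case using mult_pos_neg[of "1 + \<alpha> y" "(h' y - h y) * \<mu> y"] elim(3) \<alpha>M by linarith
    qed
  qed
  ultimately have "(L2_norm L (\<lambda>x. u' x - u x))\<^sup>2 + (L2_norm L m)\<^sup>2 \<le> 0" by simp
  then have "L2_norm L (\<lambda>x. u' x - u x) = 0 \<and> L2_norm L m = 0" by (simp only: sum_power2_le_zero_iff)
  then have "AE x in L. u' x - u x = 0" "AE x in L. m x = 0"
    using L2_norm_eq_0[OF L2_diff[OF uL'(1) uL(1)]] L2_norm_eq_0[OF mL(1)] by auto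
  then show ?thesis by eventually_elim (simp add: u_def u'_def m_def p_def p'_def prod_eq_iff)
qed

section \<open>The a priori estimate\<close>

lemma pointwise_estimate:
  fixes t h y A :: real
  assumes "- \<alpha>M \<le> A" "A \<le> \<alpha>M" "(1 - A) * t - (1 + A) * h = 2 * y"
  shows "(1 - \<alpha>M) * (t + h)\<^sup>2 - 4 * y\<^sup>2 / (1 - \<alpha>M) \<le> 4 * (h * t)" "h\<^sup>2 \<le> 2 * (t + h)\<^sup>2 + 2 * y\<^sup>2"
proof -
  define c where "c = 1 - \<alpha>M"
  define P where "P = t + h"
  have c: "0 < c" "c \<le> 1" using \<alpha>M by (auto simp: c_def)
  have M: "t - h = 2 * y + A * P" using assms(3) by (simp add: P_def algebra_simps)
  have aA: "A\<^sup>2 \<le> \<alpha>M\<^sup>2" using assms(1,2) by (intro abs_le_square_iff[THEN iffD1]) auto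
  \<comment> \<open>Young's inequality for the mixed term, weighted so that the coefficient of P^2
    becomes A^2 / \<open>\<alpha>M\<close>, at most \<open>\<alpha>M\<close>, and that of y^2
    becomes 4 / c. The weight degenerates for \<open>\<alpha>M\<close> = 0, when A is 0 as
    well.\<close>
  have key: "(2 * y + A * P)\<^sup>2 \<le> \<alpha>M * P\<^sup>2 + 4 * y\<^sup>2 / c"
  proof (cases "\<alpha>M = 0")
    case True
    then show ?thesis using assms(1,2) by (simp add: c_def power_mult_distrib)
  next
    case False
    then have a: "0 < \<alpha>M" using \<alpha>M by simp
    have "0 \<le> (c * A * P - 2 * \<alpha>M * y)\<^sup>2 / (\<alpha>M * c)" using a c by simp
    also have "\<dots> = c * A\<^sup>2 * P\<^sup>2 / \<alpha>M - 4 * A * P * y + 4 * \<alpha>M * y\<^sup>2 / c"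
      using a c by (simp add: power2_eq_square field_simps)
    finally have 1: "4 * A * P * y \<le> c * A\<^sup>2 * P\<^sup>2 / \<alpha>M + 4 * \<alpha>M * y\<^sup>2 / c" by simp
    have "c * A\<^sup>2 * P\<^sup>2 / \<alpha>M + A\<^sup>2 * P\<^sup>2 = A\<^sup>2 * P\<^sup>2 / \<alpha>M" using a by (simp add: c_def field_simps)
    also have "\<dots> \<le> \<alpha>M\<^sup>2 * P\<^sup>2 / \<alpha>M" using a aA by (intro divide_right_mono mult_right_mono) auto
    also have "\<dots> = \<alpha>M * P\<^sup>2" using a by (simp add: power2_eq_square)
    finally have 2: "c * A\<^sup>2 * P\<^sup>2 / \<alpha>M + A\<^sup>2 * P\<^sup>2 \<le> \<alpha>M * P\<^sup>2" .
    have 3: "4 * \<alpha>M * y\<^sup>2 / c + 4 * y\<^sup>2 = 4 * y\<^sup>2 / c" using c by (simp add: c_def field_simps)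
    have "(2 * y + A * P)\<^sup>2 = 4 * y\<^sup>2 + 4 * A * P * y + A\<^sup>2 * P\<^sup>2" by (simp add: power2_eq_square algebra_simps)
    then show ?thesis using 1 2 3 by linarith
  qed
  have "4 * (h * t) = P\<^sup>2 - (t - h)\<^sup>2" by (simp add: P_def power2_eq_square algebra_simps)
  then show "(1 - \<alpha>M) * (t + h)\<^sup>2 - 4 * y\<^sup>2 / (1 - \<alpha>M) \<le> 4 * (h * t)"
    using key by (simp add: M P_def[symmetric] c_def left_diff_distrib)
  \<comment> \<open>The norm of V contains the normal trace alone, so h is recovered from the sum P
    and the datum; its coefficient is bounded since |1 - A| <= 2.\<close>
  have "h = ((1 - A) * P) / 2 - y" using M by (simp add: P_def algebra_simps)
  moreover have "(a - b)\<^sup>2 \<le> 2 * a\<^sup>2 + 2 * b\<^sup>2" for a b :: real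
  proof -
    have "0 \<le> (a + b)\<^sup>2" by simp
    then show ?thesis by (simp add: power2_eq_square algebra_simps)
  qed
  ultimately have "h\<^sup>2 \<le> 2 * (((1 - A) * P) / 2)\<^sup>2 + 2 * y\<^sup>2" by metis
  moreover have "(((1 - A) * P) / 2)\<^sup>2 \<le> P\<^sup>2"
  proof -
    have "\<bar>((1 - A) * P) / 2\<bar> \<le> \<bar>P\<bar>"
    proof -
      have "\<bar>1 - A\<bar> * \<bar>P\<bar> \<le> 2 * \<bar>P\<bar>" using assms(1,2) \<alpha>M by (intro mult_right_mono) auto
      then show ?thesis by (simp add: abs_mult)
    qed
    then show ?thesis by (simp only: abs_le_square_iff)
  qed
  ultimately show "h\<^sup>2 \<le> 2 * (t + h)\<^sup>2 + 2 * y\<^sup>2" unfolding P_def by linarith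
qed

text \<open>In L the functional is the inner product with (f, sqrt 2 g), so its normalised
  representer attains the norm. The set of values must be shown bounded above before its supremum
  dominates that value.\<close>

lemma dual_norm_ge:
  "sqrt ((L2_norm L f)\<^sup>2 + 2 * (L2_norm \<sigma> g)\<^sup>2) \<le> L_dual_norm \<Omega> \<sigma> (form_l \<Omega> \<sigma> f g)"
proof -
  let ?S = "{\<bar>form_l \<Omega> \<sigma> f g \<eta>\<bar> |\<eta>. \<eta> \<in> L_space \<Omega> \<sigma> \<and> L_norm \<Omega> \<sigma> \<eta> \<le> 1}"
  define N where "N = sqrt ((L2_norm L f)\<^sup>2 + 2 * (L2_norm \<sigma> g)\<^sup>2)"
  have N2: "N\<^sup>2 = (L2_norm L f)\<^sup>2 + 2 * (L2_norm \<sigma> g)\<^sup>2" by (simp add: N_def)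
  have Ln: "L_norm \<Omega> \<sigma> \<eta> = sqrt ((L2_norm L (fst \<eta>))\<^sup>2 + (L2_norm \<sigma> (snd \<eta>))\<^sup>2)" for \<eta>
    by (simp add: L_norm_def L2_norm_power2)
  have bdd: "bdd_above ?S"
  proof (rule bdd_aboveI)
    fix s assume "s \<in> ?S"
    then obtain \<eta> where \<eta>: "s = \<bar>form_l \<Omega> \<sigma> f g \<eta>\<bar>" "\<eta> \<in> L_space \<Omega> \<sigma>" "L_norm \<Omega> \<sigma> \<eta> \<le> 1" by blast
    have e: "fst \<eta> \<in> L2 L" "snd \<eta> \<in> L2 \<sigma>" using \<eta>(2) by (auto simp: L_space_def)
    have 1: "L2_norm L (fst \<eta>) \<le> 1" "L2_norm \<sigma> (snd \<eta>) \<le> 1"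
    proof -
      have "L2_norm L (fst \<eta>) \<le> L_norm \<Omega> \<sigma> \<eta>" "L2_norm \<sigma> (snd \<eta>) \<le> L_norm \<Omega> \<sigma> \<eta>"
        unfolding Ln by (auto intro!: real_le_rsqrt)
      then show "L2_norm L (fst \<eta>) \<le> 1" "L2_norm \<sigma> (snd \<eta>) \<le> 1" using \<eta>(3) by linarith+
    qed
    have "\<bar>\<integral>x. fst \<eta> x \<bullet> f x \<partial>L\<bar> \<le> L2_norm L (fst \<eta>) * L2_norm L f" by (rule L2_Cauchy_Schwarz[OF e(1) f])
    also have "\<dots> \<le> 1 * L2_norm L f" by (intro mult_right_mono 1) simp
    finally have a: "\<bar>\<integral>x. fst \<eta> x \<bullet> f x \<partial>L\<bar> \<le> L2_norm L f" by simp
    have "\<bar>\<integral>x. snd \<eta> x * g x \<partial>\<sigma>\<bar> \<le> L2_norm \<sigma> (snd \<eta>) * L2_norm \<sigma> g" using L2_Cauchy_Schwarz[OF e(2) g] by simp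
    also have "\<dots> \<le> 1 * L2_norm \<sigma> g" by (intro mult_right_mono 1) simp
    finally have "\<bar>sqrt 2 * (\<integral>x. snd \<eta> x * g x \<partial>\<sigma>)\<bar> \<le> sqrt 2 * L2_norm \<sigma> g" by (simp add: abs_mult)
    then show "s \<le> L2_norm L f + sqrt 2 * L2_norm \<sigma> g" using a \<eta>(1) unfolding form_l_def by linarith
  qed
  have "N \<in> ?S"
  proof (cases "N = 0")
    case True
    have "(\<lambda>x. 0, \<lambda>x. 0) \<in> L_space \<Omega> \<sigma>" by (simp add: L_space_def)
    moreover have "L_norm \<Omega> \<sigma> (\<lambda>x. 0, \<lambda>x. 0) \<le> 1" by (simp add: Ln)
    moreover have "N = \<bar>form_l \<Omega> \<sigma> f g (\<lambda>x. 0, \<lambda>x. 0)\<bar>" using True by (simp add: form_l_def)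
    ultimately show ?thesis by blast
  next
    case False
    then have N: "N > 0" using N_def by (simp add: less_le)
    \<comment> \<open>The Riesz representer of the functional, divided by its norm N.\<close>
    define \<eta> where "\<eta> = ((\<lambda>x. (1 / N) *\<^sub>R f x), (\<lambda>x. (sqrt 2 / N) * g x))"
    have "\<eta> \<in> L_space \<Omega> \<sigma>" unfolding \<eta>_def L_space_def by (intro SigmaI L2_scaleR L2_cmult f g)
    moreover have "L_norm \<Omega> \<sigma> \<eta> \<le> 1"
    proof -
      have "(L2_norm L (fst \<eta>))\<^sup>2 + (L2_norm \<sigma> (snd \<eta>))\<^sup>2 = ((L2_norm L f)\<^sup>2 + 2 * (L2_norm \<sigma> g)\<^sup>2) / N\<^sup>2"
        unfolding \<eta>_def fst_conv snd_conv L2_norm_scaleR L2_norm_cmult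
        by (simp add: power_mult_distrib power_divide add_divide_distrib)
      also have "\<dots> = 1" using N by (simp add: N2[symmetric])
      finally show ?thesis by (simp add: Ln)
    qed
    moreover have "N = \<bar>form_l \<Omega> \<sigma> f g \<eta>\<bar>"
    proof -
      have 1: "(\<integral>x. fst \<eta> x \<bullet> f x \<partial>L) = (1 / N) * (L2_norm L f)\<^sup>2"
        by (simp add: \<eta>_def L2_norm_power2 power2_norm_eq_inner)
      have 2: "(\<integral>x. snd \<eta> x * g x \<partial>\<sigma>) = (sqrt 2 / N) * (L2_norm \<sigma> g)\<^sup>2"
        unfolding L2_norm_power2 by (simp add: \<eta>_def power2_eq_square mult.assoc)
      have "form_l \<Omega> \<sigma> f g \<eta> = (1 / N) * (L2_norm L f)\<^sup>2 + sqrt 2 * ((sqrt 2 / N) * (L2_norm \<sigma> g)\<^sup>2)"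
        unfolding form_l_def 1 2 ..
      also have "\<dots> = ((L2_norm L f)\<^sup>2 + 2 * (L2_norm \<sigma> g)\<^sup>2) / N"
        by (simp add: add_divide_distrib mult.assoc[symmetric])
      also have "\<dots> = N" unfolding N2[symmetric] using N by (simp add: power2_eq_square)
      finally show ?thesis using N by simp
    qed
    ultimately show ?thesis by blast
  qed
  from cSup_upper[OF this bdd] show ?thesis by (simp add: N_def L_dual_norm_def)
qed

lemma solution_estimate:
  assumes s: "solves_problem \<Omega> \<sigma> n \<alpha> f g \<xi>"
  shows "V_norm \<Omega> \<sigma> n \<xi> \<le> 3 / (1 - \<alpha>M) * L_dual_norm \<Omega> \<sigma> (form_l \<Omega> \<sigma> f g)"
proof -
  have V: "\<xi> \<in> V_space \<Omega> \<sigma> n" using s by (auto simp: solves_problem_def)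
  define u p h t where "u x = fst (\<xi> x)" and "p x = snd (\<xi> x)" and "h = normal_trace_fun \<Omega> \<sigma> n u" and "t = bdry_trace \<Omega> \<sigma> p" for x
  have uu: "u = (\<lambda>x. fst (\<xi> x))" "p = (\<lambda>x. snd (\<xi> x))" by (auto simp: u_def p_def fun_eq_iff)
  note D = V_space_D[OF V, folded uu, folded u_def] and F = solution_facts[OF s, folded uu, folded u_def p_def]
  have tr: "has_trace \<Omega> \<sigma> p t" unfolding t_def by (rule has_trace_bdry_trace[OF D(3)])
  have hL: "h \<in> L2 \<sigma>" and tL: "t \<in> L2 \<sigma>" using D(5) tr by (auto simp: h_def has_trace_def)
  note uL = HdivD[OF D(4)] and pL = H1D[OF D(3)]
  have PL: "(\<lambda>y. t y + h y) \<in> L2 \<sigma>" by (rule L2_add[OF tL hL])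
  define X2 F2 G2 P2 H2 where "X2 = (L2_norm L \<xi>)\<^sup>2" and "F2 = (L2_norm L f)\<^sup>2" and "G2 = (L2_norm \<sigma> g)\<^sup>2"
    and "P2 = (L2_norm \<sigma> (\<lambda>y. t y + h y))\<^sup>2" and "H2 = (L2_norm \<sigma> h)\<^sup>2"
  have nn: "0 \<le> X2" "0 \<le> F2" "0 \<le> G2" "0 \<le> P2" "0 \<le> H2" by (auto simp: X2_def F2_def G2_def P2_def H2_def)
  define c where "c = 1 - \<alpha>M"
  have c: "0 < c" "c \<le> 1" using \<alpha>M by (auto simp: c_def)
  have "(\<integral>y. h y * t y \<partial>\<sigma>) = (\<integral>x. u x \<bullet> weak_grad \<Omega> p x + weak_div \<Omega> u x * p x \<partial>L)"
    using D(6)[OF tr] L2_inner_integrable[OF uL(1) pL(3)] L2_mult_integrable[OF uL(3) pL(1)] by (simp add: h_def)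
  also have "\<dots> = (\<integral>x. \<xi> x \<bullet> f x - (norm (\<xi> x))\<^sup>2 \<partial>L)"
  proof (rule integral_cong_AE)
    show "(\<lambda>x. u x \<bullet> weak_grad \<Omega> p x + weak_div \<Omega> u x * p x) \<in> borel_measurable L"
      using L2_inner_integrable[OF uL(1) pL(3)] L2_mult_integrable[OF uL(3) pL(1)] by (intro borel_measurable_add) auto
    show "(\<lambda>x. \<xi> x \<bullet> f x - (norm (\<xi> x))\<^sup>2) \<in> borel_measurable L"
      using L2_inner_integrable[OF D(1) f] L2_integrable_sq[OF D(1)] by (intro borel_measurable_diff) auto
    show "AE x in L. u x \<bullet> weak_grad \<Omega> p x + weak_div \<Omega> u x * p x = \<xi> x \<bullet> f x - (norm (\<xi> x))\<^sup>2"
      using F(1)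
    proof eventually_elim
      case (elim x)
      have "\<xi> x = (u x, p x)" by (simp add: u_def p_def)
      moreover have "f x = (fst (f x), snd (f x))" by simp
      ultimately have "\<xi> x \<bullet> f x - (norm (\<xi> x))\<^sup>2 = u x \<bullet> fst (f x) + p x * snd (f x) - (u x \<bullet> u x + p x * p x)"
        by (metis inner_Pair inner_real_def power2_norm_eq_inner)
      moreover have "weak_grad \<Omega> p x = fst (f x) - u x" "weak_div \<Omega> u x = snd (f x) - p x" using elim by auto
      ultimately show ?case by (simp add: inner_diff_right left_diff_distrib right_diff_distrib mult.commute)
    qed
  qed
  also have "\<dots> = (\<integral>x. \<xi> x \<bullet> f x \<partial>L) - X2"
    using L2_inner_integrable[OF D(1) f] L2_integrable_sq[OF D(1)] by (simp add: X2_def L2_norm_power2)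
  finally have green: "X2 + (\<integral>y. h y * t y \<partial>\<sigma>) = (\<integral>x. \<xi> x \<bullet> f x \<partial>L)" by simp
  have "(\<integral>x. \<xi> x \<bullet> f x \<partial>L) \<le> L2_norm L \<xi> * L2_norm L f" using L2_Cauchy_Schwarz[OF D(1) f] by linarith
  also have "2 * \<dots> \<le> X2 + F2" using sum_squares_bound[of "L2_norm L \<xi>" "L2_norm L f"] by (simp add: X2_def F2_def)
  finally have cs: "2 * (\<integral>x. \<xi> x \<bullet> f x \<partial>L) \<le> X2 + F2" by simp
  have pw: "AE y in \<sigma>. c * (t y + h y)\<^sup>2 - 4 * (g y)\<^sup>2 / c \<le> 4 * (h y * t y) \<and> (h y)\<^sup>2 \<le> 2 * (t y + h y)\<^sup>2 + 2 * (g y)\<^sup>2"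
    using F(2) \<alpha>_bound
  proof eventually_elim
    case (elim y)
    show ?case using pointwise_estimate[of "\<alpha> y" "t y" "h y" "g y"] elim by (simp add: t_def h_def c_def)
  qed
  have sqP: "integrable \<sigma> (\<lambda>y. (t y + h y)\<^sup>2)" and sqg: "integrable \<sigma> (\<lambda>y. (g y)\<^sup>2)" and sqh: "integrable \<sigma> (\<lambda>y. (h y)\<^sup>2)"
    using L2_integrable_sq[OF PL] L2_integrable_sq[OF g] L2_integrable_sq[OF hL] by simp_all
  have "c * P2 - 4 * G2 / c = (\<integral>y. c * (t y + h y)\<^sup>2 - 4 * (g y)\<^sup>2 / c \<partial>\<sigma>)"
    using sqP sqg by (simp add: P2_def G2_def L2_norm_power2)
  also have "\<dots> \<le> (\<integral>y. 4 * (h y * t y) \<partial>\<sigma>)"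
    by (rule integral_mono_AE) (use sqP sqg L2_mult_integrable[OF hL tL] pw in \<open>auto elim: eventually_mono\<close>)
  finally have ht: "c * P2 - 4 * G2 / c \<le> 4 * (\<integral>y. h y * t y \<partial>\<sigma>)" by simp
  have "H2 = (\<integral>y. (h y)\<^sup>2 \<partial>\<sigma>)" by (simp add: H2_def L2_norm_power2)
  also have "\<dots> \<le> (\<integral>y. 2 * (t y + h y)\<^sup>2 + 2 * (g y)\<^sup>2 \<partial>\<sigma>)"
    by (rule integral_mono_AE) (use sqP sqg sqh pw in \<open>auto elim: eventually_mono\<close>)
  also have "\<dots> = 2 * P2 + 2 * G2" using sqP sqg by (simp add: P2_def G2_def L2_norm_power2)
  finally have hb: "H2 \<le> 2 * P2 + 2 * G2" .
  \<comment> \<open>Green's identity and Cauchy-Schwarz give X2 plus twice the boundary integral of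
    h t at most F2, half of the volume term having been absorbed; this is doubled and the lower
    bound on 4 h t inserted.\<close>
  have energy: "2 * X2 + c * P2 \<le> 2 * F2 + 4 * G2 / c" using green cs ht by linarith
  \<comment> \<open>As T \<xi> = f almost everywhere, the second part of the graph norm is exactly
    the norm of f.\<close>
  have Tn: "(L2_norm L (T_op \<Omega> \<xi>))\<^sup>2 = F2"
  proof -
    have "L2_norm L (T_op \<Omega> \<xi>) = L2_norm L f"
      by (rule L2_norm_cong_AE[OF L2_measurable[OF D(2)] L2_measurable[OF f]]) (use s in \<open>simp add: solves_problem_iff\<close>)
    then show ?thesis by (simp add: F2_def)
  qed
  have "c\<^sup>2 * (X2 + F2 + H2) \<le> 9 * (F2 + 2 * G2)"
  proof -
    \<comment> \<open>Multiplying the energy bound by c and using c <= 1 leaves 5 (F2 + 2 G2): one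
      F2 directly, and 4 F2 + 10 G2 from the bound on H2 through P2, while the terms in X2 are
      absorbed. The constant 9 = 3^2 covers this.\<close>
    have c2: "c\<^sup>2 \<le> c" "c\<^sup>2 \<le> 1" using c using power_le_one[of c 2] by (auto simp: power2_eq_square mult_left_le_one_le)
    have "c * (2 * X2 + c * P2) \<le> c * (2 * F2 + 4 * G2 / c)" by (intro mult_left_mono energy) (use c in simp)
    then have 1: "2 * (c * X2) + c\<^sup>2 * P2 \<le> 2 * (c * F2) + 4 * G2" using c by (simp add: algebra_simps power2_eq_square)
    have 2: "c\<^sup>2 * X2 \<le> c * X2" "c\<^sup>2 * F2 \<le> F2" "c * F2 \<le> F2" "c\<^sup>2 * G2 \<le> G2"
      using c c2 nn by (auto intro: mult_right_mono mult_left_le_one_le)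
    have 3: "c\<^sup>2 * H2 \<le> 2 * (c\<^sup>2 * P2) + 2 * (c\<^sup>2 * G2)"
      using mult_left_mono[OF hb, of "c\<^sup>2"] by (simp add: algebra_simps)
    have 4: "0 \<le> c * X2" using c nn by simp
    have "c\<^sup>2 * (X2 + F2 + H2) = c\<^sup>2 * X2 + c\<^sup>2 * F2 + c\<^sup>2 * H2" by (simp add: algebra_simps)
    then show ?thesis using 1 2 3 4 nn unfolding distrib_left by linarith
  qed
  then have "X2 + F2 + H2 \<le> (3 / c)\<^sup>2 * (F2 + 2 * G2)" using c by (simp add: field_simps power2_eq_square)
  then have "sqrt (X2 + F2 + H2) \<le> sqrt ((3 / c)\<^sup>2 * (F2 + 2 * G2))" by (rule real_sqrt_le_mono)
  also have "\<dots> = 3 / c * sqrt (F2 + 2 * G2)" using c by (simp add: real_sqrt_mult)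
  also have "\<dots> \<le> 3 / c * L_dual_norm \<Omega> \<sigma> (form_l \<Omega> \<sigma> f g)"
    using dual_norm_ge c by (intro mult_left_mono) (auto simp: F2_def G2_def)
  finally have "sqrt (X2 + F2 + H2) \<le> 3 / (1 - \<alpha>M) * L_dual_norm \<Omega> \<sigma> (form_l \<Omega> \<sigma> f g)" by (simp add: c_def)
  moreover have "V_norm \<Omega> \<sigma> n \<xi> = sqrt (X2 + F2 + H2)"
    using Tn nn(1,2) by (simp add: V_norm_def W_norm_def X2_def H2_def h_def uu(1))
  ultimately show ?thesis by simp
qed

end

text \<open>Testing with C^1 functions suffices: along a sequence that defines the trace of m, the
  volume terms converge by the H^1 convergence and the boundary term by the L^2 convergence.\<close>

lemma (in lip_dom) represents_normal_traceI:
  assumes u: "u \<in> Hdiv \<Omega>" and h: "h \<in> L2 \<sigma>"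
    and green: "\<And>v. Ck 1 v \<Longrightarrow> (\<integral>x. u x \<bullet> grad v x \<partial>L) + (\<integral>x. weak_div \<Omega> u x * v x \<partial>L) = (\<integral>y. h y * v y \<partial>\<sigma>)"
  shows "represents_normal_trace \<Omega> \<sigma> n u h"
  unfolding represents_normal_trace_def
proof (intro conjI ballI h)
  fix \<mu> assume "\<mu> \<in> Hhalf \<Omega> \<sigma>"
  then obtain m where tr: "has_trace \<Omega> \<sigma> m \<mu>" by (auto simp: Hhalf_def)
  then have m: "m \<in> H1 \<Omega>" and \<mu>: "\<mu> \<in> L2 \<sigma>" by (auto simp: has_trace_def)
  obtain q where q: "\<And>k. Ck 1 (q k)" "(\<lambda>k. L2_norm L (\<lambda>x. q k x - m x)) \<longlonglongrightarrow> 0"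
    "(\<lambda>k. L2_norm L (\<lambda>x. grad (q k) x - weak_grad \<Omega> m x)) \<longlonglongrightarrow> 0" "(\<lambda>k. L2_norm \<sigma> (\<lambda>x. q k x - \<mu> x)) \<longlonglongrightarrow> 0"
    using tr unfolding has_trace_iff by blast
  have "(\<lambda>k. (\<integral>x. u x \<bullet> grad (q k) x \<partial>L) + (\<integral>x. weak_div \<Omega> u x * q k x \<partial>L))
      \<longlonglongrightarrow> (\<integral>x. u x \<bullet> weak_grad \<Omega> m x \<partial>L) + (\<integral>x. weak_div \<Omega> u x * m x \<partial>L)"
    using L2_tendsto_inner_const[OF C1_L2(2)[OF q(1)] H1D(3)[OF m] q(3) HdivD(1)[OF u]]
      L2_tendsto_inner_const[OF C1_L2(1)[OF q(1)] H1D(1)[OF m] q(2) HdivD(3)[OF u]]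
    by (intro tendsto_add) (simp_all add: inner_commute mult.commute)
  moreover have "(\<lambda>k. \<integral>y. h y * q k y \<partial>\<sigma>) \<longlonglongrightarrow> (\<integral>y. h y * \<mu> y \<partial>\<sigma>)"
    using L2_tendsto_inner_const[OF C1_L2(4)[OF q(1)] \<mu> q(4) h] by (simp add: mult.commute)
  ultimately show "normal_trace \<Omega> \<sigma> n u \<mu> = (\<integral>y. h y * \<mu> y \<partial>\<sigma>)"
    unfolding green[OF q(1)] normal_trace_green[OF u tr] by (rule LIMSEQ_unique)
qed

context lip_problem
begin

section \<open>Existence\<close>

lemma solution_exists: "\<exists>\<xi>. solves_problem \<Omega> \<sigma> n \<alpha> f g \<xi>"
proof -
  \<comment> \<open>Solving the boundary condition for the normal trace gives h = \<beta> t -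
    \<gamma>. Because 1 + \<alpha> is at least 1 - \<open>\<alpha>M\<close> > 0, both coefficients
    are bounded by 2 / (1 - \<open>\<alpha>M\<close>).\<close>
  define \<beta> \<gamma> where "\<beta> y = (1 - \<alpha> y) / (1 + \<alpha> y)" and "\<gamma> y = (2 / (1 + \<alpha> y)) * g y" for y
  have \<beta>m: "\<beta> \<in> borel_measurable \<sigma>" unfolding \<beta>_def[abs_def] by measurable
  have \<beta>b: "AE y in \<sigma>. 0 \<le> \<beta> y \<and> \<beta> y \<le> 2 / (1 - \<alpha>M)"
    using \<alpha>_bound
  proof eventually_elim
    case (elim y)
    then show ?case unfolding \<beta>_def using \<alpha>M by (auto intro!: divide_nonneg_pos frac_le)
  qed
  have \<gamma>L: "\<gamma> \<in> L2 \<sigma>"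
    unfolding \<gamma>_def[abs_def]
  proof (rule L2_bounded_mult[OF g])
    show "AE y in \<sigma>. \<bar>2 / (1 + \<alpha> y)\<bar> \<le> 2 / (1 - \<alpha>M)"
      using \<alpha>_bound by eventually_elim (use \<alpha>M in \<open>auto simp: abs_divide intro!: frac_le\<close>)
  qed measurable
  obtain p t where tr: "has_trace \<Omega> \<sigma> p t" and el: "\<And>v. Ck 1 v \<Longrightarrow>
       (\<integral>x. p x * v x \<partial>L) + (\<integral>x. weak_grad \<Omega> p x \<bullet> grad v x \<partial>L) + (\<integral>y. (\<beta> y * t y) * v y \<partial>\<sigma>)
       = (\<integral>x. snd (f x) * v x \<partial>L) + (\<integral>x. fst (f x) \<bullet> grad v x \<partial>L) + (\<integral>y. \<gamma> y * v y \<partial>\<sigma>)"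
    by (rule robin_solution[OF L2_fst[OF f] L2_snd[OF f] \<gamma>L \<beta>m \<beta>b]) (rule that)
  have pH: "p \<in> H1 \<Omega>" and tL: "t \<in> L2 \<sigma>" using tr by (auto simp: has_trace_def)
  define u where "u x = fst (f x) - weak_grad \<Omega> p x" for x
  define D where "D x = snd (f x) - p x" for x
  define h where "h y = \<beta> y * t y - \<gamma> y" for y
  have uL: "u \<in> L2 L" unfolding u_def[abs_def] by (rule L2_diff[OF L2_fst[OF f] H1D(3)[OF pH]])
  have DL: "D \<in> L2 L" unfolding D_def[abs_def] by (rule L2_diff[OF L2_snd[OF f] H1D(1)[OF pH]])
  have \<beta>tL: "(\<lambda>y. \<beta> y * t y) \<in> L2 \<sigma>"
    by (rule L2_bounded_mult[OF tL \<beta>m, of "2 / (1 - \<alpha>M)"]) (use \<beta>b in eventually_elim, simp)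
  have hL: "h \<in> L2 \<sigma>" unfolding h_def[abs_def] by (rule L2_diff[OF \<beta>tL \<gamma>L])
  have green: "(\<integral>x. u x \<bullet> grad v x \<partial>L) + (\<integral>x. D x * v x \<partial>L) = (\<integral>y. h y * v y \<partial>\<sigma>)" if v: "Ck 1 v" for v
  proof -
    have "(\<integral>x. u x \<bullet> grad v x \<partial>L) = (\<integral>x. fst (f x) \<bullet> grad v x \<partial>L) - (\<integral>x. weak_grad \<Omega> p x \<bullet> grad v x \<partial>L)"
      using L2_inner_integrable[OF L2_fst[OF f] C1_L2(2)[OF v]] L2_inner_integrable[OF H1D(3)[OF pH] C1_L2(2)[OF v]]
      by (simp add: u_def inner_diff_left)
    moreover have "(\<integral>x. D x * v x \<partial>L) = (\<integral>x. snd (f x) * v x \<partial>L) - (\<integral>x. p x * v x \<partial>L)"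
      using L2_mult_integrable[OF L2_snd[OF f] C1_L2(1)[OF v]] L2_mult_integrable[OF H1D(1)[OF pH] C1_L2(1)[OF v]]
      by (simp add: D_def left_diff_distrib)
    moreover have "(\<integral>y. h y * v y \<partial>\<sigma>) = (\<integral>y. (\<beta> y * t y) * v y \<partial>\<sigma>) - (\<integral>y. \<gamma> y * v y \<partial>\<sigma>)"
      using L2_mult_integrable[OF \<beta>tL C1_L2(4)[OF v]] L2_mult_integrable[OF \<gamma>L C1_L2(4)[OF v]]
      by (simp add: h_def left_diff_distrib)
    ultimately show ?thesis using el[OF v] by linarith
  qed
  \<comment> \<open>The surface measure is concentrated on the frontier, where test functions
    vanish, so Green's identity loses its boundary term.\<close>
  have wd: "has_weak_divergence \<Omega> u D"
    unfolding has_weak_divergence_def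
  proof (intro conjI ballI)
    fix \<psi> assume \<psi>: "\<psi> \<in> test_functions \<Omega>"
    have "(\<integral>y. h y * \<psi> y \<partial>\<sigma>) = 0"
    proof (rule integral_eq_zero_AE)
      show "AE y in \<sigma>. h y * \<psi> y = 0"
        using AE_frontier
      proof eventually_elim
        case (elim y)
        then have "y \<notin> \<Omega>" using \<Omega>_open by (simp add: frontier_def interior_open)
        then show ?case using test_functions_D(2)[OF \<psi>] by simp
      qed
    qed
    then show "(\<integral>x. u x \<bullet> grad \<psi> x \<partial>L) = - (\<integral>x. D x * \<psi> x \<partial>L)"
      using green[OF test_functions_D(1)[OF \<psi>]] by simp
  qed (intro L2_locally_integrable uL DL)+
  note uH = HdivI[OF uL wd DL]
  \<comment> \<open>For general C^1 functions the same weak equation is Green's formula for u with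
    boundary function h: the natural boundary condition.\<close>
  have rep: "represents_normal_trace \<Omega> \<sigma> n u h"
  proof (rule represents_normal_traceI[OF uH(1) hL])
    fix v :: "real^'d \<Rightarrow> real" assume v: "Ck 1 v"
    have "(\<integral>x. weak_div \<Omega> u x * v x \<partial>L) = (\<integral>x. D x * v x \<partial>L)"
    proof (rule integral_cong_AE)
      show "(\<lambda>x. weak_div \<Omega> u x * v x) \<in> borel_measurable L" "(\<lambda>x. D x * v x) \<in> borel_measurable L"
        using L2_mult_integrable[OF uH(3) C1_L2(1)[OF v]] L2_mult_integrable[OF DL C1_L2(1)[OF v]] by auto
      show "AE x in L. weak_div \<Omega> u x * v x = D x * v x" using uH(2) by eventually_elim simp
    qed
    then show "(\<integral>x. u x \<bullet> grad v x \<partial>L) + (\<integral>x. weak_div \<Omega> u x * v x \<partial>L) = (\<integral>y. h y * v y \<partial>\<sigma>)"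
      using green[OF v] by simp
  qed
  define \<xi> where "\<xi> x = (u x, p x)" for x
  have \<xi>_eq: "(\<lambda>x. fst (\<xi> x)) = u" "(\<lambda>x. snd (\<xi> x)) = p" by (auto simp: \<xi>_def)
  have T: "T_op \<Omega> \<xi> = (\<lambda>x. (u x + weak_grad \<Omega> p x, p x + weak_div \<Omega> u x))"
    unfolding T_op_def \<xi>_eq by (simp add: \<xi>_def)
  have "\<xi> \<in> L2 L" unfolding \<xi>_def[abs_def] by (rule L2_Pair[OF uL H1D(1)[OF pH]])
  moreover have "T_op \<Omega> \<xi> \<in> L2 L" unfolding T by (intro L2_Pair L2_add uL H1D[OF pH] uH)
  ultimately have "\<xi> \<in> W_space \<Omega>" using H1D(2)[OF pH] wd by (auto simp: W_space_def \<xi>_eq)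
  then have V: "\<xi> \<in> V_space \<Omega> \<sigma> n" using rep uH(1) by (auto simp: V_space_def U_space_def \<xi>_eq)
  have "AE x in L. T_op \<Omega> \<xi> x = f x"
    using uH(2) by eventually_elim (simp add: T u_def D_def prod_eq_iff)
  moreover have "AE y in \<sigma>. tr_alpha \<Omega> \<sigma> n \<alpha> \<xi> y = sqrt 2 * g y"
  proof -
    \<comment> \<open>The operators in \<open>tr_alpha\<close> choose their own representatives;
      uniqueness identifies them almost everywhere with h and t.\<close>
    have "represents_normal_trace \<Omega> \<sigma> n u (normal_trace_fun \<Omega> \<sigma> n u)"
      unfolding normal_trace_fun_def by (rule someI[where P="represents_normal_trace \<Omega> \<sigma> n u", OF rep])
    from represents_unique[OF this rep] has_trace_unique[OF has_trace_bdry_trace[OF pH] tr] \<alpha>_bound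
    show ?thesis
    proof eventually_elim
      case (elim y)
      have "(1 + \<alpha> y) * h y = (1 - \<alpha> y) * t y - 2 * g y"
        using elim(3) \<alpha>M by (simp add: h_def \<beta>_def \<gamma>_def right_diff_distrib)
      then have "tr_alpha \<Omega> \<sigma> n \<alpha> \<xi> y = 1 / sqrt 2 * (2 * g y)"
        unfolding tr_alpha_def \<xi>_eq elim(1,2) by simp
      also have "\<dots> = sqrt 2 * g y" by (simp add: real_div_sqrt field_simps)
      finally show ?case .
    qed
  qed
  ultimately show ?thesis using V by (auto simp: solves_problem_iff)
qed

end

theorem theorem4p10:
  fixes \<Omega> :: "(real^'d) set"
    and \<sigma> :: "(real^'d) measure"
    and n :: "real^'d \<Rightarrow> real^'d"
    and \<alpha> :: "real^'d \<Rightarrow> real"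
    and \<alpha>M :: real
    and f :: "real^'d \<Rightarrow> (real^'d) \<times> real"
    and g :: "real^'d \<Rightarrow> real"
  assumes "CARD('d) = 2 \<or> CARD('d) = 3"
    and "lipschitz_domain \<Omega>"
    and "is_surface_measure \<Omega> \<sigma>"
    and "is_outward_unit_normal \<Omega> n"
    and "0 \<le> \<alpha>M" and "\<alpha>M < 1"
    and "\<alpha> \<in> borel_measurable \<sigma>"
    and "AE x in \<sigma>. - \<alpha>M \<le> \<alpha> x \<and> \<alpha> x \<le> \<alpha>M"
    and "f \<in> L2 (lebesgue_on \<Omega>)"
    and "g \<in> L2 \<sigma>"
  shows "\<exists>\<xi>. solves_problem \<Omega> \<sigma> n \<alpha> f g \<xi> \<and>
             (\<forall>\<zeta>. solves_problem \<Omega> \<sigma> n \<alpha> f g \<zeta> \<longrightarrow> (AE x in lebesgue_on \<Omega>. \<zeta> x = \<xi> x)) \<and>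
             V_norm \<Omega> \<sigma> n \<xi> \<le> 3 / (1 - \<alpha>M) * L_dual_norm \<Omega> \<sigma> (form_l \<Omega> \<sigma> f g)"
proof -
  interpret lip_problem \<Omega> \<sigma> n \<alpha> \<alpha>M f g by unfold_locales (use assms in auto)
  obtain \<xi> where "solves_problem \<Omega> \<sigma> n \<alpha> f g \<xi>" using solution_exists by blast
  then show ?thesis using solution_unique solution_estimate by blast
qed

end
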